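(* Let $\Omega^\epsilon=\mathrm{Int}\big(\overline{\Omega_-\cup\Omega^\epsilon_+}\big)$ be the comb-like domains described in the context, with $\alpha>1$. Let $f^\epsilon\in L^2(\Omega^\epsilon)$ satisfy $\|f^\epsilon\|_{L^2(\Omega^\epsilon)}\le C$ for some constant $C$ independent of $\epsilon$, and suppose that the function $\hat f^\epsilon(x)=\int_{S^\epsilon(x)}f^\epsilon(x,y)\,dy$ satisfies $\hat f^\epsilon\rightharpoonup\hat f$ weakly in $L^2(0,1)$ as $\epsilon\to0$, for some $\hat f\in L^2(0,1)$, where $S^\epsilon(x)=\{y : (x,y)\in\Omega^\epsilon\}$ is the section of $\Omega^\epsilon$ at $x\in(0,1)$. Let $u^\epsilon\in H^1(\Omega^\epsilon)$ be the unique (weak) solution of $$ \begin{cases} -\dfrac{\partial^2 u^\epsilon}{\partial x_1^2}-\dfrac1{\epsilon^2}\dfrac{\partial^2 u^\epsilon}{\partial x_2^2}+u^\epsilon=f^\epsilon & \text{in }\Omega^\epsilon,\\[2mm] \dfrac{\partial u^\epsilon}{\partial x_1}\nu_1^\epsilon+\dfrac1{\epsilon^2}\dfrac{\partial u^\epsilon}{\partial x_2}\nu_2^\epsilon=0 & \text{on }\partial\Omega^\epsilon. \end{cases} $$ If $u_0=u_0(x_1)\in H^1(0,1)$ is the unique weak solution of the Neumann problem $$ \int_0^1\Big\{b(x)\,u_x(x)\,\varphi_x(x)+q(x)\,u(x)\,\varphi(x)\Big\}\,dx=\int_0^1\hat f(x)\,\varphi(x)\,dx\qquad\forall\varphi\in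 H^1(0,1), $$ where $$q(x)=\frac{|Q_0|}{L}+b(x),\qquad x\in(0,1),$$ then $$\|u^\epsilon-u_0\|_{L^2(\Omega^\epsilon)}\to0\quad\text{as }\epsilon\to0.$$ Moreover, $u^\epsilon\to u_0$ strongly in $H^1(\Omega_-)$ as $\epsilon\to0$.
   Context: Setting. Fix $\alpha>1$ and constants $L,G>0$. The function $b:(0,1)\to(0,\infty)$ is piecewise $C^1$ with $0<b_0\le b(x)\le b_1$ for all $x\in(0,1)$, for some constants $b_0,b_1$. $Q_0\subset(0,L)\times(0,G)$ is a fixed Lipschitz domain (it is allowed to be disconnected) with $\partial Q_0\cap(\{0\}\times(0,G])=\emptyset$ and $\partial Q_0\cap(\{L\}\times(0,G])=\emptyset$. Moreover, with $\Gamma_0=\partial Q_0\cap\{x_2=0\}$, the first eigenvalue $e_1(Q_0)$ of $-\Delta$ in $Q_0$ with homogeneous Dirichlet boundary condition on $\Gamma_0$ and homogeneous Neumann boundary condition on $\partial Q_0\setminus\Gamma_0$ satisfies $e_1(Q_0)>0$. $|Q_0|$ is the area of $Q_0$. For small $\epsilon>0$, $N_\epsilon$ is the largest integer with $N_\epsilon L\epsilon^\alpha\le1$, and $$\Omega_-=\{(x_1,x_2) : 0<x_1<1,\ -b(x_1)<x_2<0\},\qquad \Omega^\epsilon_+=\bigcup_{n=1}^{N_\epsilon}\Omega^\epsilon_{n,+},$$ $$\Omega^\epsilon_{n,+}=\{((n-1)L\epsilon^\alpha+\epsilon^\alpha x_1,\,x_2) : (x_1,x_2)\in Q_0\},\qquad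 \Omega^\epsilon=\mathrm{Int}\big(\overline{\Omega_-\cup\Omega^\epsilon_+}\big).$$ $\nu^\epsilon=(\nu^\epsilon_1,\nu^\epsilon_2)$ is the outward unit normal to $\partial\Omega^\epsilon$. The boundary value problem is understood in the weak sense: $u^\epsilon\in H^1(\Omega^\epsilon)$ and $$\int_{\Omega^\epsilon}\Big\{\frac{\partial u^\epsilon}{\partial x_1}\frac{\partial\varphi}{\partial x_1}+\frac1{\epsilon^2}\frac{\partial u^\epsilon}{\partial x_2}\frac{\partial\varphi}{\partial x_2}+u^\epsilon\varphi\Big\}dx_1dx_2=\int_{\Omega^\epsilon}f^\epsilon\varphi\,dx_1dx_2\quad\forall\varphi\in H^1(\Omega^\epsilon).$$ A function of $x_1$ alone, such as $u_0$, is regarded as a function on $\Omega^\epsilon$ that is constant in $x_2$.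
   Formalization: Added assumption: the relative boundary of Γ_0 in the line x_2=0 has length zero (true when Γ_0 is a finite union of intervals and points). Without it the claim fails: if Γ_0 is a Cantor set of positive length, then e_1(Q_0)>0 but the teeth are disconnected from Ω_-. *)

theory Defs
  imports "HOL-Analysis.Analysis"
begin

section \<open>Sobolev spaces\<close>

primrec Ck_fun :: "nat \<Rightarrow> ('a::euclidean_space \<Rightarrow> real) \<Rightarrow> bool" where
  "Ck_fun 0 f \<longleftrightarrow> continuous_on UNIV f"
| "Ck_fun (Suc k) f \<longleftrightarrow> f differentiable_on UNIV \<and>
     (\<forall>v\<in>Basis. Ck_fun k (\<lambda>x. frechet_derivative f (at x) v))"

definition smooth_fun :: "('a::euclidean_space \<Rightarrow> real) \<Rightarrow> bool" where
  "smooth_fun f \<longleftrightarrow> (\<forall>k. Ck_fun k f)"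

definition test_fun :: "'a::euclidean_space set \<Rightarrow> ('a \<Rightarrow> real) \<Rightarrow> bool" where
  "test_fun \<Omega> \<phi> \<longleftrightarrow> smooth_fun \<phi> \<and> compact (closure {x. \<phi> x \<noteq> 0}) \<and> closure {x. \<phi> x \<noteq> 0} \<subseteq> \<Omega>"

text \<open>Elements of \<open>L2 \<Omega>\<close> and \<open>H1 \<Omega>\<close> are functions, not classes; their values outside \<open>\<Omega>\<close> and on
  null sets play no role. \<open>\<Omega>\<close> is meant to be open in everything that involves weak derivatives.\<close>

definition L2 :: "'a::euclidean_space set \<Rightarrow> ('a \<Rightarrow> real) set" where
  "L2 \<Omega> = {u. set_borel_measurable lebesgue \<Omega> u \<and> set_integrable lebesgue \<Omega> (\<lambda>x. (u x)\<^sup>2)}"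

definition L2_norm :: "'a::euclidean_space set \<Rightarrow> ('a \<Rightarrow> real) \<Rightarrow> real" where
  "L2_norm \<Omega> u = sqrt (LINT x:\<Omega>|lebesgue. (u x)\<^sup>2)"

text \<open>\<open>g\<close> is a square integrable weak derivative of \<open>u\<close> in direction \<open>v\<close>.\<close>

definition weak_deriv :: "'a::euclidean_space set \<Rightarrow> 'a \<Rightarrow> ('a \<Rightarrow> real) \<Rightarrow> ('a \<Rightarrow> real) \<Rightarrow> bool" where
  "weak_deriv \<Omega> v u g \<longleftrightarrow> g \<in> L2 \<Omega> \<and>
     (\<forall>\<phi>. test_fun \<Omega> \<phi> \<longrightarrow>
        (LINT x:\<Omega>|lebesgue. u x * frechet_derivative \<phi> (at x) v) = - (LINT x:\<Omega>|lebesgue. g x * \<phi> x))"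

definition H1 :: "'a::euclidean_space set \<Rightarrow> ('a \<Rightarrow> real) set" where
  "H1 \<Omega> = {u \<in> L2 \<Omega>. \<forall>v\<in>Basis. \<exists>g. weak_deriv \<Omega> v u g}"

text \<open>The weak partial derivative of \<open>u \<in> H1 \<Omega>\<close>; it is determined up to a null set of \<open>\<Omega>\<close>.\<close>

definition wderiv :: "'a::euclidean_space set \<Rightarrow> 'a \<Rightarrow> ('a \<Rightarrow> real) \<Rightarrow> 'a \<Rightarrow> real" where
  "wderiv \<Omega> v u = (SOME g. weak_deriv \<Omega> v u g)"

abbreviation (input) wd1 :: "(real \<times> real) set \<Rightarrow> (real \<times> real \<Rightarrow> real) \<Rightarrow> real \<times> real \<Rightarrow> real" where
  "wd1 \<Omega> u \<equiv> wderiv \<Omega> (1, 0) u"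

abbreviation (input) wd2 :: "(real \<times> real) set \<Rightarrow> (real \<times> real \<Rightarrow> real) \<Rightarrow> real \<times> real \<Rightarrow> real" where
  "wd2 \<Omega> u \<equiv> wderiv \<Omega> (0, 1) u"

definition H1_norm :: "'a::euclidean_space set \<Rightarrow> ('a \<Rightarrow> real) \<Rightarrow> real" where
  "H1_norm \<Omega> u = sqrt ((L2_norm \<Omega> u)\<^sup>2 + (\<Sum>v\<in>Basis. (L2_norm \<Omega> (wderiv \<Omega> v u))\<^sup>2))"

definition tendsto_H1 ::
    "'a::euclidean_space set \<Rightarrow> ('i \<Rightarrow> 'a \<Rightarrow> real) \<Rightarrow> ('a \<Rightarrow> real) \<Rightarrow> 'i filter \<Rightarrow> bool" where
  "tendsto_H1 \<Omega> U u F \<longleftrightarrow>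
     (\<forall>\<^sub>F i in F. U i \<in> H1 \<Omega>) \<and> u \<in> H1 \<Omega> \<and> ((\<lambda>i. H1_norm \<Omega> (\<lambda>x. U i x - u x)) \<longlongrightarrow> 0) F"

definition weak_tendsto_L2 ::
    "'a::euclidean_space set \<Rightarrow> ('i \<Rightarrow> 'a \<Rightarrow> real) \<Rightarrow> ('a \<Rightarrow> real) \<Rightarrow> 'i filter \<Rightarrow> bool" where
  "weak_tendsto_L2 \<Omega> U u F \<longleftrightarrow>
     (\<forall>\<^sub>F i in F. U i \<in> L2 \<Omega>) \<and> u \<in> L2 \<Omega> \<and>
     (\<forall>g\<in>L2 \<Omega>. ((\<lambda>i. LINT x:\<Omega>|lebesgue. U i x * g x) \<longlongrightarrow> (LINT x:\<Omega>|lebesgue. u x * g x)) F)"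


section \<open>The reference cell\<close>

text \<open>Near each boundary point, in suitable rotated coordinates \<open>(s, t)\<close> centred at that point, the
  set is the part of a rectangle strictly above the graph of a Lipschitz function. Connectedness is
  not required.\<close>

definition lipschitz_domain :: "(real \<times> real) set \<Rightarrow> bool" where
  "lipschitz_domain Q \<longleftrightarrow> open Q \<and> bounded Q \<and> Q \<noteq> {} \<and>
     (\<forall>p\<in>frontier Q. \<exists>\<theta> r h M \<gamma>. r > 0 \<and> h > 0 \<and> M-lipschitz_on UNIV (\<gamma> :: real \<Rightarrow> real) \<and>
        (\<forall>s t. \<bar>s\<bar> < r \<and> \<bar>t\<bar> < h \<longrightarrow>
           (p + (s * cos \<theta> - t * sin \<theta>, s * sin \<theta> + t * cos \<theta>) \<in> Q \<longleftrightarrow> \<gamma> s < t)))"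

definition Gamma0 :: "(real \<times> real) set \<Rightarrow> (real \<times> real) set" where
  "Gamma0 Q = frontier Q \<inter> {p. snd p = 0}"

text \<open>\<open>v\<close> has trace \<open>g\<close> on \<open>Gamma0 Q\<close>: restriction to the boundary, extended by continuity from
  smooth functions (which are dense in \<open>H1 Q\<close> for a Lipschitz domain). Since \<open>Gamma0 Q\<close> lies on the
  axis, its arc length measure is one-dimensional Lebesgue measure.\<close>

definition has_trace_Gamma0 :: "(real \<times> real) set \<Rightarrow> (real \<times> real \<Rightarrow> real) \<Rightarrow> (real \<Rightarrow> real) \<Rightarrow> bool" where
  "has_trace_Gamma0 Q v g \<longleftrightarrow> g \<in> L2 {s. (s, 0) \<in> Gamma0 Q} \<and>
     (\<exists>\<phi> :: nat \<Rightarrow> real \<times> real \<Rightarrow> real. (\<forall>k. smooth_fun (\<phi> k)) \<and>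
        tendsto_H1 Q \<phi> v sequentially \<and>
        (\<lambda>k. L2_norm {s. (s, 0) \<in> Gamma0 Q} (\<lambda>s. \<phi> k (s, 0) - g s)) \<longlonglongrightarrow> 0)"

definition H1_Gamma0 :: "(real \<times> real) set \<Rightarrow> (real \<times> real \<Rightarrow> real) set" where
  "H1_Gamma0 Q = {v \<in> H1 Q. has_trace_Gamma0 Q v (\<lambda>s. 0)}"

text \<open>Eigenvalues of the negative Laplacian in \<open>Q\<close>, in the weak sense, with Dirichlet condition on
  \<open>Gamma0 Q\<close> and (natural) Neumann condition on the rest of the boundary.\<close>

definition mixed_eigenvalue :: "(real \<times> real) set \<Rightarrow> real \<Rightarrow> bool" where
  "mixed_eigenvalue Q \<mu> \<longleftrightarrow>
     (\<exists>v\<in>H1_Gamma0 Q. \<not> (AE p in lebesgue. p \<in> Q \<longrightarrow> v p = 0) \<and>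
        (\<forall>\<phi>\<in>H1_Gamma0 Q.
           (LINT p:Q|lebesgue. wd1 Q v p * wd1 Q \<phi> p + wd2 Q v p * wd2 Q \<phi> p)
             = \<mu> * (LINT p:Q|lebesgue. v p * \<phi> p)))"

text \<open>For a Lipschitz domain the spectrum is discrete and bounded below, so this infimum is attained.\<close>

definition first_eigenvalue :: "(real \<times> real) set \<Rightarrow> real" where
  "first_eigenvalue Q = Inf {\<mu>. mixed_eigenvalue Q \<mu>}"


section \<open>The comb-like domains\<close>

text \<open>Jumps are allowed, in contrast to \<^const>\<open>piecewise_C1_differentiable_on\<close>.\<close>

definition piecewise_C1_01 :: "(real \<Rightarrow> real) \<Rightarrow> bool" where
  "piecewise_C1_01 b \<longleftrightarrow> (\<exists>S. finite S \<and> b C1_differentiable_on ({0<..<1} - S))"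

definition Omega_minus :: "(real \<Rightarrow> real) \<Rightarrow> (real \<times> real) set" where
  "Omega_minus b = {(x, y). 0 < x \<and> x < 1 \<and> - b x < y \<and> y < 0}"

definition num_teeth :: "real \<Rightarrow> real \<Rightarrow> real \<Rightarrow> nat" where
  "num_teeth \<alpha> L \<epsilon> = (GREATEST N. real N * L * \<epsilon> powr \<alpha> \<le> 1)"

definition tooth :: "real \<Rightarrow> real \<Rightarrow> (real \<times> real) set \<Rightarrow> real \<Rightarrow> nat \<Rightarrow> (real \<times> real) set" where
  "tooth \<alpha> L Q \<epsilon> n = (\<lambda>(x, y). ((real n - 1) * L * \<epsilon> powr \<alpha> + \<epsilon> powr \<alpha> * x, y)) ` Q"

definition Omega_plus :: "real \<Rightarrow> real \<Rightarrow> (real \<times> real) set \<Rightarrow> real \<Rightarrow> (real \<times> real) set" where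
  "Omega_plus \<alpha> L Q \<epsilon> = (\<Union>n\<in>{1..num_teeth \<alpha> L \<epsilon>}. tooth \<alpha> L Q \<epsilon> n)"

definition Omega :: "real \<Rightarrow> real \<Rightarrow> (real \<times> real) set \<Rightarrow> (real \<Rightarrow> real) \<Rightarrow> real \<Rightarrow> (real \<times> real) set" where
  "Omega \<alpha> L Q b \<epsilon> = interior (closure (Omega_minus b \<union> Omega_plus \<alpha> L Q \<epsilon>))"

definition section_integral :: "(real \<times> real) set \<Rightarrow> (real \<times> real \<Rightarrow> real) \<Rightarrow> real \<Rightarrow> real" where
  "section_integral \<Omega> f x = (LINT y:{y. (x, y) \<in> \<Omega>}|lebesgue. f (x, y))"


text \<open>The theorem assumes that the relative boundary of \<open>Gamma0 Q\<close> in the axis is a null set. Otherwise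
  \<open>Gamma0 Q\<close> could be a Cantor set of positive length (take \<open>Q\<close> above the graph of the distance to it):
  then \<^const>\<open>first_eigenvalue\<close> is positive, but no point of \<open>Gamma0 Q\<close> becomes interior to the closure
  in \<^const>\<open>Omega\<close>, so the teeth stay disconnected from the base. \<^const>\<open>Omega_minus\<close> may fail to be open
  at the jumps of \<open>b\<close>; it differs from its interior by a null set.\<close>


section \<open>The boundary value problems\<close>

definition weak_solution_thin ::
    "(real \<times> real) set \<Rightarrow> real \<Rightarrow> (real \<times> real \<Rightarrow> real) \<Rightarrow> (real \<times> real \<Rightarrow> real) \<Rightarrow> bool" where
  "weak_solution_thin \<Omega> \<epsilon> f u \<longleftrightarrow> u \<in> H1 \<Omega> \<and>
     (\<forall>\<phi>\<in>H1 \<Omega>.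
        (LINT p:\<Omega>|lebesgue. wd1 \<Omega> u p * wd1 \<Omega> \<phi> p + 1 / \<epsilon>\<^sup>2 * (wd2 \<Omega> u p * wd2 \<Omega> \<phi> p) + u p * \<phi> p)
          = (LINT p:\<Omega>|lebesgue. f p * \<phi> p))"

definition weak_solution_limit ::
    "(real \<Rightarrow> real) \<Rightarrow> (real \<Rightarrow> real) \<Rightarrow> (real \<Rightarrow> real) \<Rightarrow> (real \<Rightarrow> real) \<Rightarrow> bool" where
  "weak_solution_limit b q f u \<longleftrightarrow> u \<in> H1 {0<..<1} \<and>
     (\<forall>\<phi>\<in>H1 {0<..<1}.
        (LINT x:{0<..<1}|lebesgue.
            b x * wderiv {0<..<1} 1 u x * wderiv {0<..<1} 1 \<phi> x + q x * u x * \<phi> x)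
          = (LINT x:{0<..<1}|lebesgue. f x * \<phi> x))"

end

theory Submission
  imports Defs
begin

text \<open>Let \<open>v\<close> be a smooth approximation of \<open>u0\<close> on \<open>(0, 1)\<close>, and let \<open>\<Phi>(x, y)\<close> be \<open>v(x)\<close> for \<open>y \<le> \<delta> / 2\<close> and
  constant on each tooth for \<open>y \<ge> \<delta>\<close>. The teeth have width of order \<open>\<epsilon>\<^sup>\<alpha>\<close> with \<open>\<alpha> > 1\<close>, so \<open>\<Phi>\<close> costs little in the
  term with the factor \<open>1 / \<epsilon>\<^sup>2\<close>, and \<open>\<partial>\<^sub>1\<Phi>\<close> lives on \<open>\<Omega>\<^sub>-\<close> and on a strip of height \<open>\<delta>\<close>. The equation is tested
  with \<open>w = u - \<Phi>\<close>, and \<open>w\<close> is split into the average \<open>z(x)\<close> over a vertical segment in \<open>\<Omega>\<^sub>-\<close> and a remainder.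
  The remainder is small in \<open>L\<^sup>2\<close> compared with the energy of \<open>w\<close>: on \<open>\<Omega>\<^sub>-\<close> because \<open>\<partial>\<^sub>2w\<close> is of order \<open>\<epsilon>\<close> times the energy,
  and on the teeth by a scaled Poincare inequality. What is left are one-dimensional pairings with
  \<open>z\<close>, which is bounded in \<open>H\<^sup>1(0, 1)\<close> by the energy; weakly convergent coefficients converge uniformly against such \<open>z\<close>,
  and the limit equation tested with \<open>z\<close> cancels the main terms. No compactness of \<open>u\<close> is needed.

  The Poincare inequality on the reference cell controls a function by its values in finitely many boxes standing on
  \<open>\<Gamma>\<^sub>0\<close>. It is available because \<open>e\<^sub>1 > 0\<close>: if some component of the cell did not stand on a segment of \<open>\<Gamma>\<^sub>0\<close>, the
  indicator of the union of such components would be an eigenfunction for the eigenvalue \<open>0\<close>.\<close>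

section \<open>Smooth functions\<close>

text \<open>A profile that depends on x alone fails on the teeth: its x-derivative would contribute
  there at order one, while the limit equation has only \<open>b\<close> in front of the derivative.
  Hence \<open>\<Phi>\<close> is constant across each tooth. It must return to v at the axis, where
  moreover the teeth may touch the side walls of their cells, so the constancy starts only at height
  \<delta>, and the strip below costs a multiple of sqrt \<delta>. The remainder is small in L2, but
  its x-derivative is merely bounded by the energy. In the base this derivative is paired with v'.
  There v' is replaced by a test function \<psi> of the base, so that the derivative can be moved
  from the remainder to \<psi>. A tolerance \<tau> comes first, then v, \<delta> and \<psi>, and
  \<epsilon> last; constants that blow up with the earlier choices are therefore harmless. Every
  error is linear in the energy norm A, so A^2 <= K A yields A <= K with K a fixed multiple of
  \<tau>.\<close>

lemma Ck_fun_SucI: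
  assumes "\<And>x. (f has_derivative D x) (at x)"
    and "\<And>v. v \<in> Basis \<Longrightarrow> Ck_fun k (\<lambda>x. D x v)"
  shows "Ck_fun (Suc k) f"
proof -
  have "frechet_derivative f (at x) = D x" for x
    using assms(1) frechet_derivative_at by metis
  moreover have "f differentiable_on UNIV"
    using assms(1) by (auto simp: differentiable_on_def differentiable_def)
  ultimately show ?thesis using assms(2) by simp
qed

lemma Ck_fun_SucD:
  assumes "Ck_fun (Suc k) f"
  shows "(f has_derivative frechet_derivative f (at x)) (at x)"
    and "v \<in> Basis \<Longrightarrow> Ck_fun k (\<lambda>x. frechet_derivative f (at x) v)"
  using assms by (auto simp: differentiable_on_def frechet_derivative_works)

lemma Ck_fun_Suc_imp: "Ck_fun (Suc k) f \<Longrightarrow> Ck_fun k f"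
proof (induction k arbitrary: f)
  case 0
  then show ?case by (auto intro: differentiable_imp_continuous_on)
next
  case (Suc k)
  then show ?case by (metis Ck_fun.simps(2))
qed

lemma Ck_fun_continuous: "Ck_fun k f \<Longrightarrow> continuous_on UNIV f"
  by (induction k) (auto intro: differentiable_imp_continuous_on)

lemma Ck_fun_const: "Ck_fun k (\<lambda>x. c)"
proof (induction k arbitrary: c)
  case (Suc k)
  show ?case by (rule Ck_fun_SucI[where D="\<lambda>x v. 0"]) (use Suc in auto)
qed simp

lemma Ck_fun_add: "Ck_fun k f \<Longrightarrow> Ck_fun k g \<Longrightarrow> Ck_fun k (\<lambda>x. f x + g x)"
proof (induction k arbitrary: f g)
  case 0
  then show ?case by (auto intro: continuous_intros)
next
  case (Suc k)
  show ?case
    by (rule Ck_fun_SucI[OF has_derivative_add[OF Ck_fun_SucD(1)[OF Suc.prems(1)] Ck_fun_SucD(1)[OF Suc.prems(2)]]])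
      (intro Suc.IH Ck_fun_SucD(2) Suc.prems)
qed

lemma Ck_fun_mult: "Ck_fun k f \<Longrightarrow> Ck_fun k g \<Longrightarrow> Ck_fun k (\<lambda>x. f x * g x)"
proof (induction k arbitrary: f g)
  case 0
  then show ?case by (auto intro: continuous_intros)
next
  case (Suc k)
  show ?case
    by (rule Ck_fun_SucI[OF has_derivative_mult[OF Ck_fun_SucD(1)[OF Suc.prems(1)] Ck_fun_SucD(1)[OF Suc.prems(2)]]])
      (intro Suc.IH Ck_fun_add Ck_fun_SucD(2) Suc.prems Ck_fun_Suc_imp[OF Suc.prems(1)] Ck_fun_Suc_imp[OF Suc.prems(2)])
qed

lemma Ck_fun_sum: "(\<And>i. i \<in> I \<Longrightarrow> Ck_fun k (f i)) \<Longrightarrow> Ck_fun k (\<lambda>x. \<Sum>i\<in>I. f i x)"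
  by (induction I rule: infinite_finite_induct) (auto intro: Ck_fun_add Ck_fun_const)

lemma Ck_fun_linear: "bounded_linear f \<Longrightarrow> Ck_fun k f"
proof (induction k)
  case 0
  then show ?case by (simp add: linear_continuous_on)
next
  case (Suc k)
  show ?case
    by (rule Ck_fun_SucI[where D="\<lambda>x. f"]) (use Suc bounded_linear_imp_has_derivative Ck_fun_const in auto)
qed

text \<open>The derivative of the composition in direction v is the derivative of \<open>h\<close>
  at \<open>f x\<close> times that of \<open>f\<close>. Both factors are of one order less, so the
  product rule closes the induction.\<close>

lemma Ck_fun_compose: "Ck_fun k h \<Longrightarrow> Ck_fun k f \<Longrightarrow> Ck_fun k (\<lambda>x. (h :: real \<Rightarrow> real) (f x))"
proof (induction k arbitrary: h f)
  case 0
  then show ?case by (auto intro: continuous_on_compose2)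
next
  case (Suc k)
  let ?h' = "\<lambda>y. frechet_derivative h (at y) 1"
  have "((\<lambda>x. h (f x)) has_derivative (\<lambda>v. frechet_derivative h (at (f x)) (frechet_derivative f (at x) v))) (at x)" for x
    using diff_chain_at[OF Ck_fun_SucD(1)[OF Suc.prems(2)] Ck_fun_SucD(1)[OF Suc.prems(1)], of x] by (simp add: o_def)
  note 1 = this
  have 2: "frechet_derivative h (at y) t = ?h' y * t" for y t
  proof -
    have "linear (frechet_derivative h (at y))"
      using Ck_fun_SucD(1)[OF Suc.prems(1)] has_derivative_linear by blast
    from linear_cmul[OF this, of t 1] show ?thesis by simp
  qed
  have "((\<lambda>x. h (f x)) has_derivative (\<lambda>v. ?h' (f x) * frechet_derivative f (at x) v)) (at x)" for x
    by (rule has_derivative_eq_rhs[OF 1 ext]) (rule 2)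
  moreover have "Ck_fun k (\<lambda>x. ?h' (f x) * frechet_derivative f (at x) v)" if "v \<in> Basis" for v
    using that by (intro Ck_fun_mult Suc.IH[OF Ck_fun_SucD(2)[OF Suc.prems(1)] Ck_fun_Suc_imp[OF Suc.prems(2)]]
        Ck_fun_SucD(2)[OF Suc.prems(2)]) auto
  ultimately show ?case by (rule Ck_fun_SucI)
qed

lemma frechet_derivative_Pair_split:
  fixes D :: "real \<times> real \<Rightarrow> real"
  assumes "(f has_derivative D) (at x)"
  shows "D (a, b) = a * D (1, 0) + b * D (0, 1)"
proof -
  have l: "linear D" using assms has_derivative_linear by blast
  have "D (a, b) = D (a *\<^sub>R (1, 0) + b *\<^sub>R (0, 1))" by simp
  also have "\<dots> = a * D (1, 0) + b * D (0, 1)"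
    using l by (simp add: linear_add linear_cmul del: scaleR_Pair)
  finally show ?thesis .
qed

lemma Basis_real_prod: "(Basis :: (real \<times> real) set) = {(1, 0), (0, 1)}"
  by (auto simp: Basis_prod_def)

lemma Ck_fun_compose_Pair:
  fixes h :: "real \<times> real \<Rightarrow> real"
  shows "Ck_fun k h \<Longrightarrow> Ck_fun k f \<Longrightarrow> Ck_fun k g \<Longrightarrow> Ck_fun k (\<lambda>x. h (f x, g x))"
proof (induction k arbitrary: h f g)
  case 0
  then show ?case by (auto intro!: continuous_on_compose2[of UNIV h] continuous_intros)
next
  case (Suc k)
  let ?h1 = "\<lambda>y. frechet_derivative h (at y) (1, 0)"
  let ?h2 = "\<lambda>y. frechet_derivative h (at y) (0, 1)"
  have "((\<lambda>x. h (f x, g x)) has_derivative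
      (\<lambda>v. frechet_derivative h (at (f x, g x)) (frechet_derivative f (at x) v, frechet_derivative g (at x) v))) (at x)" for x
    using diff_chain_at[OF has_derivative_Pair[OF Ck_fun_SucD(1)[OF Suc.prems(2)] Ck_fun_SucD(1)[OF Suc.prems(3)]] Ck_fun_SucD(1)[OF Suc.prems(1)], of x] by (simp add: o_def)
  note 1 = this
  have 2: "frechet_derivative h (at y) (s, t) = s * ?h1 y + t * ?h2 y" for y s t
    by (rule frechet_derivative_Pair_split[OF Ck_fun_SucD(1)[OF Suc.prems(1)]])
  have "((\<lambda>x. h (f x, g x)) has_derivative
      (\<lambda>v. frechet_derivative f (at x) v * ?h1 (f x, g x) + frechet_derivative g (at x) v * ?h2 (f x, g x))) (at x)" for x
    by (rule has_derivative_eq_rhs[OF 1 ext]) (rule 2)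
  moreover have "Ck_fun k (\<lambda>x. frechet_derivative f (at x) v * ?h1 (f x, g x) + frechet_derivative g (at x) v * ?h2 (f x, g x))"
    if "v \<in> Basis" for v
    using that
    by (intro Ck_fun_add Ck_fun_mult Ck_fun_SucD(2)[OF Suc.prems(2)] Ck_fun_SucD(2)[OF Suc.prems(3)]
        Suc.IH[OF Ck_fun_SucD(2)[OF Suc.prems(1)] Ck_fun_Suc_imp[OF Suc.prems(2)] Ck_fun_Suc_imp[OF Suc.prems(3)]])
      (auto simp: Basis_real_prod)
  ultimately show ?case by (rule Ck_fun_SucI)
qed

lemma smooth_fun_const: "smooth_fun (\<lambda>x. c)"
  and smooth_fun_add: "smooth_fun f \<Longrightarrow> smooth_fun g \<Longrightarrow> smooth_fun (\<lambda>x. f x + g x)"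
  and smooth_fun_mult: "smooth_fun f \<Longrightarrow> smooth_fun g \<Longrightarrow> smooth_fun (\<lambda>x. f x * g x)"
  and smooth_fun_sum: "(\<And>i. i \<in> I \<Longrightarrow> smooth_fun (F i)) \<Longrightarrow> smooth_fun (\<lambda>x. \<Sum>i\<in>I. F i x)"
  and smooth_fun_linear: "bounded_linear f \<Longrightarrow> smooth_fun f"
  and smooth_fun_compose: "smooth_fun h \<Longrightarrow> smooth_fun f \<Longrightarrow> smooth_fun (\<lambda>x. (h :: real \<Rightarrow> real) (f x))"
  and smooth_fun_compose_Pair: "smooth_fun H \<Longrightarrow> smooth_fun f \<Longrightarrow> smooth_fun g \<Longrightarrow>
    smooth_fun (\<lambda>x. (H :: real \<times> real \<Rightarrow> real) (f x, g x))"
  for f g :: "'a::euclidean_space \<Rightarrow> real"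
  unfolding smooth_fun_def
  by (auto intro: Ck_fun_const Ck_fun_add Ck_fun_mult Ck_fun_sum Ck_fun_linear Ck_fun_compose Ck_fun_compose_Pair)

lemma smooth_fun_fst: "smooth_fun (fst :: real \<times> 'a::euclidean_space \<Rightarrow> real)"
  and smooth_fun_snd: "smooth_fun (snd :: 'a \<times> real \<Rightarrow> real)"
  and smooth_fun_id: "smooth_fun (\<lambda>x :: real. x)"
  by (intro smooth_fun_linear bounded_linear_fst bounded_linear_snd bounded_linear_ident)+

lemma smooth_fun_continuous: "smooth_fun f \<Longrightarrow> continuous_on S f"
  unfolding smooth_fun_def using Ck_fun_continuous continuous_on_subset by blast

lemma smooth_fun_has_derivative:
  "smooth_fun f \<Longrightarrow> (f has_derivative frechet_derivative f (at x)) (at x)"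
  unfolding smooth_fun_def using Ck_fun_SucD(1) by blast

lemma smooth_fun_deriv_Basis:
  "smooth_fun f \<Longrightarrow> v \<in> Basis \<Longrightarrow> smooth_fun (\<lambda>x. frechet_derivative f (at x) v)"
  unfolding smooth_fun_def using Ck_fun_SucD(2) by blast

text \<open>\<open>smooth_fun\<close> iterates derivatives in basis directions only; expanding
  \<open>v\<close> in the basis gives all directions.\<close>

lemma smooth_fun_deriv:
  fixes f :: "'a::euclidean_space \<Rightarrow> real"
  assumes "smooth_fun f"
  shows "smooth_fun (\<lambda>x. frechet_derivative f (at x) v)"
proof -
  have "frechet_derivative f (at x) v = (\<Sum>b\<in>Basis. (v \<bullet> b) * frechet_derivative f (at x) b)" for x
  proof -
    have l: "linear (frechet_derivative f (at x))"
      using smooth_fun_has_derivative[OF assms] has_derivative_linear by blast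
    have "frechet_derivative f (at x) v = frechet_derivative f (at x) (\<Sum>b\<in>Basis. (v \<bullet> b) *\<^sub>R b)"
      by (simp add: euclidean_representation)
    then show ?thesis using l by (simp add: linear_sum linear_cmul)
  qed
  then have "(\<lambda>x. frechet_derivative f (at x) v) = (\<lambda>x. \<Sum>b\<in>Basis. (v \<bullet> b) * frechet_derivative f (at x) b)"
    by (rule ext)
  moreover have "smooth_fun (\<lambda>x. \<Sum>b\<in>Basis. (v \<bullet> b) * frechet_derivative f (at x) b)"
    by (intro smooth_fun_sum smooth_fun_mult smooth_fun_const smooth_fun_deriv_Basis assms)
  ultimately show ?thesis by metis
qed

lemma smooth_fun_SucI:
  assumes "\<And>x. (f has_derivative D x) (at x)"
    and "\<And>v. v \<in> Basis \<Longrightarrow> smooth_fun (\<lambda>x. D x v)"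
  shows "smooth_fun f"
proof -
  have "Ck_fun (Suc k) f" for k
    using assms by (intro Ck_fun_SucI) (auto simp: smooth_fun_def)
  then show ?thesis unfolding smooth_fun_def using Ck_fun_Suc_imp by blast
qed

lemma smooth_fun_real_SucI:
  assumes "\<And>x. (f has_real_derivative g x) (at x)" "smooth_fun g"
  shows "smooth_fun f"
  by (rule smooth_fun_SucI[where D="\<lambda>x. (*) (g x)"])
    (use assms in \<open>auto simp: has_field_derivative_def\<close>)

lemma smooth_fun_translate:
  fixes f :: "'a::euclidean_space \<Rightarrow> real"
  shows "smooth_fun f \<Longrightarrow> smooth_fun (\<lambda>x. f (x + a))"
proof -
  have "Ck_fun k f \<Longrightarrow> Ck_fun k (\<lambda>x. f (x + a))" for k
  proof (induction k arbitrary: f)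
    case 0
    then show ?case by (auto intro!: continuous_on_compose2[of UNIV f] continuous_intros)
  next
    case (Suc k)
    have "((\<lambda>x. f (x + a)) has_derivative frechet_derivative f (at (x + a))) (at x)" for x
      using has_derivative_compose[OF has_derivative_add[OF has_derivative_ident has_derivative_const], OF Ck_fun_SucD(1)[OF Suc.prems], of a x UNIV] by simp
    then show ?case
      by (rule Ck_fun_SucI) (intro Suc.IH Ck_fun_SucD(2)[OF Suc.prems])
  qed
  then show "smooth_fun f \<Longrightarrow> ?thesis" by (simp add: smooth_fun_def)
qed

section \<open>The flat exponential, smooth steps and bumps\<close>

text \<open>The classical flat function, kept as a family in \<open>n\<close> because
  differentiation maps member \<open>n\<close> to a combination of members \<open>n + 1\<close> and
  \<open>n + 2\<close>: smoothness follows by one induction that runs over all \<open>n\<close> at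
  once.\<close>

definition flat_exp :: "nat \<Rightarrow> real \<Rightarrow> real" where
  "flat_exp n x = (if x > 0 then exp (- 1 / x) / x ^ n else 0)"

text \<open>Raising t <= exp t to the power m = n + 2 at t = 1 / (x m) gives exp (- 1 / x) <= (x
  m)^m. The two powers of x that remain after division by x^n make the derivative at 0
  vanish.\<close>

lemma flat_exp_bound: "\<bar>flat_exp n x\<bar> \<le> real (n + 2) ^ (n + 2) * x\<^sup>2"
proof (cases "x > 0")
  case True
  define m where "m = n + 2"
  have m: "m > 0" by (simp add: m_def)
  have "1 / (x * m) \<le> exp (1 / (x * m))"
    using exp_ge_add_one_self[of "1 / (x * m)"] by linarith
  then have "(1 / (x * m)) ^ m \<le> exp (1 / (x * m)) ^ m"
    using True by (intro power_mono) auto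
  also have "\<dots> = exp (1 / x)"
    using m True by (simp flip: exp_of_nat_mult)
  finally have "exp (- (1 / x)) \<le> (x * m) ^ m"
    using True m by (simp add: exp_minus field_simps power_divide)
  then have "exp (- 1 / x) / x ^ n \<le> (x * m) ^ m / x ^ n"
    using True by (intro divide_right_mono) auto
  also have "\<dots> = real m ^ m * x\<^sup>2"
  proof -
    have "x ^ m = x ^ n * x\<^sup>2" by (simp add: m_def power_add power2_eq_square)
    then have "(x * m) ^ m / x ^ n = real m ^ m * (x ^ n * x\<^sup>2) / x ^ n"
      by (metis mult.commute power_mult_distrib)
    also have "\<dots> = real m ^ m * x\<^sup>2" using True by (metis less_numeral_extra(3) mult.left_commute nonzero_mult_div_cancel_left power_not_zero)
    finally show ?thesis .
  qed
  finally show ?thesis using True by (simp add: flat_exp_def m_def)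
qed (auto simp: flat_exp_def)

lemma has_real_derivative_zero_of_quadratic_bound:
  fixes f :: "real \<Rightarrow> real"
  assumes "\<And>x. \<bar>f x\<bar> \<le> C * x\<^sup>2"
  shows "(f has_real_derivative 0) (at 0)"
proof -
  have "f 0 = 0" using assms[of 0] by simp
  have "(\<lambda>h. f h / h) \<midarrow>0\<rightarrow> 0"
  proof (rule Lim_null_comparison)
    show "\<forall>\<^sub>F h in at 0. norm (f h / h) \<le> C * \<bar>h\<bar>"
      using assms by (auto simp: eventually_at_filter abs_divide divide_le_eq power2_eq_square mult.assoc abs_mult_self_eq)
    show "((\<lambda>h. C * \<bar>h\<bar>) \<longlongrightarrow> 0) (at 0)" by (auto intro!: tendsto_eq_intros)
  qed
  then show ?thesis using \<open>f 0 = 0\<close> by (simp add: has_field_derivative_iff)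
qed

lemma flat_exp_deriv:
  "(flat_exp n has_real_derivative - real n * flat_exp (Suc n) x + flat_exp (n + 2) x) (at x)"
proof (cases "x = 0")
  case True
  moreover have "flat_exp m 0 = 0" for m by (simp add: flat_exp_def)
  ultimately show ?thesis
    using has_real_derivative_zero_of_quadratic_bound[OF flat_exp_bound] by simp
next
  case False
  show ?thesis
  proof (cases "x > 0")
    case True
    have p: "real n * x ^ (n - 1) = real n * x ^ n / x" using True by (cases n) auto
    have "((\<lambda>x. exp (- 1 / x) / x ^ n) has_real_derivative
        (exp (- 1 / x) * (1 / x\<^sup>2) * x ^ n - exp (- 1 / x) * (real n * x ^ (n - 1))) / (x ^ n * x ^ n)) (at x)"
      using True by (auto intro!: derivative_eq_intros simp: power2_eq_square)
    also have "(exp (- 1 / x) * (1 / x\<^sup>2) * x ^ n - exp (- 1 / x) * (real n * x ^ (n - 1))) / (x ^ n * x ^ n)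
        = - real n * flat_exp (Suc n) x + flat_exp (n + 2) x"
      unfolding p using True by (simp add: flat_exp_def field_simps power2_eq_square)
    finally have "((\<lambda>x. exp (- 1 / x) / x ^ n) has_real_derivative - real n * flat_exp (Suc n) x + flat_exp (n + 2) x) (at x)" .
    then show ?thesis
      by (rule has_field_derivative_transform_within_open[of _ _ _ "{0<..}"]) (use True in \<open>auto simp: flat_exp_def\<close>)
  next
    case f: False
    have "((\<lambda>x. 0) has_real_derivative - real n * flat_exp (Suc n) x + flat_exp (n + 2) x) (at x)"
      using f False by (auto simp: flat_exp_def)
    then show ?thesis
      by (rule has_field_derivative_transform_within_open[of _ _ _ "{..<0}"]) (use f False in \<open>auto simp: flat_exp_def\<close>)
  qed
qed

lemma smooth_flat_exp: "smooth_fun (flat_exp n)"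
proof -
  have "Ck_fun k (flat_exp n)" for k
  proof (induction k arbitrary: n)
    case 0
    show ?case using flat_exp_deriv[of n] by (auto intro: DERIV_isCont continuous_at_imp_continuous_on)
  next
    case (Suc k)
    have "Ck_fun k (\<lambda>x. (- real n * flat_exp (Suc n) x + flat_exp (n + 2) x) * v)" for v
      by (intro Ck_fun_add Ck_fun_mult Ck_fun_const Suc)
    then show ?case
      by (rule Ck_fun_SucI[rotated]) (rule flat_exp_deriv[unfolded has_field_derivative_def])
  qed
  then show ?thesis by (simp add: smooth_fun_def)
qed

definition primitive :: "real \<Rightarrow> (real \<Rightarrow> real) \<Rightarrow> real \<Rightarrow> real" where
  "primitive a f x = integral {a..x} f"

lemma primitive_deriv:
  assumes "continuous_on UNIV f" "\<And>x. x \<le> a \<Longrightarrow> f x = 0"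
  shows "(primitive a f has_real_derivative f x) (at x)"
proof -
  \<comment> \<open>A base point to the left of both \<open>a\<close> and \<open>x\<close>: near
    \<open>x\<close> the integral from \<open>c\<close> agrees with \<open>primitive a f\<close>
    also when \<open>x\<close> is at or left of \<open>a\<close>, and \<open>x\<close> becomes an
    interior point of the interval of integration.\<close>
  define c where "c = min a x - 1"
  have int: "f integrable_on {p..q}" for p q
    using assms(1) continuous_on_subset integrable_continuous_real by blast
  have eq: "primitive a f y = integral {c..y} f" if "y \<in> {c..x + 1}" for y
  proof (cases "y \<le> a")
    case True
    have "integral {c..y} f = integral {c..y} (\<lambda>x. 0)"
      using True assms(2) by (intro integral_cong) auto
    moreover have "integral {a..y} f = 0" using True by (cases "y = a") auto
    ultimately show ?thesis by (simp add: primitive_def)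
  next
    case False
    have "integral {c..a} f + integral {a..y} f = integral {c..y} f"
      using False int by (intro Henstock_Kurzweil_Integration.integral_combine) (auto simp: c_def)
    moreover have "integral {c..a} f = integral {c..a} (\<lambda>x. 0)"
      using assms(2) by (intro integral_cong) auto
    ultimately show ?thesis by (simp add: primitive_def)
  qed
  have "((\<lambda>y. integral {c..y} f) has_real_derivative f x) (at x within {c..x + 1})"
    using assms(1) continuous_on_subset by (intro integral_has_real_derivative) (auto simp: c_def)
  moreover have "x \<in> interior {c..x + 1}" by (auto simp: c_def)
  ultimately have "((\<lambda>y. integral {c..y} f) has_real_derivative f x) (at x)"
    by (metis at_within_interior)
  then show ?thesis
    by (rule has_field_derivative_transform_within_open[of _ _ _ "{c<..<x + 1}"])
      (use eq in \<open>auto simp: c_def\<close>)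
qed

lemma primitive_left: "x \<le> a \<Longrightarrow> primitive a f x = 0"
  by (cases "x = a") (auto simp: primitive_def)

lemma primitive_right:
  assumes "continuous_on UNIV f" "\<And>x. b \<le> x \<Longrightarrow> f x = 0" "a \<le> b" "b \<le> x"
  shows "primitive a f x = integral {a..b} f"
proof -
  have int: "f integrable_on {p..q}" for p q
    using assms(1) continuous_on_subset integrable_continuous_real by blast
  have "integral {a..b} f + integral {b..x} f = integral {a..x} f"
    using assms int by (intro Henstock_Kurzweil_Integration.integral_combine) auto
  moreover have "integral {b..x} f = integral {b..x} (\<lambda>x. 0)"
    using assms(2) by (intro integral_cong) auto
  ultimately show ?thesis by (simp add: primitive_def)
qed

lemma smooth_primitive: "smooth_fun f \<Longrightarrow> (\<And>x. x \<le> a \<Longrightarrow> f x = 0) \<Longrightarrow> smooth_fun (primitive a f)"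
  using primitive_deriv smooth_fun_continuous smooth_fun_real_SucI by blast

text \<open>The primitive of a bump on (0, 1), divided by its total mass.\<close>

lemma smooth_step_exists:
  obtains h :: "real \<Rightarrow> real" where "smooth_fun h" "\<And>x. 0 \<le> h x" "\<And>x. h x \<le> 1"
    "\<And>x. x \<le> 0 \<Longrightarrow> h x = 0" "\<And>x. 1 \<le> x \<Longrightarrow> h x = 1"
proof -
  define \<beta> where "\<beta> x = flat_exp 0 x * flat_exp 0 (1 + (-1) * x)" for x
  have sm: "smooth_fun \<beta>" unfolding \<beta>_def
    by (intro smooth_fun_mult smooth_flat_exp smooth_fun_compose[OF smooth_flat_exp] smooth_fun_add smooth_fun_const smooth_fun_id)
  have co: "continuous_on A \<beta>" for A using sm smooth_fun_continuous by blast
  have \<beta>: "\<beta> x \<ge> 0" "x \<le> 0 \<Longrightarrow> \<beta> x = 0" "1 \<le> x \<Longrightarrow> \<beta> x = 0" "0 < x \<Longrightarrow> x < 1 \<Longrightarrow> \<beta> x > 0" for x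
    by (auto simp: \<beta>_def flat_exp_def)
  define B where "B = primitive 0 \<beta>"
  have d: "(B has_real_derivative \<beta> x) (at x)" for x
    unfolding B_def using \<beta> by (intro primitive_deriv co) auto
  have mono: "B x \<le> B y" if "x \<le> y" for x y
    using that d \<beta>(1) DERIV_nonneg_imp_nondecreasing by blast
  have r: "B x = B 1" if "1 \<le> x" for x
    unfolding B_def using \<beta> that primitive_right[OF co, of 1 0 x] primitive_right[OF co, of 1 0 1] by auto
  have l: "B x = 0" if "x \<le> 0" for x unfolding B_def using that by (rule primitive_left)
  \<comment> \<open>With total mass zero the monotone \<open>B\<close> would vanish on (0, 1),
    against its positive derivative at 1/2.\<close>
  have "B 1 \<noteq> 0"
  proof
    assume "B 1 = 0"
    then have z: "B x = 0" if "x \<in> {0<..<1}" for x using mono[of 0 x] mono[of x 1] l[of 0] that by auto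
    have "((\<lambda>x. 0) has_real_derivative \<beta> (1/2)) (at (1/2))"
      by (rule has_field_derivative_transform_within_open[OF d, of "{0<..<1}"]) (use z in auto)
    then have "\<beta> (1/2) = 0" using DERIV_unique[OF _ DERIV_const] by blast
    then show False using \<beta>(4)[of "1/2"] by simp
  qed
  then have pos: "B 1 > 0" using mono[of 0 1] l[of 0] by auto
  show ?thesis
  proof (rule that[of "\<lambda>x. (1 / B 1) * B x"])
    show "smooth_fun (\<lambda>x. (1 / B 1) * B x)"
      unfolding B_def by (intro smooth_fun_mult smooth_fun_const smooth_primitive sm) (auto intro: \<beta>)
    show "0 \<le> 1 / B 1 * B x" for x using pos mono[of 0 x] mono[of x 0] l[of 0] l[of x] by (cases "x \<le> 0") auto
    show "1 / B 1 * B x \<le> 1" for x using pos mono[of x 1] r[of x] by (cases "x \<le> 1") auto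
    show "1 / B 1 * B x = 0" if "x \<le> 0" for x using l[OF that] by simp
    show "1 / B 1 * B x = 1" if "1 \<le> x" for x using r[OF that] pos by (metis divide_self_if less_irrefl times_divide_eq_left mult_1)
  qed
qed

section \<open>Test functions and smooth Urysohn functions\<close>

lemma closure_support_subset: "(\<And>x. x \<notin> K \<Longrightarrow> f x = 0) \<Longrightarrow> closed K \<Longrightarrow> closure {x. f x \<noteq> 0} \<subseteq> K"
  by (metis (mono_tags, lifting) closure_minimal mem_Collect_eq subsetI)

lemma test_funI:
  assumes "smooth_fun \<phi>" "compact K" "K \<subseteq> U" "\<And>x. x \<notin> K \<Longrightarrow> \<phi> x = 0"
  shows "test_fun U \<phi>"
proof -
  have "closure {x. \<phi> x \<noteq> 0} \<subseteq> K"
    using closure_support_subset[of K \<phi>] assms compact_imp_closed by blast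
  moreover from this have "compact (closure {x. \<phi> x \<noteq> 0})"
    using assms(2) compact_Int_closed[of K "closure {x. \<phi> x \<noteq> 0}"] by (simp add: inf.absorb2)
  ultimately show ?thesis using assms by (auto simp: test_fun_def)
qed

lemma test_funD:
  assumes "test_fun U \<phi>"
  shows "\<exists>K. smooth_fun \<phi> \<and> compact K \<and> K \<subseteq> U \<and> (\<forall>x. x \<notin> K \<longrightarrow> \<phi> x = 0)"
proof (intro exI conjI)
  show "\<forall>x. x \<notin> closure {x. \<phi> x \<noteq> 0} \<longrightarrow> \<phi> x = 0"
    using closure_subset[of "{x. \<phi> x \<noteq> 0}"] by auto
qed (use assms in \<open>auto simp: test_fun_def\<close>)

lemma test_fun_mono: "test_fun U \<phi> \<Longrightarrow> U \<subseteq> V \<Longrightarrow> test_fun V \<phi>"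
  by (auto simp: test_fun_def)

text \<open>The flat exponential of r^2 - |y - x|^2, which is positive exactly in the ball.\<close>

lemma bump_exists:
  fixes x :: "'a::euclidean_space"
  assumes "r > 0"
  obtains \<beta> where "smooth_fun \<beta>" "\<And>y. y \<in> ball x r \<Longrightarrow> \<beta> y > 0" "\<And>y. y \<notin> ball x r \<Longrightarrow> \<beta> y = 0" "\<And>y. 0 \<le> \<beta> y"
proof -
  define g where "g y = r\<^sup>2 - (y - x) \<bullet> (y - x)" for y
  have "smooth_fun g"
  proof (rule smooth_fun_SucI)
    show "(g has_derivative (\<lambda>v. - 2 * ((y - x) \<bullet> v))) (at y)" for y
      unfolding g_def by (auto intro!: derivative_eq_intros simp: inner_commute algebra_simps)
    show "smooth_fun (\<lambda>y. - 2 * ((y - x) \<bullet> v))" for v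
    proof -
      have "smooth_fun (\<lambda>y. (-2) * (y \<bullet> v + (-1) * (x \<bullet> v)))"
        by (intro smooth_fun_mult smooth_fun_const smooth_fun_add smooth_fun_linear bounded_linear_inner_left)
      then show ?thesis by (simp add: inner_diff_left)
    qed
  qed
  then have "smooth_fun (\<lambda>y. flat_exp 0 (g y))" by (rule smooth_fun_compose[OF smooth_flat_exp])
  moreover have "g y > 0 \<longleftrightarrow> y \<in> ball x r" for y
  proof -
    have "(y - x) \<bullet> (y - x) < r\<^sup>2 \<longleftrightarrow> norm (y - x) < r"
      using assms by (metis abs_of_pos norm_lt_square power2_eq_square power2_norm_eq_inner)
    then show ?thesis by (simp add: g_def dist_norm norm_minus_commute)
  qed
  ultimately show ?thesis
    by (intro that[of "\<lambda>y. flat_exp 0 (g y)"]) (auto simp: flat_exp_def)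
qed

text \<open>Finitely many bumps supported in \<open>U\<close> have a sum bounded below by some c > 0
  on \<open>K\<close>. A smooth step applied to the sum divided by c equals 1 on \<open>K\<close>
  and still vanishes outside the supports.\<close>

lemma smooth_Urysohn:
  fixes K :: "'a::euclidean_space set"
  assumes "compact K" "open U" "K \<subseteq> U"
  obtains \<psi> where "test_fun U \<psi>" "\<And>x. x \<in> K \<Longrightarrow> \<psi> x = 1" "\<And>x. 0 \<le> \<psi> x" "\<And>x. \<psi> x \<le> 1"
proof -
  define P where "P x r \<beta> \<longleftrightarrow> r > 0 \<and> cball x r \<subseteq> U \<and> smooth_fun \<beta> \<and> (\<forall>y. y \<in> ball x r \<longrightarrow> \<beta> y > 0)
    \<and> (\<forall>y. y \<notin> ball x r \<longrightarrow> \<beta> y = 0) \<and> (\<forall>y. 0 \<le> \<beta> y)" for x :: 'a and r :: real and \<beta> :: "'a \<Rightarrow> real"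
  have "\<exists>r \<beta>. P x r \<beta>" if x: "x \<in> K" for x
  proof -
    from x obtain r where r: "r > 0" "cball x r \<subseteq> U" using assms open_contains_cball by (metis subsetD)
    from bump_exists[OF r(1), of x] obtain \<beta> where "smooth_fun \<beta>" "\<And>y. y \<in> ball x r \<Longrightarrow> \<beta> y > 0"
      "\<And>y. y \<notin> ball x r \<Longrightarrow> \<beta> y = 0" "\<And>y. 0 \<le> \<beta> y" by blast
    with r show ?thesis unfolding P_def by blast
  qed
  then obtain r \<beta> where P: "\<And>x. x \<in> K \<Longrightarrow> P x (r x) (\<beta> x)" by metis
  have r: "x \<in> K \<Longrightarrow> r x > 0" "x \<in> K \<Longrightarrow> cball x (r x) \<subseteq> U" for x
    using P unfolding P_def by blast+
  have \<beta>: "x \<in> K \<Longrightarrow> smooth_fun (\<beta> x)" "x \<in> K \<Longrightarrow> y \<in> ball x (r x) \<Longrightarrow> \<beta> x y > 0"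
      "x \<in> K \<Longrightarrow> y \<notin> ball x (r x) \<Longrightarrow> \<beta> x y = 0" "x \<in> K \<Longrightarrow> 0 \<le> \<beta> x y" for x y
    using P unfolding P_def by blast+
  have "K \<subseteq> (\<Union>x\<in>K. ball x (r x))" using r(1) by auto
  then obtain D where D: "D \<subseteq> K" "finite D" "K \<subseteq> (\<Union>x\<in>D. ball x (r x))"
    using compactE_image[OF assms(1), of K "\<lambda>x. ball x (r x)"] by auto
  define \<sigma> where "\<sigma> y = (\<Sum>x\<in>D. \<beta> x y)" for y
  have sm: "smooth_fun \<sigma>" unfolding \<sigma>_def using D \<beta>(1) by (intro smooth_fun_sum) auto
  have pos: "\<sigma> y > 0" if "y \<in> K" for y
  proof -
    from that D obtain x where x: "x \<in> D" "y \<in> ball x (r x)" by auto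
    have "\<beta> x y \<le> \<sigma> y" unfolding \<sigma>_def using D \<beta>(4) x by (intro member_le_sum) auto
    then show ?thesis using \<beta>(2)[of x y] x D by force
  qed
  have "\<exists>c>0. \<forall>y\<in>K. c \<le> \<sigma> y"
  proof (cases "K = {}")
    case False
    obtain y where "y \<in> K" "\<forall>z\<in>K. \<sigma> y \<le> \<sigma> z"
      using continuous_attains_inf[OF assms(1) False smooth_fun_continuous[OF sm]] by blast
    then show ?thesis using pos by blast
  qed (auto intro: exI[of _ 1])
  then obtain c where c: "c > 0" "\<And>y. y \<in> K \<Longrightarrow> c \<le> \<sigma> y" by blast
  obtain h :: "real \<Rightarrow> real" where h: "smooth_fun h" "\<And>x. 0 \<le> h x" "\<And>x. h x \<le> 1"
    "\<And>x. x \<le> 0 \<Longrightarrow> h x = 0" "\<And>x. 1 \<le> x \<Longrightarrow> h x = 1" using smooth_step_exists by blast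
  show ?thesis
  proof (rule that[of "\<lambda>y. h ((1 / c) * \<sigma> y)"])
    show "test_fun U (\<lambda>y. h ((1 / c) * \<sigma> y))"
    proof (rule test_funI)
      show "smooth_fun (\<lambda>y. h ((1 / c) * \<sigma> y))"
        by (intro smooth_fun_compose[OF h(1)] smooth_fun_mult smooth_fun_const sm)
      show "compact (\<Union>x\<in>D. cball x (r x))" using D by (intro compact_UN) auto
      show "(\<Union>x\<in>D. cball x (r x)) \<subseteq> U" using D r by blast
      show "h ((1 / c) * \<sigma> y) = 0" if "y \<notin> (\<Union>x\<in>D. cball x (r x))" for y
      proof -
        have "\<sigma> y = 0" unfolding \<sigma>_def using that \<beta>(3) D
          by (intro sum.neutral) (auto simp: not_less subset_iff)
        then show ?thesis using h(4) by simp
      qed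
    qed
    show "h ((1 / c) * \<sigma> x) = 1" if "x \<in> K" for x using c that by (intro h(5)) auto
  qed (use h in auto)
qed

section \<open>Square integrable functions\<close>

text \<open>Extension by zero. It turns set integrals into integrals over the whole space and
  commutes with sums, products and squares, so that these can be rewritten freely.\<close>

definition restr :: "'a set \<Rightarrow> ('a \<Rightarrow> real) \<Rightarrow> 'a \<Rightarrow> real" where
  "restr U u x = (if x \<in> U then u x else 0)"

lemma indicator_scaleR_restr: "(\<lambda>x. indicator U x *\<^sub>R u x) = restr U u"
  by (auto simp: restr_def fun_eq_iff)

lemma set_borel_measurable_restr: "set_borel_measurable M U u \<longleftrightarrow> restr U u \<in> borel_measurable M"
  unfolding set_borel_measurable_def indicator_scaleR_restr ..

lemma set_integrable_restr: "set_integrable M U u \<longleftrightarrow> integrable M (restr U u)"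
  unfolding set_integrable_def indicator_scaleR_restr ..

lemma LINT_restr: "(LINT x:U|M. u x) = (LINT x|M. restr U u x)"
  unfolding set_lebesgue_integral_def indicator_scaleR_restr ..

lemma restr_simps:
  "restr U (\<lambda>x. u x + v x) = (\<lambda>x. restr U u x + restr U v x)"
  "restr U (\<lambda>x. u x - v x) = (\<lambda>x. restr U u x - restr U v x)"
  "restr U (\<lambda>x. c * u x) = (\<lambda>x. c * restr U u x)"
  "restr U (\<lambda>x. - u x) = (\<lambda>x. - restr U u x)"
  "restr U (\<lambda>x. (u x)\<^sup>2) = (\<lambda>x. (restr U u x)\<^sup>2)"
  "restr U (\<lambda>x. \<bar>u x\<bar>) = (\<lambda>x. \<bar>restr U u x\<bar>)"
  "restr U (\<lambda>x. 0) = (\<lambda>x. 0)"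
  by (auto simp: restr_def fun_eq_iff)

lemma restr_mult: "restr U (\<lambda>x. u x * v x) = (\<lambda>x. restr U u x * restr U v x)"
  by (auto simp: restr_def fun_eq_iff)

lemma L2_iff: "u \<in> L2 U \<longleftrightarrow> restr U u \<in> borel_measurable lebesgue \<and> integrable lebesgue (\<lambda>x. (restr U u x)\<^sup>2)"
  by (simp add: L2_def set_borel_measurable_restr set_integrable_restr restr_simps)

lemma L2_norm_restr: "L2_norm U u = sqrt (LINT x|lebesgue. (restr U u x)\<^sup>2)"
  by (simp add: L2_norm_def LINT_restr restr_simps)

lemma L2_norm_nonneg [simp]: "0 \<le> L2_norm U u"
  by (simp add: L2_norm_restr)

lemma L2_norm_power2: "(L2_norm U u)\<^sup>2 = (LINT x:U|lebesgue. (u x)\<^sup>2)"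
  by (simp add: L2_norm_restr LINT_restr restr_simps)

lemma L2_measurable: "u \<in> L2 U \<Longrightarrow> restr U u \<in> borel_measurable lebesgue"
  by (simp add: L2_iff)

text \<open>Lebesgue measure is complete, so preimages that agree up to a null set are measurable
  together.\<close>

lemma lebesgue_measurable_cong_AE:
  fixes f g :: "'a::euclidean_space \<Rightarrow> real"
  assumes f: "f \<in> borel_measurable lebesgue" and eq: "AE x in lebesgue. f x = g x"
  shows "g \<in> borel_measurable lebesgue"
proof (rule measurableI)
  fix A :: "real set" assume A: "A \<in> sets borel"
  have "AE x in lebesgue. x \<in> f -` A \<inter> space lebesgue \<longleftrightarrow> x \<in> g -` A \<inter> space lebesgue"
    using eq by eventually_elim auto
  then show "g -` A \<inter> space lebesgue \<in> sets lebesgue"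
    using completion.in_sets_AE[of "f -` A \<inter> space lebesgue" "g -` A \<inter> space lebesgue"] measurable_sets[OF f A] by auto
qed auto

text \<open>Completeness transfers measurability, so both functions are integrable or neither is; in
  the second case both integrals have the default value 0.\<close>

lemma lebesgue_integrable_cong_AE:
  fixes f g :: "'a::euclidean_space \<Rightarrow> real"
  assumes "AE x in lebesgue. f x = g x"
  shows "integrable lebesgue f \<longleftrightarrow> integrable lebesgue g"
    and "(LINT x|lebesgue. f x) = (LINT x|lebesgue. g x)"
proof -
  have *: "AE x in lebesgue. g x = f x" using assms by eventually_elim auto
  show 1: "integrable lebesgue f \<longleftrightarrow> integrable lebesgue g"
    using integrable_cong_AE_imp assms * lebesgue_measurable_cong_AE borel_measurable_integrable by metis
  show "(LINT x|lebesgue. f x) = (LINT x|lebesgue. g x)"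
  proof (cases "integrable lebesgue f")
    case True
    then show ?thesis using 1 assms by (intro integral_cong_AE) auto
  next
    case False
    then show ?thesis using 1 by (simp add: not_integrable_integral_eq)
  qed
qed

lemma restr_cong_AE: "(AE x in M. x \<in> U \<longrightarrow> u x = v x) \<Longrightarrow> AE x in M. restr U u x = restr U v x"
  by (erule AE_mp, rule AE_I2) (auto simp: restr_def)

lemma LINT_cong_AE:
  fixes u v :: "'a::euclidean_space \<Rightarrow> real"
  assumes "AE x in lebesgue. x \<in> U \<longrightarrow> u x = v x"
  shows "(LINT x:U|lebesgue. u x) = (LINT x:U|lebesgue. v x)"
  unfolding LINT_restr by (rule lebesgue_integrable_cong_AE(2)[OF restr_cong_AE[OF assms]])

lemma L2_cong_AE:
  assumes "AE x in lebesgue. x \<in> U \<longrightarrow> u x = v x"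
  shows "u \<in> L2 U \<longleftrightarrow> v \<in> L2 U" and "L2_norm U u = L2_norm U v"
proof -
  have a: "AE x in lebesgue. restr U u x = restr U v x" "AE x in lebesgue. restr U v x = restr U u x"
    using restr_cong_AE[OF assms] by (auto elim: AE_mp)
  have b: "AE x in lebesgue. (restr U u x)\<^sup>2 = (restr U v x)\<^sup>2" using a(1) by eventually_elim auto
  show "u \<in> L2 U \<longleftrightarrow> v \<in> L2 U"
    unfolding L2_iff using lebesgue_measurable_cong_AE a lebesgue_integrable_cong_AE(1)[OF b] by metis
  show "L2_norm U u = L2_norm U v"
    unfolding L2_norm_restr using lebesgue_integrable_cong_AE(2)[OF b] by simp
qed

lemma L2_cong:
  assumes "\<And>x. x \<in> U \<Longrightarrow> u x = v x"
  shows "u \<in> L2 U \<longleftrightarrow> v \<in> L2 U" and "L2_norm U u = L2_norm U v"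
  using L2_cong_AE[of U u v] assms by auto

lemma integrable_mult_of_square:
  fixes f g :: "'a \<Rightarrow> real"
  assumes [measurable]: "f \<in> borel_measurable M" "g \<in> borel_measurable M"
    and "integrable M (\<lambda>x. (f x)\<^sup>2)" "integrable M (\<lambda>x. (g x)\<^sup>2)"
  shows "integrable M (\<lambda>x. f x * g x)"
proof (rule Bochner_Integration.integrable_bound)
  show "integrable M (\<lambda>x. (f x)\<^sup>2 + (g x)\<^sup>2)" using assms by auto
  have "\<bar>a * b\<bar> \<le> a\<^sup>2 + b\<^sup>2" for a b :: real
  proof -
    have "0 \<le> (\<bar>a\<bar> - \<bar>b\<bar>)\<^sup>2" by simp
    also have "\<dots> = a\<^sup>2 + b\<^sup>2 - 2 * \<bar>a * b\<bar>" by (simp add: power2_diff abs_mult)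
    finally show ?thesis using abs_ge_zero[of "a * b"] by linarith
  qed
  then show "AE x in M. norm (f x * g x) \<le> norm ((f x)\<^sup>2 + (g x)\<^sup>2)" by (intro AE_I2) simp
qed measurable

lemma L2_mult_integrable: "u \<in> L2 U \<Longrightarrow> v \<in> L2 U \<Longrightarrow> set_integrable lebesgue U (\<lambda>x. u x * v x)"
  unfolding L2_iff set_integrable_restr restr_mult by (intro integrable_mult_of_square) auto

lemma L2_zero [simp]: "(\<lambda>x. 0) \<in> L2 U" "L2_norm U (\<lambda>x. 0) = 0"
  by (simp_all add: L2_iff L2_norm_restr restr_simps)

lemma L2_cmult: "u \<in> L2 U \<Longrightarrow> (\<lambda>x. c * u x) \<in> L2 U"
  by (auto simp: L2_iff restr_simps power_mult_distrib)

lemma L2_norm_cmult: "L2_norm U (\<lambda>x. c * u x) = \<bar>c\<bar> * L2_norm U u"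
  by (simp add: L2_norm_restr restr_simps power_mult_distrib real_sqrt_mult)

lemma L2_add: "u \<in> L2 U \<Longrightarrow> v \<in> L2 U \<Longrightarrow> (\<lambda>x. u x + v x) \<in> L2 U"
  using integrable_mult_of_square[of "restr U u" lebesgue "restr U v"]
  by (auto simp: L2_iff restr_simps power2_sum mult.assoc)

lemma L2_uminus: "u \<in> L2 U \<Longrightarrow> (\<lambda>x. - u x) \<in> L2 U"
  using L2_cmult[of u U "-1"] by simp

lemma L2_diff: "u \<in> L2 U \<Longrightarrow> v \<in> L2 U \<Longrightarrow> (\<lambda>x. u x - v x) \<in> L2 U"
  using L2_add[of u U "\<lambda>x. - v x"] L2_uminus[of v U] by simp

lemma L2_norm_uminus [simp]: "L2_norm U (\<lambda>x. - u x) = L2_norm U u"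
  by (simp add: L2_norm_restr restr_simps)

lemma L2_set_integrable_power2: "u \<in> L2 U \<Longrightarrow> set_integrable lebesgue U (\<lambda>x. (u x)\<^sup>2)"
  by (simp add: L2_def)

text \<open>The squared norm of u + t v is a nonnegative quadratic polynomial in t, so its
  discriminant is not positive.\<close>

lemma L2_Cauchy_Schwarz:
  assumes "u \<in> L2 U" "v \<in> L2 U"
  shows "\<bar>LINT x:U|lebesgue. u x * v x\<bar> \<le> L2_norm U u * L2_norm U v"
proof -
  define a where "a = (L2_norm U u)\<^sup>2"
  define b where "b = (LINT x:U|lebesgue. u x * v x)"
  define c where "c = (L2_norm U v)\<^sup>2"
  have i: "set_integrable lebesgue U (\<lambda>x. (u x)\<^sup>2)" "set_integrable lebesgue U (\<lambda>x. (v x)\<^sup>2)"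
    "set_integrable lebesgue U (\<lambda>x. u x * v x)"
    using assms L2_set_integrable_power2 L2_mult_integrable by auto
  have q: "0 \<le> a + 2 * t * b + t\<^sup>2 * c" for t
  proof -
    have "0 \<le> (LINT x:U|lebesgue. (u x + t * v x)\<^sup>2)"
      unfolding LINT_restr restr_simps by simp
    also have "(\<lambda>x. (u x + t * v x)\<^sup>2) = (\<lambda>x. (u x)\<^sup>2 + (2 * t) * (u x * v x) + t\<^sup>2 * (v x)\<^sup>2)"
      by (auto simp: power2_sum power_mult_distrib)
    also have "(LINT x:U|lebesgue. (u x)\<^sup>2 + (2 * t) * (u x * v x) + t\<^sup>2 * (v x)\<^sup>2) = a + 2 * t * b + t\<^sup>2 * c"
      using i by (simp add: set_integral_add(2) set_integral_add(1) a_def b_def c_def L2_norm_power2)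
    finally show ?thesis .
  qed
  have "b\<^sup>2 \<le> a * c"
  proof (cases "c = 0")
    case True
    have "b = 0"
    proof (rule ccontr)
      assume "b \<noteq> 0"
      \<comment> \<open>At this t the polynomial, which is linear because \<open>c = 0\<close>,
        takes the value -1.\<close>
      then show False using q[of "- (a + 1) / (2 * b)"] True by (simp add: field_simps)
    qed
    then show ?thesis using True by simp
  next
    case False
    then have "c > 0" by (simp add: c_def)
    have "a + 2 * (- b / c) * b + (- b / c)\<^sup>2 * c = a - b\<^sup>2 / c"
      using False by (simp add: field_simps power2_eq_square)
    then have "b\<^sup>2 / c \<le> a" using q[of "- b / c"] by linarith
    then show ?thesis using \<open>c > 0\<close> by (simp add: divide_le_eq)
  qed
  then have "\<bar>b\<bar> \<le> sqrt (a * c)" by (metis real_sqrt_abs real_sqrt_le_mono)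
  then show ?thesis by (simp add: a_def b_def c_def real_sqrt_mult)
qed

lemma L2_norm_triangle:
  assumes "u \<in> L2 U" "v \<in> L2 U"
  shows "L2_norm U (\<lambda>x. u x + v x) \<le> L2_norm U u + L2_norm U v"
proof -
  have i: "set_integrable lebesgue U (\<lambda>x. (u x)\<^sup>2)" "set_integrable lebesgue U (\<lambda>x. (v x)\<^sup>2)"
    "set_integrable lebesgue U (\<lambda>x. u x * v x)"
    using assms L2_set_integrable_power2 L2_mult_integrable by auto
  have "(L2_norm U (\<lambda>x. u x + v x))\<^sup>2 = (LINT x:U|lebesgue. (u x)\<^sup>2 + (v x)\<^sup>2 + 2 * (u x * v x))"
    by (simp add: L2_norm_power2 power2_sum mult.assoc)
  also have "\<dots> = (L2_norm U u)\<^sup>2 + (L2_norm U v)\<^sup>2 + 2 * (LINT x:U|lebesgue. u x * v x)"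
    using i by (simp add: set_integral_add(2) set_integral_add(1) L2_norm_power2)
  also have "\<dots> \<le> (L2_norm U u + L2_norm U v)\<^sup>2"
    using L2_Cauchy_Schwarz[OF assms] by (simp add: power2_sum)
  finally show ?thesis by (rule power2_le_imp_le) simp
qed

lemma L2_norm_triangle_diff:
  assumes "u \<in> L2 U" "v \<in> L2 U"
  shows "L2_norm U (\<lambda>x. u x - v x) \<le> L2_norm U u + L2_norm U v"
  using L2_norm_triangle[OF assms(1) L2_uminus[OF assms(2)]] by simp

lemma L2_norm_triangle3:
  assumes "u \<in> L2 U" "v \<in> L2 U" "w \<in> L2 U"
  shows "L2_norm U (\<lambda>x. u x - w x) \<le> L2_norm U (\<lambda>x. u x - v x) + L2_norm U (\<lambda>x. v x - w x)"
  using L2_norm_triangle[OF L2_diff[OF assms(1,2)] L2_diff[OF assms(2,3)]] by simp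

lemma L2_of_measurable_bound:
  assumes "restr U u \<in> borel_measurable lebesgue" "v \<in> L2 U" "\<And>x. x \<in> U \<Longrightarrow> \<bar>u x\<bar> \<le> \<bar>v x\<bar>"
  shows "u \<in> L2 U" and "L2_norm U u \<le> L2_norm U v"
proof -
  have le: "(restr U u x)\<^sup>2 \<le> (restr U v x)\<^sup>2" for x
    using assms(3)[of x] by (auto simp: restr_def abs_le_square_iff)
  have "integrable lebesgue (\<lambda>x. (restr U u x)\<^sup>2)"
    by (rule Bochner_Integration.integrable_bound[of _ "\<lambda>x. (restr U v x)\<^sup>2"])
      (use assms le in \<open>auto simp: L2_iff\<close>)
  then show "u \<in> L2 U" using assms by (simp add: L2_iff)
  show "L2_norm U u \<le> L2_norm U v"
    unfolding L2_norm_restr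
    by (intro real_sqrt_le_mono integral_mono) (use assms le \<open>u \<in> L2 U\<close> in \<open>auto simp: L2_iff\<close>)
qed

lemma restr_measurable:
  "u \<in> borel_measurable lebesgue \<Longrightarrow> U \<in> sets lebesgue \<Longrightarrow> restr U u \<in> borel_measurable lebesgue"
  unfolding indicator_scaleR_restr[symmetric] by (intro borel_measurable_scaleR borel_measurable_indicator)

lemma restr_subset: "A \<subseteq> U \<Longrightarrow> restr A (restr U u) = restr A u"
  by (auto simp: restr_def fun_eq_iff)

lemma restr_self [simp]: "restr U (restr U u) = restr U u"
  by (auto simp: restr_def)

lemma L2_subset:
  assumes "u \<in> L2 U" "A \<subseteq> U" "A \<in> sets lebesgue"
  shows "u \<in> L2 A" and "L2_norm A u \<le> L2_norm U u"
proof -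
  have m: "restr A u \<in> borel_measurable lebesgue"
    using restr_measurable[OF L2_measurable[OF assms(1)] assms(3)] restr_subset[OF assms(2)] by simp
  have le: "(restr A u x)\<^sup>2 \<le> (restr U u x)\<^sup>2" for x
    using assms(2) by (auto simp: restr_def)
  have "integrable lebesgue (\<lambda>x. (restr A u x)\<^sup>2)"
    by (rule Bochner_Integration.integrable_bound[of _ "\<lambda>x. (restr U u x)\<^sup>2"])
      (use assms le m in \<open>auto simp: L2_iff\<close>)
  then show "u \<in> L2 A" using m by (simp add: L2_iff)
  show "L2_norm A u \<le> L2_norm U u"
    unfolding L2_norm_restr
    by (intro real_sqrt_le_mono integral_mono) (use assms le \<open>u \<in> L2 A\<close> in \<open>auto simp: L2_iff\<close>)
qed

lemma L2_mult_bounded: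
  assumes "u \<in> L2 U" "restr U m \<in> borel_measurable lebesgue" "\<And>x. x \<in> U \<Longrightarrow> \<bar>m x\<bar> \<le> B"
  shows "(\<lambda>x. m x * u x) \<in> L2 U" and "L2_norm U (\<lambda>x. m x * u x) \<le> B * L2_norm U u"
proof -
  have b: "\<bar>m x * u x\<bar> \<le> \<bar>\<bar>B\<bar> * u x\<bar>" if "x \<in> U" for x
    using assms(3)[OF that] by (auto simp: abs_mult intro!: mult_right_mono)
  have m: "restr U (\<lambda>x. m x * u x) \<in> borel_measurable lebesgue"
    unfolding restr_mult by (intro borel_measurable_times assms L2_measurable)
  show "(\<lambda>x. m x * u x) \<in> L2 U" by (rule L2_of_measurable_bound(1)[OF m L2_cmult[OF assms(1)] b])
  have le: "L2_norm U (\<lambda>x. m x * u x) \<le> \<bar>B\<bar> * L2_norm U u"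
    using L2_of_measurable_bound(2)[OF m L2_cmult[OF assms(1)] b] by (simp add: L2_norm_cmult)
  show "L2_norm U (\<lambda>x. m x * u x) \<le> B * L2_norm U u"
  \<comment> \<open>The bound just proved has |B| in place of B. On a nonempty set B is nonnegative;
    on the empty set both norms are 0.\<close>
  proof (cases "U = {}")
    case True
    then show ?thesis by (simp add: L2_norm_restr restr_def)
  next
    case False
    then have "B \<ge> 0" using assms(3) abs_ge_zero order_trans by blast
    then show ?thesis using le by simp
  qed
qed

lemma L2_one: "U \<in> lmeasurable \<Longrightarrow> (\<lambda>x. 1) \<in> L2 U" "U \<in> lmeasurable \<Longrightarrow> L2_norm U (\<lambda>x. 1) = sqrt (measure lebesgue U)"
proof -
  have e: "restr U (\<lambda>x. 1) = indicator U" "(\<lambda>x. (indicator U x)\<^sup>2) = (indicator U :: _ \<Rightarrow> real)"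
    by (auto simp: restr_def indicator_def fun_eq_iff)
  show "U \<in> lmeasurable \<Longrightarrow> (\<lambda>x. 1) \<in> L2 U" "U \<in> lmeasurable \<Longrightarrow> L2_norm U (\<lambda>x. 1) = sqrt (measure lebesgue U)"
    by (auto simp: L2_iff L2_norm_restr e fmeasurable_def)
qed

lemma L2_bounded:
  assumes "U \<in> lmeasurable" "restr U m \<in> borel_measurable lebesgue" "\<And>x. x \<in> U \<Longrightarrow> \<bar>m x\<bar> \<le> B"
  shows "m \<in> L2 U" and "L2_norm U m \<le> B * sqrt (measure lebesgue U)"
  using L2_mult_bounded[OF L2_one(1)[OF assms(1)] assms(2,3)] by (simp_all add: L2_one(2)[OF assms(1)])

lemma continuous_lebesgue_measurable:
  "continuous_on UNIV f \<Longrightarrow> f \<in> borel_measurable lebesgue" for f :: "'a::euclidean_space \<Rightarrow> real"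
  using borel_measurable_continuous_onI measurable_completion by (metis measurable_lborel2)

lemma smooth_restr_measurable:
  "smooth_fun f \<Longrightarrow> U \<in> sets lebesgue \<Longrightarrow> restr U f \<in> borel_measurable lebesgue"
  by (intro restr_measurable continuous_lebesgue_measurable smooth_fun_continuous)

lemma test_fun_bounded:
  assumes "test_fun U \<phi>"
  shows "\<exists>B. \<forall>x. \<bar>\<phi> x\<bar> \<le> B"
proof -
  from test_funD[OF assms(1)] obtain K where K: "smooth_fun \<phi>" "compact K" "\<And>x. x \<notin> K \<Longrightarrow> \<phi> x = 0" by blast
  have "bounded (\<phi> ` K)"
    using K compact_continuous_image compact_imp_bounded smooth_fun_continuous by blast
  then obtain B where B: "\<And>x. x \<in> K \<Longrightarrow> \<bar>\<phi> x\<bar> \<le> B" by (auto simp: bounded_iff)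
  have "\<bar>\<phi> x\<bar> \<le> max B 0" for x using B[of x] K(3)[of x] by (cases "x \<in> K") auto
  then show ?thesis by blast
qed

lemma test_fun_zero_outside: "test_fun U \<phi> \<Longrightarrow> x \<notin> U \<Longrightarrow> \<phi> x = 0"
  using test_funD by blast

lemma test_fun_L2:
  assumes "test_fun U \<phi>" "S \<in> sets lebesgue"
  shows "\<phi> \<in> L2 S"
proof -
  from test_funD[OF assms(1)] obtain K where K: "smooth_fun \<phi>" "compact K" "K \<subseteq> U" "\<And>x. x \<notin> K \<Longrightarrow> \<phi> x = 0" by blast
  from test_fun_bounded[OF assms(1)] obtain B where B: "\<And>x. \<bar>\<phi> x\<bar> \<le> B" by blast
  have m: "S \<inter> K \<in> lmeasurable" using K(2) assms(2) by (simp add: fmeasurable_Int_fmeasurable inf_commute lmeasurable_compact)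
  have "\<phi> \<in> L2 (S \<inter> K)"
    by (rule L2_bounded(1)[OF m]) (use K B m in \<open>auto intro!: smooth_restr_measurable simp: fmeasurable_def\<close>)
  moreover have "restr (S \<inter> K) \<phi> = restr S \<phi>" using K(4) by (auto simp: restr_def)
  ultimately show ?thesis by (simp add: L2_iff)
qed

lemma test_fun_deriv:
  assumes "test_fun U \<phi>"
  shows "test_fun U (\<lambda>x. frechet_derivative \<phi> (at x) v)"
proof -
  from test_funD[OF assms(1)] obtain K where K: "smooth_fun \<phi>" "compact K" "K \<subseteq> U" "\<And>x. x \<notin> K \<Longrightarrow> \<phi> x = 0" by blast
  show ?thesis
  proof (rule test_funI[OF smooth_fun_deriv[OF K(1)] K(2,3)])
    fix x assume "x \<notin> K"
    have "((\<lambda>x. 0) has_derivative frechet_derivative \<phi> (at x)) (at x)"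
      by (rule has_derivative_transform_within_open[OF smooth_fun_has_derivative[OF K(1)], of "- K"])
        (use K \<open>x \<notin> K\<close> compact_imp_closed in auto)
    then have "frechet_derivative \<phi> (at x) = (\<lambda>v. 0)"
      using has_derivative_unique[OF _ has_derivative_const] by blast
    then show "frechet_derivative \<phi> (at x) v = 0" by simp
  qed
qed

lemma test_fun_add: "test_fun U \<phi> \<Longrightarrow> test_fun U \<psi> \<Longrightarrow> test_fun U (\<lambda>x. \<phi> x + \<psi> x)"
proof -
  assume a: "test_fun U \<phi>" "test_fun U \<psi>"
  from test_funD[OF a(1)] obtain K where K: "smooth_fun \<phi>" "compact K" "K \<subseteq> U" "\<And>x. x \<notin> K \<Longrightarrow> \<phi> x = 0" by blast
  from test_funD[OF a(2)] obtain L where L: "smooth_fun \<psi>" "compact L" "L \<subseteq> U" "\<And>x. x \<notin> L \<Longrightarrow> \<psi> x = 0" by blast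
  show ?thesis by (rule test_funI[of _ "K \<union> L"]) (use K L smooth_fun_add in auto)
qed

lemma test_fun_mult_smooth: "test_fun U \<phi> \<Longrightarrow> smooth_fun \<psi> \<Longrightarrow> test_fun U (\<lambda>x. \<psi> x * \<phi> x)"
proof -
  assume a: "test_fun U \<phi>" "smooth_fun \<psi>"
  from test_funD[OF a(1)] obtain K where K: "smooth_fun \<phi>" "compact K" "K \<subseteq> U" "\<And>x. x \<notin> K \<Longrightarrow> \<phi> x = 0" by blast
  show ?thesis by (rule test_funI[of _ "K"]) (use K a smooth_fun_mult in auto)
qed

lemma test_fun_cmult: "test_fun U \<phi> \<Longrightarrow> test_fun U (\<lambda>x. c * \<phi> x)"
  using test_fun_mult_smooth smooth_fun_const by blast

lemma test_fun_zero: "test_fun U (\<lambda>x. 0)"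
  by (rule test_funI[OF smooth_fun_const, of "{}"]) auto

lemma LINT_diff_mult:
  assumes "u \<in> L2 U" "v \<in> L2 U" "w \<in> L2 U"
  shows "(LINT x:U|lebesgue. (u x - v x) * w x) = (LINT x:U|lebesgue. u x * w x) - (LINT x:U|lebesgue. v x * w x)"
  using set_integral_diff(2)[OF L2_mult_integrable[OF assms(1,3)] L2_mult_integrable[OF assms(2,3)]]
  by (simp add: left_diff_distrib)

lemma LINT_mult_diff:
  assumes "u \<in> L2 U" "v \<in> L2 U" "w \<in> L2 U"
  shows "(LINT x:U|lebesgue. w x * (u x - v x)) = (LINT x:U|lebesgue. w x * u x) - (LINT x:U|lebesgue. w x * v x)"
  using LINT_diff_mult[OF assms] by (simp add: mult.commute)

lemma abs_LINT_mult_le: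
  assumes "u \<in> L2 U" "v \<in> L2 U" "L2_norm U u \<le> a" "L2_norm U v \<le> c"
  shows "\<bar>LINT x:U|lebesgue. u x * v x\<bar> \<le> a * c"
proof -
  have "L2_norm U u * L2_norm U v \<le> a * c"
    by (rule mult_mono[OF assms(3,4) order_trans[OF L2_norm_nonneg assms(3)] L2_norm_nonneg])
  then show ?thesis using L2_Cauchy_Schwarz[OF assms(1,2)] by linarith
qed

subsection \<open>Density of test functions\<close>

lemma L2_dominated_convergence:
  fixes s :: "nat \<Rightarrow> 'a::euclidean_space \<Rightarrow> real"
  assumes "w \<in> L2 U" "u \<in> L2 U" "\<And>n. s n \<in> L2 U"
    and "\<And>x. x \<in> U \<Longrightarrow> (\<lambda>n. s n x) \<longlonglongrightarrow> u x" "\<And>n x. x \<in> U \<Longrightarrow> \<bar>s n x\<bar> \<le> \<bar>w x\<bar>"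
  shows "(\<lambda>n. L2_norm U (\<lambda>x. u x - s n x)) \<longlonglongrightarrow> 0"
proof -
  have m [measurable]: "restr U u \<in> borel_measurable lebesgue" "restr U (s n) \<in> borel_measurable lebesgue" for n
    using assms by (auto intro: L2_measurable)
  have "(\<lambda>n. LINT x|lebesgue. (restr U u x - restr U (s n) x)\<^sup>2) \<longlonglongrightarrow> (LINT x :: 'a|lebesgue. 0 :: real)"
  proof (rule integral_dominated_convergence[where w="\<lambda>x. 2 * (restr U u x)\<^sup>2 + 2 * (restr U w x)\<^sup>2"])
    show "integrable lebesgue (\<lambda>x. 2 * (restr U u x)\<^sup>2 + 2 * (restr U w x)\<^sup>2)"
      using assms by (auto simp: L2_iff)
    show "AE x in lebesgue. (\<lambda>n. (restr U u x - restr U (s n) x)\<^sup>2) \<longlonglongrightarrow> 0"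
    proof (rule AE_I2)
      fix x
      have "(\<lambda>n. restr U (s n) x) \<longlonglongrightarrow> restr U u x" using assms(4)[of x] by (auto simp: restr_def)
      from tendsto_power[OF tendsto_diff[OF tendsto_const this], of "restr U u x" 2]
      show "(\<lambda>n. (restr U u x - restr U (s n) x)\<^sup>2) \<longlonglongrightarrow> 0" by simp
    qed
    fix n
    show "AE x in lebesgue. norm ((restr U u x - restr U (s n) x)\<^sup>2) \<le> 2 * (restr U u x)\<^sup>2 + 2 * (restr U w x)\<^sup>2"
    proof (rule AE_I2)
      fix x
      have "(restr U (s n) x)\<^sup>2 \<le> (restr U w x)\<^sup>2"
        using assms(5)[of x n] by (auto simp: restr_def abs_le_square_iff)
      moreover have "(a - b)\<^sup>2 \<le> 2 * a\<^sup>2 + 2 * b\<^sup>2" for a b :: real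
        using zero_le_power2[of "a + b"] by (simp add: power2_sum power2_diff)
      ultimately show "norm ((restr U u x - restr U (s n) x)\<^sup>2) \<le> 2 * (restr U u x)\<^sup>2 + 2 * (restr U w x)\<^sup>2"
        by (smt (verit) norm_power power2_abs real_norm_def)
    qed
  qed measurable
  from tendsto_real_sqrt[OF this] show ?thesis by (simp add: L2_norm_restr restr_simps)
qed

text \<open>Membership in the L2 closure of the test functions. Density follows because this class
  contains the indicators of bounded measurable subsets, hence bounded simple approximations, and is
  closed under L2 limits.\<close>

definition test_approx :: "'a::euclidean_space set \<Rightarrow> ('a \<Rightarrow> real) \<Rightarrow> bool" where
  "test_approx U u \<longleftrightarrow> u \<in> L2 U \<and> (\<forall>e>0. \<exists>\<phi>. test_fun U \<phi> \<and> L2_norm U (\<lambda>x. u x - \<phi> x) < e)"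

lemma test_approx_limit:
  assumes "open U" "u \<in> L2 U" "\<And>n. test_approx U (s n)" "(\<lambda>n. L2_norm U (\<lambda>x. u x - s n x)) \<longlonglongrightarrow> 0"
  shows "test_approx U u"
  unfolding test_approx_def
proof (intro conjI allI impI assms)
  fix e :: real assume "e > 0"
  then have "\<forall>\<^sub>F n in sequentially. L2_norm U (\<lambda>x. u x - s n x) < e / 2"
    using order_tendstoD(2)[OF assms(4), of "e/2"] by simp
  then obtain n where n: "L2_norm U (\<lambda>x. u x - s n x) < e / 2" by (auto dest: eventually_happens)
  from assms(3)[of n] \<open>e > 0\<close> obtain \<phi> where p: "test_fun U \<phi>" "L2_norm U (\<lambda>x. s n x - \<phi> x) < e / 2"
    unfolding test_approx_def by (meson half_gt_zero)
  have "\<phi> \<in> L2 U" using test_fun_L2[OF p(1)] assms(1) by auto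
  then have "L2_norm U (\<lambda>x. u x - \<phi> x) < e"
    using L2_norm_triangle3[of u U "s n" \<phi>] n p assms(2,3) by (fastforce simp: test_approx_def)
  then show "\<exists>\<phi>. test_fun U \<phi> \<and> L2_norm U (\<lambda>x. u x - \<phi> x) < e" using p by blast
qed

lemma test_approx_add:
  assumes "open U" "test_approx U u" "test_approx U v"
  shows "test_approx U (\<lambda>x. u x + v x)"
  unfolding test_approx_def
proof (intro conjI allI impI)
  show "(\<lambda>x. u x + v x) \<in> L2 U" using assms L2_add by (auto simp: test_approx_def)
  fix e :: real assume "e > 0"
  with assms obtain \<phi> \<psi> where p: "test_fun U \<phi>" "L2_norm U (\<lambda>x. u x - \<phi> x) < e / 2"
    "test_fun U \<psi>" "L2_norm U (\<lambda>x. v x - \<psi> x) < e / 2"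
    unfolding test_approx_def by (meson half_gt_zero)
  have "u \<in> L2 U" "v \<in> L2 U" "\<phi> \<in> L2 U" "\<psi> \<in> L2 U" using p assms test_fun_L2[OF p(1)] test_fun_L2[OF p(3)] by (auto simp: test_approx_def)
  from L2_norm_triangle[OF L2_diff[OF this(1,3)] L2_diff[OF this(2,4)]] p
  have "L2_norm U (\<lambda>x. u x + v x - (\<phi> x + \<psi> x)) < e" by (simp add: algebra_simps)
  then show "\<exists>\<phi>. test_fun U \<phi> \<and> L2_norm U (\<lambda>x. u x + v x - \<phi> x) < e" using p test_fun_add by blast
qed

lemma test_approx_cmult:
  assumes "test_approx U u"
  shows "test_approx U (\<lambda>x. c * u x)"
  unfolding test_approx_def
proof (intro conjI allI impI)
  show "(\<lambda>x. c * u x) \<in> L2 U" using assms L2_cmult by (auto simp: test_approx_def)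
  fix e :: real assume e: "e > 0"
  then have "e / (\<bar>c\<bar> + 1) > 0" by simp
  with assms obtain \<phi> where p: "test_fun U \<phi>" "L2_norm U (\<lambda>x. u x - \<phi> x) < e / (\<bar>c\<bar> + 1)"
    unfolding test_approx_def by blast
  have "L2_norm U (\<lambda>x. c * u x - c * \<phi> x) = \<bar>c\<bar> * L2_norm U (\<lambda>x. u x - \<phi> x)"
    using L2_norm_cmult[of U c "\<lambda>x. u x - \<phi> x"] by (simp add: algebra_simps)
  also have "\<dots> \<le> \<bar>c\<bar> * (e / (\<bar>c\<bar> + 1))" using p by (intro mult_left_mono) auto
  also have "\<dots> < e" using e by (simp add: field_simps)
  finally show "\<exists>\<phi>. test_fun U \<phi> \<and> L2_norm U (\<lambda>x. c * u x - \<phi> x) < e"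
    using test_fun_cmult[OF p(1)] by blast
qed

lemma test_approx_sum:
  assumes "open U" "finite I" "\<And>i. i \<in> I \<Longrightarrow> test_approx U (u i)"
  shows "test_approx U (\<lambda>x. \<Sum>i\<in>I. u i x)"
  using assms(2,3)
proof (induction I rule: finite_induct)
  case empty
  then show ?case using test_fun_zero by (auto simp: test_approx_def intro!: exI[of _ "\<lambda>x. 0"])
next
  case (insert i I)
  then show ?case using test_approx_add[OF assms(1)] by simp
qed

text \<open>Regularity of Lebesgue measure squeezes \<open>A\<close> between a compact
  \<open>K\<close> and an open \<open>T\<close>. A smooth function that is 1 on \<open>K\<close> and
  supported in \<open>T\<close> differs from the indicator by at most 1, and only on
  \<open>T - A\<close> and \<open>A - K\<close>, each of measure below e^2 / 3.\<close>

lemma test_approx_indicator_bounded: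
  fixes A :: "'a::euclidean_space set"
  assumes "open U" "A \<in> sets lebesgue" "bounded A" "A \<subseteq> U"
  shows "test_approx U (indicator A)"
  unfolding test_approx_def
proof (intro conjI allI impI)
  have A: "A \<in> lmeasurable" using assms by (simp add: bounded_set_imp_lmeasurable)
  have "restr U (indicator A) = restr A (\<lambda>x. 1)" using assms(4) by (auto simp: restr_def indicator_def fun_eq_iff)
  then show "indicator A \<in> L2 U" using L2_one(1)[OF A] by (simp add: L2_iff)
  then have iU: "indicator A \<in> L2 U" .
  fix e :: real assume e: "e > 0"
  then have e2: "e\<^sup>2 / 3 > 0" by simp
  obtain T where T: "open T" "A \<subseteq> T" "T - A \<in> lmeasurable" "emeasure lebesgue (T - A) < ennreal (e\<^sup>2/3)"
    using sets_lebesgue_outer_open[OF assms(2) e2] by blast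
  obtain K where K: "closed K" "K \<subseteq> A" "A - K \<in> lmeasurable" "emeasure lebesgue (A - K) < ennreal (e\<^sup>2/3)"
    using sets_lebesgue_inner_closed[OF assms(2) e2] by blast
  have "compact K" using K assms(3) bounded_subset compact_eq_bounded_closed by blast
  moreover have "open (T \<inter> U)" "K \<subseteq> T \<inter> U" using T K assms by auto
  ultimately obtain \<psi> where \<psi>: "test_fun (T \<inter> U) \<psi>" "\<And>x. x \<in> K \<Longrightarrow> \<psi> x = 1" "\<And>x. 0 \<le> \<psi> x" "\<And>x. \<psi> x \<le> 1"
    using smooth_Urysohn by metis
  have tU: "test_fun U \<psi>" using \<psi>(1) test_fun_mono by blast
  have m: "measure lebesgue (T - A) < e\<^sup>2/3" "measure lebesgue (A - K) < e\<^sup>2/3"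
    using T K e2 by (auto simp: emeasure_eq_measure2 ennreal_less_iff)
  have d: "(T - A) \<union> (A - K) \<in> lmeasurable" using T K by auto
  have dL: "(\<lambda>x. indicator A x - \<psi> x) \<in> L2 U"
    using L2_diff[OF iU test_fun_L2[OF tU]] assms(1) by auto
  have "(L2_norm U (\<lambda>x. indicator A x - \<psi> x))\<^sup>2 = (LINT x|lebesgue. (restr U (\<lambda>x. indicator A x - \<psi> x) x)\<^sup>2)"
    by (simp add: L2_norm_restr)
  also have "\<dots> \<le> (LINT x|lebesgue. indicator ((T - A) \<union> (A - K)) x)"
  proof (rule integral_mono)
    show "integrable lebesgue (\<lambda>x. (restr U (\<lambda>x. indicator A x - \<psi> x) x)\<^sup>2)" using dL by (simp add: L2_iff)
    show "integrable lebesgue (indicator ((T - A) \<union> (A - K)) :: 'a \<Rightarrow> real)"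
      using d by (intro integrable_real_indicator) (auto simp: fmeasurable_def)
    fix x
    have "\<bar>indicator A x - \<psi> x\<bar> \<le> indicator ((T - A) \<union> (A - K)) x"
      using \<psi>(2)[of x] \<psi>(3)[of x] \<psi>(4)[of x] test_fun_zero_outside[OF \<psi>(1), of x] T(2) K(2)
      by (auto simp: indicator_def)
    then have "\<bar>restr U (\<lambda>x. indicator A x - \<psi> x) x\<bar> \<le> indicator ((T - A) \<union> (A - K)) x"
      by (auto simp: restr_def)
    then have "(restr U (\<lambda>x. indicator A x - \<psi> x) x)\<^sup>2 \<le> (indicator ((T - A) \<union> (A - K)) x)\<^sup>2"
      by (metis abs_ge_zero power2_abs power_mono)
    then show "(restr U (\<lambda>x. indicator A x - \<psi> x) x)\<^sup>2 \<le> indicator ((T - A) \<union> (A - K)) x"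
      by (auto simp: indicator_def split: if_splits)
  qed
  also have "\<dots> = measure lebesgue ((T - A) \<union> (A - K))" using d by simp
  also have "\<dots> \<le> measure lebesgue (T - A) + measure lebesgue (A - K)" using T K measure_Un_le by blast
  also have "\<dots> < e\<^sup>2" using m e2 by linarith
  finally have "L2_norm U (\<lambda>x. indicator A x - \<psi> x) < e" using e power_less_imp_less_base by fastforce
  then show "\<exists>\<phi>. test_fun U \<phi> \<and> L2_norm U (\<lambda>x. indicator A x - \<phi> x) < e" using tU by blast
qed

lemma test_approx_bounded_support:
  fixes u :: "'a::euclidean_space \<Rightarrow> real"
  assumes U: "open U" and L: "u \<in> L2 U" and b: "\<And>x. x \<notin> ball 0 r \<Longrightarrow> u x = 0"
  shows "test_approx U u"
proof -
  have m: "restr U u \<in> borel_measurable lebesgue" using L L2_measurable by auto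
  \<comment> \<open>The factor 2 comes from approximating with respect to the distance to 0. The
    domination makes the simple functions vanish wherever \<open>u\<close> does, so their level sets
    for nonzero values are bounded; it also supplies the dominating function for the limit.\<close>
  from borel_measurable_implies_sequence_metric[OF this, of 0] obtain s where
    s: "\<And>i. simple_function lebesgue (s i)" "\<And>x. (\<lambda>i. s i x) \<longlonglongrightarrow> restr U u x"
      "\<And>i x. \<bar>s i x\<bar> \<le> 2 * \<bar>restr U u x\<bar>" by auto
  have z: "s i x = 0" if "x \<notin> U \<inter> ball 0 r" for i x
    using s(3)[of i x] b[of x] that by (auto simp: restr_def split: if_splits)
  show ?thesis
  proof (rule test_approx_limit[OF U L])
    fix i
    have fin: "finite (range (s i))" using s(1)[of i] by (simp add: simple_function_def)
    have "test_approx U (\<lambda>x. \<Sum>y\<in>range (s i) - {0}. y * indicator (s i -` {y}) x)"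
    proof (intro test_approx_sum U test_approx_cmult test_approx_indicator_bounded)
      fix y assume y: "y \<in> range (s i) - {0}"
      show "s i -` {y} \<in> sets lebesgue" using s(1)[of i] y by (auto simp: simple_function_def)
      have "s i -` {y} \<subseteq> U \<inter> ball 0 r"
      proof
        fix x assume "x \<in> s i -` {y}"
        then have "s i x \<noteq> 0" using y by auto
        then show "x \<in> U \<inter> ball 0 r" using z[of x i] by blast
      qed
      then show "bounded (s i -` {y})" "s i -` {y} \<subseteq> U"
        using bounded_subset[OF bounded_ball[of 0 r]] by blast+
    qed (use fin in auto)
    moreover have "(\<lambda>x. \<Sum>y\<in>range (s i) - {0}. y * indicator (s i -` {y}) x) = s i"
    proof
      fix x
      have "(\<Sum>y\<in>range (s i) - {0}. y * indicator (s i -` {y}) x) = (\<Sum>y\<in>range (s i) - {0}. if y = s i x then s i x else 0)"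
        by (intro sum.cong) (auto simp: indicator_def)
      also have "\<dots> = s i x" using fin by (subst sum.delta) auto
      finally show "(\<Sum>y\<in>range (s i) - {0}. y * indicator (s i -` {y}) x) = s i x" .
    qed
    ultimately show ti: "test_approx U (s i)" by simp
  next
    have sL: "s i \<in> L2 U" for i
    proof (rule L2_of_measurable_bound(1)[OF _ L2_cmult[OF L, of 2]])
      have "restr U (s i) = s i" using z by (auto simp: restr_def)
      then show "restr U (s i) \<in> borel_measurable lebesgue"
        using borel_measurable_simple_function[OF s(1)[of i]] by simp
      show "\<bar>s i x\<bar> \<le> \<bar>2 * u x\<bar>" if "x \<in> U" for x using s(3)[of i x] that by (simp add: restr_def abs_mult)
    qed
    show "(\<lambda>n. L2_norm U (\<lambda>x. u x - s n x)) \<longlonglongrightarrow> 0"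
    proof (rule L2_dominated_convergence[OF L2_cmult[OF L, of 2] L sL])
      show "(\<lambda>n. s n x) \<longlonglongrightarrow> u x" if "x \<in> U" for x using s(2)[of x] that by (simp add: restr_def)
      show "\<bar>s n x\<bar> \<le> \<bar>2 * u x\<bar>" if "x \<in> U" for n x using s(3)[of n x] that by (simp add: restr_def abs_mult)
    qed
  qed
qed

text \<open>Truncation to the balls of radius n reduces the claim to functions of bounded
  support.\<close>

lemma test_fun_dense:
  fixes u :: "'a::euclidean_space \<Rightarrow> real"
  assumes U: "open U" and L: "u \<in> L2 U" and "e > 0"
  obtains \<phi> where "test_fun U \<phi>" "L2_norm U (\<lambda>x. u x - \<phi> x) < e"
proof -
  define s where "s n = (\<lambda>x. indicator (ball 0 (real n)) x * u x)" for n
  have sL: "s n \<in> L2 U" for n unfolding s_def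
  proof (rule L2_mult_bounded(1)[OF L, of _ 1])
    show "restr U (indicator (ball 0 (real n))) \<in> borel_measurable lebesgue"
      using U by (intro restr_measurable borel_measurable_indicator) (auto simp: fmeasurableD)
  qed (auto simp: indicator_def)
  have "test_approx U u"
  proof (rule test_approx_limit[OF U L])
    show "test_approx U (s n)" for n
      by (rule test_approx_bounded_support[OF U sL, where r="real n"]) (auto simp: s_def)
    show "(\<lambda>n. L2_norm U (\<lambda>x. u x - s n x)) \<longlonglongrightarrow> 0"
    proof (rule L2_dominated_convergence[OF L L sL])
      fix x :: 'a
      obtain N where N: "norm x < real N" using reals_Archimedean2 by blast
      have "\<forall>\<^sub>F n in sequentially. u x = s n x"
        using eventually_ge_at_top[of N] by eventually_elim (use N in \<open>auto simp: s_def indicator_def\<close>)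
      then show "(\<lambda>n. s n x) \<longlonglongrightarrow> u x" using tendsto_eventually by (simp add: eq_commute)
    qed (auto simp: s_def indicator_def)
  qed
  then show ?thesis using that \<open>e > 0\<close> unfolding test_approx_def by blast
qed

text \<open>With n the norm of \<open>w\<close>, a test function close to \<open>w\<close> turns the
  hypothesis into n^2 <= M n + e. Increments and the Poincare inequality on an interval are
  estimated through this duality, because a weak derivative is accessible only by pairing with test
  functions.\<close>

lemma L2_norm_le_dual:
  fixes w :: "'a::euclidean_space \<Rightarrow> real"
  assumes U: "open U" and w: "w \<in> L2 U" and "M \<ge> 0"
    and le: "\<And>\<phi>. test_fun U \<phi> \<Longrightarrow> \<bar>LINT x:U|lebesgue. w x * \<phi> x\<bar> \<le> M * L2_norm U \<phi>"
  shows "L2_norm U w \<le> M"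
proof -
  define n where "n = L2_norm U w"
  have "n\<^sup>2 \<le> M * n + e" if "e > 0" for e
  proof -
    \<comment> \<open>Chosen so that the total error (M + n) d is at most e.\<close>
    define d where "d = e / (M + n + 1)"
    have pos: "M + n + 1 > 0" using \<open>M \<ge> 0\<close> by (simp add: n_def add_nonneg_pos)
    then have d: "d > 0" using \<open>e > 0\<close> by (simp add: d_def)
    obtain \<phi> where \<phi>: "test_fun U \<phi>" "L2_norm U (\<lambda>x. w x - \<phi> x) < d" using test_fun_dense[OF U w d] by blast
    have L: "\<phi> \<in> L2 U" "(\<lambda>x. w x - \<phi> x) \<in> L2 U" using test_fun_L2[OF \<phi>(1)] U L2_diff[OF w test_fun_L2[OF \<phi>(1)]] by auto
    have "L2_norm U \<phi> \<le> n + d"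
      using L2_norm_triangle_diff[OF w L(2)] \<phi>(2) by (simp add: n_def)
    have "n\<^sup>2 = (LINT x:U|lebesgue. w x * \<phi> x + w x * (w x - \<phi> x))"
    proof -
      have "(\<lambda>x. w x * \<phi> x + w x * (w x - \<phi> x)) = (\<lambda>x. (w x)\<^sup>2)"
        by (auto simp: algebra_simps power2_eq_square)
      then show ?thesis by (simp add: n_def L2_norm_power2)
    qed
    also have "\<dots> = (LINT x:U|lebesgue. w x * \<phi> x) + (LINT x:U|lebesgue. w x * (w x - \<phi> x))"
      using L w by (intro set_integral_add L2_mult_integrable)
    also have "\<dots> \<le> M * L2_norm U \<phi> + n * L2_norm U (\<lambda>x. w x - \<phi> x)"
      using le[OF \<phi>(1)] L2_Cauchy_Schwarz[OF w L(2)] by (simp add: n_def)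
    also have "\<dots> \<le> M * (n + d) + n * d"
      using \<open>M \<ge> 0\<close> \<open>L2_norm U \<phi> \<le> n + d\<close> \<phi>(2) by (intro add_mono mult_left_mono) (auto simp: n_def)
    also have "\<dots> = M * n + (M + n) * d" by (simp add: algebra_simps)
    also have "(M + n) * d \<le> e"
      using pos \<open>e > 0\<close> \<open>M \<ge> 0\<close> by (simp add: d_def divide_le_eq mult.commute)
    finally show ?thesis by simp
  qed
  then have "n\<^sup>2 \<le> M * n" by (rule field_le_epsilon)
  then have "n * n \<le> M * n" by (simp add: power2_eq_square)
  moreover have "n \<ge> 0" by (simp add: n_def)
  ultimately have "n \<le> M" using \<open>M \<ge> 0\<close> mult_right_le_imp_le[of n n M] by (cases "n = 0") auto
  then show ?thesis by (simp add: n_def)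
qed

lemma L2_norm_zero_AE:
  assumes "w \<in> L2 U" "L2_norm U w = 0"
  shows "AE x in lebesgue. x \<in> U \<longrightarrow> w x = 0"
proof -
  have "(LINT x|lebesgue. (restr U w x)\<^sup>2) = 0" using assms(2) by (simp add: L2_norm_restr)
  then have "AE x in lebesgue. (restr U w x)\<^sup>2 = 0"
    using integral_nonneg_eq_0_iff_AE[of lebesgue "\<lambda>x. (restr U w x)\<^sup>2"] assms(1) by (auto simp: L2_iff)
  then show ?thesis by eventually_elim (auto simp: restr_def)
qed

text \<open>The fundamental lemma of the calculus of variations.\<close>

lemma AE_zero_of_test_fun:
  fixes w :: "'a::euclidean_space \<Rightarrow> real"
  assumes "open U" "w \<in> L2 U" "\<And>\<phi>. test_fun U \<phi> \<Longrightarrow> (LINT x:U|lebesgue. w x * \<phi> x) = 0"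
  shows "AE x in lebesgue. x \<in> U \<longrightarrow> w x = 0"
proof -
  have "L2_norm U w \<le> 0" using assms by (intro L2_norm_le_dual) auto
  then show ?thesis using assms(2) L2_norm_zero_AE L2_norm_nonneg by (metis order_antisym)
qed

text \<open>The form in which the final limits are reached: every error is at most a fixed multiple
  of an arbitrary tolerance. The sign of \<open>M\<close> is left open, hence |M| + 1 in the
  proof.\<close>

lemma tendsto_zero_of_multiple:
  fixes g :: "'i \<Rightarrow> real"
  assumes "\<And>\<tau>. \<tau> > 0 \<Longrightarrow> \<forall>\<^sub>F i in F. g i \<le> M * \<tau>" "\<And>i. 0 \<le> g i"
  shows "(g \<longlongrightarrow> 0) F"
proof (rule tendstoI)
  fix e :: real assume "e > 0"
  define \<tau> where "\<tau> = e / (\<bar>M\<bar> + 1)"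
  have \<tau>: "\<tau> > 0" "\<tau> * (\<bar>M\<bar> + 1) = e" unfolding \<tau>_def using \<open>e > 0\<close> by auto
  have "M * \<tau> \<le> \<bar>M\<bar> * \<tau>" using \<tau>(1) by (intro mult_right_mono) auto
  moreover have "\<bar>M\<bar> * \<tau> = e - \<tau>" using \<tau>(2) by (simp add: algebra_simps)
  ultimately have lt: "M * \<tau> < e" using \<tau>(1) by linarith
  show "\<forall>\<^sub>F i in F. dist (g i) 0 < e"
    by (rule eventually_mono[OF assms(1)[OF \<tau>(1)]]) (use assms(2) lt in \<open>auto simp: dist_real_def intro: le_less_trans\<close>)
qed

section \<open>Weak derivatives\<close>

lemma restr_UNIV [simp]: "restr UNIV u = u"
  by (simp add: restr_def fun_eq_iff)

lemma restr_eq_of_zero: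
  "U \<subseteq> V \<Longrightarrow> (\<And>x. x \<in> V \<Longrightarrow> x \<notin> U \<Longrightarrow> f x = 0) \<Longrightarrow> restr V f = restr U f"
  by (auto simp: restr_def fun_eq_iff)

lemma LINT_eq_of_zero:
  fixes f :: "'a \<Rightarrow> real"
  shows "U \<subseteq> V \<Longrightarrow> (\<And>x. x \<in> V \<Longrightarrow> x \<notin> U \<Longrightarrow> f x = 0) \<Longrightarrow> (LINT x:V|M. f x) = (LINT x:U|M. f x)"
  using restr_eq_of_zero[of U V f] by (simp add: LINT_restr)

lemma L2_norm_eq_of_zero:
  "U \<subseteq> V \<Longrightarrow> (\<And>x. x \<in> V \<Longrightarrow> x \<notin> U \<Longrightarrow> f x = 0) \<Longrightarrow> L2_norm V f = L2_norm U f"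
  using restr_eq_of_zero[of U V f] by (simp add: L2_norm_restr)

lemma weak_derivD:
  "weak_deriv \<Omega> v u g \<Longrightarrow> g \<in> L2 \<Omega>"
  "weak_deriv \<Omega> v u g \<Longrightarrow> test_fun \<Omega> \<phi> \<Longrightarrow>
    (LINT x:\<Omega>|lebesgue. u x * frechet_derivative \<phi> (at x) v) = - (LINT x:\<Omega>|lebesgue. g x * \<phi> x)"
  by (auto simp: weak_deriv_def)

lemma weak_derivI:
  "g \<in> L2 \<Omega> \<Longrightarrow> (\<And>\<phi>. test_fun \<Omega> \<phi> \<Longrightarrow>
    (LINT x:\<Omega>|lebesgue. u x * frechet_derivative \<phi> (at x) v) = - (LINT x:\<Omega>|lebesgue. g x * \<phi> x))
   \<Longrightarrow> weak_deriv \<Omega> v u g"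
  by (auto simp: weak_deriv_def)

lemma weak_deriv_unique:
  assumes "open \<Omega>" "weak_deriv \<Omega> v u g" "weak_deriv \<Omega> v u h"
  shows "AE x in lebesgue. x \<in> \<Omega> \<longrightarrow> g x = h x"
proof -
  have "AE x in lebesgue. x \<in> \<Omega> \<longrightarrow> g x - h x = 0"
  proof (rule AE_zero_of_test_fun[OF assms(1)])
    show "(\<lambda>x. g x - h x) \<in> L2 \<Omega>" using assms weak_derivD(1) L2_diff by blast
    fix \<phi> assume t: "test_fun \<Omega> \<phi>"
    have p: "\<phi> \<in> L2 \<Omega>" using test_fun_L2[OF t] assms(1) by auto
    have "(LINT x:\<Omega>|lebesgue. (g x - h x) * \<phi> x) = (LINT x:\<Omega>|lebesgue. g x * \<phi> x - h x * \<phi> x)"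
      by (simp add: algebra_simps)
    also have "\<dots> = (LINT x:\<Omega>|lebesgue. g x * \<phi> x) - (LINT x:\<Omega>|lebesgue. h x * \<phi> x)"
      using assms weak_derivD(1) p by (intro set_integral_diff L2_mult_integrable) auto
    also have "\<dots> = 0" using weak_derivD(2)[OF assms(2) t] weak_derivD(2)[OF assms(3) t] by simp
    finally show "(LINT x:\<Omega>|lebesgue. (g x - h x) * \<phi> x) = 0" .
  qed
  then show ?thesis by eventually_elim auto
qed

lemma H1_L2: "u \<in> H1 \<Omega> \<Longrightarrow> u \<in> L2 \<Omega>"
  by (simp add: H1_def)

lemma weak_deriv_wderiv:
  assumes "weak_deriv \<Omega> v u g"
  shows "weak_deriv \<Omega> v u (wderiv \<Omega> v u)"
  unfolding wderiv_def using someI[of "weak_deriv \<Omega> v u" g] assms by simp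

lemma H1_weak_deriv: "u \<in> H1 \<Omega> \<Longrightarrow> v \<in> Basis \<Longrightarrow> weak_deriv \<Omega> v u (wderiv \<Omega> v u)"
  unfolding H1_def using weak_deriv_wderiv by blast

lemma wderiv_L2: "u \<in> H1 \<Omega> \<Longrightarrow> v \<in> Basis \<Longrightarrow> wderiv \<Omega> v u \<in> L2 \<Omega>"
  using H1_weak_deriv weak_derivD(1) by blast

text \<open>\<open>wderiv\<close> is an arbitrary choice, tied to a concrete weak derivative only up
  to a null set. Through this lemma the integrals in the weak formulations are rewritten with
  explicit derivatives.\<close>

lemma wderiv_AE:
  assumes "open \<Omega>" "weak_deriv \<Omega> v u g"
  shows "AE x in lebesgue. x \<in> \<Omega> \<longrightarrow> wderiv \<Omega> v u x = g x"
  using weak_deriv_unique[OF assms(1) weak_deriv_wderiv assms(2)] assms by blast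

lemma L2_norm_wderiv:
  assumes "open \<Omega>" "weak_deriv \<Omega> v u g"
  shows "L2_norm \<Omega> (wderiv \<Omega> v u) = L2_norm \<Omega> g"
  by (rule L2_cong_AE(2)[OF wderiv_AE[OF assms]])

lemma weak_deriv_cong_AE:
  assumes "weak_deriv \<Omega> v u g" "AE x in lebesgue. x \<in> \<Omega> \<longrightarrow> u x = u' x" "AE x in lebesgue. x \<in> \<Omega> \<longrightarrow> g x = g' x"
  shows "weak_deriv \<Omega> v u' g'"
proof (rule weak_derivI)
  show "g' \<in> L2 \<Omega>" using L2_cong_AE(1)[OF assms(3)] weak_derivD(1)[OF assms(1)] by simp
  fix \<phi> assume t: "test_fun \<Omega> \<phi>"
  have "(LINT x:\<Omega>|lebesgue. u x * frechet_derivative \<phi> (at x) v) = (LINT x:\<Omega>|lebesgue. u' x * frechet_derivative \<phi> (at x) v)"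
    by (rule LINT_cong_AE) (use assms(2) in \<open>eventually_elim, auto\<close>)
  moreover have "(LINT x:\<Omega>|lebesgue. g x * \<phi> x) = (LINT x:\<Omega>|lebesgue. g' x * \<phi> x)"
    by (rule LINT_cong_AE) (use assms(3) in \<open>eventually_elim, auto\<close>)
  ultimately show "(LINT x:\<Omega>|lebesgue. u' x * frechet_derivative \<phi> (at x) v) = - (LINT x:\<Omega>|lebesgue. g' x * \<phi> x)"
    using weak_derivD(2)[OF assms(1) t] by simp
qed

lemma test_fun_deriv_L2:
  "test_fun U \<phi> \<Longrightarrow> S \<in> sets lebesgue \<Longrightarrow> (\<lambda>x. frechet_derivative \<phi> (at x) v) \<in> L2 S"
  by (intro test_fun_L2[OF test_fun_deriv])

lemma weak_deriv_combine:
  assumes "open \<Omega>" "u \<in> L2 \<Omega>" "w \<in> L2 \<Omega>" "weak_deriv \<Omega> v u g" "weak_deriv \<Omega> v w h"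
  shows "weak_deriv \<Omega> v (\<lambda>x. a * u x + b * w x) (\<lambda>x. a * g x + b * h x)"
proof (rule weak_derivI)
  have L: "g \<in> L2 \<Omega>" "h \<in> L2 \<Omega>" using assms weak_derivD(1) by auto
  then show "(\<lambda>x. a * g x + b * h x) \<in> L2 \<Omega>" by (intro L2_add L2_cmult)
  fix \<phi> assume t: "test_fun \<Omega> \<phi>"
  let ?d = "\<lambda>x. frechet_derivative \<phi> (at x) v"
  have o: "\<Omega> \<in> sets lebesgue" using assms(1) by auto
  have p: "\<phi> \<in> L2 \<Omega>" "?d \<in> L2 \<Omega>" using t o test_fun_L2 test_fun_deriv_L2 by blast+
  have lin: "(LINT x:\<Omega>|lebesgue. (a * f1 x + b * f2 x) * k x) = a * (LINT x:\<Omega>|lebesgue. f1 x * k x) + b * (LINT x:\<Omega>|lebesgue. f2 x * k x)"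
    if "f1 \<in> L2 \<Omega>" "f2 \<in> L2 \<Omega>" "k \<in> L2 \<Omega>" for f1 f2 k
  proof -
    have "(LINT x:\<Omega>|lebesgue. (a * f1 x + b * f2 x) * k x) = (LINT x:\<Omega>|lebesgue. a * (f1 x * k x) + b * (f2 x * k x))"
      by (simp add: algebra_simps)
    also have "\<dots> = (LINT x:\<Omega>|lebesgue. a * (f1 x * k x)) + (LINT x:\<Omega>|lebesgue. b * (f2 x * k x))"
      using that by (intro set_integral_add set_integrable_mult_right L2_mult_integrable)
    finally show ?thesis by simp
  qed
  show "(LINT x:\<Omega>|lebesgue. (a * u x + b * w x) * ?d x) = - (LINT x:\<Omega>|lebesgue. (a * g x + b * h x) * \<phi> x)"
    using lin[OF assms(2,3) p(2)] lin[OF L p(1)] weak_derivD(2)[OF assms(4) t] weak_derivD(2)[OF assms(5) t] by simp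
qed

lemma weak_deriv_diff:
  assumes "open \<Omega>" "u \<in> L2 \<Omega>" "w \<in> L2 \<Omega>" "weak_deriv \<Omega> v u g" "weak_deriv \<Omega> v w h"
  shows "weak_deriv \<Omega> v (\<lambda>x. u x - w x) (\<lambda>x. g x - h x)"
  using weak_deriv_combine[OF assms, of 1 "-1"] by simp

text \<open>Increments are taken along arbitrary vectors, whereas \<open>H1\<close> provides the
  coordinate derivatives.\<close>

lemma weak_deriv_direction:
  assumes "open \<Omega>" "u \<in> L2 \<Omega>" "weak_deriv \<Omega> v u g" "weak_deriv \<Omega> w u h"
  shows "weak_deriv \<Omega> (a *\<^sub>R v + b *\<^sub>R w) u (\<lambda>x. a * g x + b * h x)"
proof (rule weak_derivI)
  have L: "g \<in> L2 \<Omega>" "h \<in> L2 \<Omega>" using assms weak_derivD(1) by auto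
  then show "(\<lambda>x. a * g x + b * h x) \<in> L2 \<Omega>" by (intro L2_add L2_cmult)
  fix \<phi> assume t: "test_fun \<Omega> \<phi>"
  have o: "\<Omega> \<in> sets lebesgue" using assms(1) by auto
  have p: "\<phi> \<in> L2 \<Omega>" "(\<lambda>x. frechet_derivative \<phi> (at x) z) \<in> L2 \<Omega>" for z
    using t o test_fun_L2 test_fun_deriv_L2 by blast+
  have "frechet_derivative \<phi> (at x) (a *\<^sub>R v + b *\<^sub>R w) = a * frechet_derivative \<phi> (at x) v + b * frechet_derivative \<phi> (at x) w" for x
  proof -
    have "linear (frechet_derivative \<phi> (at x))"
      using smooth_fun_has_derivative[of \<phi>] has_derivative_linear t unfolding test_fun_def by blast
    then show ?thesis by (simp add: linear_add linear_cmul)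
  qed
  then have "(LINT x:\<Omega>|lebesgue. u x * frechet_derivative \<phi> (at x) (a *\<^sub>R v + b *\<^sub>R w))
     = (LINT x:\<Omega>|lebesgue. a * (u x * frechet_derivative \<phi> (at x) v) + b * (u x * frechet_derivative \<phi> (at x) w))"
    by (simp add: algebra_simps)
  also have "\<dots> = a * (LINT x:\<Omega>|lebesgue. u x * frechet_derivative \<phi> (at x) v) + b * (LINT x:\<Omega>|lebesgue. u x * frechet_derivative \<phi> (at x) w)"
    using assms(2) p by (subst set_integral_add) (auto intro!: set_integrable_mult_right L2_mult_integrable)
  also have "\<dots> = - (a * (LINT x:\<Omega>|lebesgue. g x * \<phi> x) + b * (LINT x:\<Omega>|lebesgue. h x * \<phi> x))"
    using weak_derivD(2)[OF assms(3) t] weak_derivD(2)[OF assms(4) t] by simp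
  also have "a * (LINT x:\<Omega>|lebesgue. g x * \<phi> x) + b * (LINT x:\<Omega>|lebesgue. h x * \<phi> x)
     = (LINT x:\<Omega>|lebesgue. a * (g x * \<phi> x) + b * (h x * \<phi> x))"
    using L p by (subst set_integral_add) (auto intro!: set_integrable_mult_right L2_mult_integrable)
  also have "\<dots> = (LINT x:\<Omega>|lebesgue. (a * g x + b * h x) * \<phi> x)"
    by (simp add: algebra_simps)
  finally show "(LINT x:\<Omega>|lebesgue. u x * frechet_derivative \<phi> (at x) (a *\<^sub>R v + b *\<^sub>R w))
     = - (LINT x:\<Omega>|lebesgue. (a * g x + b * h x) * \<phi> x)" .
qed

lemma weak_deriv_subset:
  assumes "weak_deriv \<Omega> v u g" "A \<subseteq> \<Omega>" "open A"
  shows "weak_deriv A v u g"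
proof (rule weak_derivI)
  show "g \<in> L2 A" using L2_subset(1)[OF weak_derivD(1)[OF assms(1)] assms(2)] assms(3) by auto
  fix \<phi> assume t: "test_fun A \<phi>"
  have "(LINT x:\<Omega>|lebesgue. u x * frechet_derivative \<phi> (at x) v) = (LINT x:A|lebesgue. u x * frechet_derivative \<phi> (at x) v)"
    using test_fun_zero_outside[OF test_fun_deriv[OF t]] assms(2) by (intro LINT_eq_of_zero) auto
  moreover have "(LINT x:\<Omega>|lebesgue. g x * \<phi> x) = (LINT x:A|lebesgue. g x * \<phi> x)"
    using test_fun_zero_outside[OF t] assms(2) by (intro LINT_eq_of_zero) auto
  ultimately show "(LINT x:A|lebesgue. u x * frechet_derivative \<phi> (at x) v) = - (LINT x:A|lebesgue. g x * \<phi> x)"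
    using weak_derivD(2)[OF assms(1) test_fun_mono[OF t assms(2)]] by simp
qed

lemma H1I: "u \<in> L2 \<Omega> \<Longrightarrow> (\<And>v. v \<in> Basis \<Longrightarrow> weak_deriv \<Omega> v u (g v)) \<Longrightarrow> u \<in> H1 \<Omega>"
  by (auto simp: H1_def)

lemma H1_subset:
  assumes "u \<in> H1 \<Omega>" "A \<subseteq> \<Omega>" "open A"
  shows "u \<in> H1 A"
proof (rule H1I)
  show "u \<in> L2 A" using L2_subset(1)[OF H1_L2[OF assms(1)] assms(2)] assms(3) by auto
qed (rule weak_deriv_subset[OF H1_weak_deriv[OF assms(1)] assms(2,3)])

lemma H1_diff:
  assumes "open \<Omega>" "u \<in> H1 \<Omega>" "w \<in> H1 \<Omega>"
  shows "(\<lambda>x. u x - w x) \<in> H1 \<Omega>"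
  by (rule H1I[OF L2_diff[OF H1_L2[OF assms(2)] H1_L2[OF assms(3)]]])
    (rule weak_deriv_diff[OF assms(1) H1_L2[OF assms(2)] H1_L2[OF assms(3)] H1_weak_deriv[OF assms(2)] H1_weak_deriv[OF assms(3)]])

subsection \<open>Affine changes of variables\<close>

text \<open>Diagonal affine maps cover both changes of variables that occur: translations, with all
  \<open>c j\<close> equal to 1, and the map of the cell onto a tooth, which scales the first
  coordinate only.\<close>

lemma lebesgue_integral_affine:
  fixes f :: "'a::euclidean_space \<Rightarrow> real" and c :: "'a \<Rightarrow> real" and t :: 'a
  assumes c: "\<And>j. j \<in> Basis \<Longrightarrow> c j \<noteq> 0" and f: "f \<in> borel_measurable lebesgue"
  defines "T \<equiv> (\<lambda>x. t + (\<Sum>j\<in>Basis. (c j * (x \<bullet> j)) *\<^sub>R j))"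
  shows "(\<lambda>x. f (T x)) \<in> borel_measurable lebesgue"
    and "integrable lebesgue f \<longleftrightarrow> integrable lebesgue (\<lambda>x. f (T x))"
    and "(LINT x|lebesgue. f x) = (\<Prod>j\<in>Basis. \<bar>c j\<bar>) * (LINT x|lebesgue. f (T x))"
proof -
  define p where "p = (\<Prod>j\<in>Basis. \<bar>c j\<bar>)"
  have p: "p > 0" unfolding p_def using c by (intro prod_pos) auto
  have T: "T \<in> lebesgue \<rightarrow>\<^sub>M lebesgue" unfolding T_def by (rule lebesgue_affine_measurable[where c=c and t=t, OF c])
  show fT: "(\<lambda>x. f (T x)) \<in> borel_measurable lebesgue" using measurable_compose[OF T f] .
  have eq: "lebesgue = density (distr lebesgue lebesgue T) (\<lambda>_. ennreal p)"
    using lebesgue_affine_euclidean[where c=c and t=t, OF c] by (simp add: T_def p_def)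
  have "integrable lebesgue f \<longleftrightarrow> integrable (density (distr lebesgue lebesgue T) (\<lambda>_. ennreal p)) f"
    using eq by simp
  also have "\<dots> \<longleftrightarrow> integrable (distr lebesgue lebesgue T) (\<lambda>x. p *\<^sub>R f x)"
    using p f by (intro integrable_density) auto
  also have "\<dots> \<longleftrightarrow> integrable lebesgue (\<lambda>x. p *\<^sub>R f (T x))"
    using T f by (intro integrable_distr_eq) auto
  also have "\<dots> \<longleftrightarrow> integrable lebesgue (\<lambda>x. f (T x))" using p by simp
  finally show "integrable lebesgue f \<longleftrightarrow> integrable lebesgue (\<lambda>x. f (T x))" .
  have "(LINT x|lebesgue. f x) = (LINT x|density (distr lebesgue lebesgue T) (\<lambda>_. ennreal p). f x)"
    using eq by simp
  also have "\<dots> = (LINT x|distr lebesgue lebesgue T. p *\<^sub>R f x)"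
    using p f by (intro integral_density) auto
  also have "\<dots> = (LINT x|lebesgue. p *\<^sub>R f (T x))"
    using T f by (intro integral_distr) auto
  finally show "(LINT x|lebesgue. f x) = (\<Prod>j\<in>Basis. \<bar>c j\<bar>) * (LINT x|lebesgue. f (T x))" by (simp add: p_def)
qed

lemma lebesgue_integral_translate:
  fixes f :: "'a::euclidean_space \<Rightarrow> real"
  assumes f: "f \<in> borel_measurable lebesgue"
  shows "(\<lambda>x. f (x + a)) \<in> borel_measurable lebesgue"
    and "integrable lebesgue (\<lambda>x. f (x + a)) \<longleftrightarrow> integrable lebesgue f"
    and "(LINT x|lebesgue. f (x + a)) = (LINT x|lebesgue. f x)"
  using lebesgue_integral_affine[of "\<lambda>_. 1" f a, OF _ f] by (simp_all add: euclidean_representation add.commute)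

lemma L2_translate:
  fixes u :: "'a::euclidean_space \<Rightarrow> real"
  assumes "u \<in> L2 UNIV"
  shows "(\<lambda>x. u (x + a)) \<in> L2 UNIV" "L2_norm UNIV (\<lambda>x. u (x + a)) = L2_norm UNIV u"
proof -
  have r: "restr UNIV w = w" for w :: "'a \<Rightarrow> real" by (simp add: restr_def fun_eq_iff)
  have m: "u \<in> borel_measurable lebesgue" "integrable lebesgue (\<lambda>x. (u x)\<^sup>2)" using assms by (auto simp: L2_iff r)
  have m2: "(\<lambda>x. (u x)\<^sup>2) \<in> borel_measurable lebesgue" using m by simp
  show "(\<lambda>x. u (x + a)) \<in> L2 UNIV" "L2_norm UNIV (\<lambda>x. u (x + a)) = L2_norm UNIV u"
    using m lebesgue_integral_translate(1)[OF m(1)] lebesgue_integral_translate(2,3)[OF m2]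
    by (auto simp: L2_iff L2_norm_restr r)
qed

subsection \<open>Smooth functions have weak derivatives\<close>

lemma smooth_fun_along_line:
  fixes f :: "'a::euclidean_space \<Rightarrow> real"
  assumes "smooth_fun f"
  shows "((\<lambda>t. f (x + t *\<^sub>R v)) has_real_derivative frechet_derivative f (at (x + t *\<^sub>R v)) v) (at t)"
proof -
  have l: "linear (frechet_derivative f (at y))" for y
    using smooth_fun_has_derivative[OF assms] has_derivative_linear by blast
  have "((\<lambda>t. x + t *\<^sub>R v) has_derivative (\<lambda>h. h *\<^sub>R v)) (at t)"
    by (auto intro!: derivative_eq_intros)
  from diff_chain_at[OF this smooth_fun_has_derivative[OF assms]]
  have "((\<lambda>t. f (x + t *\<^sub>R v)) has_derivative (\<lambda>h. frechet_derivative f (at (x + t *\<^sub>R v)) (h *\<^sub>R v))) (at t)"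
    by (simp add: o_def)
  then show ?thesis
    unfolding has_field_derivative_def by (rule has_derivative_eq_rhs) (auto simp: linear_cmul[OF l])
qed

lemma smooth_fun_increment_bound:
  fixes f :: "'a::euclidean_space \<Rightarrow> real"
  assumes "smooth_fun f" "\<And>y. \<bar>frechet_derivative f (at y) v\<bar> \<le> B"
  shows "\<bar>f (x + t *\<^sub>R v) - f x\<bar> \<le> B * \<bar>t\<bar>"
proof -
  have "\<bar>f (x + t *\<^sub>R v) - f (x + 0 *\<^sub>R v)\<bar> \<le> B * \<bar>t - 0\<bar>"
    using field_differentiable_bound[of UNIV "\<lambda>t. f (x + t *\<^sub>R v)" "\<lambda>t. frechet_derivative f (at (x + t *\<^sub>R v)) v" B t 0]
      smooth_fun_along_line[OF assms(1)] assms(2) by (simp add: has_field_derivative_at_within)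
  then show ?thesis by simp
qed

text \<open>The mean value inequality for \<open>k\<close>, whose derivative at s is an increment of
  the first derivative over a distance |s| <= |t|, hence at most B |t|.\<close>

lemma smooth_fun_Taylor_bound:
  fixes f :: "'a::euclidean_space \<Rightarrow> real"
  assumes "smooth_fun f"
    and B: "\<And>y. \<bar>frechet_derivative (\<lambda>x. frechet_derivative f (at x) v) (at y) v\<bar> \<le> B"
  shows "\<bar>f (x + t *\<^sub>R v) - f x - t * frechet_derivative f (at x) v\<bar> \<le> B * t\<^sup>2"
proof -
  let ?d = "\<lambda>x. frechet_derivative f (at x) v"
  define k where "k s = f (x + s *\<^sub>R v) - s * ?d x" for s
  have B0: "B \<ge> 0" using B[of x] abs_ge_zero order_trans by blast
  have "\<bar>k t - k 0\<bar> \<le> (B * \<bar>t\<bar>) * \<bar>t - 0\<bar>"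
  proof -
    have "norm (k t - k 0) \<le> (B * \<bar>t\<bar>) * norm (t - 0)"
    proof (rule field_differentiable_bound[of "cball 0 \<bar>t\<bar>" k "\<lambda>s. ?d (x + s *\<^sub>R v) - ?d x"])
      show "(k has_field_derivative ?d (x + s *\<^sub>R v) - ?d x) (at s within cball 0 \<bar>t\<bar>)" for s
        unfolding k_def
        by (rule has_field_derivative_at_within) (auto intro!: derivative_eq_intros smooth_fun_along_line[OF assms(1)])
      show "norm (?d (x + s *\<^sub>R v) - ?d x) \<le> B * \<bar>t\<bar>" if "s \<in> cball 0 \<bar>t\<bar>" for s
      proof -
        have "\<bar>?d (x + s *\<^sub>R v) - ?d x\<bar> \<le> B * \<bar>s\<bar>"
          by (rule smooth_fun_increment_bound[OF smooth_fun_deriv[OF assms(1)] B])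
        also have "\<dots> \<le> B * \<bar>t\<bar>" using that B0 by (intro mult_left_mono) auto
        finally show ?thesis by simp
      qed
    qed auto
    then show ?thesis by simp
  qed
  then show ?thesis by (simp add: k_def power2_eq_square abs_mult_self_eq mult.assoc algebra_simps)
qed

text \<open>Difference quotients of \<psi> have integral 0 by translation invariance. They converge
  to the derivative, dominated by a constant on a fixed ball.\<close>

lemma integral_test_fun_deriv_zero:
  fixes \<psi> :: "'a::euclidean_space \<Rightarrow> real"
  assumes "test_fun UNIV \<psi>"
  shows "(LINT x|lebesgue. frechet_derivative \<psi> (at x) v) = 0"
proof -
  from test_funD[OF assms] obtain K where K: "smooth_fun \<psi>" "compact K" "\<And>x. x \<notin> K \<Longrightarrow> \<psi> x = 0" by blast
  obtain r where r: "K \<subseteq> ball 0 r" using compact_imp_bounded[OF K(2)] bounded_subset_ballD by blast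
  let ?d = "\<lambda>x. frechet_derivative \<psi> (at x) v"
  from test_fun_bounded[OF test_fun_deriv[OF assms]] obtain B where B: "\<And>x. \<bar>?d x\<bar> \<le> B" by blast
  have B0: "B \<ge> 0" using B[of 0] abs_ge_zero order_trans by blast
  have mes: "\<psi> \<in> borel_measurable lebesgue" by (intro continuous_lebesgue_measurable smooth_fun_continuous K)
  \<comment> \<open>Steps of length at most 1, so that every shifted support stays in the ball of
    radius \<open>r + norm v\<close>.\<close>
  define s where "s n = 1 / real (Suc n)" for n
  have s: "s n > 0" "s n \<le> 1" for n by (auto simp: s_def)
  have s0: "s \<longlonglongrightarrow> 0" unfolding s_def using LIMSEQ_Suc[OF lim_1_over_n] by simp
  have int: "integrable lebesgue \<psi>"
  proof -
    have "set_integrable lebesgue UNIV (\<lambda>x. \<psi> x * indicator K x)"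
    proof (rule L2_mult_integrable)
      show "\<psi> \<in> L2 UNIV" by (rule test_fun_L2[OF assms]) simp
      have "restr UNIV (indicator K) = restr K (\<lambda>x. 1)" by (auto simp: restr_def indicator_def fun_eq_iff)
      then show "indicator K \<in> L2 UNIV" using L2_one(1)[OF lmeasurable_compact[OF K(2)]] by (simp add: L2_iff)
    qed
    moreover have "(\<lambda>x. \<psi> x * indicator K x) = \<psi>" using K(3) by (auto simp: indicator_def fun_eq_iff)
    ultimately show ?thesis by (simp add: set_integrable_def)
  qed
  have "(\<lambda>n. LINT x|lebesgue. (\<psi> (x + s n *\<^sub>R v) - \<psi> x) / s n) \<longlonglongrightarrow> (LINT x|lebesgue. ?d x)"
  proof (rule integral_dominated_convergence[where w="\<lambda>x. B * indicator (ball 0 (r + norm v)) x"])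
    show "(\<lambda>x. ?d x) \<in> borel_measurable lebesgue"
      by (intro continuous_lebesgue_measurable smooth_fun_continuous smooth_fun_deriv K)
    show "(\<lambda>x. (\<psi> (x + s n *\<^sub>R v) - \<psi> x) / s n) \<in> borel_measurable lebesgue" for n
      by (intro borel_measurable_divide borel_measurable_diff lebesgue_integral_translate(1)[OF mes] mes borel_measurable_const)
    show "integrable lebesgue (\<lambda>x :: 'a. B * indicator (ball 0 (r + norm v)) x)"
      using lmeasurable_ball[of "0 :: 'a" "r + norm v"] unfolding fmeasurable_def mem_Collect_eq
      by (intro integrable_mult_right integrable_real_indicator) blast+
    show "AE x in lebesgue. (\<lambda>n. (\<psi> (x + s n *\<^sub>R v) - \<psi> x) / s n) \<longlonglongrightarrow> ?d x"
    proof (rule AE_I2)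
      fix x
      have "((\<lambda>t. \<psi> (x + t *\<^sub>R v)) has_real_derivative ?d x) (at 0)"
        using smooth_fun_along_line[OF K(1), of x v 0] by simp
      then have l: "((\<lambda>t. (\<psi> (x + t *\<^sub>R v) - \<psi> x) / t) \<longlongrightarrow> ?d x) (at 0)"
        by (simp add: has_field_derivative_iff)
      have "filterlim s (at 0) sequentially"
        using s0 s(1) by (auto simp: filterlim_at less_imp_neq[THEN not_sym] eventually_sequentially intro!: exI[of _ 0])
      from filterlim_compose[OF l this]
      show "(\<lambda>n. (\<psi> (x + s n *\<^sub>R v) - \<psi> x) / s n) \<longlonglongrightarrow> ?d x" .
    qed
    show "AE x in lebesgue. norm ((\<psi> (x + s n *\<^sub>R v) - \<psi> x) / s n) \<le> B * indicator (ball 0 (r + norm v)) x" for n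
    proof (rule AE_I2)
      fix x
      show "norm ((\<psi> (x + s n *\<^sub>R v) - \<psi> x) / s n) \<le> B * indicator (ball 0 (r + norm v)) x"
      proof (cases "x \<in> ball 0 (r + norm v)")
        case True
        have "\<bar>\<psi> (x + s n *\<^sub>R v) - \<psi> x\<bar> \<le> B * \<bar>s n\<bar>"
          by (rule smooth_fun_increment_bound[OF K(1) B])
        then show ?thesis using True s(1)[of n] by (simp add: abs_divide divide_le_eq)
      next
        case False
        have "x \<notin> K"
        proof
          assume "x \<in> K"
          then have "norm x < r" using r by auto
          then show False using False norm_ge_zero[of v] unfolding mem_ball dist_0_norm by linarith
        qed
        moreover have "x + s n *\<^sub>R v \<notin> K"
        proof
          assume "x + s n *\<^sub>R v \<in> K"
          then have "norm (x + s n *\<^sub>R v) < r" using r by auto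
          moreover have "norm (s n *\<^sub>R v) \<le> norm v" using s[of n] by (simp add: mult_left_le_one_le)
          ultimately have "norm x < r + norm v"
            using norm_triangle_ineq4[of "x + s n *\<^sub>R v" "s n *\<^sub>R v"] by simp
          then show False using False by simp
        qed
        ultimately show ?thesis using K(3) False by simp
      qed
    qed
  qed
  moreover have "(LINT x|lebesgue. (\<psi> (x + s n *\<^sub>R v) - \<psi> x) / s n) = 0" for n
    using int lebesgue_integral_translate(2,3)[OF mes, of "s n *\<^sub>R v"] by simp
  ultimately have "(\<lambda>n. 0 :: real) \<longlonglongrightarrow> (LINT x|lebesgue. ?d x)" by (simp only:)
  then show ?thesis by (simp add: LIMSEQ_const_iff)
qed

lemma frechet_derivative_mult_smooth:
  assumes "smooth_fun f" "smooth_fun g"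
  shows "frechet_derivative (\<lambda>x. f x * g x) (at x) v
    = f x * frechet_derivative g (at x) v + frechet_derivative f (at x) v * g x"
proof -
  have "((\<lambda>x. f x * g x) has_derivative (\<lambda>v. f x * frechet_derivative g (at x) v + frechet_derivative f (at x) v * g x)) (at x)"
    by (intro has_derivative_mult smooth_fun_has_derivative assms)
  from frechet_derivative_at[OF this] show ?thesis by metis
qed

text \<open>The product f \<phi> is again a test function for u; the Leibniz rule for its derivative
  produces both terms of the claim.\<close>

lemma weak_deriv_mult_smooth:
  assumes "open \<Omega>" "u \<in> L2 \<Omega>" "weak_deriv \<Omega> v u g" "smooth_fun f"
    and "\<And>x. x \<in> \<Omega> \<Longrightarrow> \<bar>f x\<bar> \<le> B" "\<And>x. x \<in> \<Omega> \<Longrightarrow> \<bar>frechet_derivative f (at x) v\<bar> \<le> B"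
  shows "weak_deriv \<Omega> v (\<lambda>x. f x * u x) (\<lambda>x. f x * g x + frechet_derivative f (at x) v * u x)"
proof (rule weak_derivI)
  let ?f' = "\<lambda>x. frechet_derivative f (at x) v"
  have o: "\<Omega> \<in> sets lebesgue" using assms(1) by auto
  have g: "g \<in> L2 \<Omega>" using assms weak_derivD(1) by blast
  have L: "(\<lambda>x. f x * u x) \<in> L2 \<Omega>" "(\<lambda>x. f x * g x) \<in> L2 \<Omega>" "(\<lambda>x. ?f' x * u x) \<in> L2 \<Omega>"
    using assms(5,6) o g assms(2)
    by (auto intro!: L2_mult_bounded(1)[where B=B] smooth_restr_measurable smooth_fun_deriv assms(4))
  show "(\<lambda>x. f x * g x + ?f' x * u x) \<in> L2 \<Omega>" using L by (intro L2_add)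
  fix \<phi> assume t: "test_fun \<Omega> \<phi>"
  then have sm: "smooth_fun \<phi>" by (simp add: test_fun_def)
  let ?\<phi>' = "\<lambda>x. frechet_derivative \<phi> (at x) v"
  have p: "\<phi> \<in> L2 \<Omega>" "?\<phi>' \<in> L2 \<Omega>" using t o test_fun_L2 test_fun_deriv_L2 by blast+
  have "(LINT x:\<Omega>|lebesgue. u x * frechet_derivative (\<lambda>x. f x * \<phi> x) (at x) v) = - (LINT x:\<Omega>|lebesgue. g x * (f x * \<phi> x))"
    by (rule weak_derivD(2)[OF assms(3) test_fun_mult_smooth[OF t assms(4)]])
  moreover have "(LINT x:\<Omega>|lebesgue. u x * frechet_derivative (\<lambda>x. f x * \<phi> x) (at x) v)
    = (LINT x:\<Omega>|lebesgue. f x * u x * ?\<phi>' x) + (LINT x:\<Omega>|lebesgue. ?f' x * u x * \<phi> x)"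
    unfolding frechet_derivative_mult_smooth[OF assms(4) sm]
    using set_integral_add(2)[OF L2_mult_integrable[OF L(1) p(2)] L2_mult_integrable[OF L(3) p(1)]]
    by (simp add: algebra_simps)
  moreover have "(LINT x:\<Omega>|lebesgue. (f x * g x + ?f' x * u x) * \<phi> x)
    = (LINT x:\<Omega>|lebesgue. g x * (f x * \<phi> x)) + (LINT x:\<Omega>|lebesgue. ?f' x * u x * \<phi> x)"
    using set_integral_add(2)[OF L2_mult_integrable[OF L(2) p(1)] L2_mult_integrable[OF L(3) p(1)]]
    by (simp add: algebra_simps)
  ultimately show "(LINT x:\<Omega>|lebesgue. f x * u x * ?\<phi>' x) = - (LINT x:\<Omega>|lebesgue. (f x * g x + ?f' x * u x) * \<phi> x)"
    by simp
qed

lemma weak_deriv_one: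
  assumes "open \<Omega>"
  shows "weak_deriv \<Omega> v (\<lambda>x. 1) (\<lambda>x. 0)"
proof (rule weak_derivI)
  fix \<phi> assume t: "test_fun \<Omega> \<phi>"
  have "(LINT x:UNIV|lebesgue. 1 * frechet_derivative \<phi> (at x) v) = 0"
    using integral_test_fun_deriv_zero[OF test_fun_mono[OF t], of v] by (simp add: set_lebesgue_integral_def)
  moreover have "(LINT x:UNIV|lebesgue. 1 * frechet_derivative \<phi> (at x) v) = (LINT x:\<Omega>|lebesgue. 1 * frechet_derivative \<phi> (at x) v)"
    using test_fun_zero_outside[OF test_fun_deriv[OF t]] by (intro LINT_eq_of_zero) auto
  ultimately show "(LINT x:\<Omega>|lebesgue. 1 * frechet_derivative \<phi> (at x) v) = - (LINT x:\<Omega>|lebesgue. 0 * \<phi> x)" by simp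
qed simp

lemma smooth_bounded_on:
  assumes "smooth_fun f" "bounded \<Omega>"
  shows "\<exists>B. \<forall>x\<in>\<Omega>. \<bar>f x\<bar> \<le> B"
proof -
  have "compact (f ` closure \<Omega>)"
    using assms by (intro compact_continuous_image smooth_fun_continuous) auto
  then have "bounded (f ` \<Omega>)" by (meson bounded_subset closure_subset compact_imp_bounded image_mono)
  then show ?thesis by (auto simp: bounded_iff)
qed

text \<open>The product rule applied to f times the constant 1, whose weak derivative is 0 because
  derivatives of test functions have integral 0.\<close>

lemma smooth_weak_deriv:
  assumes "open \<Omega>" "bounded \<Omega>" "smooth_fun f"
  shows "f \<in> L2 \<Omega>" and "weak_deriv \<Omega> v f (\<lambda>x. frechet_derivative f (at x) v)"
proof -
  obtain B1 B2 where "\<forall>x\<in>\<Omega>. \<bar>f x\<bar> \<le> B1" "\<forall>x\<in>\<Omega>. \<bar>frechet_derivative f (at x) v\<bar> \<le> B2"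
    using smooth_bounded_on assms smooth_fun_deriv by metis
  then have B: "\<And>x. x \<in> \<Omega> \<Longrightarrow> \<bar>f x\<bar> \<le> max B1 B2" "\<And>x. x \<in> \<Omega> \<Longrightarrow> \<bar>frechet_derivative f (at x) v\<bar> \<le> max B1 B2"
    by force+
  have m: "\<Omega> \<in> lmeasurable" using assms(1,2) by (simp add: bounded_set_imp_lmeasurable)
  show "f \<in> L2 \<Omega>" by (rule L2_bounded(1)[OF m smooth_restr_measurable[OF assms(3)] B(1)]) (use assms in auto)
  show "weak_deriv \<Omega> v f (\<lambda>x. frechet_derivative f (at x) v)"
    using weak_deriv_mult_smooth[OF assms(1) L2_one(1)[OF m] weak_deriv_one[OF assms(1), of v] assms(3) B] by simp
qed

lemma smooth_H1: "open \<Omega> \<Longrightarrow> bounded \<Omega> \<Longrightarrow> smooth_fun f \<Longrightarrow> f \<in> H1 \<Omega>"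
  by (rule H1I) (auto intro: smooth_weak_deriv)

subsection \<open>Increments of Sobolev functions\<close>

lemma has_real_derivative_of_quadratic_remainder:
  fixes f :: "real \<Rightarrow> real"
  assumes "\<And>s. \<bar>s\<bar> \<le> 1 \<Longrightarrow> \<bar>f (t + s) - f t - s * d\<bar> \<le> C * s\<^sup>2"
  shows "(f has_real_derivative d) (at t)"
proof -
  have "(\<lambda>s. (f (t + s) - f t) / s - d) \<midarrow>0\<rightarrow> 0"
  proof (rule Lim_null_comparison)
    have "\<forall>\<^sub>F s in at 0. s \<in> ball (0::real) 1 - {0}"
      by (rule eventually_at_in_open) auto
    then show "\<forall>\<^sub>F s in at 0. norm ((f (t + s) - f t) / s - d) \<le> C * \<bar>s\<bar>"
    proof eventually_elim
      case (elim s)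
      then have s: "s \<noteq> 0" "\<bar>s\<bar> \<le> 1" by auto
      have "(f (t + s) - f t) / s - d = (f (t + s) - f t - s * d) / s" using s by (simp add: field_simps)
      then have "norm ((f (t + s) - f t) / s - d) = \<bar>f (t + s) - f t - s * d\<bar> / \<bar>s\<bar>" by (simp add: abs_divide)
      also have "\<dots> \<le> C * s\<^sup>2 / \<bar>s\<bar>" using assms[OF s(2)] by (intro divide_right_mono) auto
      also have "\<dots> = C * \<bar>s\<bar>" using s by (simp add: power2_eq_square field_simps abs_mult_self_eq)
      finally show ?case .
    qed
    show "((\<lambda>s. C * \<bar>s\<bar>) \<longlongrightarrow> 0) (at 0)" by (auto intro!: tendsto_eq_intros)
  qed
  then show ?thesis by (simp add: DERIV_def LIM_zero_iff)
qed

text \<open>By duality: for a test function \<open>\<phi>\<close> supported in \<open>A\<close>, the derivative of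
  \<open>t \<mapsto> \<integral> v(x) \<phi>(x - t e) dx\<close> is \<open>\<integral> g(x) \<phi>(x - t e) dx\<close>, hence bounded by the product of the norms.\<close>

lemma L2_norm_increment_le:
  fixes v :: "'a::euclidean_space \<Rightarrow> real"
  assumes "open \<Omega>" "v \<in> L2 \<Omega>" "weak_deriv \<Omega> e v g" "open A"
    and sw: "\<And>x t. x \<in> A \<Longrightarrow> 0 \<le> t \<Longrightarrow> t \<le> 1 \<Longrightarrow> x + t *\<^sub>R e \<in> \<Omega>"
  shows "(\<lambda>x. v (x + e)) \<in> L2 A" and "L2_norm A (\<lambda>x. v (x + e) - v x) \<le> L2_norm \<Omega> g"
proof -
  have A\<Omega>: "A \<subseteq> \<Omega>" using sw[of _ 0] by auto
  have o: "\<Omega> \<in> sets lebesgue" "A \<in> sets lebesgue" using assms by auto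
  have g: "g \<in> L2 \<Omega>" using assms(3) weak_derivD(1) by blast
  \<comment> \<open>Extension by zero, so that all translates live in L2 of the whole space.\<close>
  define V where "V = restr \<Omega> v"
  have V: "V \<in> L2 UNIV" using assms(2) by (simp add: V_def L2_iff restr_subset)
  have Ve: "(\<lambda>x. V (x + e)) \<in> L2 UNIV" by (rule L2_translate(1)[OF V])
  have Veq: "V (x + e) = v (x + e)" if "x \<in> A" for x using sw[of x 1] that by (simp add: V_def restr_def)
  have "(\<lambda>x. V (x + e)) \<in> L2 A" by (rule L2_subset(1)[OF Ve]) (use o in auto)
  then show ve: "(\<lambda>x. v (x + e)) \<in> L2 A" using L2_cong(1)[of A "\<lambda>x. V (x + e)" "\<lambda>x. v (x + e)"] Veq by simp
  have vA: "v \<in> L2 A" by (rule L2_subset(1)[OF assms(2) A\<Omega> o(2)])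
  show "L2_norm A (\<lambda>x. v (x + e) - v x) \<le> L2_norm \<Omega> g"
  proof (rule L2_norm_le_dual[OF assms(4) L2_diff[OF ve vA] L2_norm_nonneg])
    fix \<phi> assume t: "test_fun A \<phi>"
    from test_funD[OF t] obtain K where K: "smooth_fun \<phi>" "compact K" "K \<subseteq> A" "\<And>x. x \<notin> K \<Longrightarrow> \<phi> x = 0" by blast
    let ?d = "\<lambda>x. frechet_derivative \<phi> (at x) e"
    obtain r where r: "K \<subseteq> ball 0 r" using compact_imp_bounded[OF K(2)] bounded_subset_ballD by blast
    from test_fun_bounded[OF test_fun_deriv[OF test_fun_deriv[OF t]]]
    obtain B where B: "\<And>y. \<bar>frechet_derivative ?d (at y) e\<bar> \<le> B" by blast
    have dK: "?d x = 0" if "x \<notin> K" for x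
      using test_fun_zero_outside[OF test_fun_deriv[OF test_funI[OF K(1,2) subset_refl K(4)]] that] .
    define P where "P t = (\<lambda>x. \<phi> (x - t *\<^sub>R e))" for t
    define D where "D t = (\<lambda>x. ?d (x - t *\<^sub>R e))" for t
    have tL: "\<phi> \<in> L2 UNIV" "?d \<in> L2 UNIV" using test_fun_L2[OF t] test_fun_deriv_L2[OF t] by auto
    have PL: "P t \<in> L2 \<Omega>" "D t \<in> L2 \<Omega>" "P t \<in> L2 UNIV" for t
      using L2_subset(1)[OF L2_translate(1)[OF tL(1), of "- t *\<^sub>R e"], of \<Omega>]
        L2_subset(1)[OF L2_translate(1)[OF tL(2), of "- t *\<^sub>R e"], of \<Omega>] o L2_translate(1)[OF tL(1), of "- t *\<^sub>R e"]
      by (auto simp: P_def D_def)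
    \<comment> \<open>The condition \<open>sw\<close> keeps the support, moved by t e, inside
      \<Omega> for t in [0, 1]. This permits the moved \<phi> to be used in the definition of the
      weak derivative on \<Omega>.\<close>
    have Ptest: "test_fun \<Omega> (P t)" if "0 \<le> t" "t \<le> 1" for t
    proof (rule test_funI)
      show "smooth_fun (P t)" unfolding P_def using smooth_fun_translate[OF K(1), of "- t *\<^sub>R e"] by simp
      show "compact ((\<lambda>x. x + t *\<^sub>R e) ` K)" using K(2) by (intro compact_continuous_image continuous_intros)
      show "(\<lambda>x. x + t *\<^sub>R e) ` K \<subseteq> \<Omega>" using sw that K(3) by auto
      show "P t x = 0" if "x \<notin> (\<lambda>x. x + t *\<^sub>R e) ` K" for x
      proof -
        have "x - t *\<^sub>R e \<notin> K" using that by (metis diff_add_cancel imageI)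
        then show ?thesis using K(4) by (simp add: P_def)
      qed
    qed
    have Pder: "frechet_derivative (P t) (at x) e = D t x" for t x
    proof -
      have "(P t has_derivative frechet_derivative \<phi> (at (x - t *\<^sub>R e))) (at x)"
        unfolding P_def
        using has_derivative_compose[OF has_derivative_diff[OF has_derivative_ident has_derivative_const] smooth_fun_has_derivative[OF K(1)], of "t *\<^sub>R e" x UNIV]
        by simp
      from frechet_derivative_at[OF this] show ?thesis by (metis D_def)
    qed
    define H where "H t = (LINT x:\<Omega>|lebesgue. v x * P t x)" for t
    \<comment> \<open>Differentiation under the integral sign: the Taylor remainder of \<phi> along
      e is at most B s^2 and, for |s| <= 1, vanishes outside a fixed ball, so the remainder of
      \<open>H\<close> is quadratic in s.\<close>
    have Hd: "(H has_real_derivative - (LINT x:\<Omega>|lebesgue. v x * D t x)) (at t)" for t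
    proof -
      define R where "R = r + (\<bar>t\<bar> + 1) * norm e"
      define W where "W = (\<lambda>x :: 'a. B * indicator (ball 0 R) x :: real)"
      have iball: "indicator (ball 0 R) \<in> L2 \<Omega>"
      proof -
        have "indicator (ball 0 R) \<in> L2 (UNIV :: 'a set)"
        proof -
          have "restr UNIV (indicator (ball 0 R)) = restr (ball (0::'a) R) (\<lambda>x. 1)" by (auto simp: restr_def indicator_def fun_eq_iff)
          then show ?thesis using L2_one(1)[of "ball (0::'a) R"] by (simp add: L2_iff)
        qed
        then show ?thesis using L2_subset(1) o by blast
      qed
      define C where "C = (LINT x:\<Omega>|lebesgue. \<bar>v x\<bar> * W x)"
      show ?thesis
      proof (rule has_real_derivative_of_quadratic_remainder)
        fix s :: real assume s: "\<bar>s\<bar> \<le> 1"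
        let ?R = "\<lambda>x. P (t + s) x - P t x + s * D t x"
        have RL: "?R \<in> L2 \<Omega>" by (intro L2_add L2_diff L2_cmult PL)
        have Rb: "\<bar>?R x\<bar> \<le> W x * s\<^sup>2" for x
        proof (cases "x \<in> ball 0 R")
          case True
          have "\<bar>\<phi> (x - t *\<^sub>R e + (- s) *\<^sub>R e) - \<phi> (x - t *\<^sub>R e) - (- s) * ?d (x - t *\<^sub>R e)\<bar> \<le> B * (- s)\<^sup>2"
            by (rule smooth_fun_Taylor_bound[OF K(1) B])
          then show ?thesis using True by (simp add: P_def D_def W_def algebra_simps)
        next
          case False
          have far: "x - c *\<^sub>R e \<notin> K" if "\<bar>c\<bar> \<le> \<bar>t\<bar> + 1" for c
          proof
            assume "x - c *\<^sub>R e \<in> K"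
            then have "norm (x - c *\<^sub>R e) < r" using r by auto
            moreover have "norm (c *\<^sub>R e) \<le> (\<bar>t\<bar> + 1) * norm e" using that by (simp add: mult_right_mono)
            ultimately have "norm x < R"
              using norm_triangle_ineq[of "x - c *\<^sub>R e" "c *\<^sub>R e"] by (simp add: R_def)
            then show False using False by simp
          qed
          have "x - (t + s) *\<^sub>R e \<notin> K" "x - t *\<^sub>R e \<notin> K" using far[of "t + s"] far[of t] s by auto
          then show ?thesis using K(4) dK False by (simp add: P_def D_def W_def)
        qed
        have i: "set_integrable lebesgue \<Omega> (\<lambda>x. v x * P t x)" "set_integrable lebesgue \<Omega> (\<lambda>x. v x * P (t + s) x)"
          "set_integrable lebesgue \<Omega> (\<lambda>x. v x * D t x)" "set_integrable lebesgue \<Omega> (\<lambda>x. v x * ?R x)"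
          using assms(2) PL RL L2_mult_integrable by blast+
        have "H (t + s) - H t - s * - (LINT x:\<Omega>|lebesgue. v x * D t x) = (LINT x:\<Omega>|lebesgue. v x * ?R x)"
        proof -
          have "(\<lambda>x. v x * ?R x) = (\<lambda>x. (v x * P (t + s) x - v x * P t x) + s * (v x * D t x))"
            by (auto simp: algebra_simps)
          then have "(LINT x:\<Omega>|lebesgue. v x * ?R x) = (LINT x:\<Omega>|lebesgue. (v x * P (t + s) x - v x * P t x) + s * (v x * D t x))"
            by simp
          also have "\<dots> = (LINT x:\<Omega>|lebesgue. v x * P (t + s) x) - (LINT x:\<Omega>|lebesgue. v x * P t x) + s * (LINT x:\<Omega>|lebesgue. v x * D t x)"
            using i by (simp add: set_integral_add(2) set_integral_diff)
          finally show ?thesis by (simp add: H_def)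
        qed
        moreover have "\<bar>LINT x:\<Omega>|lebesgue. v x * ?R x\<bar> \<le> (LINT x:\<Omega>|lebesgue. s\<^sup>2 * (\<bar>v x\<bar> * W x))"
        proof -
          have vL: "(\<lambda>x. \<bar>v x\<bar>) \<in> L2 \<Omega>"
            using L2_of_measurable_bound(1)[of \<Omega> "\<lambda>x. \<bar>v x\<bar>" v] assms(2) by (simp add: restr_simps L2_measurable borel_measurable_abs)
          have "set_integrable lebesgue \<Omega> (\<lambda>x. s\<^sup>2 * (\<bar>v x\<bar> * W x))"
            unfolding W_def by (intro set_integrable_mult_right L2_mult_integrable[OF vL] L2_cmult iball)
          then have "(LINT x|lebesgue. \<bar>restr \<Omega> (\<lambda>x. v x * ?R x) x\<bar>) \<le> (LINT x|lebesgue. restr \<Omega> (\<lambda>x. s\<^sup>2 * (\<bar>v x\<bar> * W x)) x)"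
          proof (intro integral_mono)
            fix x
            have "\<bar>v x * ?R x\<bar> \<le> \<bar>v x\<bar> * (W x * s\<^sup>2)"
              using Rb[of x] by (simp add: abs_mult mult_left_mono)
            then show "\<bar>restr \<Omega> (\<lambda>x. v x * ?R x) x\<bar> \<le> restr \<Omega> (\<lambda>x. s\<^sup>2 * (\<bar>v x\<bar> * W x)) x"
              by (simp add: restr_def mult_ac)
          qed (use i(4) in \<open>auto simp: set_integrable_restr\<close>)
          then show ?thesis unfolding LINT_restr using integral_abs_bound[of lebesgue "restr \<Omega> (\<lambda>x. v x * ?R x)"] by linarith
        qed
        ultimately show "\<bar>H (t + s) - H t - s * - (LINT x:\<Omega>|lebesgue. v x * D t x)\<bar> \<le> C * s\<^sup>2"
          by (simp add: C_def mult.commute)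
      qed
    qed
    have nP: "L2_norm \<Omega> (P t) \<le> L2_norm A \<phi>" for t
    proof -
      have "L2_norm \<Omega> (P t) \<le> L2_norm UNIV (P t)" using L2_subset(2)[OF PL(3)] o by blast
      also have "\<dots> = L2_norm UNIV \<phi>" using L2_translate(2)[OF tL(1), of "- t *\<^sub>R e"] by (simp add: P_def)
      also have "\<dots> = L2_norm A \<phi>" using test_fun_zero_outside[OF t] by (intro L2_norm_eq_of_zero) auto
      finally show ?thesis .
    qed
    have "\<bar>H 1 - H 0\<bar> \<le> L2_norm \<Omega> g * L2_norm A \<phi>"
    proof -
      have "norm (H 1 - H 0) \<le> (L2_norm \<Omega> g * L2_norm A \<phi>) * norm ((1::real) - 0)"
      proof (rule field_differentiable_bound[of "{0..1}" H "\<lambda>t. - (LINT x:\<Omega>|lebesgue. v x * D t x)"])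
        show "(H has_field_derivative - (LINT x:\<Omega>|lebesgue. v x * D t x)) (at t within {0..1})" for t
          by (rule has_field_derivative_at_within[OF Hd])
        fix t :: real assume "t \<in> {0..1}"
        then have "(LINT x:\<Omega>|lebesgue. v x * D t x) = - (LINT x:\<Omega>|lebesgue. g x * P t x)"
          using weak_derivD(2)[OF assms(3) Ptest, of t] Pder by simp
        then have "norm (- (LINT x:\<Omega>|lebesgue. v x * D t x)) \<le> L2_norm \<Omega> g * L2_norm \<Omega> (P t)"
          using L2_Cauchy_Schwarz[OF g PL(1)] by simp
        also have "\<dots> \<le> L2_norm \<Omega> g * L2_norm A \<phi>" using nP by (intro mult_left_mono) auto
        finally show "norm (- (LINT x:\<Omega>|lebesgue. v x * D t x)) \<le> L2_norm \<Omega> g * L2_norm A \<phi>" .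
      qed auto
      then show ?thesis by simp
    qed
    \<comment> \<open>Substituting x + e for x turns the moved test function back into \<phi> and
      puts the shift on \<open>v\<close>.\<close>
    moreover have "H 1 = (LINT x:A|lebesgue. v (x + e) * \<phi> x)"
    proof -
      have m: "(\<lambda>x. V x * P 1 x) \<in> borel_measurable lebesgue"
        using L2_measurable[OF V] L2_measurable[OF PL(3)] by (simp add: restr_def)
      have "H 1 = (LINT x|lebesgue. V x * P 1 x)"
        unfolding H_def LINT_restr by (rule Bochner_Integration.integral_cong) (auto simp: V_def restr_def)
      also have "\<dots> = (LINT x|lebesgue. V (x + e) * P 1 (x + e))"
        using lebesgue_integral_translate(3)[OF m, of e] by simp
      also have "\<dots> = (LINT x:A|lebesgue. v (x + e) * \<phi> x)"
        unfolding LINT_restr using Veq test_fun_zero_outside[OF t]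
        by (intro Bochner_Integration.integral_cong) (auto simp: restr_def P_def)
      finally show ?thesis .
    qed
    moreover have "H 0 = (LINT x:A|lebesgue. v x * \<phi> x)"
      unfolding H_def P_def using test_fun_zero_outside[OF t] A\<Omega> by (simp, intro LINT_eq_of_zero) auto
    moreover have "(LINT x:A|lebesgue. (v (x + e) - v x) * \<phi> x) = (LINT x:A|lebesgue. v (x + e) * \<phi> x) - (LINT x:A|lebesgue. v x * \<phi> x)"
      using ve vA test_fun_L2[OF t o(2)]
      by (subst set_integral_diff(2)[symmetric]) (auto intro: L2_mult_integrable simp: algebra_simps)
    ultimately show "\<bar>LINT x:A|lebesgue. (v (x + e) - v x) * \<phi> x\<bar> \<le> L2_norm \<Omega> g * L2_norm A \<phi>" by simp
  qed
qed

lemma indicator_L2: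
  assumes "{a<..<e} \<subseteq> {0<..<1::real}"
  shows "indicator {a<..<e} \<in> L2 {0<..<1::real}"
proof -
  have "restr {0<..<1} (indicator {a<..<e}) = restr {a<..<e} (\<lambda>x. 1)" using assms by (auto simp: restr_def indicator_def fun_eq_iff)
  then show ?thesis using L2_one(1)[of "{a<..<e}"] by (simp add: L2_iff)
qed

lemma LINT_mult_indicator:
  fixes F :: "real \<Rightarrow> real"
  assumes "{a<..<e} \<subseteq> {0<..<1::real}"
  shows "(LINT x:{0<..<1}|lebesgue. F x * indicator {a<..<e} x) = (LINT x:{a<..<e}|lebesgue. F x)"
  unfolding LINT_restr using assms by (intro Bochner_Integration.integral_cong) (auto simp: restr_def indicator_def)

text \<open>An affine rescaling of the smooth step, whose derivative vanishes outside
  [\<delta> / 2, \<delta>]. The bound \<open>H\<close> depends on \<delta> alone, and \<delta> is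
  fixed before \<epsilon>.\<close>

lemma cutoff_exists:
  fixes \<delta> :: real
  assumes "\<delta> > 0"
  shows "\<exists>\<eta> H. smooth_fun \<eta> \<and> (\<forall>y. 0 \<le> \<eta> y) \<and> (\<forall>y. \<eta> y \<le> 1) \<and> (\<forall>y. y \<le> \<delta> / 2 \<longrightarrow> \<eta> y = 0)
    \<and> (\<forall>y. \<delta> \<le> y \<longrightarrow> \<eta> y = 1) \<and> (\<forall>y. \<bar>frechet_derivative \<eta> (at y) (1::real)\<bar> \<le> H)"
proof -
  obtain h :: "real \<Rightarrow> real" where h: "smooth_fun h" "\<And>x. 0 \<le> h x" "\<And>x. h x \<le> 1" "\<And>x. x \<le> 0 \<Longrightarrow> h x = 0" "\<And>x. 1 \<le> x \<Longrightarrow> h x = 1"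
    using smooth_step_exists by metis
  define \<eta> where "\<eta> y = h ((2 / \<delta>) * y + (-1))" for y
  have s: "smooth_fun \<eta>" unfolding \<eta>_def
    by (intro smooth_fun_compose[OF h(1)] smooth_fun_add smooth_fun_mult smooth_fun_const smooth_fun_id)
  have e0: "\<eta> y = 0" if "y \<le> \<delta> / 2" for y using that assms unfolding \<eta>_def by (intro h(4)) (simp add: field_simps)
  have e1: "\<eta> y = 1" if "\<delta> \<le> y" for y using that assms unfolding \<eta>_def by (intro h(5)) (simp add: field_simps)
  let ?d = "\<lambda>y. frechet_derivative \<eta> (at y) (1::real)"
  obtain H where H: "\<And>y. y \<in> {\<delta> / 2..\<delta>} \<Longrightarrow> \<bar>?d y\<bar> \<le> H"
    using smooth_bounded_on[OF smooth_fun_deriv[OF s] bounded_closed_interval] by metis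
  have H0: "H \<ge> 0" using H[of \<delta>] assms by fastforce
  have const: "?d y = 0" if "open S" "y \<in> S" "\<And>z. z \<in> S \<Longrightarrow> \<eta> z = c" for S y c
  proof -
    have "((\<lambda>y. c) has_derivative frechet_derivative \<eta> (at y)) (at y)"
      by (rule has_derivative_transform_within_open[OF smooth_fun_has_derivative[OF s] that(1,2)]) (use that(3) in auto)
    then have "frechet_derivative \<eta> (at y) = (\<lambda>v. 0)" using has_derivative_unique[OF _ has_derivative_const] by blast
    then show ?thesis by simp
  qed
  have "\<bar>?d y\<bar> \<le> H" for y
  proof -
    consider "y < \<delta> / 2" | "y \<in> {\<delta> / 2..\<delta>}" | "\<delta> < y" by fastforce
    then show ?thesis
    proof cases
      case 1 then show ?thesis using const[of "{..<\<delta> / 2}" y 0] e0 H0 by auto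
    next
      case 2 then show ?thesis by (rule H)
    next
      case 3 then show ?thesis using const[of "{\<delta><..}" y 1] e1 H0 by auto
    qed
  qed
  then show ?thesis using s e0 e1 h(2,3) unfolding \<eta>_def by blast
qed

section \<open>Sobolev functions on an interval\<close>

lemma LINT_AE_set:
  fixes f :: "'a::euclidean_space \<Rightarrow> real"
  assumes "AE x in lebesgue. x \<in> A \<longleftrightarrow> x \<in> B"
  shows "(LINT x:A|lebesgue. f x) = (LINT x:B|lebesgue. f x)"
  unfolding LINT_restr
  by (rule lebesgue_integrable_cong_AE(2)) (use assms in \<open>eventually_elim, auto simp: restr_def\<close>)

lemma LINT_abs_bound:
  "set_integrable M A f \<Longrightarrow> \<bar>LINT x:A|M. f x\<bar> \<le> (LINT x:A|M. \<bar>f x\<bar>)" for f :: "'a \<Rightarrow> real"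
  unfolding LINT_restr restr_simps by (rule integral_abs_bound)

lemma L2_integrable:
  assumes "u \<in> L2 U" "U \<in> lmeasurable"
  shows "set_integrable lebesgue U u"
  using L2_mult_integrable[OF assms(1) L2_one(1)[OF assms(2)]] by simp

lemma L2_abs: "u \<in> L2 U \<Longrightarrow> (\<lambda>x. \<bar>u x\<bar>) \<in> L2 U" "L2_norm U (\<lambda>x. \<bar>u x\<bar>) = L2_norm U u"
  by (auto simp: L2_iff L2_norm_restr restr_simps)

lemma L2_integral_abs_le:
  assumes "u \<in> L2 U" "U \<in> lmeasurable"
  shows "(LINT x:U|lebesgue. \<bar>u x\<bar>) \<le> L2_norm U u * sqrt (measure lebesgue U)"
  using L2_Cauchy_Schwarz[OF L2_abs(1)[OF assms(1)] L2_one(1)[OF assms(2)]] L2_abs(2)[of U u] L2_one(2)[OF assms(2)]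
  by simp

lemma L2_integral_le:
  assumes "u \<in> L2 U" "U \<in> lmeasurable"
  shows "\<bar>LINT x:U|lebesgue. u x\<bar> \<le> L2_norm U u * sqrt (measure lebesgue U)"
  using L2_integral_abs_le[OF assms] LINT_abs_bound[OF L2_integrable[OF assms]] by linarith

lemma unit_test_fun_exists:
  fixes U :: "'a::euclidean_space set"
  assumes "open U" "U \<noteq> {}"
  obtains \<rho> where "test_fun U \<rho>" "\<And>x. 0 \<le> \<rho> x" "(LINT x:U|lebesgue. \<rho> x) = 1"
proof -
  from assms obtain a r where r: "r > 0" "cball a r \<subseteq> U" using open_contains_cball by blast
  obtain \<psi> where \<psi>: "test_fun U \<psi>" "\<And>x. x \<in> cball a r \<Longrightarrow> \<psi> x = 1" "\<And>x. 0 \<le> \<psi> x" "\<And>x. \<psi> x \<le> 1"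
    using smooth_Urysohn[OF compact_cball assms(1) r(2)] by metis
  have L: "\<psi> \<in> L2 U" "\<psi> \<in> L2 (cball a r)" using test_fun_L2[OF \<psi>(1)] assms(1) by auto
  define I where "I = (LINT x:U|lebesgue. \<psi> x)"
  have "measure lebesgue (cball a r) > 0" using r(1) by (simp add: content_cball_pos)
  also have "measure lebesgue (cball a r) \<le> I"
  proof -
    from test_funD[OF \<psi>(1)] obtain K where K: "compact K" "K \<subseteq> U" "\<And>x. x \<notin> K \<Longrightarrow> \<psi> x = 0" by blast
    have i: "integrable lebesgue (restr K \<psi>)"
      using L2_integrable[OF _ lmeasurable_compact[OF K(1)]] test_fun_L2[OF \<psi>(1)] K(1)
      by (simp add: set_integrable_restr lmeasurable_compact fmeasurableD)
    have e: "restr U \<psi> = restr K \<psi>" using K by (intro restr_eq_of_zero) auto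
    have "measure lebesgue (cball a r) = (LINT x|lebesgue. indicator (cball a r) x)" by simp
    also have "\<dots> \<le> (LINT x|lebesgue. restr U \<psi> x)"
    proof (rule integral_mono)
      show "integrable lebesgue (indicator (cball a r) :: 'a \<Rightarrow> real)"
        using lmeasurable_cball[of a r] unfolding fmeasurable_def mem_Collect_eq
        by (intro integrable_real_indicator) blast+
      show "integrable lebesgue (restr U \<psi>)" using i e by simp
      show "indicator (cball a r) x \<le> restr U \<psi> x" for x
        using \<psi>(2)[of x] \<psi>(3)[of x] r(2) by (auto simp: indicator_def restr_def subset_iff)
    qed
    also have "\<dots> = I" by (simp add: I_def LINT_restr)
    finally show ?thesis .
  qed
  finally have I: "I > 0" .
  show ?thesis
  proof (rule that[of "\<lambda>x. (1 / I) * \<psi> x"])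
    show "test_fun U (\<lambda>x. (1 / I) * \<psi> x)" by (rule test_fun_cmult[OF \<psi>(1)])
    show "0 \<le> 1 / I * \<psi> x" for x using \<psi>(3)[of x] I by simp
    show "(LINT x:U|lebesgue. 1 / I * \<psi> x) = 1" using I by (simp add: I_def)
  qed
qed

lemma frechet_derivative_real:
  assumes "(f has_real_derivative d) (at x)"
  shows "frechet_derivative f (at x) 1 = d"
  using frechet_derivative_at[OF assms[unfolded has_field_derivative_def]] by (metis mult.right_neutral)

text \<open>The primitive is 0 to the left of the support and, because the mean is zero, returns to
  0 to the right of it.\<close>

lemma test_fun_primitive:
  fixes \<psi> :: "real \<Rightarrow> real"
  assumes t: "test_fun {a<..<b} \<psi>" and "a < b" and z: "(LINT x:{a<..<b}|lebesgue. \<psi> x) = 0"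
  obtains \<Psi> where "test_fun {a<..<b} \<Psi>" "\<And>x. frechet_derivative \<Psi> (at x) 1 = \<psi> x"
    "\<And>x. \<bar>\<Psi> x\<bar> \<le> (LINT x:{a<..<b}|lebesgue. \<bar>\<psi> x\<bar>)"
proof -
  from test_funD[OF t] obtain K where K: "smooth_fun \<psi>" "compact K" "K \<subseteq> {a<..<b}" "\<And>x. x \<notin> K \<Longrightarrow> \<psi> x = 0" by blast
  have "\<exists>p q. a < p \<and> p \<le> q \<and> q < b \<and> K \<subseteq> {p..q}"
  proof (cases "K = {}")
    case True
    then show ?thesis using \<open>a < b\<close> dense[OF \<open>a < b\<close>] by auto
  next
    case False
    then obtain p q where "p \<in> K" "\<forall>x\<in>K. p \<le> x" "q \<in> K" "\<forall>x\<in>K. x \<le> q"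
      using compact_attains_inf[OF K(2)] compact_attains_sup[OF K(2)] by metis
    then show ?thesis using K(3) by (intro exI[of _ p] exI[of _ q]) auto
  qed
  then obtain p q where pq: "a < p" "p \<le> q" "q < b" "K \<subseteq> {p..q}" by blast
  have z0: "\<psi> x = 0" if "x \<le> p \<or> x \<ge> q" for x
  proof -
    have out: "\<psi> x = 0" if "x < p \<or> x > q" for x
    proof -
      have "x \<notin> K" using pq(4) that by auto
      then show ?thesis by (rule K(4))
    qed
    \<comment> \<open>The end points p and q may belong to \<open>K\<close>; there the value is 0 by
      one-sided continuity.\<close>
    have "\<psi> p = 0" "\<psi> q = 0"
    proof -
      have c: "continuous (at x) \<psi>" for x using smooth_fun_continuous[OF K(1), of UNIV] by (simp add: continuous_on_eq_continuous_at)
      have "(\<psi> \<longlongrightarrow> 0) (at_left p)"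
        by (rule tendsto_eventually) (auto simp: eventually_at_filter intro!: always_eventually out)
      moreover have "(\<psi> \<longlongrightarrow> \<psi> p) (at_left p)" using c[of p] by (simp add: continuous_at filterlim_at_split)
      ultimately show "\<psi> p = 0" using tendsto_unique[OF trivial_limit_at_left_real] by blast
      have "(\<psi> \<longlongrightarrow> 0) (at_right q)"
        by (rule tendsto_eventually) (auto simp: eventually_at_filter intro!: always_eventually out)
      moreover have "(\<psi> \<longlongrightarrow> \<psi> q) (at_right q)" using c[of q] by (simp add: continuous_at filterlim_at_split)
      ultimately show "\<psi> q = 0" using tendsto_unique[OF trivial_limit_at_right_real] by blast
    qed
    then show ?thesis using that out by (metis order_le_less)
  qed
  have co: "continuous_on S \<psi>" for S using smooth_fun_continuous[OF K(1)] .
  have L: "\<psi> \<in> L2 S" if "S \<in> sets lebesgue" for S using test_fun_L2[OF t that] .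
  have lm: "{c..d} \<in> lmeasurable" "{c<..<d} \<in> lmeasurable" for c d :: real by auto
  have int: "integral {c..d} \<psi> = (LINT x:{c..d}|lebesgue. \<psi> x)" for c d
    using L2_integrable[OF L lm(1)[of c d]] lm(1)[of c d] by (subst set_lebesgue_integral_eq_integral(2)) (auto simp: fmeasurableD)
  have iabs: "set_integrable lebesgue {a<..<b} (\<lambda>x. \<bar>\<psi> x\<bar>)"
    by (intro set_integrable_abs L2_integrable L lm) auto
  have "integral {p..q} \<psi> = (LINT x:{a<..<b}|lebesgue. \<psi> x)"
    unfolding int using pq z0 by (intro LINT_eq_of_zero[symmetric]) auto
  then have pq0: "integral {p..q} \<psi> = 0" using z by simp
  define \<Psi> where "\<Psi> = primitive p \<psi>"
  have d: "(\<Psi> has_real_derivative \<psi> x) (at x)" for x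
    unfolding \<Psi>_def using z0 by (intro primitive_deriv co) auto
  have zl: "\<Psi> x = 0" if "x \<le> p" for x unfolding \<Psi>_def using that by (rule primitive_left)
  have zr: "\<Psi> x = 0" if "q \<le> x" for x
    unfolding \<Psi>_def using primitive_right[OF co, of q p x] z0 pq(2) that pq0 by auto
  show ?thesis
  proof (rule that[of \<Psi>])
    show "test_fun {a<..<b} \<Psi>"
    proof (rule test_funI)
      show "smooth_fun \<Psi>" unfolding \<Psi>_def by (rule smooth_primitive[OF K(1)]) (use z0 in auto)
      show "{p..q} \<subseteq> {a<..<b}" using pq by auto
      show "\<Psi> x = 0" if "x \<notin> {p..q}" for x using zl[of x] zr[of x] that by auto
    qed auto
    show "frechet_derivative \<Psi> (at x) 1 = \<psi> x" for x by (rule frechet_derivative_real[OF d])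
    show "\<bar>\<Psi> x\<bar> \<le> (LINT x:{a<..<b}|lebesgue. \<bar>\<psi> x\<bar>)" for x
    proof (cases "p \<le> x \<and> x \<le> q")
      case True
      then have s: "{p..x} \<subseteq> {a<..<b}" using pq by auto
      have "\<bar>\<Psi> x\<bar> = \<bar>LINT y:{p..x}|lebesgue. \<psi> y\<bar>" by (simp add: \<Psi>_def primitive_def int)
      also have "\<dots> \<le> (LINT y:{p..x}|lebesgue. \<bar>\<psi> y\<bar>)"
        by (intro LINT_abs_bound L2_integrable L lm) auto
      also have "\<dots> \<le> (LINT y:{a<..<b}|lebesgue. \<bar>\<psi> y\<bar>)"
        unfolding LINT_restr
        by (rule integral_mono)
          (use s set_integrable_subset[OF iabs _ s] iabs in \<open>auto simp: set_integrable_restr restr_def subset_iff\<close>)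
      finally show ?thesis .
    next
      case False
      then have "\<Psi> x = 0" using zl[of x] zr[of x] by auto
      moreover have "0 \<le> (LINT x:{a<..<b}|lebesgue. \<bar>\<psi> x\<bar>)"
        unfolding LINT_restr by (rule integral_nonneg_AE) (auto simp: restr_def)
      ultimately show ?thesis by simp
    qed
  qed
qed

text \<open>By duality: \<open>\<integral> (u - c) \<phi> = \<integral> u (\<phi> - \<rho> \<integral> \<phi>)\<close>, and the second factor has mean zero, hence is
  the derivative of a test function.\<close>

lemma Poincare_interval:
  fixes a b :: real
  assumes "a < b" "u \<in> L2 {a<..<b}" "weak_deriv {a<..<b} 1 u g"
    and \<rho>: "test_fun {a<..<b} \<rho>" "\<And>x. 0 \<le> \<rho> x" "(LINT x:{a<..<b}|lebesgue. \<rho> x) = 1"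
  shows "L2_norm {a<..<b} (\<lambda>x. u x - (LINT x:{a<..<b}|lebesgue. u x * \<rho> x)) \<le> 2 * (b - a) * L2_norm {a<..<b} g"
proof -
  let ?I = "{a<..<b}"
  define c where "c = (LINT x:?I|lebesgue. u x * \<rho> x)"
  have o: "open ?I" "?I \<in> lmeasurable" "?I \<in> sets lebesgue" by auto
  have c1: "(\<lambda>x. c) \<in> L2 ?I" using L2_cmult[OF L2_one(1)[OF o(2)], of c] by simp
  have g: "g \<in> L2 ?I" using assms(3) weak_derivD(1) by blast
  have m: "measure lebesgue ?I = b - a" using assms(1) by simp
  have "L2_norm ?I (\<lambda>x. u x - c) \<le> 2 * (b - a) * L2_norm ?I g"
  proof (rule L2_norm_le_dual[OF o(1) L2_diff[OF assms(2) c1]])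
    show "0 \<le> 2 * (b - a) * L2_norm ?I g" using assms(1) by simp
    fix \<phi> assume t: "test_fun ?I \<phi>"
    have L: "\<phi> \<in> L2 ?I" "\<rho> \<in> L2 ?I" using t \<rho>(1) test_fun_L2 o by blast+
    define M where "M = (LINT x:?I|lebesgue. \<phi> x)"
    define \<psi> where "\<psi> x = \<phi> x + (- M) * \<rho> x" for x
    have i: "set_integrable lebesgue ?I \<phi>" "set_integrable lebesgue ?I \<rho>" using L L2_integrable o by blast+
    have t\<psi>: "test_fun ?I \<psi>" unfolding \<psi>_def by (intro test_fun_add test_fun_cmult t \<rho>(1))
    have "(LINT x:?I|lebesgue. \<psi> x) = (LINT x:?I|lebesgue. \<phi> x) + (LINT x:?I|lebesgue. (- M) * \<rho> x)"
      unfolding \<psi>_def by (intro set_integral_add set_integrable_mult_right i)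
    also have "\<dots> = 0" unfolding set_integral_mult_right \<rho>(3) M_def by simp
    finally have z: "(LINT x:?I|lebesgue. \<psi> x) = 0" .
    obtain \<Psi> where \<Psi>: "test_fun ?I \<Psi>" "\<And>x. frechet_derivative \<Psi> (at x) 1 = \<psi> x"
      "\<And>x. \<bar>\<Psi> x\<bar> \<le> (LINT x:?I|lebesgue. \<bar>\<psi> x\<bar>)"
      using test_fun_primitive[OF t\<psi> assms(1) z] by blast
    have \<Psi>L: "\<Psi> \<in> L2 ?I" using test_fun_L2[OF \<Psi>(1) o(3)] .
    \<comment> \<open>Subtracting \<open>M * \<rho>\<close> at most doubles the L1 norm, since
      \<rho> has integral 1: this is the factor 2 of the constant. The factor b - a arises as sqrt
      (b - a) twice, here from L1 against L2 and below from L2 against the sup bound on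
      \<Psi>.\<close>
    have "(LINT x:?I|lebesgue. \<bar>\<psi> x\<bar>) \<le> (LINT x:?I|lebesgue. \<bar>\<phi> x\<bar> + \<bar>M\<bar> * \<rho> x)"
    proof (rule set_integral_mono)
      show "set_integrable lebesgue ?I (\<lambda>x. \<bar>\<psi> x\<bar>)"
        by (intro set_integrable_abs L2_integrable[OF test_fun_L2[OF t\<psi> o(3)] o(2)])
      show "set_integrable lebesgue ?I (\<lambda>x. \<bar>\<phi> x\<bar> + \<bar>M\<bar> * \<rho> x)"
        by (intro set_integral_add(1) set_integrable_abs set_integrable_mult_right i)
      show "\<bar>\<psi> x\<bar> \<le> \<bar>\<phi> x\<bar> + \<bar>M\<bar> * \<rho> x" for x
        using abs_triangle_ineq[of "\<phi> x" "- M * \<rho> x"] \<rho>(2)[of x] by (simp add: \<psi>_def abs_mult)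
    qed
    also have "\<dots> = (LINT x:?I|lebesgue. \<bar>\<phi> x\<bar>) + \<bar>M\<bar>"
      using i by (subst set_integral_add(2)) (auto intro: set_integrable_abs simp: \<rho>(3))
    also have "\<dots> \<le> 2 * (LINT x:?I|lebesgue. \<bar>\<phi> x\<bar>)"
      using LINT_abs_bound[OF i(1)] by (simp add: M_def)
    also have "\<dots> \<le> 2 * (L2_norm ?I \<phi> * sqrt (b - a))"
      using L2_integral_abs_le[OF L(1) o(2)] m by simp
    finally have B: "\<bar>\<Psi> x\<bar> \<le> 2 * (L2_norm ?I \<phi> * sqrt (b - a))" for x using \<Psi>(3)[of x] by linarith
    have nP: "L2_norm ?I \<Psi> \<le> 2 * (b - a) * L2_norm ?I \<phi>"
    proof -
      have "L2_norm ?I \<Psi> \<le> 2 * (L2_norm ?I \<phi> * sqrt (b - a)) * sqrt (measure lebesgue ?I)"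
        using \<Psi>(1) B o by (intro L2_bounded(2) smooth_restr_measurable) (auto simp: test_fun_def)
      also have "\<dots> = 2 * (b - a) * L2_norm ?I \<phi>" using m assms(1) by simp
      finally show ?thesis .
    qed
    have "(LINT x:?I|lebesgue. (u x - c) * \<phi> x) = (LINT x:?I|lebesgue. u x * \<phi> x - c * \<phi> x)"
      by (simp add: algebra_simps)
    also have "\<dots> = (LINT x:?I|lebesgue. u x * \<phi> x) - c * M"
      using L2_mult_integrable[OF assms(2) L(1)] i(1) by (subst set_integral_diff) (auto simp: M_def)
    also have "\<dots> = (LINT x:?I|lebesgue. u x * \<phi> x) + (LINT x:?I|lebesgue. (- M) * (u x * \<rho> x))"
      unfolding set_integral_mult_right c_def by simp
    also have "\<dots> = (LINT x:?I|lebesgue. u x * \<phi> x + (- M) * (u x * \<rho> x))"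
      using L2_mult_integrable[OF assms(2) L(1)] L2_mult_integrable[OF assms(2) L(2)]
      by (intro set_integral_add(2)[symmetric] set_integrable_mult_right)
    also have "\<dots> = (LINT x:?I|lebesgue. u x * frechet_derivative \<Psi> (at x) 1)"
      by (simp add: \<Psi>(2) \<psi>_def algebra_simps)
    also have "\<dots> = - (LINT x:?I|lebesgue. g x * \<Psi> x)" by (rule weak_derivD(2)[OF assms(3) \<Psi>(1)])
    finally have "\<bar>LINT x:?I|lebesgue. (u x - c) * \<phi> x\<bar> \<le> L2_norm ?I g * L2_norm ?I \<Psi>"
      using L2_Cauchy_Schwarz[OF g \<Psi>L] by simp
    also have "\<dots> \<le> L2_norm ?I g * (2 * (b - a) * L2_norm ?I \<phi>)" using nP by (intro mult_left_mono) auto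
    finally show "\<bar>LINT x:?I|lebesgue. (u x - c) * \<phi> x\<bar> \<le> 2 * (b - a) * L2_norm ?I g * L2_norm ?I \<phi>"
      by (simp add: mult_ac)
  qed
  then show ?thesis by (simp add: c_def)
qed

text \<open>The derivative \<open>g\<close> is approximated by a test function and integrated; the
  Poincare inequality then fixes the constant of integration, so that function and derivative are
  close at once. The approximants are smooth on the whole line, hence bounded together with their
  derivatives up to the end points.\<close>

lemma smooth_dense_interval:
  fixes a b :: real
  assumes "a < b" "u \<in> L2 {a<..<b}" "weak_deriv {a<..<b} 1 u g" "e > 0"
  obtains f where "smooth_fun f" "L2_norm {a<..<b} (\<lambda>x. u x - f x) < e"
    "L2_norm {a<..<b} (\<lambda>x. g x - frechet_derivative f (at x) 1) < e"
proof -
  let ?I = "{a<..<b}"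
  have o: "open ?I" "bounded ?I" "?I \<in> lmeasurable" "?I \<in> sets lebesgue" by auto
  have g: "g \<in> L2 ?I" using assms(3) weak_derivD(1) by blast
  define d where "d = e / (1 + 2 * (b - a))"
  have d: "d > 0" "d \<le> e" "2 * (b - a) * d < e"
    using assms(1,4) by (auto simp: d_def divide_le_eq field_simps)
  obtain \<phi> where \<phi>: "test_fun ?I \<phi>" "L2_norm ?I (\<lambda>x. g x - \<phi> x) < d" using test_fun_dense[OF o(1) g d(1)] by blast
  then have sm: "smooth_fun \<phi>" by (simp add: test_fun_def)
  define F where "F = primitive a \<phi>"
  have z: "\<phi> x = 0" if "x \<le> a" for x using test_fun_zero_outside[OF \<phi>(1), of x] that by auto
  have Fd: "(F has_real_derivative \<phi> x) (at x)" for x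
    unfolding F_def using z by (intro primitive_deriv smooth_fun_continuous sm) auto
  have Fs: "smooth_fun F" unfolding F_def by (rule smooth_primitive[OF sm z])
  have Ff: "frechet_derivative F (at x) 1 = \<phi> x" for x by (rule frechet_derivative_real[OF Fd])
  have Fw: "F \<in> L2 ?I" "weak_deriv ?I 1 F \<phi>"
    using smooth_weak_deriv(1)[OF o(1,2) Fs] smooth_weak_deriv(2)[OF o(1,2) Fs, of 1] by (simp_all add: Ff)
  have ne: "?I \<noteq> {}" using assms(1) by simp
  from unit_test_fun_exists[OF o(1) ne]
  obtain \<rho> where \<rho>: "test_fun ?I \<rho>" "\<And>x. 0 \<le> \<rho> x" "(LINT x:?I|lebesgue. \<rho> x) = 1" by blast
  define c where "c = (LINT x:?I|lebesgue. (u x - F x) * \<rho> x)"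
  have "L2_norm ?I (\<lambda>x. (u x - F x) - c) \<le> 2 * (b - a) * L2_norm ?I (\<lambda>x. g x - \<phi> x)"
    unfolding c_def
    by (rule Poincare_interval[OF assms(1) L2_diff[OF assms(2) Fw(1)] weak_deriv_diff[OF o(1) assms(2) Fw(1) assms(3) Fw(2)] \<rho>])
  also have "\<dots> \<le> 2 * (b - a) * d" using \<phi>(2) assms(1) by (intro mult_left_mono) auto
  also have "\<dots> < e" by (rule d(3))
  finally have le: "L2_norm ?I (\<lambda>x. u x - (F x + c)) < e" by (simp add: algebra_simps)
  have "frechet_derivative (\<lambda>x. F x + c) (at x) 1 = \<phi> x" for x
    by (rule frechet_derivative_real) (use Fd in \<open>auto intro!: derivative_eq_intros\<close>)
  then show ?thesis
    using that[of "\<lambda>x. F x + c"] smooth_fun_add[OF Fs smooth_fun_const] le \<phi>(2) d(2) by simp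
qed

lemma sum_L2_norm_disjoint:
  fixes A :: "'i \<Rightarrow> 'a::euclidean_space set"
  assumes "finite J" "disjoint_family_on A J" "\<And>j. j \<in> J \<Longrightarrow> A j \<in> sets lebesgue" "\<And>j. j \<in> J \<Longrightarrow> A j \<subseteq> U" "u \<in> L2 U"
  shows "(\<Sum>j\<in>J. (L2_norm (A j) u)\<^sup>2) = (L2_norm (\<Union>j\<in>J. A j) u)\<^sup>2"
    and "(\<Sum>j\<in>J. (L2_norm (A j) u)\<^sup>2) \<le> (L2_norm U u)\<^sup>2"
proof -
  have "set_integrable lebesgue (A j) (\<lambda>x. (u x)\<^sup>2)" if "j \<in> J" for j
    by (rule set_integrable_subset[OF L2_set_integrable_power2[OF assms(5)]]) (use assms that in auto)
  then show 1: "(\<Sum>j\<in>J. (L2_norm (A j) u)\<^sup>2) = (L2_norm (\<Union>j\<in>J. A j) u)\<^sup>2"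
    unfolding L2_norm_power2 using assms by (intro set_integral_finite_Union[symmetric]) auto
  have "L2_norm (\<Union>j\<in>J. A j) u \<le> L2_norm U u"
    using assms by (intro L2_subset(2)) auto
  then show "(\<Sum>j\<in>J. (L2_norm (A j) u)\<^sup>2) \<le> (L2_norm U u)\<^sup>2" unfolding 1 by (intro power_mono) auto
qed

text \<open>Replace \<open>w\<close> by its averages on the intervals of a fine partition of \<open>(0,1)\<close>.\<close>

lemma weak_pairing_tendsto:
  fixes g :: "'i \<Rightarrow> real \<Rightarrow> real"
  assumes L: "\<forall>\<^sub>F i in F. g i \<in> L2 {0<..<1} \<and> L2_norm {0<..<1} (g i) \<le> M"
    and int: "\<And>a b. 0 \<le> a \<Longrightarrow> a < b \<Longrightarrow> b \<le> 1 \<Longrightarrow> ((\<lambda>i. LINT x:{a<..<b}|lebesgue. g i x) \<longlongrightarrow> 0) F"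
    and "\<eta> > 0"
  shows "\<forall>\<^sub>F i in F. \<forall>w w'. w \<in> L2 {0<..<1} \<longrightarrow> weak_deriv {0<..<1} 1 w w' \<longrightarrow>
    \<bar>LINT x:{0<..<1}|lebesgue. g i x * w x\<bar> \<le> \<eta> * (L2_norm {0<..<1} w + L2_norm {0<..<1} w')"
proof -
  let ?U = "{0<..<1::real}"
  have oU: "open ?U" "?U \<in> lmeasurable" "?U \<in> sets lebesgue" by auto
  define M' where "M' = \<bar>M\<bar> + 1"
  \<comment> \<open>The partition is so fine that the Poincare constant 2 / N of a subinterval,
    times the norm bound \<open>M'\<close>, is at most \<eta>.\<close>
  obtain N where N: "2 * M' / \<eta> < real N" using reals_Archimedean2 by blast
  have "0 < 2 * M' / \<eta>" using \<open>\<eta> > 0\<close> by (simp add: M'_def)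
  then have N0: "real N > 0" using N by linarith
  have NM: "2 / N * M' \<le> \<eta>" using N N0 \<open>\<eta> > 0\<close> by (simp add: field_simps)
  define I where "I j = {real j / N <..< real (Suc j) / N}" for j
  have lt: "real j / N < real (Suc j) / N" for j using N0 by (simp add: divide_strict_right_mono)
  have sub: "0 \<le> real j / N" "real (Suc j) / N \<le> 1" if "j < N" for j using that N0 by (auto simp: divide_le_eq)
  have IU: "I j \<subseteq> ?U" if "j < N" for j
  proof
    fix x assume "x \<in> I j"
    then have "real j / N < x" "x < real (Suc j) / N" unfolding I_def by simp_all
    then show "x \<in> ?U" using sub[OF that] unfolding greaterThanLessThan_iff by linarith
  qed
  have Im: "I j \<in> sets lebesgue" "open (I j)" "I j \<noteq> {}" for j using lt[of j] by (auto simp: I_def)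
  have "\<exists>\<rho>. test_fun (I j) \<rho> \<and> (\<forall>x. 0 \<le> \<rho> x) \<and> (LINT x:I j|lebesgue. \<rho> x) = 1" for j
    using unit_test_fun_exists[OF Im(2,3)[of j]] by metis
  then obtain \<rho> where \<rho>: "\<And>j. test_fun (I j) (\<rho> j)" "\<And>j x. 0 \<le> \<rho> j x" "\<And>j. (LINT x:I j|lebesgue. \<rho> j x) = 1"
    by metis
  \<comment> \<open>A bound for the norms of the weights; it turns the norm of \<open>w\<close> into
    a bound for its averages \<open>c j\<close>.\<close>
  define X where "X = (\<Sum>j<N. L2_norm (I j) (\<rho> j)) + 1"
  have X: "L2_norm (I j) (\<rho> j) \<le> X" if "j < N" for j
  proof -
    have "L2_norm (I j) (\<rho> j) \<le> (\<Sum>j<N. L2_norm (I j) (\<rho> j))" using that by (intro member_le_sum) auto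
    then show ?thesis by (simp add: X_def)
  qed
  have X0: "X > 0" unfolding X_def by (intro add_nonneg_pos sum_nonneg) auto
  have disj: "disjoint_family_on I {..<N}"
  proof -
    have "I j \<inter> I k = {}" if "j < k" for j k
    proof -
      have "real (Suc j) / N \<le> real k / N" using that N0 by (intro divide_right_mono) auto
      then show ?thesis unfolding I_def by auto
    qed
    then show ?thesis unfolding disjoint_family_on_def by (metis inf_commute linorder_neqE_nat)
  qed
  have cover: "AE x in lebesgue. x \<in> ?U \<longleftrightarrow> x \<in> (\<Union>j\<in>{..<N}. I j)"
  proof -
    have "countable ((\<lambda>j. real j / N) ` {..N})" by simp
    then have "(\<lambda>j. real j / N) ` {..N} \<in> null_sets lebesgue"
      by (intro null_sets_completionI countable_imp_null_set_lborel)
    then show ?thesis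
    proof (rule AE_I')
      show "{x \<in> space lebesgue. \<not> (x \<in> ?U \<longleftrightarrow> x \<in> (\<Union>j\<in>{..<N}. I j))} \<subseteq> (\<lambda>j. real j / N) ` {..N}"
      proof
        fix x assume "x \<in> {x \<in> space lebesgue. \<not> (x \<in> ?U \<longleftrightarrow> x \<in> (\<Union>j\<in>{..<N}. I j))}"
        then have x: "x \<in> ?U" "\<And>j. j < N \<Longrightarrow> x \<notin> I j" using IU by blast+
        define j where "j = nat \<lfloor>x * N\<rfloor>"
        have "x * N \<ge> 0" "x * N < N" using x(1) N0 by auto
        then have j: "real j \<le> x * N" "x * N < real (Suc j)" "j < N" by (auto simp: j_def, linarith+)
        have "real j / N \<le> x" "x < real (Suc j) / N" using j N0 by (auto simp: field_simps)
        then have "x = real j / N" using x(2)[OF j(3)] by (auto simp: I_def)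
        then show "x \<in> (\<lambda>j. real j / N) ` {..N}" using j(3) by auto
      qed
    qed
  qed
  \<comment> \<open>The convergence enters through finitely many integrals over subintervals. No
    pair w, w' occurs here, so the resulting estimate is uniform in them and may be applied to
    functions that vary with the index of the filter.\<close>
  have "\<forall>\<^sub>F i in F. \<forall>j\<in>{..<N}. \<bar>LINT x:I j|lebesgue. g i x\<bar> < \<eta> / (X * N)"
  proof (intro eventually_ball_finite ballI)
    fix j assume "j \<in> {..<N}"
    then have "((\<lambda>i. LINT x:I j|lebesgue. g i x) \<longlongrightarrow> 0) F" unfolding I_def using sub lt by (intro int) auto
    then have "((\<lambda>i. \<bar>LINT x:I j|lebesgue. g i x\<bar>) \<longlongrightarrow> 0) F" by (rule tendsto_rabs_zero)
    then show "\<forall>\<^sub>F i in F. \<bar>LINT x:I j|lebesgue. g i x\<bar> < \<eta> / (X * N)"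
      using X0 N0 \<open>\<eta> > 0\<close> by (intro order_tendstoD(2)) auto
  qed auto
  with L show ?thesis
  proof eventually_elim
    case (elim i)
    show ?case
    proof (intro allI impI)
      fix w w' assume w: "w \<in> L2 ?U" and w': "weak_deriv ?U 1 w w'"
      have gU: "g i \<in> L2 ?U" and w'U: "w' \<in> L2 ?U" using elim w' weak_derivD(1) by auto
      define c where "c j = (LINT x:I j|lebesgue. w x * \<rho> j x)" for j
      have Lj: "g i \<in> L2 (I j)" "w \<in> L2 (I j)" "w' \<in> L2 (I j)" "(\<lambda>x. w x - c j) \<in> L2 (I j)"
        "\<rho> j \<in> L2 (I j)" "(\<lambda>x. c j) \<in> L2 (I j)" "set_integrable lebesgue (I j) (g i)" if "j < N" for j
      proof -
        have m: "I j \<in> lmeasurable" unfolding I_def by simp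
        show 1: "g i \<in> L2 (I j)" "w \<in> L2 (I j)" "w' \<in> L2 (I j)"
          using L2_subset(1)[OF _ IU[OF that] Im(1)] gU w w'U by blast+
        show 2: "(\<lambda>x. c j) \<in> L2 (I j)" using L2_cmult[OF L2_one(1)[OF m], of "c j"] by simp
        show "(\<lambda>x. w x - c j) \<in> L2 (I j)" using L2_diff[OF 1(2) 2] .
        show "\<rho> j \<in> L2 (I j)" by (rule test_fun_L2[OF \<rho>(1) Im(1)])
        show "set_integrable lebesgue (I j) (g i)" by (rule L2_integrable[OF 1(1) m])
      qed
      have cj: "\<bar>c j\<bar> \<le> L2_norm ?U w * X" if "j < N" for j
      proof -
        have "\<bar>c j\<bar> \<le> L2_norm (I j) w * L2_norm (I j) (\<rho> j)"
          unfolding c_def using L2_Cauchy_Schwarz Lj that by blast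
        also have "\<dots> \<le> L2_norm ?U w * X"
          using L2_subset(2)[OF w IU[OF that] Im(1)] X[OF that] by (intro mult_mono) auto
        finally show ?thesis .
      qed
      have P: "L2_norm (I j) (\<lambda>x. w x - c j) \<le> 2 / N * L2_norm (I j) w'" if "j < N" for j
      proof -
        have "real (Suc j) / N - real j / N = 1 / N" by (simp add: add_divide_distrib)
        moreover have "L2_norm (I j) (\<lambda>x. w x - c j) \<le> 2 * (real (Suc j) / N - real j / N) * L2_norm (I j) w'"
          unfolding c_def
          by (rule Poincare_interval[OF lt[of j], folded I_def]) (use Lj(2)[OF that]
            weak_deriv_subset[OF w' IU[OF that] Im(2)] \<rho>[of j] in auto)
        ultimately show ?thesis by simp
      qed
      have pj: "\<bar>LINT x:I j|lebesgue. g i x * w x\<bar> \<le> 2 / N * (\<bar>L2_norm (I j) (g i)\<bar> * \<bar>L2_norm (I j) w'\<bar>) + \<eta> / N * L2_norm ?U w"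
        if "j < N" for j
      proof -
        have "(LINT x:I j|lebesgue. g i x * w x) = (LINT x:I j|lebesgue. g i x * (w x - c j) + c j * g i x)"
          by (simp add: algebra_simps)
        also have "\<dots> = (LINT x:I j|lebesgue. g i x * (w x - c j)) + c j * (LINT x:I j|lebesgue. g i x)"
          using L2_mult_integrable[OF Lj(1,4)[OF that]] Lj(7)[OF that] by (subst set_integral_add(2)) auto
        finally have "\<bar>LINT x:I j|lebesgue. g i x * w x\<bar> \<le> \<bar>LINT x:I j|lebesgue. g i x * (w x - c j)\<bar> + \<bar>c j\<bar> * \<bar>LINT x:I j|lebesgue. g i x\<bar>"
          using abs_triangle_ineq by (simp add: abs_mult[symmetric])
        also have "\<bar>LINT x:I j|lebesgue. g i x * (w x - c j)\<bar> \<le> L2_norm (I j) (g i) * (2 / N * L2_norm (I j) w')"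
          using L2_Cauchy_Schwarz[OF Lj(1,4)[OF that]] mult_left_mono[OF P[OF that], of "L2_norm (I j) (g i)"]
          by (simp add: order_trans)
        also have "\<bar>c j\<bar> * \<bar>LINT x:I j|lebesgue. g i x\<bar> \<le> (L2_norm ?U w * X) * (\<eta> / (X * N))"
          using cj[OF that] elim(2) that X0 by (intro mult_mono) (auto intro: less_imp_le)
        also have "(L2_norm ?U w * X) * (\<eta> / (X * N)) = \<eta> / N * L2_norm ?U w" using X0 by simp
        finally show ?thesis by (simp add: mult_ac)
      qed
      have "(LINT x:?U|lebesgue. g i x * w x) = (LINT x:(\<Union>j\<in>{..<N}. I j)|lebesgue. g i x * w x)"
        by (rule LINT_AE_set[OF cover])
      also have "\<dots> = (\<Sum>j<N. LINT x:I j|lebesgue. g i x * w x)"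
        using disj Im(1) by (intro set_integral_finite_Union) (auto intro: L2_mult_integrable[OF Lj(1,2)])
      finally have "\<bar>LINT x:?U|lebesgue. g i x * w x\<bar> \<le> (\<Sum>j<N. \<bar>LINT x:I j|lebesgue. g i x * w x\<bar>)" by simp
      also have "\<dots> \<le> (\<Sum>j<N. 2 / N * (\<bar>L2_norm (I j) (g i)\<bar> * \<bar>L2_norm (I j) w'\<bar>) + \<eta> / N * L2_norm ?U w)"
        using pj by (intro sum_mono) auto
      also have "\<dots> = 2 / N * (\<Sum>j<N. \<bar>L2_norm (I j) (g i)\<bar> * \<bar>L2_norm (I j) w'\<bar>) + \<eta> * L2_norm ?U w"
        using N0 by (simp add: sum.distrib sum_distrib_left)
      also have "\<dots> \<le> 2 / N * (M' * L2_norm ?U w') + \<eta> * L2_norm ?U w"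
      proof -
        \<comment> \<open>Cauchy-Schwarz for the sum over the subintervals recombines the local
          norms into global ones.\<close>
        have "(\<Sum>j<N. \<bar>L2_norm (I j) (g i)\<bar> * \<bar>L2_norm (I j) w'\<bar>) \<le> L2_set (\<lambda>j. L2_norm (I j) (g i)) {..<N} * L2_set (\<lambda>j. L2_norm (I j) w') {..<N}"
          by (rule L2_set_mult_ineq)
        also have "\<dots> \<le> M' * L2_norm ?U w'"
        proof (rule mult_mono)
          have "L2_set (\<lambda>j. L2_norm (I j) (g i)) {..<N} \<le> L2_norm ?U (g i)"
            unfolding L2_set_def using sum_L2_norm_disjoint(2)[OF _ disj Im(1) IU gU] by (intro real_le_lsqrt) auto
          then show "L2_set (\<lambda>j. L2_norm (I j) (g i)) {..<N} \<le> M'" using conjunct2[OF elim(1)] by (simp add: M'_def)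
          show "L2_set (\<lambda>j. L2_norm (I j) w') {..<N} \<le> L2_norm ?U w'"
            unfolding L2_set_def using sum_L2_norm_disjoint(2)[OF _ disj Im(1) IU w'U] by (intro real_le_lsqrt) auto
        qed (auto simp: M'_def L2_set_nonneg)
        finally show ?thesis using N0 by (intro add_right_mono mult_left_mono) auto
      qed
      also have "\<dots> \<le> \<eta> * L2_norm ?U w' + \<eta> * L2_norm ?U w"
        using mult_right_mono[OF NM, of "L2_norm ?U w'"] by simp
      finally show "\<bar>LINT x:?U|lebesgue. g i x * w x\<bar> \<le> \<eta> * (L2_norm ?U w + L2_norm ?U w')"
        by (simp add: algebra_simps)
    qed
  qed
qed

section \<open>Sections and functions of one variable\<close>

text \<open>Sections of a Lebesgue measurable function in the plane are controlled only up to null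
  sets, so Fubini is applied to a Borel representative throughout.\<close>

lemma lebesgue_borel_version:
  fixes f :: "'a::euclidean_space \<Rightarrow> real"
  assumes "f \<in> borel_measurable lebesgue"
  obtains f' where "f' \<in> borel_measurable borel" "AE x in lebesgue. f x = f' x"
  using completion_ex_borel_measurable_real[OF assms] AE_completion by auto

lemma integrable_lborel_iff:
  fixes f :: "'a::euclidean_space \<Rightarrow> real"
  assumes "f \<in> borel_measurable borel"
  shows "integrable lborel f \<longleftrightarrow> integrable lebesgue f" "(LINT x|lborel. f x) = (LINT x|lebesgue. f x)"
  using assms by (simp_all add: integrable_completion integral_completion)

lemma AE_lebesgue_pair:
  fixes P :: "real \<times> real \<Rightarrow> bool"
  assumes "AE p in lebesgue. P p"
  shows "AE x in lebesgue. AE y in lebesgue. P (x, y)"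
proof -
  have "AE p in lborel \<Otimes>\<^sub>M lborel. P p" using assms unfolding lborel_prod by (simp add: AE_completion_iff)
  from lborel_pair.AE_pair[OF this] show ?thesis by (simp add: AE_completion_iff)
qed

lemma AE_lebesgue_fst:
  fixes P :: "real \<Rightarrow> bool"
  assumes "AE x in lebesgue. P x"
  shows "AE p in (lebesgue :: (real \<times> real) measure). P (fst p)"
proof -
  have "AE x in lborel. P x" using assms by (simp add: AE_completion_iff)
  then obtain N where N: "N \<in> null_sets lborel" "{x. \<not> P x} \<subseteq> N" by (auto simp: eventually_ae_filter)
  have "N \<times> UNIV \<in> null_sets (lborel \<Otimes>\<^sub>M (lborel :: real measure))"
    using N(1) by (auto simp: null_sets_def lborel.emeasure_pair_measure_Times)
  then have "AE p in (lborel :: (real \<times> real) measure). P (fst p)"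
    unfolding lborel_prod by (rule AE_I') (use N(2) in auto)
  then show ?thesis by (rule AE_completion)
qed

lemma section_integral_restr: "section_integral \<Omega> F x = (LINT y|lebesgue. restr \<Omega> F (x, y))"
  unfolding section_integral_def LINT_restr by (simp add: restr_def[abs_def])

lemma section_integral_AE_borel:
  assumes "AE p in lebesgue. restr \<Omega> F p = F' p" "F' \<in> borel_measurable borel"
  shows "AE x in lebesgue. section_integral \<Omega> F x = (LINT y|lborel. F' (x, y))"
proof -
  have "AE x in lebesgue. AE y in lebesgue. restr \<Omega> F (x, y) = F' (x, y)" by (rule AE_lebesgue_pair[OF assms(1)])
  then show ?thesis
  proof eventually_elim
    case (elim x)
    have "(\<lambda>y. F' (x, y)) \<in> borel_measurable borel" using assms(2) by simp
    from integrable_lborel_iff(2)[OF this] lebesgue_integrable_cong_AE(2)[OF elim]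
    show ?case by (simp add: section_integral_restr)
  qed
qed

lemma section_integral_Fubini:
  assumes "set_integrable lebesgue \<Omega> F"
  shows "integrable lebesgue (section_integral \<Omega> F)"
    and "(LINT x|lebesgue. section_integral \<Omega> F x) = (LINT p:\<Omega>|lebesgue. F p)"
proof -
  have G: "integrable lebesgue (restr \<Omega> F)" using assms by (simp add: set_integrable_restr)
  then obtain F' where F': "F' \<in> borel_measurable borel" "AE p in lebesgue. restr \<Omega> F p = F' p"
    using lebesgue_borel_version borel_measurable_integrable by blast
  have i: "integrable (lborel \<Otimes>\<^sub>M lborel) F'"
    using G lebesgue_integrable_cong_AE(1)[OF F'(2)] integrable_lborel_iff(1)[OF F'(1)] by (simp add: lborel_prod)
  have ae: "AE x in lebesgue. section_integral \<Omega> F x = (LINT y|lborel. F' (x, y))"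
    by (rule section_integral_AE_borel[OF F'(2,1)])
  have m: "(\<lambda>x. LINT y|lborel. F' (x, y)) \<in> borel_measurable borel"
    using borel_measurable_integrable[OF lborel_pair.integrable_fst'[OF i]] by simp
  show "integrable lebesgue (section_integral \<Omega> F)"
    using lebesgue_integrable_cong_AE(1)[OF ae] integrable_lborel_iff(1)[OF m] lborel_pair.integrable_fst'[OF i] by simp
  have "(LINT x|lebesgue. section_integral \<Omega> F x) = (LINT x|lborel. LINT y|lborel. F' (x, y))"
    using lebesgue_integrable_cong_AE(2)[OF ae] integrable_lborel_iff(2)[OF m] by simp
  also have "\<dots> = (LINT p|lborel. F' p)" using lborel_pair.integral_fst'[OF i] by (simp add: lborel_prod)
  also have "\<dots> = (LINT p:\<Omega>|lebesgue. F p)"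
    unfolding LINT_restr using lebesgue_integrable_cong_AE(2)[OF F'(2)] integrable_lborel_iff(2)[OF F'(1)] by simp
  finally show "(LINT x|lebesgue. section_integral \<Omega> F x) = (LINT p:\<Omega>|lebesgue. F p)" .
qed

lemma section_integral_zero:
  "\<Omega> \<subseteq> A \<times> B \<Longrightarrow> x \<notin> A \<Longrightarrow> section_integral \<Omega> F x = 0"
proof -
  assume "\<Omega> \<subseteq> A \<times> B" "x \<notin> A"
  then have "(\<lambda>y. restr \<Omega> F (x, y)) = (\<lambda>y. 0)" by (auto simp: restr_def fun_eq_iff)
  then show ?thesis by (simp add: section_integral_restr)
qed

lemma LINT_section_integral:
  assumes "\<Omega> \<subseteq> A \<times> B" "set_integrable lebesgue \<Omega> F"
  shows "(LINT x:A|lebesgue. section_integral \<Omega> F x) = (LINT p:\<Omega>|lebesgue. F p)"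
proof -
  have "restr A (section_integral \<Omega> F) = section_integral \<Omega> F"
    using section_integral_zero[OF assms(1)] by (auto simp: restr_def fun_eq_iff)
  then show ?thesis using section_integral_Fubini(2)[OF assms(2)] by (simp add: LINT_restr)
qed

lemma section_integral_mult_fst:
  "section_integral \<Omega> (\<lambda>p. F p * z (fst p)) x = section_integral \<Omega> F x * z x"
proof -
  have "(\<lambda>y. restr \<Omega> (\<lambda>p. F p * z (fst p)) (x, y)) = (\<lambda>y. z x * restr \<Omega> F (x, y))"
    by (auto simp: restr_def)
  then show ?thesis by (simp add: section_integral_restr)
qed

text \<open>Cauchy-Schwarz on each section, which has length at most d - c, followed by Fubini for
  the square of \<open>F\<close>.\<close>

lemma section_integral_L2:
  assumes \<Omega>: "\<Omega> \<subseteq> A \<times> {c<..<d}" and "c \<le> d" and F: "F \<in> L2 \<Omega>"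
  shows "section_integral \<Omega> F \<in> L2 A"
    and "L2_norm A (section_integral \<Omega> F) \<le> sqrt (d - c) * L2_norm \<Omega> F"
proof -
  define H where "H = restr \<Omega> (\<lambda>p. (F p)\<^sup>2)"
  have G: "restr \<Omega> F \<in> borel_measurable lebesgue" using F L2_measurable by auto
  have sq: "set_integrable lebesgue \<Omega> (\<lambda>p. (F p)\<^sup>2)" by (rule L2_set_integrable_power2[OF F])
  obtain F' where F': "F' \<in> borel_measurable borel" "AE p in lebesgue. restr \<Omega> F p = F' p"
    using lebesgue_borel_version[OF G] by blast
  have F'2: "AE p in lebesgue. restr \<Omega> (\<lambda>p. (F p)\<^sup>2) p = (F' p)\<^sup>2"
    using F'(2) by eventually_elim (simp add: restr_simps)
  have i2: "integrable (lborel \<Otimes>\<^sub>M lborel) (\<lambda>p. (F' p)\<^sup>2)"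
  proof -
    have "(\<lambda>p. (F' p)\<^sup>2) \<in> borel_measurable borel" using F'(1) by simp
    from integrable_lborel_iff(1)[OF this] lebesgue_integrable_cong_AE(1)[OF F'2] sq
    show ?thesis by (simp add: lborel_prod set_integrable_restr)
  qed
  have ae: "AE x in lebesgue. section_integral \<Omega> F x = (LINT y|lborel. F' (x, y))"
    by (rule section_integral_AE_borel[OF F'(2,1)])
  have m: "(\<lambda>x. LINT y|lborel. F' (x, y)) \<in> borel_measurable borel"
    using F'(1) by measurable
  have mS: "section_integral \<Omega> F \<in> borel_measurable lebesgue"
    by (rule lebesgue_measurable_cong_AE[of "\<lambda>x. LINT y|lborel. F' (x, y)"])
      (use m ae in \<open>auto intro: measurable_completion elim: AE_mp\<close>)
  have out: "section_integral \<Omega> F x = 0" if "x \<notin> A" for x using section_integral_zero[OF \<Omega> that] .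
  then have rA: "restr A (section_integral \<Omega> F) = section_integral \<Omega> F" by (auto simp: restr_def fun_eq_iff)
  have S2: "integrable lebesgue (section_integral \<Omega> (\<lambda>p. (F p)\<^sup>2))" by (rule section_integral_Fubini(1)[OF sq])
  have pt: "AE x in lebesgue. (section_integral \<Omega> F x)\<^sup>2 \<le> (d - c) * section_integral \<Omega> (\<lambda>p. (F p)\<^sup>2) x"
  proof -
    have "AE x in lborel. integrable lborel (\<lambda>y. (F' (x, y))\<^sup>2)" by (rule lborel_pair.AE_integrable_fst'[OF i2])
    then have "AE x in lebesgue. integrable lborel (\<lambda>y. (F' (x, y))\<^sup>2)" by (rule AE_completion)
    then show ?thesis using AE_lebesgue_pair[OF F'(2)]
    proof eventually_elim
      case (elim x)
      let ?f = "\<lambda>y. restr \<Omega> F (x, y)"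
      have fm: "(\<lambda>y. F' (x, y)) \<in> borel_measurable borel" "(\<lambda>y. (F' (x, y))\<^sup>2) \<in> borel_measurable borel"
        using F'(1) by simp_all
      have e': "AE y in lebesgue. F' (x, y) = ?f y" using elim(2) by eventually_elim auto
      have e2: "AE y in lebesgue. (?f y)\<^sup>2 = (F' (x, y))\<^sup>2" using elim(2) by eventually_elim auto
      have "?f \<in> borel_measurable lebesgue"
        using lebesgue_measurable_cong_AE[OF _ e'] fm(1) measurable_completion by (metis measurable_lborel2)
      moreover have "integrable lebesgue (\<lambda>y. (?f y)\<^sup>2)"
        using lebesgue_integrable_cong_AE(1)[OF e2] integrable_lborel_iff(1)[OF fm(2)] elim(1) by simp
      moreover have r: "restr {c<..<d} ?f = ?f" using \<Omega> by (auto simp: restr_def fun_eq_iff)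
      ultimately have L: "?f \<in> L2 {c<..<d}" by (simp add: L2_iff)
      have "\<bar>section_integral \<Omega> F x\<bar> \<le> L2_norm {c<..<d} ?f * sqrt (d - c)"
        using L2_integral_le[OF L] \<open>c \<le> d\<close> r by (simp add: section_integral_restr LINT_restr)
      then have "\<bar>section_integral \<Omega> F x\<bar>\<^sup>2 \<le> (L2_norm {c<..<d} ?f * sqrt (d - c))\<^sup>2" by (intro power_mono) auto
      also have "\<dots> = (d - c) * (LINT y|lebesgue. (?f y)\<^sup>2)"
        using \<open>c \<le> d\<close> r by (simp add: power_mult_distrib L2_norm_restr)
      also have "(LINT y|lebesgue. (?f y)\<^sup>2) = section_integral \<Omega> (\<lambda>p. (F p)\<^sup>2) x"
        by (simp add: section_integral_restr restr_simps)
      finally show ?case by simp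
    qed
  qed
  have int: "integrable lebesgue (\<lambda>x. (section_integral \<Omega> F x)\<^sup>2)"
    by (rule Bochner_Integration.integrable_bound[OF integrable_mult_right[OF S2, of "d - c"]])
      (use mS pt in \<open>auto elim!: AE_mp simp: abs_if\<close>)
  then show "section_integral \<Omega> F \<in> L2 A" using mS by (simp add: L2_iff rA)
  have "(L2_norm A (section_integral \<Omega> F))\<^sup>2 = (LINT x|lebesgue. (section_integral \<Omega> F x)\<^sup>2)"
    by (simp add: L2_norm_restr rA)
  also have "\<dots> \<le> (LINT x|lebesgue. (d - c) * section_integral \<Omega> (\<lambda>p. (F p)\<^sup>2) x)"
    by (rule integral_mono_AE[OF int integrable_mult_right[OF S2] pt])
  also have "\<dots> = (d - c) * (L2_norm \<Omega> F)\<^sup>2"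
    using section_integral_Fubini(2)[OF sq] by (simp add: L2_norm_power2)
  also have "\<dots> = (sqrt (d - c) * L2_norm \<Omega> F)\<^sup>2" using \<open>c \<le> d\<close> by (simp add: power_mult_distrib)
  finally show "L2_norm A (section_integral \<Omega> F) \<le> sqrt (d - c) * L2_norm \<Omega> F"
    by (rule power2_le_imp_le) (use \<open>c \<le> d\<close> in auto)
qed

text \<open>Fubini: the square is constant along vertical sections, and these have length at most d
  - c.\<close>

lemma fst_L2:
  fixes z :: "real \<Rightarrow> real"
  assumes \<Omega>: "\<Omega> \<subseteq> A \<times> {c<..<d}" "\<Omega> \<in> sets lebesgue" and "c \<le> d" and z: "z \<in> L2 A"
  shows "(\<lambda>p. z (fst p)) \<in> L2 \<Omega>"
    and "L2_norm \<Omega> (\<lambda>p. z (fst p)) \<le> sqrt (d - c) * L2_norm A z"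
proof -
  obtain z' where z': "z' \<in> borel_measurable borel" "AE x in lebesgue. restr A z x = z' x"
    using lebesgue_borel_version[OF L2_measurable[OF z]] by blast
  define F where "F = (\<lambda>p. z' (fst p) * indicator {c<..<d} (snd p) :: real)"
  have Fm: "F \<in> borel_measurable borel" unfolding F_def using z'(1) by (auto simp: borel_prod[symmetric])
  have aeF: "AE p in lebesgue. p \<in> \<Omega> \<longrightarrow> z (fst p) = F p"
    using AE_lebesgue_fst[OF z'(2)] by eventually_elim (use \<Omega>(1) in \<open>auto simp: F_def restr_def\<close>)
  have zi: "integrable lborel (\<lambda>x. (z' x)\<^sup>2)" "(LINT x|lborel. (z' x)\<^sup>2) = (L2_norm A z)\<^sup>2"
  proof -
    have e: "AE x in lebesgue. (restr A z x)\<^sup>2 = (z' x)\<^sup>2" using z'(2) by eventually_elim auto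
    have m: "(\<lambda>x. (z' x)\<^sup>2) \<in> borel_measurable borel" using z'(1) by simp
    show "integrable lborel (\<lambda>x. (z' x)\<^sup>2)" "(LINT x|lborel. (z' x)\<^sup>2) = (L2_norm A z)\<^sup>2"
      using z integrable_lborel_iff[OF m] lebesgue_integrable_cong_AE[OF e] by (auto simp: L2_iff L2_norm_restr)
  qed
  have sec: "(F (x, y))\<^sup>2 = (z' x)\<^sup>2 * indicator {c<..<d} y" for x y by (simp add: F_def indicator_def)
  have li: "(LINT y|lborel. (z' x)\<^sup>2 * indicator {c<..<d} y) = (z' x)\<^sup>2 * (d - c)" for x using \<open>c \<le> d\<close> by simp
  have i: "integrable (lborel \<Otimes>\<^sub>M lborel) (\<lambda>p. (F p)\<^sup>2)"
  proof (rule lborel_pair.Fubini_integrable)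
    show "(\<lambda>p. (F p)\<^sup>2) \<in> borel_measurable (lborel \<Otimes>\<^sub>M lborel)" using Fm by (simp add: lborel_prod)
    show "integrable lborel (\<lambda>x. LINT y|lborel. norm ((F (x, y))\<^sup>2))" using zi(1) li by (simp add: sec)
    have "integrable lborel (indicator {c<..<d} :: real \<Rightarrow> real)"
      using assms(3) by (intro integrable_real_indicator) auto
    then show "AE x in lborel. integrable lborel (\<lambda>y. (F (x, y))\<^sup>2)"
      unfolding sec by (intro AE_I2 integrable_mult_right)
  qed
  have v: "(LINT p|lborel. (F p)\<^sup>2) = (d - c) * (L2_norm A z)\<^sup>2"
  proof -
    have "(LINT x|lborel. LINT y|lborel. (F (x, y))\<^sup>2) = (LINT x|lborel. (z' x)\<^sup>2 * (d - c))" unfolding sec li ..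
    then show ?thesis using lborel_pair.integral_fst'[OF i] zi(2) by (simp add: lborel_prod mult.commute)
  qed
  have F2m: "(\<lambda>p. (F p)\<^sup>2) \<in> borel_measurable borel" using Fm by simp
  have FL: "F \<in> L2 UNIV" "(L2_norm UNIV F)\<^sup>2 = (d - c) * (L2_norm A z)\<^sup>2"
    using i v integrable_lborel_iff[OF F2m] Fm assms(3)
    by (auto simp: L2_iff L2_norm_restr lborel_prod intro: measurable_completion intro!: mult_nonneg_nonneg)
  show "(\<lambda>p. z (fst p)) \<in> L2 \<Omega>"
    using L2_cong_AE(1)[OF aeF] L2_subset(1)[OF FL(1), of \<Omega>] \<Omega>(2) by simp
  have "L2_norm \<Omega> (\<lambda>p. z (fst p)) \<le> L2_norm UNIV F"
    using L2_cong_AE(2)[OF aeF] L2_subset(2)[OF FL(1), of \<Omega>] \<Omega>(2) by simp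
  also have "\<dots> = sqrt (d - c) * L2_norm A z"
    using FL(2) \<open>c \<le> d\<close> by (metis L2_norm_nonneg power2_eq_imp_eq power_mult_distrib real_sqrt_pow2 mult_nonneg_nonneg real_sqrt_ge_zero diff_ge_0_iff_ge)
  finally show "L2_norm \<Omega> (\<lambda>p. z (fst p)) \<le> sqrt (d - c) * L2_norm A z" .
qed

text \<open>The bridge from the plane to the interval: against a function of x alone, only the
  section integrals of \<open>F\<close> matter.\<close>

lemma LINT_mult_fst:
  fixes z :: "real \<Rightarrow> real"
  assumes \<Omega>: "\<Omega> \<subseteq> A \<times> {c<..<d}" "\<Omega> \<in> sets lebesgue" and "c \<le> d" and "z \<in> L2 A" "F \<in> L2 \<Omega>"
  shows "(LINT p:\<Omega>|lebesgue. F p * z (fst p)) = (LINT x:A|lebesgue. section_integral \<Omega> F x * z x)"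
  using LINT_section_integral[OF \<Omega>(1) L2_mult_integrable[OF assms(5) fst_L2(1)[OF \<Omega> assms(3,4)]]]
  by (simp add: section_integral_mult_fst)

subsection \<open>Weak derivatives of functions of one variable\<close>

lemma smooth_fun_comp_fst:
  fixes f :: "real \<Rightarrow> real"
  assumes "smooth_fun f"
  shows "smooth_fun (\<lambda>p :: real \<times> real. f (fst p))"
    and "frechet_derivative (\<lambda>p :: real \<times> real. f (fst p)) (at p) v = frechet_derivative f (at (fst p)) 1 * fst v"
proof -
  show "smooth_fun (\<lambda>p :: real \<times> real. f (fst p))" by (rule smooth_fun_compose[OF assms smooth_fun_fst])
  have l: "linear (frechet_derivative f (at (fst p)))"
    using smooth_fun_has_derivative[OF assms] has_derivative_linear by blast
  have "((\<lambda>p. f (fst p)) has_derivative (\<lambda>v. frechet_derivative f (at (fst p)) (fst v))) (at p)"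
    by (rule has_derivative_compose[OF has_derivative_fst[OF has_derivative_ident] smooth_fun_has_derivative[OF assms]])
  from frechet_derivative_at[OF this]
  have "frechet_derivative (\<lambda>p. f (fst p)) (at p) v = frechet_derivative f (at (fst p)) (fst v)" by metis
  then show "frechet_derivative (\<lambda>p :: real \<times> real. f (fst p)) (at p) v = frechet_derivative f (at (fst p)) 1 * fst v"
    using linear_cmul[OF l, of "fst v" 1] by simp
qed

lemma smooth_fun_comp_snd:
  fixes f :: "real \<Rightarrow> real"
  assumes "smooth_fun f"
  shows "smooth_fun (\<lambda>p :: real \<times> real. f (snd p))"
    and "frechet_derivative (\<lambda>p :: real \<times> real. f (snd p)) (at p) v = frechet_derivative f (at (snd p)) 1 * snd v"
proof -
  show "smooth_fun (\<lambda>p :: real \<times> real. f (snd p))" by (rule smooth_fun_compose[OF assms smooth_fun_snd])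
  have l: "linear (frechet_derivative f (at (snd p)))"
    using smooth_fun_has_derivative[OF assms] has_derivative_linear by blast
  have "((\<lambda>p. f (snd p)) has_derivative (\<lambda>v. frechet_derivative f (at (snd p)) (snd v))) (at p)"
    by (rule has_derivative_compose[OF has_derivative_snd[OF has_derivative_ident] smooth_fun_has_derivative[OF assms]])
  from frechet_derivative_at[OF this]
  have "frechet_derivative (\<lambda>p. f (snd p)) (at p) v = frechet_derivative f (at (snd p)) (snd v)" by metis
  then show "frechet_derivative (\<lambda>p :: real \<times> real. f (snd p)) (at p) v = frechet_derivative f (at (snd p)) 1 * snd v"
    using linear_cmul[OF l, of "snd v" 1] by simp
qed

lemma test_fun_tensor:
  fixes \<phi> \<rho> :: "real \<Rightarrow> real"
  assumes "test_fun A \<phi>" "test_fun B \<rho>"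
  shows "test_fun (A \<times> B) (\<lambda>p. \<phi> (fst p) * \<rho> (snd p))"
    and "frechet_derivative (\<lambda>p. \<phi> (fst p) * \<rho> (snd p)) (at p) (1, 0) = frechet_derivative \<phi> (at (fst p)) 1 * \<rho> (snd p)"
proof -
  from test_funD[OF assms(1)] obtain K where K: "smooth_fun \<phi>" "compact K" "K \<subseteq> A" "\<And>x. x \<notin> K \<Longrightarrow> \<phi> x = 0" by blast
  from test_funD[OF assms(2)] obtain L where L: "smooth_fun \<rho>" "compact L" "L \<subseteq> B" "\<And>x. x \<notin> L \<Longrightarrow> \<rho> x = 0" by blast
  note s = smooth_fun_comp_fst(1)[OF K(1)] smooth_fun_comp_snd(1)[OF L(1)]
  show "test_fun (A \<times> B) (\<lambda>p. \<phi> (fst p) * \<rho> (snd p))"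
  proof (rule test_funI)
    show "smooth_fun (\<lambda>p. \<phi> (fst p) * \<rho> (snd p))" by (rule smooth_fun_mult[OF s])
    show "compact (K \<times> L)" by (rule compact_Times[OF K(2) L(2)])
    show "K \<times> L \<subseteq> A \<times> B" using K(3) L(3) by blast
    show "\<phi> (fst p) * \<rho> (snd p) = 0" if "p \<notin> K \<times> L" for p
      using that K(4)[of "fst p"] L(4)[of "snd p"] by (auto simp: mem_Times_iff)
  qed
  show "frechet_derivative (\<lambda>p. \<phi> (fst p) * \<rho> (snd p)) (at p) (1, 0) = frechet_derivative \<phi> (at (fst p)) 1 * \<rho> (snd p)"
    unfolding frechet_derivative_mult_smooth[OF s] smooth_fun_comp_fst(2)[OF K(1)] smooth_fun_comp_snd(2)[OF L(1)] by simp
qed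

text \<open>For a fixed test function both sides of the defining identity are continuous in
  L2.\<close>

lemma weak_deriv_limit:
  assumes \<Omega>: "open \<Omega>" and u: "u \<in> L2 \<Omega>" "g \<in> L2 \<Omega>"
    and ap: "\<And>e. e > 0 \<Longrightarrow> \<exists>u' g'. u' \<in> L2 \<Omega> \<and> weak_deriv \<Omega> v u' g' \<and> L2_norm \<Omega> (\<lambda>x. u x - u' x) < e \<and> L2_norm \<Omega> (\<lambda>x. g x - g' x) < e"
  shows "weak_deriv \<Omega> v u g"
proof (rule weak_derivI[OF u(2)])
  fix \<phi> assume t: "test_fun \<Omega> \<phi>"
  let ?d = "\<lambda>x. frechet_derivative \<phi> (at x) v"
  have p: "\<phi> \<in> L2 \<Omega>" "?d \<in> L2 \<Omega>" using test_fun_L2[OF t] test_fun_deriv_L2[OF t] \<Omega> by auto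
  define X where "X = (LINT x:\<Omega>|lebesgue. u x * ?d x) + (LINT x:\<Omega>|lebesgue. g x * \<phi> x)"
  define N where "N = L2_norm \<Omega> ?d + L2_norm \<Omega> \<phi> + 1"
  have N: "N > 0" unfolding N_def by (intro add_nonneg_pos add_nonneg_nonneg) auto
  have "\<bar>X\<bar> \<le> 0 + e" if "e > 0" for e
  proof -
    have "e / N > 0" using that N by simp
    from ap[OF this] obtain u' g' where u': "u' \<in> L2 \<Omega>" "weak_deriv \<Omega> v u' g'"
      "L2_norm \<Omega> (\<lambda>x. u x - u' x) < e / N" "L2_norm \<Omega> (\<lambda>x. g x - g' x) < e / N" by blast
    have g': "g' \<in> L2 \<Omega>" using u'(2) weak_derivD(1) by blast
    have s: "(LINT x:\<Omega>|lebesgue. (a x - a' x) * k x) = (LINT x:\<Omega>|lebesgue. a x * k x) - (LINT x:\<Omega>|lebesgue. a' x * k x)"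
      if "a \<in> L2 \<Omega>" "a' \<in> L2 \<Omega>" "k \<in> L2 \<Omega>" for a a' k
      using set_integral_diff(2)[OF L2_mult_integrable[OF that(1,3)] L2_mult_integrable[OF that(2,3)]]
      by (simp add: algebra_simps)
    have "X = (LINT x:\<Omega>|lebesgue. (u x - u' x) * ?d x) + (LINT x:\<Omega>|lebesgue. (g x - g' x) * \<phi> x)"
      using s[OF u(1) u'(1) p(2)] s[OF u(2) g' p(1)] weak_derivD(2)[OF u'(2) t] by (simp add: X_def)
    then have "\<bar>X\<bar> \<le> L2_norm \<Omega> (\<lambda>x. u x - u' x) * L2_norm \<Omega> ?d + L2_norm \<Omega> (\<lambda>x. g x - g' x) * L2_norm \<Omega> \<phi>"
      using L2_Cauchy_Schwarz[OF L2_diff[OF u(1) u'(1)] p(2)] L2_Cauchy_Schwarz[OF L2_diff[OF u(2) g'] p(1)] by linarith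
    also have "\<dots> \<le> e / N * L2_norm \<Omega> ?d + e / N * L2_norm \<Omega> \<phi>"
      using u' by (intro add_mono mult_right_mono) auto
    also have "\<dots> \<le> e / N * N" using that N by (simp add: N_def algebra_simps add_divide_distrib)
    finally show ?thesis using N by simp
  qed
  then have "\<bar>X\<bar> \<le> 0" by (rule field_le_epsilon)
  then show "(LINT x:\<Omega>|lebesgue. u x * ?d x) = - (LINT x:\<Omega>|lebesgue. g x * \<phi> x)" by (simp add: X_def)
qed

text \<open>For smooth functions this is the chain rule. The general case follows by smooth
  approximation on the interval, because composition with \<open>fst\<close> is bounded in
  L2.\<close>

lemma weak_deriv_fst:
  fixes u g :: "real \<Rightarrow> real" and \<Omega> :: "(real \<times> real) set"
  assumes \<Omega>: "open \<Omega>" "\<Omega> \<subseteq> {a<..<b} \<times> {c<..<d}" and "a < b" "c \<le> d"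
    and u: "u \<in> L2 {a<..<b}" "weak_deriv {a<..<b} 1 u g"
  shows "weak_deriv \<Omega> (1, 0) (\<lambda>p. u (fst p)) (\<lambda>p. g (fst p))"
    and "weak_deriv \<Omega> (0, 1) (\<lambda>p. u (fst p)) (\<lambda>p. 0)"
proof -
  let ?I = "{a<..<b}"
  have m: "\<Omega> \<in> sets lebesgue" using \<Omega> by auto
  have "bounded ({a<..<b} \<times> {c<..<d})"
    by (rule bounded_subset[OF bounded_cbox[of "(a, c)" "(b, d)"]]) (auto simp: cbox_Pair_eq box_real)
  then have bd: "bounded \<Omega>" using \<Omega>(2) bounded_subset by blast
  have g: "g \<in> L2 ?I" using u weak_derivD(1) by blast
  note L = fst_L2[OF \<Omega>(2) m assms(4)]
  have ap: "\<exists>f. smooth_fun f \<and> L2_norm \<Omega> (\<lambda>p. u (fst p) - f (fst p)) < e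
      \<and> L2_norm \<Omega> (\<lambda>p. g (fst p) - frechet_derivative f (at (fst p)) 1) < e" if "e > 0" for e
  proof -
    have s: "sqrt (d - c) \<ge> 0" using assms(4) by simp
    define e' where "e' = e / (sqrt (d - c) + 1)"
    have e': "e' > 0" "sqrt (d - c) * e' < e"
      using s that by (auto simp: e'_def divide_less_eq field_simps add_pos_nonneg add_nonneg_pos)
    obtain f where f: "smooth_fun f" "L2_norm ?I (\<lambda>x. u x - f x) < e'"
      "L2_norm ?I (\<lambda>x. g x - frechet_derivative f (at x) 1) < e'"
      using smooth_dense_interval[OF assms(3) u e'(1)] by blast
    have fL: "f \<in> L2 ?I" "(\<lambda>x. frechet_derivative f (at x) 1) \<in> L2 ?I"
      by (rule smooth_weak_deriv(1)[OF _ _ f(1)] smooth_weak_deriv(1)[OF _ _ smooth_fun_deriv[OF f(1)]]; simp)+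
    have "L2_norm \<Omega> (\<lambda>p. u (fst p) - f (fst p)) \<le> sqrt (d - c) * e'"
      using L(2)[OF L2_diff[OF u(1) fL(1)]] mult_left_mono[OF less_imp_le[OF f(2)] s] by linarith
    moreover have "L2_norm \<Omega> (\<lambda>p. g (fst p) - frechet_derivative f (at (fst p)) 1) \<le> sqrt (d - c) * e'"
      using L(2)[OF L2_diff[OF g fL(2)]] mult_left_mono[OF less_imp_le[OF f(3)] s] by linarith
    ultimately show ?thesis using f(1) e'(2) by (intro exI[of _ f]) auto
  qed
  have sm: "(\<lambda>p. f (fst p)) \<in> L2 \<Omega>" "weak_deriv \<Omega> (1, 0) (\<lambda>p. f (fst p)) (\<lambda>p. frechet_derivative f (at (fst p)) 1)"
    "weak_deriv \<Omega> (0, 1) (\<lambda>p. f (fst p)) (\<lambda>p. 0)" if "smooth_fun f" for f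
    using smooth_weak_deriv(1)[OF \<Omega>(1) bd smooth_fun_comp_fst(1)[OF that]]
      smooth_weak_deriv(2)[OF \<Omega>(1) bd smooth_fun_comp_fst(1)[OF that], of "(1,0)"]
      smooth_weak_deriv(2)[OF \<Omega>(1) bd smooth_fun_comp_fst(1)[OF that], of "(0,1)"]
    unfolding smooth_fun_comp_fst(2)[OF that] by simp_all
  show "weak_deriv \<Omega> (1, 0) (\<lambda>p. u (fst p)) (\<lambda>p. g (fst p))"
  proof (rule weak_deriv_limit[OF \<Omega>(1) L(1)[OF u(1)] L(1)[OF g]])
    fix e :: real assume "e > 0"
    from ap[OF this] sm show "\<exists>u' g'. u' \<in> L2 \<Omega> \<and> weak_deriv \<Omega> (1, 0) u' g' \<and> L2_norm \<Omega> (\<lambda>x. u (fst x) - u' x) < e \<and> L2_norm \<Omega> (\<lambda>x. g (fst x) - g' x) < e"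
      by blast
  qed
  show "weak_deriv \<Omega> (0, 1) (\<lambda>p. u (fst p)) (\<lambda>p. 0)"
  proof (rule weak_deriv_limit[OF \<Omega>(1) L(1)[OF u(1)]])
    fix e :: real assume e: "e > 0"
    from ap[OF this] obtain f where f: "smooth_fun f" "L2_norm \<Omega> (\<lambda>p. u (fst p) - f (fst p)) < e" by blast
    then show "\<exists>u' g'. u' \<in> L2 \<Omega> \<and> weak_deriv \<Omega> (0, 1) u' g' \<and> L2_norm \<Omega> (\<lambda>x. u (fst x) - u' x) < e \<and> L2_norm \<Omega> (\<lambda>x. 0 - g' x) < e"
      using sm[OF f(1)] e by (intro exI[of _ "\<lambda>p. f (fst p)"] exI[of _ "\<lambda>p. 0"]) auto
  qed simp
qed

subsection \<open>Vertical averages\<close>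

text \<open>In the applications \<rho> is a test function of total mass 1. A plain average would not
  do: the weight makes the product of \<phi>(x) and \<rho>(y) a test function in the plane, and this
  gives the average its weak derivative.\<close>

definition vavg :: "(real \<Rightarrow> real) \<Rightarrow> (real \<times> real) set \<Rightarrow> (real \<times> real \<Rightarrow> real) \<Rightarrow> real \<Rightarrow> real" where
  "vavg \<rho> R w = section_integral R (\<lambda>p. \<rho> (snd p) * w p)"

lemma vavg_weak_deriv:
  assumes R: "open \<Omega>" "A \<times> {c<..<d} \<subseteq> \<Omega>" "open A" and "c \<le> d" and \<rho>: "test_fun {c<..<d} \<rho>" "\<And>y. \<bar>\<rho> y\<bar> \<le> B"
    and w: "w \<in> L2 \<Omega>" "weak_deriv \<Omega> (1, 0) w g"
  shows "vavg \<rho> (A \<times> {c<..<d}) w \<in> L2 A" "L2_norm A (vavg \<rho> (A \<times> {c<..<d}) w) \<le> sqrt (d - c) * B * L2_norm \<Omega> w"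
    and "weak_deriv A 1 (vavg \<rho> (A \<times> {c<..<d}) w) (vavg \<rho> (A \<times> {c<..<d}) g)"
    and "L2_norm A (vavg \<rho> (A \<times> {c<..<d}) g) \<le> sqrt (d - c) * B * L2_norm \<Omega> g"
proof -
  let ?R = "A \<times> {c<..<d}"
  have oR: "open ?R" using R by (intro open_Times) auto
  have mR: "?R \<in> sets lebesgue" using oR by auto
  have sm: "smooth_fun \<rho>" using \<rho> by (simp add: test_fun_def)
  have B0: "B \<ge> 0" using \<rho>(2)[of 0] by linarith
  have *: "(\<lambda>p. \<rho> (snd p) * h p) \<in> L2 ?R" "vavg \<rho> ?R h \<in> L2 A" "L2_norm A (vavg \<rho> ?R h) \<le> sqrt (d - c) * B * L2_norm \<Omega> h"
    if h: "h \<in> L2 \<Omega>" for h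
  proof -
    have hR: "h \<in> L2 ?R" "L2_norm ?R h \<le> L2_norm \<Omega> h" using L2_subset[OF h R(2) mR] by auto
    have 1: "(\<lambda>p. \<rho> (snd p) * h p) \<in> L2 ?R" "L2_norm ?R (\<lambda>p. \<rho> (snd p) * h p) \<le> B * L2_norm ?R h"
      using L2_mult_bounded[OF hR(1) smooth_restr_measurable[OF smooth_fun_comp_snd(1)[OF sm] mR], of B] \<rho>(2) by auto
    show "(\<lambda>p. \<rho> (snd p) * h p) \<in> L2 ?R" by (rule 1)
    show "vavg \<rho> ?R h \<in> L2 A" unfolding vavg_def by (rule section_integral_L2(1)[OF subset_refl assms(4) 1(1)])
    have "L2_norm A (vavg \<rho> ?R h) \<le> sqrt (d - c) * L2_norm ?R (\<lambda>p. \<rho> (snd p) * h p)"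
      unfolding vavg_def by (rule section_integral_L2(2)[OF subset_refl assms(4) 1(1)])
    also have "\<dots> \<le> sqrt (d - c) * (B * L2_norm \<Omega> h)"
      using 1(2) hR(2) B0 assms(4) by (intro mult_left_mono) (auto intro: order_trans mult_left_mono)
    finally show "L2_norm A (vavg \<rho> ?R h) \<le> sqrt (d - c) * B * L2_norm \<Omega> h" by (simp add: mult.assoc)
  qed
  have g: "g \<in> L2 \<Omega>" using w weak_derivD(1) by blast
  show "vavg \<rho> ?R w \<in> L2 A" "L2_norm A (vavg \<rho> ?R w) \<le> sqrt (d - c) * B * L2_norm \<Omega> w"
    "L2_norm A (vavg \<rho> ?R g) \<le> sqrt (d - c) * B * L2_norm \<Omega> g" using *[OF w(1)] *[OF g] by auto
  show "weak_deriv A 1 (vavg \<rho> ?R w) (vavg \<rho> ?R g)"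
  proof (rule weak_derivI[OF *(2)[OF g]])
    fix \<phi> assume t: "test_fun A \<phi>"
    let ?d = "\<lambda>x. frechet_derivative \<phi> (at x) 1"
    have p: "\<phi> \<in> L2 A" "?d \<in> L2 A" using test_fun_L2[OF t] test_fun_deriv_L2[OF t] R(3) by auto
    have tt: "test_fun ?R (\<lambda>p. \<phi> (fst p) * \<rho> (snd p))" by (rule test_fun_tensor(1)[OF t \<rho>(1)])
    have "(LINT x:A|lebesgue. vavg \<rho> ?R w x * ?d x) = (LINT p:?R|lebesgue. (\<rho> (snd p) * w p) * ?d (fst p))"
      unfolding vavg_def by (rule LINT_mult_fst[OF subset_refl mR assms(4) p(2) *(1)[OF w(1)], symmetric])
    also have "\<dots> = (LINT p:?R|lebesgue. w p * frechet_derivative (\<lambda>p. \<phi> (fst p) * \<rho> (snd p)) (at p) (1, 0))"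
      unfolding test_fun_tensor(2)[OF t \<rho>(1)] by (simp add: mult_ac)
    also have "\<dots> = - (LINT p:?R|lebesgue. g p * (\<phi> (fst p) * \<rho> (snd p)))"
      by (rule weak_derivD(2)[OF weak_deriv_subset[OF w(2) R(2) oR] tt])
    also have "(LINT p:?R|lebesgue. g p * (\<phi> (fst p) * \<rho> (snd p))) = (LINT p:?R|lebesgue. (\<rho> (snd p) * g p) * \<phi> (fst p))"
      by (simp add: mult_ac)
    also have "\<dots> = (LINT x:A|lebesgue. vavg \<rho> ?R g x * \<phi> x)"
      unfolding vavg_def by (rule LINT_mult_fst[OF subset_refl mR assms(4) p(1) *(1)[OF g]])
    finally show "(LINT x:A|lebesgue. vavg \<rho> ?R w x * ?d x) = - (LINT x:A|lebesgue. vavg \<rho> ?R g x * \<phi> x)" .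
  qed
qed

lemma nn_integral_L2_norm:
  assumes "u \<in> L2 A"
  shows "(\<integral>\<^sup>+x. ennreal ((restr A u x)\<^sup>2) \<partial>lebesgue) = ennreal ((L2_norm A u)\<^sup>2)"
  using assms by (subst nn_integral_eq_integral) (auto simp: L2_iff L2_norm_restr)

lemma L2_of_nn_integral:
  assumes m: "restr A u \<in> borel_measurable lebesgue" and C: "0 \<le> C"
    and le: "(\<integral>\<^sup>+x. ennreal ((restr A u x)\<^sup>2) \<partial>lebesgue) \<le> ennreal (C\<^sup>2)"
  shows "u \<in> L2 A" "L2_norm A u \<le> C"
proof -
  have i: "integrable lebesgue (\<lambda>x. (restr A u x)\<^sup>2)"
    using m le by (intro integrableI_nonneg) (auto intro: le_less_trans)
  then show L: "u \<in> L2 A" using m by (simp add: L2_iff)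
  have "ennreal ((L2_norm A u)\<^sup>2) \<le> ennreal (C\<^sup>2)" using le nn_integral_L2_norm[OF L] by simp
  then have "(L2_norm A u)\<^sup>2 \<le> C\<^sup>2" by simp
  then show "L2_norm A u \<le> C" using C by (rule power2_le_imp_le)
qed

text \<open>The difference is the \<rho>-average over y' of w(x, y) - w(x, y'). After Cauchy-Schwarz
  and the substitution y' = y + t, Tonelli leaves for each t the squared norm of the increment by
  (0, t), at most t^2 times the squared norm of \<open>g\<close>. The values t range over |t| < D =
  h - l, an interval of length 2 D, which explains the constant. The hypothesis \<open>vert\<close>
  keeps all these vertical segments in \<open>U\<close>.\<close>

lemma vavg_diff_le:
  fixes U :: "(real \<times> real) set"
  assumes U: "open U" "U \<subseteq> A \<times> {l<..<h}" and R: "A \<times> {c<..<d} \<subseteq> U" and "l < h"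
    and vert: "\<And>x y y' t. (x, y) \<in> U \<Longrightarrow> c < y' \<Longrightarrow> y' < d \<Longrightarrow> 0 \<le> t \<Longrightarrow> t \<le> 1 \<Longrightarrow> (x, y + t * (y' - y)) \<in> U"
    and cd: "l \<le> c" "c < d" "d \<le> h" and A: "open A"
    and \<rho>: "test_fun {c<..<d} \<rho>" "(LINT y:{c<..<d}|lebesgue. \<rho> y) = 1"
    and w: "w \<in> L2 U" "weak_deriv U (0, 1) w g"
  shows "L2_norm U (\<lambda>p. w p - vavg \<rho> (A \<times> {c<..<d}) w (fst p)) \<le> L2_norm {c<..<d} \<rho> * sqrt (2 * (h - l)) * (h - l) * L2_norm U g"
proof -
  let ?I = "{c<..<d}" and ?R = "A \<times> {c<..<d}"
  define D where "D = h - l"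
  have D: "D > 0" using \<open>l < h\<close> by (simp add: D_def)
  have Im: "?I \<in> lmeasurable" "?I \<in> sets lebesgue" by auto
  have \<rho>L: "\<rho> \<in> L2 ?I" by (rule test_fun_L2[OF \<rho>(1) Im(2)])
  have \<rho>m: "\<rho> \<in> borel_measurable borel"
    using \<rho>(1) by (intro borel_measurable_continuous_onI smooth_fun_continuous) (simp add: test_fun_def)
  have g: "g \<in> L2 U" using w weak_derivD(1) by blast
  have Um[measurable]: "U \<in> sets borel" using U(1) by simp
  have Rm: "?R \<in> sets borel" using A by (intro borel_open open_Times) auto
  obtain W0 where W0: "W0 \<in> borel_measurable borel" "AE p in lebesgue. restr U w p = W0 p"
    using lebesgue_borel_version[OF L2_measurable[OF w(1)]] by blast
  \<comment> \<open>A Borel function that vanishes outside \<open>U\<close> and agrees with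
    \<open>w\<close> almost everywhere in \<open>U\<close>, so that values on single vertical lines
    are meaningful.\<close>
  define W where "W = (\<lambda>p. indicator U p * W0 p)"
  have Wm[measurable]: "W \<in> borel_measurable borel" unfolding W_def using W0(1) by measurable
  have WAE: "AE p in lebesgue. restr U w p = W p"
    using W0(2) by eventually_elim (auto simp: W_def restr_def indicator_def split: if_splits)
  have WU: "AE p in lebesgue. p \<in> U \<longrightarrow> w p = W p"
    using WAE by eventually_elim (auto simp: restr_def)
  have W2: "W \<in> L2 U" using L2_cong_AE(1)[OF WU] w(1) by simp
  have WL: "W \<in> L2 UNIV"
  proof -
    have "restr U W = W" by (auto simp: W_def restr_def fun_eq_iff indicator_def)
    then show ?thesis using W2 by (simp add: L2_iff)
  qed
  have Wd: "weak_deriv U (0, 1) W g" by (rule weak_deriv_cong_AE[OF w(2) WU]) simp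
  define F' where "F' = (\<lambda>p. indicator ?R p * (\<rho> (snd p) * W p))"
  have F'm: "F' \<in> borel_measurable borel"
  proof -
    have "(\<lambda>p :: real \<times> real. \<rho> (snd p)) \<in> borel_measurable borel"
      using \<rho>m by (simp add: borel_prod[symmetric])
    then show ?thesis unfolding F'_def using Wm Rm by measurable
  qed
  define v where "v x = (LINT y|lborel. F' (x, y))" for x
  have "AE p in lebesgue. restr ?R (\<lambda>p. \<rho> (snd p) * w p) p = F' p"
    using WU by eventually_elim (use R in \<open>auto simp: F'_def restr_def indicator_def\<close>)
  from section_integral_AE_borel[OF this F'm]
  have vAE: "AE x in lebesgue. vavg \<rho> ?R w x = v x" by (simp add: vavg_def v_def)
  have vm[measurable]: "v \<in> borel_measurable borel" unfolding v_def using F'm by (simp add: borel_prod[symmetric])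
  have diffAE: "AE p in lebesgue. p \<in> U \<longrightarrow> w p - vavg \<rho> ?R w (fst p) = W p - v (fst p)"
    using WU AE_lebesgue_fst[OF vAE] by eventually_elim auto
  have fstm: "(fst :: real \<times> real \<Rightarrow> real) \<in> borel_measurable borel"
    and sndm: "(snd :: real \<times> real \<Rightarrow> real) \<in> borel_measurable borel"
    by (intro borel_measurable_continuous_onI continuous_intros)+
  \<comment> \<open>Taken with values in the extended nonnegative reals, so that the integrals over
    p and over the height can be exchanged.\<close>
  define Q where "Q p y' = indicator U p * indicator ?I y' * ennreal ((W (fst p, y') - W p)\<^sup>2)" for p y'
  have Qm[measurable]: "case_prod Q \<in> borel_measurable (borel \<Otimes>\<^sub>M borel)"
  proof -
    have "(\<lambda>z :: (real \<times> real) \<times> real. (fst (fst z), snd z)) \<in> (borel \<Otimes>\<^sub>M borel) \<rightarrow>\<^sub>M borel"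
      by (intro borel_measurable_Pair measurable_compose[OF measurable_fst fstm] measurable_snd)
    from measurable_compose[OF this Wm]
    have [measurable]: "(\<lambda>z :: (real \<times> real) \<times> real. W (fst (fst z), snd z)) \<in> borel_measurable (borel \<Otimes>\<^sub>M borel)" .
    show ?thesis unfolding Q_def split_beta' by measurable
  qed
  have pw: "AE p in lborel. indicator U p * ennreal ((W p - v (fst p))\<^sup>2) \<le> ennreal ((L2_norm ?I \<rho>)\<^sup>2) * (\<integral>\<^sup>+y'. Q p y' \<partial>lborel)"
  proof -
    have "integrable lebesgue (\<lambda>p. (W p)\<^sup>2)" using WL by (simp add: L2_iff)
    then have "integrable (lborel \<Otimes>\<^sub>M lborel) (\<lambda>p. (W p)\<^sup>2)"
      using integrable_lborel_iff(1)[of "\<lambda>p. (W p)\<^sup>2"] Wm by (simp add: lborel_prod)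
    then have "AE x in lborel. integrable lborel (\<lambda>y. (W (x, y))\<^sup>2)" by (rule lborel_pair.AE_integrable_fst')
    then have "AE p in (lebesgue :: (real \<times> real) measure). integrable lborel (\<lambda>y. (W (fst p, y))\<^sup>2)"
      by (intro AE_lebesgue_fst AE_completion)
    then have "AE p in (lborel :: (real \<times> real) measure). integrable lborel (\<lambda>y. (W (fst p, y))\<^sup>2)"
      by (simp add: AE_completion_iff)
    then show ?thesis
    proof eventually_elim
      case (elim p)
      show ?case
      proof (cases "p \<in> U")
        case True
        define x where "x = fst p"
        have xA: "x \<in> A" using True U(2) by (auto simp: x_def)
        have m: "(\<lambda>y. W (x, y)) \<in> borel_measurable borel" using Wm by (simp add: borel_prod[symmetric])
        have m2: "(\<lambda>y. (W (x, y))\<^sup>2) \<in> borel_measurable borel" using m by simp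
        have "(\<lambda>y. W (x, y)) \<in> L2 UNIV"
          using elim integrable_lborel_iff(1)[OF m2] m by (auto simp: L2_iff x_def intro: measurable_completion)
        then have L: "(\<lambda>y. W (x, y)) \<in> L2 ?I" by (rule L2_subset(1)) (use Im in auto)
        have Lc: "(\<lambda>y :: real. W p) \<in> L2 ?I" using L2_cmult[OF L2_one(1)[OF Im(1)], of "W p"] by simp
        have Lh: "(\<lambda>y. W (x, y) - W p) \<in> L2 ?I" by (rule L2_diff[OF L Lc])
        have "v x = (LINT y|lebesgue. F' (x, y))"
          unfolding v_def using F'm by (intro integrable_lborel_iff(2)) (simp add: borel_prod[symmetric])
        also have "\<dots> = (LINT y:?I|lebesgue. \<rho> y * W (x, y))"
          unfolding LINT_restr using xA by (intro Bochner_Integration.integral_cong) (auto simp: F'_def restr_def)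
        finally have v: "v x = (LINT y:?I|lebesgue. \<rho> y * W (x, y))" .
        have "(LINT y:?I|lebesgue. \<rho> y * (W (x, y) - W p)) = (LINT y:?I|lebesgue. \<rho> y * W (x, y) - \<rho> y * W p)"
          by (simp add: algebra_simps)
        also have "\<dots> = v x - (LINT y:?I|lebesgue. \<rho> y * W p)"
          unfolding v by (intro set_integral_diff(2) L2_mult_integrable \<rho>L L Lc)
        also have "(LINT y:?I|lebesgue. \<rho> y * W p) = W p" using \<rho>(2) by simp
        finally have "\<bar>v x - W p\<bar> \<le> L2_norm ?I \<rho> * L2_norm ?I (\<lambda>y. W (x, y) - W p)"
          using L2_Cauchy_Schwarz[OF \<rho>L Lh] by simp
        then have "\<bar>v x - W p\<bar>\<^sup>2 \<le> (L2_norm ?I \<rho> * L2_norm ?I (\<lambda>y. W (x, y) - W p))\<^sup>2" by (intro power_mono) auto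
        then have "(W p - v x)\<^sup>2 \<le> (L2_norm ?I \<rho>)\<^sup>2 * (L2_norm ?I (\<lambda>y. W (x, y) - W p))\<^sup>2"
          by (simp add: power_mult_distrib power2_commute)
        then have "ennreal ((W p - v x)\<^sup>2) \<le> ennreal ((L2_norm ?I \<rho>)\<^sup>2) * ennreal ((L2_norm ?I (\<lambda>y. W (x, y) - W p))\<^sup>2)"
          by (simp add: ennreal_mult[symmetric])
        also have "ennreal ((L2_norm ?I (\<lambda>y. W (x, y) - W p))\<^sup>2) = (\<integral>\<^sup>+y'. Q p y' \<partial>lborel)"
          unfolding nn_integral_L2_norm[OF Lh, symmetric] nn_integral_completion
          using True by (intro nn_integral_cong) (auto simp: Q_def restr_def x_def indicator_def)
        finally show ?thesis using True by (simp add: x_def)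
      qed simp
    qed
  qed
  \<comment> \<open>For fixed t the integrand is the squared increment of \<open>W\<close> by (0,
    t), over the points of \<open>U\<close> that this shift carries into the averaging slab. For |t|
    >= D there are no such points.\<close>
  have slice: "(\<integral>\<^sup>+p. Q p (snd p + t) \<partial>lborel) \<le> indicator {-D<..<D} t * ennreal ((D * L2_norm U g)\<^sup>2)" for t
  proof (cases "t \<in> {-D<..<D}")
    case True
    define At where "At = U \<inter> {p. snd p + t \<in> ?I}"
    have oAt: "open At"
      unfolding At_def by (intro open_Int U open_vimage[of ?I "\<lambda>p. snd p + t", unfolded vimage_def]) (auto intro!: continuous_intros)
    have "weak_deriv U (t *\<^sub>R (0, 1) + 0 *\<^sub>R (0, 1)) W (\<lambda>x. t * g x + 0 * g x)"
      by (rule weak_deriv_direction[OF U(1) W2 Wd Wd])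
    then have wd: "weak_deriv U (0, t) W (\<lambda>x. t * g x)" by simp
    have sw: "p + s *\<^sub>R (0, t) \<in> U" if "p \<in> At" "0 \<le> s" "s \<le> 1" for p s
    proof -
      have "(fst p, snd p + s * ((snd p + t) - snd p)) \<in> U"
        by (rule vert) (use that in \<open>auto simp: At_def\<close>)
      moreover have "p + s *\<^sub>R (0, t) = (fst p, snd p + s * t)" by (simp add: prod_eq_iff)
      ultimately show ?thesis by simp
    qed
    note inc = L2_norm_increment_le[OF U(1) W2 wd oAt sw]
    have AtU: "At \<subseteq> U" by (auto simp: At_def)
    have Ld: "(\<lambda>p. W (p + (0, t)) - W p) \<in> L2 At"
      using L2_diff[OF inc(1) L2_subset(1)[OF W2 AtU]] oAt by auto
    have "(\<integral>\<^sup>+p. Q p (snd p + t) \<partial>lborel) = (\<integral>\<^sup>+p. ennreal ((restr At (\<lambda>p. W (p + (0, t)) - W p) p)\<^sup>2) \<partial>lebesgue)"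
      unfolding nn_integral_completion
    proof (rule nn_integral_cong)
      fix p :: "real \<times> real"
      have "p + (0, t) = (fst p, snd p + t)" by (simp add: prod_eq_iff)
      then show "Q p (snd p + t) = ennreal ((restr At (\<lambda>p. W (p + (0, t)) - W p) p)\<^sup>2)"
        by (auto simp: Q_def restr_def At_def indicator_def)
    qed
    also have "\<dots> = ennreal ((L2_norm At (\<lambda>p. W (p + (0, t)) - W p))\<^sup>2)" by (rule nn_integral_L2_norm[OF Ld])
    also have "\<dots> \<le> ennreal ((D * L2_norm U g)\<^sup>2)"
    proof (intro ennreal_leI power_mono)
      have "L2_norm At (\<lambda>p. W (p + (0, t)) - W p) \<le> \<bar>t\<bar> * L2_norm U g"
        using inc(2) by (simp add: L2_norm_cmult)
      also have "\<dots> \<le> D * L2_norm U g" using True by (intro mult_right_mono) auto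
      finally show "L2_norm At (\<lambda>p. W (p + (0, t)) - W p) \<le> D * L2_norm U g" .
    qed simp
    finally show ?thesis using True by simp
  next
    case False
    have "Q p (snd p + t) = 0" for p
    proof (rule ccontr)
      assume "Q p (snd p + t) \<noteq> 0"
      then have "p \<in> U" "snd p + t \<in> ?I" by (auto simp: Q_def indicator_def split: if_splits)
      then have "l < snd p" "snd p < h" "c < snd p + t" "snd p + t < d" using U(2) by auto
      then show False using False cd by (auto simp: D_def)
    qed
    then show ?thesis by simp
  qed
  have "(\<integral>\<^sup>+p. indicator U p * ennreal ((W p - v (fst p))\<^sup>2) \<partial>lborel) \<le> (\<integral>\<^sup>+p. ennreal ((L2_norm ?I \<rho>)\<^sup>2) * (\<integral>\<^sup>+y'. Q p y' \<partial>lborel) \<partial>lborel)"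
    by (rule nn_integral_mono_AE[OF pw])
  also have "\<dots> = ennreal ((L2_norm ?I \<rho>)\<^sup>2) * (\<integral>\<^sup>+p. (\<integral>\<^sup>+y'. Q p y' \<partial>lborel) \<partial>lborel)"
    by (rule nn_integral_cmult) measurable
  also have "(\<integral>\<^sup>+p. (\<integral>\<^sup>+y'. Q p y' \<partial>lborel) \<partial>lborel) = (\<integral>\<^sup>+p. (\<integral>\<^sup>+t. Q p (snd p + t) \<partial>lborel) \<partial>lborel)"
  proof (rule nn_integral_cong)
    fix p :: "real \<times> real"
    have "Q p \<in> borel_measurable borel" by measurable
    from nn_integral_real_affine[OF this, of 1 "snd p"]
    show "(\<integral>\<^sup>+y'. Q p y' \<partial>lborel) = (\<integral>\<^sup>+t. Q p (snd p + t) \<partial>lborel)" by simp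
  qed
  also have "\<dots> = (\<integral>\<^sup>+t. (\<integral>\<^sup>+p. Q p (snd p + t) \<partial>lborel) \<partial>lborel)"
  proof -
    have "(\<lambda>(p, t). Q p (snd p + t)) \<in> borel_measurable (lborel \<Otimes>\<^sub>M lborel)"
    proof -
      have "(\<lambda>z :: (real \<times> real) \<times> real. case_prod Q (fst z, snd (fst z) + snd z)) \<in> borel_measurable (borel \<Otimes>\<^sub>M borel)"
        by (rule measurable_compose[OF _ Qm])
          (intro measurable_Pair measurable_fst borel_measurable_add measurable_compose[OF measurable_fst sndm] measurable_snd)
      then show ?thesis
        unfolding measurable_cong_sets[OF sets_pair_measure_cong[OF sets_lborel sets_lborel] refl] by (simp add: split_beta')
    qed
    from lborel_pair.Fubini[OF this] show ?thesis by simp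
  qed
  also have "\<dots> \<le> (\<integral>\<^sup>+t. indicator {-D<..<D} t * ennreal ((D * L2_norm U g)\<^sup>2) \<partial>lborel)"
    by (rule nn_integral_mono[OF slice])
  also have "\<dots> = ennreal (2 * D) * ennreal ((D * L2_norm U g)\<^sup>2)"
    using D by (subst nn_integral_multc) auto
  also have "ennreal ((L2_norm ?I \<rho>)\<^sup>2) * (ennreal (2 * D) * ennreal ((D * L2_norm U g)\<^sup>2))
      = ennreal ((L2_norm ?I \<rho> * sqrt (2 * D) * D * L2_norm U g)\<^sup>2)"
    using D by (simp add: ennreal_mult[symmetric] power_mult_distrib mult.assoc)
  finally have main: "(\<integral>\<^sup>+p. indicator U p * ennreal ((W p - v (fst p))\<^sup>2) \<partial>lborel)
      \<le> ennreal ((L2_norm ?I \<rho> * sqrt (2 * D) * D * L2_norm U g)\<^sup>2)" by (simp add: mult_left_mono)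
  have "L2_norm U (\<lambda>p. W p - v (fst p)) \<le> L2_norm ?I \<rho> * sqrt (2 * D) * D * L2_norm U g"
  proof (rule L2_of_nn_integral(2))
    have "(\<lambda>p :: real \<times> real. v (fst p)) \<in> borel_measurable borel" by (simp add: borel_prod[symmetric])
    then have "(\<lambda>p. W p - v (fst p)) \<in> borel_measurable borel" using Wm by simp
    then show "restr U (\<lambda>p. W p - v (fst p)) \<in> borel_measurable lebesgue"
      using Um by (intro restr_measurable measurable_completion) auto
    have "(\<integral>\<^sup>+p. ennreal ((restr U (\<lambda>p. W p - v (fst p)) p)\<^sup>2) \<partial>lebesgue) = (\<integral>\<^sup>+p. indicator U p * ennreal ((W p - v (fst p))\<^sup>2) \<partial>lborel)"
      unfolding nn_integral_completion by (rule nn_integral_cong) (auto simp: restr_def indicator_def)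
    then show "(\<integral>\<^sup>+p. ennreal ((restr U (\<lambda>p. W p - v (fst p)) p)\<^sup>2) \<partial>lebesgue)
        \<le> ennreal ((L2_norm ?I \<rho> * sqrt (2 * D) * D * L2_norm U g)\<^sup>2)" using main by simp
    show "0 \<le> L2_norm ?I \<rho> * sqrt (2 * D) * D * L2_norm U g" using D by simp
  qed
  then show ?thesis using L2_cong_AE(2)[OF diffAE] by (simp add: D_def)
qed

section \<open>Lipschitz domains\<close>

text \<open>The boundary chart of \<open>lipschitz_domain\<close> at one frontier point;
  \<open>c\<close> and \<open>\<sigma>\<close> are the cosine and the sine of the rotation
  angle.\<close>

locale lipschitz_chart =
  fixes Q :: "(real \<times> real) set" and p :: "real \<times> real" and c \<sigma> r h M :: real and \<gamma> :: "real \<Rightarrow> real"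
  assumes openQ: "open Q" and norm1: "c\<^sup>2 + \<sigma>\<^sup>2 = 1" and rh: "r > 0" "h > 0"
    and lip: "M-lipschitz_on UNIV \<gamma>" and p_frontier: "p \<in> frontier Q"
    and chart0: "\<And>s t. \<bar>s\<bar> < r \<Longrightarrow> \<bar>t\<bar> < h \<Longrightarrow> p + (s * c - t * \<sigma>, s * \<sigma> + t * c) \<in> Q \<longleftrightarrow> \<gamma> s < t"
begin

text \<open>\<open>cs\<close> and \<open>ct\<close> are the rotated coordinates (s, t) of a point;
  \<open>pt\<close> is the inverse map.\<close>

definition cs :: "real \<times> real \<Rightarrow> real" where "cs q = (fst q - fst p) * c + (snd q - snd p) * \<sigma>"
definition ct :: "real \<times> real \<Rightarrow> real" where "ct q = (snd q - snd p) * c - (fst q - fst p) * \<sigma>"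
definition pt :: "real \<Rightarrow> real \<Rightarrow> real \<times> real" where "pt s t = p + (s * c - t * \<sigma>, s * \<sigma> + t * c)"

lemma pt_cs_ct: "pt (cs q) (ct q) = q"
proof -
  have n: "c * c + \<sigma> * \<sigma> = 1" using norm1 by (simp add: power2_eq_square)
  have "cs q * c - ct q * \<sigma> = (fst q - fst p) * (c * c + \<sigma> * \<sigma>)" "cs q * \<sigma> + ct q * c = (snd q - snd p) * (c * c + \<sigma> * \<sigma>)"
    by (simp_all add: cs_def ct_def algebra_simps)
  then show ?thesis unfolding n by (simp add: pt_def prod_eq_iff)
qed

lemma cs_pt: "cs (pt s t) = s" and ct_pt: "ct (pt s t) = t"
proof -
  have n: "c * c + \<sigma> * \<sigma> = 1" using norm1 by (simp add: power2_eq_square)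
  have "cs (pt s t) = s * (c * c + \<sigma> * \<sigma>)" "ct (pt s t) = t * (c * c + \<sigma> * \<sigma>)"
    by (simp_all add: cs_def ct_def pt_def algebra_simps)
  then show "cs (pt s t) = s" "ct (pt s t) = t" unfolding n by simp_all
qed

lemma chart: "\<bar>cs q\<bar> < r \<Longrightarrow> \<bar>ct q\<bar> < h \<Longrightarrow> q \<in> Q \<longleftrightarrow> \<gamma> (cs q) < ct q"
  using chart0[of "cs q" "ct q"] pt_cs_ct[of q] by (simp add: pt_def)

lemma cont_cs: "continuous_on S cs" and cont_ct: "continuous_on S ct"
  unfolding cs_def ct_def by (intro continuous_intros)+

lemma cont_gamma: "continuous_on S \<gamma>"
  using lipschitz_on_continuous_on[OF lip] continuous_on_subset by blast

definition nbhd :: "real \<Rightarrow> real \<Rightarrow> (real \<times> real) set" where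
  "nbhd a b = {q. \<bar>cs q\<bar> < a \<and> \<bar>ct q\<bar> < b}"

lemma open_nbhd: "open (nbhd a b)"
  unfolding nbhd_def by (intro open_Collect_conj open_Collect_less continuous_intros cont_cs cont_ct)

lemma p_in_nbhd: "a > 0 \<Longrightarrow> b > 0 \<Longrightarrow> p \<in> nbhd a b"
  by (simp add: nbhd_def cs_def ct_def)

text \<open>Points strictly below the graph have a neighbourhood that misses \<open>Q\<close>, and
  points strictly above it lie in the open set \<open>Q\<close>.\<close>

lemma frontier_graph:
  assumes "q \<in> frontier Q" "\<bar>cs q\<bar> < r" "\<bar>ct q\<bar> < h"
  shows "ct q = \<gamma> (cs q)"
proof (rule ccontr)
  assume ne: "ct q \<noteq> \<gamma> (cs q)"
  have "q \<notin> Q" using assms(1) openQ by (simp add: frontier_def interior_open)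
  then have lt: "ct q < \<gamma> (cs q)" using chart[OF assms(2,3)] ne by auto
  define V where "V = nbhd r h \<inter> {q. ct q < \<gamma> (cs q)}"
  have "open V" unfolding V_def
    by (intro open_Int open_nbhd open_Collect_less continuous_intros cont_ct continuous_on_compose2[OF cont_gamma cont_cs]) auto
  moreover have "q \<in> V" using lt assms by (simp add: V_def nbhd_def)
  moreover have "V \<inter> Q = {}" using chart by (force simp: V_def nbhd_def)
  ultimately have "q \<notin> closure Q" using open_Int_closure_eq_empty by blast
  then show False using assms(1) by (simp add: frontier_def)
qed

lemma gamma_0: "\<gamma> 0 = 0"
  using frontier_graph[OF p_frontier] rh by (simp add: cs_def ct_def)

lemma negligible_frontier_nbhd: "negligible (frontier Q \<inter> nbhd r h)"
proof -
  \<comment> \<open>The graph is the Lipschitz image of a line. The line is placed in the plane,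
    where it is a null set, so that the image is a null set as well.\<close>
  define f where "f z = pt (fst z) (\<gamma> (fst z))" for z :: "real \<times> real"
  have M0: "M \<ge> 0" using lip lipschitz_on_nonneg by blast
  have ns: "negligible {z :: real \<times> real. snd z = 0}"
    using negligible_hyperplane[of "(0, 1) :: real \<times> real" 0] by (simp add: inner_prod_def zero_prod_def)
  have "negligible (f ` {z. snd z = 0})"
  proof (rule negligible_locally_Lipschitz_image[OF _ ns])
    fix z :: "real \<times> real" assume "z \<in> {z. snd z = 0}"
    have "norm (f y - f z) \<le> (\<bar>c\<bar> + \<bar>\<sigma>\<bar> + M * (\<bar>\<sigma>\<bar> + \<bar>c\<bar>)) * norm (y - z)" for y
    proof -
      let ?d = "fst y - fst z" and ?g = "\<gamma> (fst y) - \<gamma> (fst z)"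
      have g: "\<bar>?g\<bar> \<le> M * \<bar>?d\<bar>" using lipschitz_onD[OF lip, of "fst y" "fst z"] by (simp add: dist_real_def)
      have d: "\<bar>?d\<bar> \<le> norm (y - z)" by (cases y; cases z) (use norm_fst_le[of "fst (y - z)" "snd (y - z)"] in simp)
      have "f y - f z = (?d * c - ?g * \<sigma>, ?d * \<sigma> + ?g * c)"
        by (simp add: f_def pt_def algebra_simps)
      then have "norm (f y - f z) \<le> \<bar>?d * c - ?g * \<sigma>\<bar> + \<bar>?d * \<sigma> + ?g * c\<bar>"
        using norm_Pair_le[of "?d * c - ?g * \<sigma>" "?d * \<sigma> + ?g * c"] by simp
      also have "\<dots> \<le> \<bar>?d\<bar> * \<bar>c\<bar> + \<bar>?g\<bar> * \<bar>\<sigma>\<bar> + (\<bar>?d\<bar> * \<bar>\<sigma>\<bar> + \<bar>?g\<bar> * \<bar>c\<bar>)"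
        using abs_triangle_ineq4[of "?d * c" "?g * \<sigma>"] abs_triangle_ineq[of "?d * \<sigma>" "?g * c"] by (simp add: abs_mult)
      also have "\<dots> \<le> \<bar>?d\<bar> * \<bar>c\<bar> + (M * \<bar>?d\<bar>) * \<bar>\<sigma>\<bar> + (\<bar>?d\<bar> * \<bar>\<sigma>\<bar> + (M * \<bar>?d\<bar>) * \<bar>c\<bar>)"
        using g by (intro add_mono mult_right_mono order_refl) auto
      also have "\<dots> = (\<bar>c\<bar> + \<bar>\<sigma>\<bar> + M * (\<bar>\<sigma>\<bar> + \<bar>c\<bar>)) * \<bar>?d\<bar>" by (simp add: algebra_simps)
      also have "\<dots> \<le> (\<bar>c\<bar> + \<bar>\<sigma>\<bar> + M * (\<bar>\<sigma>\<bar> + \<bar>c\<bar>)) * norm (y - z)" using d M0 by (intro mult_left_mono) auto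
      finally show ?thesis .
    qed
    then show "\<exists>T B. open T \<and> z \<in> T \<and> (\<forall>y\<in>{z. snd z = 0} \<inter> T. norm (f y - f z) \<le> B * norm (y - z))"
      by (intro exI[of _ UNIV]) auto
  qed auto
  moreover have "frontier Q \<inter> nbhd r h \<subseteq> f ` {z. snd z = 0}"
  proof
    fix q assume "q \<in> frontier Q \<inter> nbhd r h"
    then have "q = f (cs q, 0)" using frontier_graph[of q] pt_cs_ct[of q] by (simp add: f_def nbhd_def)
    then show "q \<in> f ` {z. snd z = 0}" by (intro image_eqI) auto
  qed
  ultimately show ?thesis using negligible_subset by blast
qed

text \<open>Along one inward vector \<open>e\<close>, of length h / 2, all of \<open>Q\<close> near
  \<open>p\<close> is carried through \<open>Q\<close> into a compact connected subset of
  \<open>Q\<close>. Estimates known in the interior can thus reach the boundary by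
  translation.\<close>

lemma boundary_layer:
  obtains N e K where "open N" "p \<in> N" "compact K" "connected K" "K \<subseteq> Q"
    "\<And>q t. q \<in> N \<inter> Q \<Longrightarrow> 0 \<le> t \<Longrightarrow> t \<le> 1 \<Longrightarrow> q + t *\<^sub>R e \<in> Q" "\<And>q. q \<in> N \<inter> Q \<Longrightarrow> q + e \<in> K"
proof -
  have M0: "M \<ge> 0" using lip lipschitz_on_nonneg by blast
  \<comment> \<open>So narrow that the graph stays within h / 8 of height 0 over |s| <= a.\<close>
  define a where "a = min (r / 2) (h / (8 * (M + 1)))"
  have a: "a > 0" "a < r" using rh M0 by (auto simp: a_def)
  have "M * a \<le> M * (h / (8 * (M + 1)))" using M0 by (intro mult_left_mono) (auto simp: a_def)
  also have "\<dots> \<le> h / 8" using M0 rh by (simp add: field_simps)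
  finally have Ma: "M * a \<le> h / 8" .
  have small: "\<bar>\<gamma> s\<bar> \<le> h / 8" if "\<bar>s\<bar> \<le> a" for s
  proof -
    have "\<bar>\<gamma> s\<bar> \<le> M * \<bar>s\<bar>" using lipschitz_onD[OF lip, of s 0] gamma_0 by (simp add: dist_real_def)
    also have "\<dots> \<le> M * a" using that M0 by (intro mult_left_mono)
    finally show ?thesis using Ma by simp
  qed
  define e where "e = (- (h / 2) * \<sigma>, (h / 2) * c)"
  \<comment> \<open>Points of \<open>Q\<close> with |t| < h / 8, raised by h / 2, end up at heights
    between 3 h / 8 and 5 h / 8: above the graph and still inside the chart.\<close>
  define K where "K = (\<lambda>z. pt (fst z) (snd z)) ` ({-a..a} \<times> {3 * h / 8..5 * h / 8})"
  have cK: "continuous_on S (\<lambda>z. pt (fst z) (snd z))" for S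
    unfolding pt_def by (intro continuous_intros)
  have shift: "cs (q + t *\<^sub>R e) = cs q" "ct (q + t *\<^sub>R e) = ct q + t * (h / 2)" for q t
  proof -
    have n: "c * c + \<sigma> * \<sigma> = 1" using norm1 by (simp add: power2_eq_square)
    have "ct (q + t *\<^sub>R e) = ct q + t * (h / 2) * (c * c + \<sigma> * \<sigma>)" "cs (q + t *\<^sub>R e) = cs q"
      by (simp_all add: cs_def ct_def e_def algebra_simps)
    then show "cs (q + t *\<^sub>R e) = cs q" "ct (q + t *\<^sub>R e) = ct q + t * (h / 2)" unfolding n by simp_all
  qed
  show ?thesis
  proof (rule that[of "nbhd a (h / 8)" K e])
    show "open (nbhd a (h / 8))" by (rule open_nbhd)
    show "p \<in> nbhd a (h / 8)" using a rh by (intro p_in_nbhd) auto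
    show "compact K" unfolding K_def by (intro compact_continuous_image cK compact_Times) auto
    show "connected K" unfolding K_def by (intro connected_continuous_image cK connected_Times) auto
    show "K \<subseteq> Q"
    proof
      fix q assume "q \<in> K"
      then obtain s t where st: "q = pt s t" "\<bar>s\<bar> \<le> a" "3 * h / 8 \<le> t" "t \<le> 5 * h / 8" by (auto simp: K_def)
      then show "q \<in> Q" using chart[of q] small[of s] a rh by (simp add: cs_pt ct_pt)
    qed
    fix q assume q: "q \<in> nbhd a (h / 8) \<inter> Q"
    then have qq: "\<bar>cs q\<bar> < a" "\<bar>ct q\<bar> < h / 8" "\<gamma> (cs q) < ct q" using chart[of q] a rh by (auto simp: nbhd_def)
    show "q + t *\<^sub>R e \<in> Q" if t: "0 \<le> t" "t \<le> 1" for t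
    proof -
      have "0 \<le> t * (h / 2)" "t * (h / 2) \<le> h / 2" using t rh by (auto intro: mult_left_le_one_le)
      then have "\<bar>ct q + t * (h / 2)\<bar> < h" "\<gamma> (cs q) < ct q + t * (h / 2)" using qq rh by linarith+
      then show ?thesis using chart[of "q + t *\<^sub>R e"] qq a unfolding shift by simp
    qed
    have "q + e = pt (cs q) (ct q + h / 2)" using pt_cs_ct[of "q + 1 *\<^sub>R e"] unfolding shift by simp
    then show "q + e \<in> K" unfolding K_def using qq by (intro image_eqI[of _ _ "(cs q, ct q + h / 2)"]) auto
  qed
qed

text \<open>Along the segment the graph is a straight line, so in the original coordinates
  membership in \<open>Q\<close> near \<open>p\<close> becomes the condition 0 < y / c. Since
  \<open>Q\<close> lies above the axis, c must be positive.\<close>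

lemma flat_boundary:
  assumes ps: "p = (s0, 0)" and \<delta>: "\<delta> > 0" "\<And>s. \<bar>s - s0\<bar> < \<delta> \<Longrightarrow> (s, 0) \<in> frontier Q" and Q: "\<And>q. q \<in> Q \<Longrightarrow> snd q > 0"
  obtains d where "d > 0" "{s0 - d<..<s0 + d} \<times> {0<..<d} \<subseteq> Q"
proof -
  have fp: "fst p = s0" "snd p = 0" by (simp_all add: ps)
  define m where "m = min r (min h \<delta>)"
  have m: "m > 0" using rh \<delta> by (simp add: m_def)
  have c1: "\<bar>c\<bar> \<le> 1" "\<bar>\<sigma>\<bar> \<le> 1"
    using norm1 by (metis abs_square_le_1 le_add_same_cancel1 zero_le_power2 add.commute)+
  have line: "\<gamma> (x * c) = - (x * \<sigma>)" if "\<bar>x\<bar> < m" for x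
  proof -
    have "\<bar>x * c\<bar> \<le> \<bar>x\<bar>" "\<bar>x * \<sigma>\<bar> \<le> \<bar>x\<bar>" using c1 by (simp_all add: abs_mult mult_left_le)
    then have "\<bar>cs (s0 + x, 0)\<bar> < r" "\<bar>ct (s0 + x, 0)\<bar> < h" using that by (auto simp: cs_def ct_def fp m_def)
    moreover have "(s0 + x, 0) \<in> frontier Q" using \<delta>(2)[of "s0 + x"] that by (simp add: m_def)
    ultimately show ?thesis using frontier_graph[of "(s0 + x, 0)"] by (simp add: cs_def ct_def fp)
  qed
  \<comment> \<open>For c = 0 the segment would be perpendicular to the parameter direction, and no
    graph contains such a segment.\<close>
  have c0: "c \<noteq> 0"
  proof
    assume "c = 0"
    then have "m / 2 * \<sigma> = 0" using line[of "m / 2"] gamma_0 m by simp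
    then show False using m norm1 \<open>c = 0\<close> by simp
  qed
  \<comment> \<open>The formula of \<open>line\<close> applies to parameters of the form x' c with
    |x'| < m. For the parameter x c + y \<sigma> this asks for |x c + y \<sigma>| < m |c|, hence the
    factor |c|.\<close>
  define d where "d = min (m / 2) (m * \<bar>c\<bar> / 4)"
  have d: "d > 0" "d \<le> m / 2" "d \<le> m * \<bar>c\<bar> / 4" using m c0 by (auto simp: d_def)
  have key: "(s0 + x, y) \<in> Q \<longleftrightarrow> - ((x * c + y * \<sigma>) / c * \<sigma>) < y * c - x * \<sigma>" if "\<bar>x\<bar> < d" "\<bar>y\<bar> < d" for x y
  proof -
    have "\<bar>x * c\<bar> \<le> \<bar>x\<bar>" "\<bar>x * \<sigma>\<bar> \<le> \<bar>x\<bar>" "\<bar>y * c\<bar> \<le> \<bar>y\<bar>" "\<bar>y * \<sigma>\<bar> \<le> \<bar>y\<bar>"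
      using c1 by (simp_all add: abs_mult mult_left_le)
    then have b: "\<bar>x * c + y * \<sigma>\<bar> < 2 * d" "\<bar>y * c - x * \<sigma>\<bar> < 2 * d" using that by linarith+
    then have in1: "\<bar>cs (s0 + x, y)\<bar> < r" "\<bar>ct (s0 + x, y)\<bar> < h" using d(2) by (auto simp: cs_def ct_def fp m_def)
    have "\<bar>(x * c + y * \<sigma>) / c\<bar> = \<bar>x * c + y * \<sigma>\<bar> / \<bar>c\<bar>" by (simp add: abs_divide)
    also have "\<dots> < 2 * d / \<bar>c\<bar>" using b(1) c0 by (intro divide_strict_right_mono) auto
    also have "\<dots> \<le> m" using d(1,3) c0 m by (simp add: field_simps)
    finally have "\<gamma> ((x * c + y * \<sigma>) / c * c) = - ((x * c + y * \<sigma>) / c * \<sigma>)" by (rule line)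
    then have "\<gamma> (x * c + y * \<sigma>) = - ((x * c + y * \<sigma>) / c * \<sigma>)" using c0 by simp
    then show ?thesis using chart[OF in1] by (simp add: cs_def ct_def fp)
  qed
  have eq: "(y * c - x * \<sigma>) + ((x * c + y * \<sigma>) / c * \<sigma>) = y / c" for x y
  proof -
    have n: "c * c + \<sigma> * \<sigma> = 1" using norm1 by (simp add: power2_eq_square)
    have "(y * c - x * \<sigma>) + ((x * c + y * \<sigma>) / c * \<sigma>) = y * (c * c + \<sigma> * \<sigma>) / c"
      using c0 by (simp add: field_simps)
    then show ?thesis unfolding n by simp
  qed
  have key': "(s0 + x, y) \<in> Q \<longleftrightarrow> 0 < y / c" if "\<bar>x\<bar> < d" "\<bar>y\<bar> < d" for x y
    unfolding key[OF that] eq[of y x, symmetric] by linarith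
  have "c > 0"
  proof (rule ccontr)
    assume "\<not> c > 0"
    then have "c < 0" using c0 by simp
    then have "d / (2 * c) < 0" using d(1) by (simp add: divide_less_0_iff)
    then have "(s0 + 0, - d / 2) \<in> Q" using key'[of 0 "- d / 2"] d(1) by simp
    then show False using Q d by fastforce
  qed
  show ?thesis
  proof (rule that[OF d(1)], rule subsetI)
    fix q assume "q \<in> {s0 - d<..<s0 + d} \<times> {0<..<d}"
    then show "q \<in> Q" using key'[of "fst q - s0" "snd q"] \<open>c > 0\<close> by (cases q) auto
  qed
qed

end

lemma lipschitz_domain_chart:
  assumes "lipschitz_domain Q" "p \<in> frontier Q"
  obtains c \<sigma> r h M \<gamma> where "lipschitz_chart Q p c \<sigma> r h M \<gamma>"
proof -
  from assms obtain \<theta> r h M \<gamma> where *: "r > 0" "h > 0" "M-lipschitz_on UNIV (\<gamma> :: real \<Rightarrow> real)"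
      "\<forall>s t. \<bar>s\<bar> < r \<and> \<bar>t\<bar> < h \<longrightarrow>
           (p + (s * cos \<theta> - t * sin \<theta>, s * sin \<theta> + t * cos \<theta>) \<in> Q \<longleftrightarrow> \<gamma> s < t)"
    unfolding lipschitz_domain_def by blast
  have "open Q" using assms(1) by (simp add: lipschitz_domain_def)
  have "lipschitz_chart Q p (cos \<theta>) (sin \<theta>) r h M \<gamma>"
    by unfold_locales (use * assms(2) \<open>open Q\<close> in auto)
  then show ?thesis by (rule that)
qed

lemma lipschitz_domain_negligible_frontier:
  assumes "lipschitz_domain Q"
  shows "negligible (frontier Q)"
proof -
  have "\<exists>N. open N \<and> p \<in> N \<and> negligible (frontier Q \<inter> N)" if p: "p \<in> frontier Q" for p
  proof -
    obtain c \<sigma> r h M \<gamma> where "lipschitz_chart Q p c \<sigma> r h M \<gamma>" using lipschitz_domain_chart[OF assms p] .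
    then interpret lipschitz_chart Q p c \<sigma> r h M \<gamma> .
    show ?thesis using open_nbhd p_in_nbhd[OF rh] negligible_frontier_nbhd by blast
  qed
  then obtain N where N: "\<And>p. p \<in> frontier Q \<Longrightarrow> open (N p) \<and> p \<in> N p \<and> negligible (frontier Q \<inter> N p)" by metis
  have "compact (frontier Q)" using assms by (simp add: lipschitz_domain_def compact_frontier_bounded)
  then obtain F where F: "F \<subseteq> frontier Q" "finite F" "frontier Q \<subseteq> (\<Union>p\<in>F. N p)"
    using compactE_image[of "frontier Q" "frontier Q" N] N by blast
  then have "frontier Q = (\<Union>p\<in>F. frontier Q \<inter> N p)" by auto
  moreover have "negligible (\<Union>p\<in>F. frontier Q \<inter> N p)" using F N by (intro negligible_Union) auto
  ultimately show ?thesis by (rule ssubst)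
qed

section \<open>A Poincare inequality on the reference cell\<close>

text \<open>The only property of \<open>v\<close> that the Poincare inequality uses; unlike weak derivatives it is
  easily transported by the anisotropic scaling of a tooth.\<close>

definition incr_bounded :: "(real \<times> real) set \<Rightarrow> (real \<times> real \<Rightarrow> real) \<Rightarrow> real \<Rightarrow> bool" where
  "incr_bounded Q v D \<longleftrightarrow> 0 \<le> D \<and> v \<in> L2 Q \<and>
     (\<forall>A e. open A \<and> (\<forall>x\<in>A. \<forall>t. 0 \<le> t \<and> t \<le> 1 \<longrightarrow> x + t *\<^sub>R e \<in> Q) \<longrightarrow>
        (\<lambda>x. v (x + e)) \<in> L2 A \<and> L2_norm A (\<lambda>x. v (x + e) - v x) \<le> norm e * D)"

definition base_box :: "real \<times> real \<Rightarrow> (real \<times> real) set" where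
  "base_box z = {fst z - snd z<..<fst z + snd z} \<times> {0<..<snd z}"

text \<open>The height bound is used with k = b0: a box shifted down by its own height then lies in
  the rectangle of depth \<open>b0\<close> below the axis, which belongs to the base.\<close>

definition base_boxes :: "real \<Rightarrow> (real \<times> real) set \<Rightarrow> (real \<times> real) set" where
  "base_boxes k Q = {z. 0 < snd z \<and> snd z \<le> k \<and> base_box z \<subseteq> Q}"

text \<open>A local Poincare inequality in which \<open>D\<close> stands for the gradient norm.
  \<open>P\<close> and \<open>C\<close> may depend on \<open>S\<close> but not on \<open>v\<close>,
  so the property passes to finite unions and, through the increment bound, along
  translations.\<close>

definition controlled :: "real \<Rightarrow> (real \<times> real) set \<Rightarrow> (real \<times> real) set \<Rightarrow> bool" where
  "controlled k Q S \<longleftrightarrow> open S \<and> S \<subseteq> Q \<and> (\<exists>P C. finite P \<and> P \<subseteq> base_boxes k Q \<and> 0 \<le> C \<and>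
     (\<forall>v D. incr_bounded Q v D \<longrightarrow> L2_norm S v \<le> C * (D + (\<Sum>z\<in>P. L2_norm (base_box z) v))))"

lemma open_base_box: "open (base_box z)"
  unfolding base_box_def by (intro open_Times) auto

lemma controlled_base_box:
  assumes "z \<in> base_boxes k Q"
  shows "controlled k Q (base_box z)"
  unfolding controlled_def
proof (intro conjI exI[of _ "{z}"] exI[of _ 1] allI impI)
  fix v D assume "incr_bounded Q v D"
  then show "L2_norm (base_box z) v \<le> 1 * (D + (\<Sum>z\<in>{z}. L2_norm (base_box z) v))"
    by (simp add: incr_bounded_def)
qed (use assms open_base_box in \<open>auto simp: base_boxes_def\<close>)

lemma controlled_subset:
  assumes "controlled k Q S" "T \<subseteq> S" "open T"
  shows "controlled k Q T"
proof -
  from assms(1) obtain P C where PC: "open S" "S \<subseteq> Q" "finite P" "P \<subseteq> base_boxes k Q" "0 \<le> C"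
    "\<And>v D. incr_bounded Q v D \<Longrightarrow> L2_norm S v \<le> C * (D + (\<Sum>z\<in>P. L2_norm (base_box z) v))"
    unfolding controlled_def by blast
  have "L2_norm T v \<le> C * (D + (\<Sum>z\<in>P. L2_norm (base_box z) v))" if i: "incr_bounded Q v D" for v D
  proof -
    have "v \<in> L2 S" using L2_subset(1)[of v Q S] i PC by (auto simp: incr_bounded_def)
    then have "L2_norm T v \<le> L2_norm S v" using L2_subset(2)[of v S T] assms by auto
    then show ?thesis using PC(6)[OF i] by linarith
  qed
  then show ?thesis unfolding controlled_def using PC assms by blast
qed

lemma L2_norm_Un_le:
  assumes "v \<in> L2 (S \<union> T)" "S \<in> sets lebesgue" "T \<in> sets lebesgue"
  shows "L2_norm (S \<union> T) v \<le> L2_norm S v + L2_norm T v"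
proof -
  have e: "v \<in> L2 S" "v \<in> L2 (T - S)" "v \<in> L2 T"
    using L2_subset(1)[OF assms(1)] assms(2,3) by auto
  have i: "set_integrable lebesgue S (\<lambda>x. (v x)\<^sup>2)" "set_integrable lebesgue (T - S) (\<lambda>x. (v x)\<^sup>2)"
    using e L2_set_integrable_power2 by auto
  have "(L2_norm (S \<union> T) v)\<^sup>2 = (L2_norm S v)\<^sup>2 + (L2_norm (T - S) v)\<^sup>2"
    unfolding L2_norm_power2 using set_integral_Un[OF _ i] by simp
  also have "\<dots> \<le> (L2_norm S v)\<^sup>2 + (L2_norm T v)\<^sup>2"
    using L2_subset(2)[OF e(3), of "T - S"] assms by (intro add_left_mono power_mono) auto
  also have "\<dots> \<le> (L2_norm S v + L2_norm T v)\<^sup>2" by (simp add: power2_sum)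
  finally show ?thesis by (rule power2_le_imp_le) simp
qed

lemma controlled_Un:
  assumes "controlled k Q S" "controlled k Q T"
  shows "controlled k Q (S \<union> T)"
proof -
  from assms(1) obtain P C where PC: "open S" "S \<subseteq> Q" "finite P" "P \<subseteq> base_boxes k Q" "0 \<le> C"
    "\<And>v D. incr_bounded Q v D \<Longrightarrow> L2_norm S v \<le> C * (D + (\<Sum>z\<in>P. L2_norm (base_box z) v))"
    unfolding controlled_def by blast
  from assms(2) obtain P' C' where PC': "open T" "T \<subseteq> Q" "finite P'" "P' \<subseteq> base_boxes k Q" "0 \<le> C'"
    "\<And>v D. incr_bounded Q v D \<Longrightarrow> L2_norm T v \<le> C' * (D + (\<Sum>z\<in>P'. L2_norm (base_box z) v))"
    unfolding controlled_def by blast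
  have "L2_norm (S \<union> T) v \<le> (C + C') * (D + (\<Sum>z\<in>P \<union> P'. L2_norm (base_box z) v))" if i: "incr_bounded Q v D" for v D
  proof -
    have D: "D \<ge> 0" "v \<in> L2 Q" using i by (auto simp: incr_bounded_def)
    have "v \<in> L2 (S \<union> T)" using L2_subset(1)[OF D(2), of "S \<union> T"] PC PC' by auto
    then have "L2_norm (S \<union> T) v \<le> L2_norm S v + L2_norm T v" using PC(1) PC'(1) by (intro L2_norm_Un_le) auto
    also have "\<dots> \<le> C * (D + (\<Sum>z\<in>P. L2_norm (base_box z) v)) + C' * (D + (\<Sum>z\<in>P'. L2_norm (base_box z) v))"
      using PC(6)[OF i] PC'(6)[OF i] by linarith
    also have "\<dots> \<le> C * (D + (\<Sum>z\<in>P \<union> P'. L2_norm (base_box z) v)) + C' * (D + (\<Sum>z\<in>P \<union> P'. L2_norm (base_box z) v))"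
      using PC PC' by (intro add_mono mult_left_mono sum_mono2) auto
    finally show ?thesis by (simp add: algebra_simps)
  qed
  then show ?thesis unfolding controlled_def using PC PC'
    by (intro conjI exI[of _ "P \<union> P'"] exI[of _ "C + C'"]) auto
qed

lemma controlled_empty: "controlled k Q {}"
  unfolding controlled_def
  by (intro conjI exI[of _ "{}"] exI[of _ 0]) (auto simp: L2_norm_restr restr_def)

lemma controlled_UN: "finite I \<Longrightarrow> (\<And>i. i \<in> I \<Longrightarrow> controlled k Q (S i)) \<Longrightarrow> controlled k Q (\<Union>i\<in>I. S i)"
  by (induction I rule: finite_induct) (auto intro: controlled_Un controlled_empty)

lemma L2_norm_translate_set:
  fixes v :: "'a::euclidean_space \<Rightarrow> real"
  assumes "v \<in> L2 S" "\<And>x. x \<in> A \<Longrightarrow> x + e \<in> S" "A \<in> sets lebesgue"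
  shows "L2_norm A (\<lambda>x. v (x + e)) \<le> L2_norm S v"
proof -
  have V: "restr S v \<in> L2 UNIV" using assms(1) by (simp add: L2_iff)
  have "L2_norm A (\<lambda>x. v (x + e)) = L2_norm A (\<lambda>x. restr S v (x + e))"
    using assms(2) by (intro L2_cong) (simp add: restr_def)
  also have "\<dots> \<le> L2_norm UNIV (\<lambda>x. restr S v (x + e))"
    by (rule L2_subset(2)[OF L2_translate(1)[OF V]]) (use assms in auto)
  also have "\<dots> = L2_norm S v" using L2_translate(2)[OF V, of e] by (simp add: L2_norm_restr)
  finally show ?thesis .
qed

text \<open>\<open>v\<close> is its own translate minus an increment, and the increment has norm at
  most \<open>norm e * D\<close>. In this way control spreads from one place to another.\<close>

lemma controlled_translate:
  assumes "controlled k Q S" "open A" "\<And>x. x \<in> A \<Longrightarrow> x + e \<in> S"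
    and sw: "\<And>x t. x \<in> A \<Longrightarrow> 0 \<le> t \<Longrightarrow> t \<le> 1 \<Longrightarrow> x + t *\<^sub>R e \<in> Q"
  shows "controlled k Q A"
proof -
  from assms(1) obtain P C where PC: "open S" "S \<subseteq> Q" "finite P" "P \<subseteq> base_boxes k Q" "0 \<le> C"
    "\<And>v D. incr_bounded Q v D \<Longrightarrow> L2_norm S v \<le> C * (D + (\<Sum>z\<in>P. L2_norm (base_box z) v))"
    unfolding controlled_def by blast
  have AQ: "A \<subseteq> Q" using sw[of _ 0] by auto
  have "L2_norm A v \<le> (C + norm e) * (D + (\<Sum>z\<in>P. L2_norm (base_box z) v))" if i: "incr_bounded Q v D" for v D
  proof -
    have D: "D \<ge> 0" "v \<in> L2 Q" using i by (auto simp: incr_bounded_def)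
    have inc: "(\<lambda>x. v (x + e)) \<in> L2 A" "L2_norm A (\<lambda>x. v (x + e) - v x) \<le> norm e * D"
      using i assms(2) sw unfolding incr_bounded_def by blast+
    have vA: "v \<in> L2 A" using L2_subset(1)[OF D(2) AQ] assms(2) by auto
    have vS: "v \<in> L2 S" using L2_subset(1)[OF D(2) PC(2)] PC(1) by auto
    have "L2_norm A v \<le> L2_norm A (\<lambda>x. v (x + e)) + L2_norm A (\<lambda>x. v (x + e) - v x)"
      using L2_norm_triangle_diff[OF inc(1) L2_diff[OF inc(1) vA]] by simp
    also have "\<dots> \<le> C * (D + (\<Sum>z\<in>P. L2_norm (base_box z) v)) + norm e * D"
      using L2_norm_translate_set[OF vS assms(3)] assms(2) PC(6)[OF i] inc(2) by fastforce
    also have "\<dots> \<le> C * (D + (\<Sum>z\<in>P. L2_norm (base_box z) v)) + norm e * (D + (\<Sum>z\<in>P. L2_norm (base_box z) v))"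
      by (intro add_left_mono mult_left_mono) (auto intro: sum_nonneg)
    finally show ?thesis by (simp add: algebra_simps)
  qed
  then show ?thesis unfolding controlled_def using PC AQ assms(2)
    by (intro conjI exI[of _ P] exI[of _ "C + norm e"]) auto
qed

section \<open>Propagation of the local inequality through the cell\<close>

definition good :: "real \<Rightarrow> (real \<times> real) set \<Rightarrow> (real \<times> real) set" where
  "good k Q = {x. \<exists>r>0. controlled k Q (ball x r)}"

text \<open>A small ball about \<open>y\<close> is translated into the controlled ball about
  \<open>x\<close>. By convexity the segment from \<open>y\<close> to \<open>x\<close> stays in the
  ball of radius r, and the moving small ball stays in the doubled one.\<close>

lemma good_in_ball:
  assumes "ball z (2 * r) \<subseteq> Q" "x \<in> ball z r" "y \<in> ball z r" "x \<in> good k Q"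
  shows "y \<in> good k Q"
proof -
  from assms(4) obtain \<rho> where \<rho>: "\<rho> > 0" "controlled k Q (ball x \<rho>)" by (auto simp: good_def)
  have r: "r > 0" using assms(2) by (metis ball_empty empty_iff not_le_imp_less)
  define s where "s = min \<rho> r"
  have s: "s > 0" "s \<le> \<rho>" "s \<le> r" using \<rho> r by (auto simp: s_def)
  have "controlled k Q (ball y s)"
  proof (rule controlled_translate[OF \<rho>(2), of _ "x - y"])
    show "q + (x - y) \<in> ball x \<rho>" if "q \<in> ball y s" for q
      using that s by (simp add: dist_norm algebra_simps)
    fix q t assume q: "q \<in> ball y s" and t: "0 \<le> t" "(t::real) \<le> 1"
    have "y + t *\<^sub>R (x - y) \<in> ball z r"
      using convexD[OF convex_ball assms(3,2), of "1 - t" t] t by (simp add: algebra_simps)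
    then have n1: "norm (z - (y + t *\<^sub>R (x - y))) < r" by (simp add: dist_norm)
    have n2: "norm (y - q) < r" using q s by (simp add: dist_norm)
    have eq: "z - (q + t *\<^sub>R (x - y)) = (z - (y + t *\<^sub>R (x - y))) + (y - q)" by simp
    have "norm (z - (q + t *\<^sub>R (x - y))) < 2 * r"
      unfolding eq using norm_triangle_ineq[of "z - (y + t *\<^sub>R (x - y))" "y - q"] n1 n2 by linarith
    then show "q + t *\<^sub>R (x - y) \<in> Q" using assms(1) by (auto simp: dist_norm)
  qed auto
  then show ?thesis using s by (auto simp: good_def)
qed

lemma good_subset: "good k Q \<subseteq> Q"
  by (force simp: good_def controlled_def)

text \<open>By \<open>good_in_ball\<close> a small ball inside \<open>Q\<close> consists of good
  points or contains none. Thus \<open>good k Q\<close> is a union of components of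
  \<open>Q\<close>.\<close>

lemma open_good_bad:
  assumes "open Q"
  shows "open (good k Q)" "open (Q - good k Q)"
proof -
  have key: "\<exists>r>0. ball z r \<subseteq> Q \<and> (ball z r \<subseteq> good k Q \<or> ball z r \<inter> good k Q = {})" if z: "z \<in> Q" for z
  proof -
    from z assms obtain R where R: "R > 0" "ball z R \<subseteq> Q" using open_contains_ball by blast
    have "ball z (2 * (R / 2)) \<subseteq> Q" using R by simp
    from good_in_ball[OF this] have "ball z (R / 2) \<subseteq> good k Q \<or> ball z (R / 2) \<inter> good k Q = {}" by blast
    moreover have "ball z (R / 2) \<subseteq> Q" using R by (auto simp: subset_iff)
    ultimately show ?thesis using R(1) by (intro exI[of _ "R / 2"]) auto
  qed
  show "open (good k Q)" unfolding open_contains_ball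
  proof
    fix x assume x: "x \<in> good k Q"
    then have xQ: "x \<in> Q" using good_subset by blast
    obtain r where r: "r > 0" "ball x r \<subseteq> good k Q \<or> ball x r \<inter> good k Q = {}" using key[OF xQ] by blast
    have "x \<in> ball x r" using r(1) by simp
    then show "\<exists>e>0. ball x e \<subseteq> good k Q" using r x by blast
  qed
  show "open (Q - good k Q)" unfolding open_contains_ball
  proof
    fix x assume x: "x \<in> Q - good k Q"
    obtain r where r: "r > 0" "ball x r \<subseteq> Q" "ball x r \<subseteq> good k Q \<or> ball x r \<inter> good k Q = {}" using key[of x] x by blast
    have "x \<in> ball x r" using r(1) by simp
    then show "\<exists>e>0. ball x e \<subseteq> Q - good k Q" using r x by blast
  qed
qed

lemma good_connected:
  assumes "open Q" "connected S" "S \<subseteq> Q" "x \<in> S" "y \<in> S" "x \<in> good k Q"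
  shows "y \<in> good k Q"
proof (rule ccontr)
  assume "y \<notin> good k Q"
  then show False
    using connectedD[OF assms(2) open_good_bad[OF assms(1)]] assms(3-6) by blast
qed

text \<open>The layer of \<open>Q\<close> at \<open>p\<close> is carried into a compact connected
  set \<open>K\<close>, which is good as a whole or not at all, and the layer shares its type. In
  the good case finitely many controlled balls cover \<open>K\<close>, and the translation gives
  control of the layer up to the boundary.\<close>

lemma boundary_controlled:
  assumes "lipschitz_domain Q" "p \<in> frontier Q"
  shows "\<exists>N. open N \<and> p \<in> N \<and> (N \<inter> Q \<subseteq> good k Q \<or> N \<inter> good k Q = {}) \<and> (N \<inter> Q \<subseteq> good k Q \<longrightarrow> controlled k Q (N \<inter> Q))"
proof -
  have oQ: "open Q" using assms(1) by (simp add: lipschitz_domain_def)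
  obtain c \<sigma> r h M \<gamma> where "lipschitz_chart Q p c \<sigma> r h M \<gamma>" using lipschitz_domain_chart[OF assms] .
  then interpret lipschitz_chart Q p c \<sigma> r h M \<gamma> .
  obtain N e K where N: "open N" "p \<in> N" "compact K" "connected K" "K \<subseteq> Q"
    "\<And>q t. q \<in> N \<inter> Q \<Longrightarrow> 0 \<le> t \<Longrightarrow> t \<le> 1 \<Longrightarrow> q + t *\<^sub>R e \<in> Q" "\<And>q. q \<in> N \<inter> Q \<Longrightarrow> q + e \<in> K"
    by (rule boundary_layer) (rule that; assumption)
  have same: "q \<in> good k Q \<longleftrightarrow> q + e \<in> good k Q" if q: "q \<in> N \<inter> Q" for q
  proof -
    have cs: "connected (closed_segment q (q + e))" by (intro convex_connected convex_closed_segment)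
    have sub: "closed_segment q (q + e) \<subseteq> Q"
    proof
      fix w assume "w \<in> closed_segment q (q + e)"
      then obtain u where u: "0 \<le> u" "u \<le> 1" "w = (1 - u) *\<^sub>R q + u *\<^sub>R (q + e)" by (auto simp: in_segment)
      then have "w = q + u *\<^sub>R e" by (simp add: algebra_simps)
      then show "w \<in> Q" using N(6)[OF q u(1,2)] by simp
    qed
    show ?thesis using good_connected[OF oQ cs sub] by (meson ends_in_segment)
  qed
  have K: "K \<subseteq> good k Q \<or> K \<inter> good k Q = {}" using good_connected[OF oQ N(4,5)] by blast
  show ?thesis
  proof (intro exI[of _ N] conjI impI N(1,2))
    show "N \<inter> Q \<subseteq> good k Q \<or> N \<inter> good k Q = {}"
      using K same N(7) good_subset by blast
    assume gd: "N \<inter> Q \<subseteq> good k Q"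
    show "controlled k Q (N \<inter> Q)"
    proof (cases "N \<inter> Q = {}")
      case True
      then show ?thesis using controlled_empty by simp
    next
      case False
      then have Kg: "K \<subseteq> good k Q" using K gd same N(7) by blast
      then have "\<exists>r. r > 0 \<and> controlled k Q (ball x r)" if "x \<in> K" for x using that by (auto simp: good_def)
      then obtain R where R: "\<And>x. x \<in> K \<Longrightarrow> R x > 0 \<and> controlled k Q (ball x (R x))" by metis
      obtain F where F: "F \<subseteq> K" "finite F" "K \<subseteq> (\<Union>x\<in>F. ball x (R x))"
        using compactE_image[OF N(3), of K "\<lambda>x. ball x (R x)"] R by force
      have "controlled k Q (\<Union>x\<in>F. ball x (R x))" using F R by (intro controlled_UN) auto
      then show ?thesis
        by (rule controlled_translate[where e=e]) (use N F oQ in blast)+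
    qed
  qed
qed

section \<open>The first eigenvalue and the inequality on the whole cell\<close>

text \<open>Testing with the eigenfunction itself. The first eigenvalue is an infimum, and comparing
  it with a single eigenvalue requires that the set of eigenvalues is bounded below.\<close>

lemma mixed_eigenvalue_nonneg:
  assumes "mixed_eigenvalue Q \<mu>"
  shows "0 \<le> \<mu>"
proof -
  from assms obtain v where v: "v \<in> H1_Gamma0 Q" "\<not> (AE p in lebesgue. p \<in> Q \<longrightarrow> v p = 0)"
    "(LINT p:Q|lebesgue. wd1 Q v p * wd1 Q v p + wd2 Q v p * wd2 Q v p) = \<mu> * (LINT p:Q|lebesgue. v p * v p)"
    unfolding mixed_eigenvalue_def by blast
  then have L: "v \<in> L2 Q" using H1_L2 by (auto simp: H1_Gamma0_def)
  have "L2_norm Q v \<noteq> 0" using L2_norm_zero_AE[OF L] v(2) by blast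
  moreover have "(LINT p:Q|lebesgue. v p * v p) = (L2_norm Q v)\<^sup>2"
    unfolding L2_norm_power2 by (simp add: power2_eq_square)
  ultimately have vv: "(LINT p:Q|lebesgue. v p * v p) > 0" by simp
  have "0 \<le> (LINT p:Q|lebesgue. wd1 Q v p * wd1 Q v p + wd2 Q v p * wd2 Q v p)"
    unfolding LINT_restr by (rule integral_nonneg_AE) (auto simp: restr_def)
  then show ?thesis using v(3) vv by (simp add: zero_le_mult_iff)
qed

text \<open>The good and the bad part do not even touch at the frontier, so their closures are
  disjoint and the indicator of the bad part is the restriction of a function \<psi> that is smooth
  on the plane. Being smooth, \<psi> serves as its own approximating sequence in the definition of
  the trace.\<close>

lemma good_everything:
  assumes Q: "lipschitz_domain Q" and pos: "\<And>q. q \<in> Q \<Longrightarrow> snd q > 0"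
    and neg: "negligible (frontier {s. (s, 0) \<in> Gamma0 Q})" and e1: "first_eigenvalue Q > 0" and "k > 0"
  shows "good k Q = Q"
proof (rule ccontr)
  assume "good k Q \<noteq> Q"
  define A where "A = good k Q"
  define B where "B = Q - good k Q"
  have oQ: "open Q" and bQ: "bounded Q" using Q by (auto simp: lipschitz_domain_def)
  have AB: "open A" "open B" "B \<noteq> {}" "A \<union> B = Q" "A \<inter> B = {}"
    using open_good_bad(1)[OF oQ, of k] open_good_bad(2)[OF oQ, of k] good_subset[of k Q] \<open>good k Q \<noteq> Q\<close>
    unfolding A_def B_def by auto
  have disj: "closure A \<inter> closure B = {}"
  proof (rule ccontr)
    assume "closure A \<inter> closure B \<noteq> {}"
    then obtain p where p: "p \<in> closure A" "p \<in> closure B" by blast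
    have "p \<notin> A" using p(2) AB open_Int_closure_eq_empty[of A B] by blast
    moreover have "p \<notin> B" using p(1) AB open_Int_closure_eq_empty[of B A] by blast
    moreover have "p \<in> closure Q" using p(1) AB(4) closure_mono[of A Q] by blast
    ultimately have "p \<in> frontier Q" using AB(4) oQ by (auto simp: frontier_def interior_open)
    then obtain N where N: "open N" "p \<in> N" "N \<inter> Q \<subseteq> good k Q \<or> N \<inter> good k Q = {}"
      using boundary_controlled[OF Q \<open>p \<in> frontier Q\<close>] by blast
    have "N \<inter> A \<noteq> {}" "N \<inter> B \<noteq> {}" using p N open_Int_closure_eq_empty[of N] by blast+
    then show False using N(3) by (auto simp: A_def B_def)
  qed
  have "compact (closure B)" using bQ AB(4) bounded_subset[of Q B] by auto
  moreover have "open (- closure A)" "closure B \<subseteq> - closure A" using disj by auto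
  ultimately obtain \<psi> where \<psi>: "test_fun (- closure A) \<psi>" "\<And>x. x \<in> closure B \<Longrightarrow> \<psi> x = 1"
    using smooth_Urysohn by metis
  have sm: "smooth_fun \<psi>" using \<psi>(1) by (simp add: test_fun_def)
  have \<psi>A: "\<psi> x = 0" if "x \<in> closure A" for x using test_fun_zero_outside[OF \<psi>(1)] that by simp
  have \<psi>B: "\<psi> x = 1" if "x \<in> B" for x using \<psi>(2) that closure_subset by blast
  have d0: "frechet_derivative \<psi> (at x) v = 0" if x: "x \<in> Q" for x v
  proof -
    have *: "frechet_derivative \<psi> (at x) v = 0" if "open S" "x \<in> S" "\<And>y. y \<in> S \<Longrightarrow> \<psi> y = k" for S k
    proof -
      have "((\<lambda>x. k) has_derivative frechet_derivative \<psi> (at x)) (at x)"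
        by (rule has_derivative_transform_within_open[OF smooth_fun_has_derivative[OF sm] that(1,2)]) (use that in auto)
      then have "frechet_derivative \<psi> (at x) = (\<lambda>v. 0)" using has_derivative_unique[OF _ has_derivative_const] by blast
      then show ?thesis by simp
    qed
    show ?thesis using x AB *[of A 0] *[of B 1] \<psi>A \<psi>B closure_subset by blast
  qed
  have wd: "weak_deriv Q v \<psi> (\<lambda>x. 0)" for v
    by (rule weak_deriv_cong_AE[OF smooth_weak_deriv(2)[OF oQ bQ sm, of v]]) (use d0 in auto)
  have H1: "\<psi> \<in> H1 Q" by (rule smooth_H1[OF oQ bQ sm])
  have w0: "weak_deriv Q v (\<lambda>x. 0) (\<lambda>x. 0)" for v
    using smooth_weak_deriv(2)[OF oQ bQ smooth_fun_const, of v 0] frechet_derivative_const by simp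
  let ?G = "{s. (s, 0) \<in> Gamma0 Q}"
  have trace: "has_trace_Gamma0 Q \<psi> (\<lambda>s. 0)"
    unfolding has_trace_Gamma0_def
  proof (intro conjI exI[of _ "\<lambda>k. \<psi>"] allI)
    show "tendsto_H1 Q (\<lambda>k. \<psi>) \<psi> sequentially"
      unfolding tendsto_H1_def using H1
      by (simp add: H1_norm_def L2_norm_wderiv[OF oQ w0])
    \<comment> \<open>Almost every point of the base set is interior to it. Over such a point stands
      a base box by \<open>flat_boundary\<close>; the points of the box are good, so the base point
      lies in the closure of \<open>A\<close>, where \<psi> vanishes.\<close>
    have "AE s in lebesgue. s \<in> ?G \<longrightarrow> \<psi> (s, 0) - 0 = 0"
    proof -
      have "AE s in lebesgue. s \<notin> frontier ?G"
        using neg by (simp add: negligible_iff_null_sets AE_not_in)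
      then show ?thesis
      proof eventually_elim
        case (elim s)
        show ?case
        proof
          assume s: "s \<in> ?G"
          then have "s \<in> interior ?G" using elim subsetD[OF closure_subset s] by (simp add: frontier_def)
          then obtain \<delta> where \<delta>: "\<delta> > 0" "ball s \<delta> \<subseteq> ?G" using mem_interior by blast
          have p: "(s, 0) \<in> frontier Q" using s by (simp add: Gamma0_def)
          obtain c \<sigma> r h M \<gamma> where "lipschitz_chart Q (s, 0) c \<sigma> r h M \<gamma>" using lipschitz_domain_chart[OF Q p] .
          then interpret lipschitz_chart Q "(s, 0)" c \<sigma> r h M \<gamma> .
          have fr: "(s', 0) \<in> frontier Q" if "\<bar>s' - s\<bar> < \<delta>" for s'
            using \<delta>(2) that by (force simp: dist_real_def Gamma0_def abs_minus_commute)
          obtain d where d: "d > 0" "{s - d<..<s + d} \<times> {0<..<d} \<subseteq> Q"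
            using flat_boundary[OF refl \<delta>(1) fr pos] by blast
          define m where "m = min d k"
          have m: "m \<le> d" "m \<le> k" "0 < m" using d(1) \<open>k > 0\<close> by (auto simp: m_def)
          have "base_box (s, m) \<subseteq> {s - d<..<s + d} \<times> {0<..<d}" using m by (auto simp: base_box_def)
          then have bb: "(s, m) \<in> base_boxes k Q" using m d(2) by (auto simp: base_boxes_def)
          have "base_box (s, m) \<subseteq> good k Q"
          proof
            fix x assume "x \<in> base_box (s, m)"
            then obtain \<rho> where "\<rho> > 0" "ball x \<rho> \<subseteq> base_box (s, m)" using open_base_box open_contains_ball by blast
            then show "x \<in> good k Q" using controlled_subset[OF controlled_base_box[OF bb]] by (auto simp: good_def)
          qed
          moreover have "(s, 0) \<in> closure (base_box (s, m))"
            using m(3) closure_greaterThanLessThan[of "s - m" "s + m"] closure_greaterThanLessThan[of 0 m]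
            by (simp add: base_box_def closure_Times)
          ultimately have "(s, 0) \<in> closure A" using closure_mono[of "base_box (s, m)" A] by (auto simp: A_def)
          then show "\<psi> (s, 0) - 0 = 0" using \<psi>A by simp
        qed
      qed
    qed
    then have "L2_norm ?G (\<lambda>s. \<psi> (s, 0) - 0) = L2_norm ?G (\<lambda>s. 0)" by (rule L2_cong_AE(2))
    then show "(\<lambda>k. L2_norm ?G (\<lambda>s. \<psi> (s, 0) - 0)) \<longlonglongrightarrow> 0" by simp
  qed (use sm in auto)
  have "mixed_eigenvalue Q 0"
    unfolding mixed_eigenvalue_def
  proof (intro bexI[of _ \<psi>] conjI ballI)
    show "\<psi> \<in> H1_Gamma0 Q" using H1 trace by (simp add: H1_Gamma0_def)
    show "\<not> (AE p in lebesgue. p \<in> Q \<longrightarrow> \<psi> p = 0)"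
    proof
      assume "AE p in lebesgue. p \<in> Q \<longrightarrow> \<psi> p = 0"
      then have "AE p in lebesgue. p \<notin> B" by eventually_elim (use \<psi>B AB in auto)
      then have "negligible B"
        by (simp add: negligible_iff_null_sets completion.null_sets_iff_AE)
      then show False using AB open_not_negligible by blast
    qed
    fix \<phi>
    have "AE p in lebesgue. p \<in> Q \<longrightarrow> wd1 Q \<psi> p * wd1 Q \<phi> p + wd2 Q \<psi> p * wd2 Q \<phi> p = 0"
      using wderiv_AE[OF oQ wd, of "(1, 0)"] wderiv_AE[OF oQ wd, of "(0, 1)"] by eventually_elim auto
    from LINT_cong_AE[OF this] show "(LINT p:Q|lebesgue. wd1 Q \<psi> p * wd1 Q \<phi> p + wd2 Q \<psi> p * wd2 Q \<phi> p)
        = 0 * (LINT p:Q|lebesgue. \<psi> p * \<phi> p)" by simp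
  qed
  then have "first_eigenvalue Q \<le> 0"
    unfolding first_eigenvalue_def using mixed_eigenvalue_nonneg by (intro cInf_lower bdd_belowI) auto
  then show False using e1 by simp
qed

text \<open>Once every point is good, compactness of the closure leaves finitely many
  neighbourhoods: balls at points of \<open>Q\<close> and layers at frontier points.\<close>

theorem Poincare_Lipschitz:
  assumes Q: "lipschitz_domain Q" and pos: "\<And>q. q \<in> Q \<Longrightarrow> snd q > 0"
    and neg: "negligible (frontier {s. (s, 0) \<in> Gamma0 Q})" and e1: "first_eigenvalue Q > 0" and "k > 0"
  obtains P C where "finite P" "P \<subseteq> base_boxes k Q" "0 \<le> C"
     "\<And>v D. incr_bounded Q v D \<Longrightarrow> L2_norm Q v \<le> C * (D + (\<Sum>z\<in>P. L2_norm (base_box z) v))"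
proof -
  have oQ: "open Q" and bQ: "bounded Q" using Q by (auto simp: lipschitz_domain_def)
  note gQ = good_everything[OF assms]
  have "\<exists>N. open N \<and> p \<in> N \<and> controlled k Q (N \<inter> Q)" if p: "p \<in> closure Q" for p
  proof (cases "p \<in> Q")
    case True
    then obtain r where r: "r > 0" "controlled k Q (ball p r)" using gQ by (auto simp: good_def)
    then have "ball p r \<inter> Q = ball p r" by (auto simp: controlled_def)
    then show ?thesis using r by (intro exI[of _ "ball p r"]) auto
  next
    case False
    then have "p \<in> frontier Q" using p oQ by (simp add: frontier_def interior_open)
    from boundary_controlled[OF Q this, of k] obtain N where N: "open N" "p \<in> N"
      "N \<inter> Q \<subseteq> good k Q \<longrightarrow> controlled k Q (N \<inter> Q)" by blast
    have "N \<inter> Q \<subseteq> good k Q" using gQ by simp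
    then show ?thesis using N by (intro exI[of _ N]) simp
  qed
  then obtain N where N: "\<And>p. p \<in> closure Q \<Longrightarrow> open (N p) \<and> p \<in> N p \<and> controlled k Q (N p \<inter> Q)" by metis
  have cQ: "compact (closure Q)" using bQ by simp
  obtain F where F: "F \<subseteq> closure Q" "finite F" "closure Q \<subseteq> (\<Union>p\<in>F. N p)"
    using compactE_image[OF cQ, of "closure Q" N] N by blast
  have "controlled k Q (\<Union>p\<in>F. N p \<inter> Q)" using F N by (intro controlled_UN) auto
  moreover have "(\<Union>p\<in>F. N p \<inter> Q) = Q" using F(3) closure_subset[of Q] by auto
  ultimately have "controlled k Q Q" by metis
  then show ?thesis unfolding controlled_def using that by blast
qed

section \<open>The comb-like domains\<close>

lemma num_teeth_bounds:
  assumes "L > 0" "l > 0"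
  shows "real (GREATEST N. real N * L * l \<le> 1) * L * l \<le> 1"
    and "real N * L * l \<le> 1 \<Longrightarrow> N \<le> (GREATEST N. real N * L * l \<le> 1)"
proof -
  have b: "n \<le> nat \<lceil>1 / (L * l)\<rceil>" if "real n * L * l \<le> 1" for n
  proof -
    have "real n \<le> 1 / (L * l)" using that assms by (simp add: field_simps)
    then show ?thesis by linarith
  qed
  show "real (GREATEST N. real N * L * l \<le> 1) * L * l \<le> 1"
    by (rule GreatestI_nat[where P="\<lambda>N. real N * L * l \<le> 1" and k=0 and b="nat \<lceil>1 / (L * l)\<rceil>"]) (use b in auto)
  show "N \<le> (GREATEST N. real N * L * l \<le> 1)" if "real N * L * l \<le> 1"
    by (rule Greatest_le_nat[where P="\<lambda>N. real N * L * l \<le> 1" and b="nat \<lceil>1 / (L * l)\<rceil>"]) (use b that in auto)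
qed

text \<open>The part of the closure at height at least d is compact and meets neither side wall. The
  hypotheses exclude contact at positive heights only, so \<kappa> depends on d and may shrink with
  it; this is one reason why the profile is flattened only above height \<delta> / 2.\<close>

lemma lateral_gap:
  fixes L G d :: real
  assumes Q: "open Q" "Q \<subseteq> {0<..<L} \<times> {0<..<G}"
    and fr: "frontier Q \<inter> ({0} \<times> {0<..G}) = {}" "frontier Q \<inter> ({L} \<times> {0<..G}) = {}" and d: "d > 0" 
  shows "\<exists>\<kappa>>0. \<forall>q\<in>closure Q. d \<le> snd q \<longrightarrow> \<kappa> < fst q \<and> fst q < L - \<kappa>"
proof -
  let ?K = "closure Q \<inter> {q. d \<le> snd q}" and ?m = "\<lambda>q::real\<times>real. min (fst q) (L - fst q)"
  have sub: "closure Q \<subseteq> {0..L} \<times> {0..G}"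
    by (rule closure_minimal[OF order_trans[OF Q(2)] closed_Times[OF closed_atLeastAtMost closed_atLeastAtMost]]) auto
  have pos: "?m q > 0" if q: "q \<in> ?K" for q
  proof -
    have b: "0 \<le> fst q" "fst q \<le> L" "0 < snd q" "snd q \<le> G" using sub q d by auto
    have "q \<in> frontier Q" if "fst q = 0 \<or> fst q = L"
      using q Q that by (auto simp: frontier_def interior_open)
    then have "fst q \<noteq> 0" "fst q \<noteq> L" using fr b by (cases q; auto)+
    then show ?thesis using b by simp
  qed
  show ?thesis
  proof (cases "?K = {}")
    case True
    then show ?thesis by (intro exI[of _ 1]) auto
  next
    case False
    have "bounded (closure Q)" by (rule bounded_subset[OF _ sub]) (auto intro: bounded_Times)
    moreover have "closed {q :: real \<times> real. d \<le> snd q}" by (intro closed_Collect_le continuous_intros)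
    ultimately have "compact ?K" by (auto simp: compact_eq_bounded_closed intro: bounded_subset)
    moreover have "continuous_on ?K ?m" by (intro continuous_intros)
    ultimately obtain q where q: "q \<in> ?K" "\<And>y. y \<in> ?K \<Longrightarrow> ?m q \<le> ?m y"
      using continuous_attains_inf[of ?K ?m] False by blast
    define \<mu> where "\<mu> = ?m q"
    have \<mu>: "\<mu> > 0" using pos[OF q(1)] by (simp add: \<mu>_def)
    have "\<mu> / 2 < fst y \<and> fst y < L - \<mu> / 2" if y: "y \<in> closure Q" "d \<le> snd y" for y
    proof -
      have "\<mu> \<le> ?m y" unfolding \<mu>_def using q(2) y by blast
      then have "\<mu> \<le> fst y" "\<mu> \<le> L - fst y" by auto
      then show ?thesis using \<mu> by linarith
    qed
    then show ?thesis using \<mu> by (intro exI[of _ "\<mu> / 2"]) auto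
  qed
qed

text \<open>The sum \<open>c0 + c1 + c2 + c3\<close> of the constants of
  \<open>split_exists\<close>, with \<open>R\<close> the norm of the averaging weight and
  \<open>K\<close> the constant of \<open>teeth_estimate\<close>. The closed form shows that neither
  the tooth width nor \<epsilon> enters.\<close>

definition split_const :: "real \<Rightarrow> real \<Rightarrow> real \<Rightarrow> real \<Rightarrow> real \<Rightarrow> real \<Rightarrow> real" where
  "split_const b0 b1 G B R K = sqrt b0 * B + (1 + sqrt (b1 + G) * (sqrt b0 * B))
     + R * sqrt (2 * b1) * b1 + (R * sqrt (2 * b1) * b1 + K * ((1 + sqrt (b1 + G) * (sqrt b0 * B)) + 1 + R * sqrt (2 * b1) * b1))"

text \<open>The geometry for a single \<epsilon>: \<open>l\<close> stands for
  \<open>\<epsilon> powr \<alpha>\<close>, and \<open>N1\<close> and \<open>N2\<close> express that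
  \<open>N\<close> is the largest number of cells of width \<open>L * l\<close> that fit. The locale
  is interpreted anew for each \<epsilon>, so the dependence of all bounds on \<open>l\<close> has
  to be explicit.\<close>

locale comb =
  fixes L G b0 b1 l :: real and b :: "real \<Rightarrow> real" and Q :: "(real \<times> real) set" and N :: nat
  assumes L: "L > 0" and G: "G > 0" and b0: "b0 > 0" and l: "l > 0"
    and b: "\<And>x. 0 < x \<Longrightarrow> x < 1 \<Longrightarrow> b0 \<le> b x \<and> b x \<le> b1"
    and pw: "piecewise_C1_01 b"
    and lipQ: "lipschitz_domain Q" and Qsub: "Q \<subseteq> {0<..<L} \<times> {0<..<G}"
    and N1: "real N * L * l \<le> 1" and N2: "real (Suc N) * L * l > 1"
begin

definition org :: "nat \<Rightarrow> real" where "org n = (real n - 1) * L * l"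
definition T :: "nat \<Rightarrow> real \<times> real \<Rightarrow> real \<times> real" where "T n p = (org n + l * fst p, snd p)"
definition Ti :: "nat \<Rightarrow> real \<times> real \<Rightarrow> real \<times> real" where "Ti n p = ((fst p - org n) / l, snd p)"
definition teeth :: "(real \<times> real) set" where "teeth = (\<Union>n\<in>{1..N}. T n ` Q)"
definition Om :: "(real \<times> real) set" where "Om = interior (Omega_minus b)"
definition \<Omega> :: "(real \<times> real) set" where "\<Omega> = interior (closure (Omega_minus b \<union> teeth))"
definition cell :: "nat \<Rightarrow> real set" where "cell n = {org n<..<org n + L * l}"

lemma oQ: "open Q" and bQ: "bounded Q"
  using lipQ by (auto simp: lipschitz_domain_def)

lemma T_Ti [simp]: "T n (Ti n p) = p" "Ti n (T n p) = p"
  using l by (auto simp: T_def Ti_def prod_eq_iff)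

lemma T_image: "T n ` A = {p. Ti n p \<in> A}"
proof (intro set_eqI iffI)
  fix p assume "p \<in> {p. Ti n p \<in> A}"
  then show "p \<in> T n ` A" by (intro image_eqI[of _ _ "Ti n p"]) auto
qed auto

lemma T_continuous: "continuous_on S (T n)" "continuous_on S (Ti n)"
  unfolding T_def Ti_def using l by (auto intro!: continuous_intros)

lemma open_T_image: "open A \<Longrightarrow> open (T n ` A)"
  unfolding T_image using open_vimage[OF _ T_continuous(2)[of UNIV n], of A] by (simp add: vimage_def)

lemma closure_T_image: "closure (T n ` A) = T n ` closure A"
proof
  have "closed (T n ` closure A)"
    unfolding T_image using closed_vimage[OF _ T_continuous(2)[of UNIV n], of "closure A"] by (simp add: vimage_def)
  then show "closure (T n ` A) \<subseteq> T n ` closure A" by (intro closure_minimal image_mono closure_subset)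
  show "T n ` closure A \<subseteq> closure (T n ` A)"
    by (rule image_closure_subset[OF T_continuous(1)]) (auto simp: closure_subset)
qed

lemma negligible_T_image:
  assumes "negligible A"
  shows "negligible (T n ` A)"
proof (rule negligible_differentiable_image_negligible[OF _ assms])
  have "(T n has_derivative (\<lambda>h. (l * fst h, snd h))) (at p within A)" for p
    unfolding T_def by (auto intro!: derivative_eq_intros)
  then show "T n differentiable_on A" by (auto simp: differentiable_on_def differentiable_def)
qed simp

lemma org_bounds: "n \<in> {1..N} \<Longrightarrow> 0 \<le> org n" "n \<in> {1..N} \<Longrightarrow> org n + L * l \<le> 1"
proof -
  assume n: "n \<in> {1..N}"
  show "0 \<le> org n" using n L l by (auto simp: org_def)
  have "org n + L * l = real n * (L * l)" by (simp add: org_def algebra_simps)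
  also have "\<dots> \<le> real N * (L * l)" using n L l by (intro mult_right_mono) auto
  finally show "org n + L * l \<le> 1" using N1 by (simp add: mult.assoc)
qed

lemma cell_sub: "n \<in> {1..N} \<Longrightarrow> cell n \<subseteq> {0<..<1}"
  using org_bounds[of n] by (auto simp: cell_def)

lemma cell_disjoint_less: "m < n \<Longrightarrow> cell m \<inter> cell n = {}"
proof -
  assume "m < n"
  then have "real m * (L * l) \<le> (real n - 1) * (L * l)" using L l by (intro mult_right_mono) auto
  then have "org m + L * l \<le> org n" by (simp add: org_def algebra_simps)
  then show ?thesis by (auto simp: cell_def)
qed

lemma T_Q_sub: "T n ` Q \<subseteq> cell n \<times> {0<..<G}"
proof
  fix p assume "p \<in> T n ` Q"
  then obtain q where q: "q \<in> Q" "p = T n q" by blast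
  then have "0 < fst q" "fst q < L" "0 < snd q" "snd q < G" using Qsub by auto
  moreover from this have "l * fst q < l * L" "0 < l * fst q" using l by auto
  ultimately show "p \<in> cell n \<times> {0<..<G}" using q(2) by (simp add: T_def cell_def mult.commute)
qed

lemma open_teeth: "open teeth"
  unfolding teeth_def by (intro open_UN ballI open_T_image oQ)

lemma closure_teeth: "closure teeth = (\<Union>n\<in>{1..N}. T n ` closure Q)"
proof
  have c: "closed (T n ` closure Q)" for n using closure_T_image[of n Q] by (metis closed_closure)
  show "closure teeth \<subseteq> (\<Union>n\<in>{1..N}. T n ` closure Q)"
    unfolding teeth_def using closure_subset[of Q] by (intro closure_minimal closed_UN) (auto simp: c)
  show "(\<Union>n\<in>{1..N}. T n ` closure Q) \<subseteq> closure teeth"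
    unfolding closure_T_image[symmetric] teeth_def by (intro UN_least closure_mono UN_upper)
qed

lemma open_Om: "open Om" and open_\<Omega>: "open \<Omega>"
  by (simp_all add: Om_def \<Omega>_def)

lemma Om_sub_minus: "Om \<subseteq> Omega_minus b"
  by (simp add: Om_def interior_subset)

lemma Om_sub_\<Omega>: "Om \<subseteq> \<Omega>"
proof -
  have "Om \<subseteq> closure (Omega_minus b \<union> teeth)"
    using Om_sub_minus closure_subset[of "Omega_minus b \<union> teeth"] by blast
  then show ?thesis unfolding \<Omega>_def using open_Om by (rule interior_maximal)
qed

lemma teeth_sub_\<Omega>: "teeth \<subseteq> \<Omega>"
  unfolding \<Omega>_def using open_teeth closure_subset[of "Omega_minus b \<union> teeth"] by (intro interior_maximal) auto

lemma tooth_sub_\<Omega>: "n \<in> {1..N} \<Longrightarrow> T n ` Q \<subseteq> \<Omega>"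
  using teeth_sub_\<Omega> unfolding teeth_def by blast

lemma b01: "b0 \<le> b1"
  using b[of "1/2"] by simp

lemma minus_sub: "Omega_minus b \<subseteq> {0<..<1} \<times> {-b1<..<0}"
  using b by (force simp: Omega_minus_def)

lemma \<Omega>_sub: "\<Omega> \<subseteq> {0<..<1} \<times> {-b1<..<G}"
proof -
  have "Omega_minus b \<subseteq> {0..1} \<times> {-b1..G}" using minus_sub G by force
  moreover have "teeth \<subseteq> {0..1} \<times> {-b1..G}"
  proof
    fix p assume "p \<in> teeth"
    then obtain n where n: "n \<in> {1..N}" "p \<in> T n ` Q" by (auto simp: teeth_def)
    then have "p \<in> cell n \<times> {0<..<G}" using T_Q_sub by blast
    then show "p \<in> {0..1} \<times> {-b1..G}" using cell_sub[OF n(1)] b01 b0 by force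
  qed
  ultimately have "closure (Omega_minus b \<union> teeth) \<subseteq> {0..1} \<times> {-b1..G}"
    by (intro closure_minimal closed_Times) auto
  then have "\<Omega> \<subseteq> interior ({0..1} \<times> {-b1..G})" unfolding \<Omega>_def by (rule interior_mono)
  then show ?thesis by (simp add: interior_Times)
qed

lemma Om_rect: "{0<..<1} \<times> {-b0<..<0} \<subseteq> Om"
  unfolding Om_def using b by (intro interior_maximal open_Times) (force simp: Omega_minus_def)+

text \<open>Above height -b0 the point lies in the rectangle of \<open>Om_rect\<close>. Below that
  height the path has moved upwards, and a ball inside \<open>Omega_minus b\<close> can be moved up
  with it, because the base is bounded below by a graph; the radius \<open>b0\<close> keeps the ball
  under the axis.\<close>

lemma Om_vertical:
  assumes p: "(x, y) \<in> Om" and y': "-b0 < y'" "y' < 0" and t: "0 \<le> t" "t \<le> 1"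
  shows "(x, y + t * (y' - y)) \<in> Om"
proof -
  define z where "z = y + t * (y' - y)"
  have xy: "0 < x" "x < 1" "y < 0" using p Om_sub_minus by (auto simp: Omega_minus_def)
  have zz: "z = (1 - t) * y + t * y'" by (simp add: z_def algebra_simps)
  show ?thesis
  proof (cases "-b0 < z")
    case True
    have "z < 0"
    proof (cases "t = 0")
      case True
      then show ?thesis using xy by (simp add: z_def)
    next
      case False
      then have "t * y' < 0" "(1 - t) * y \<le> 0" using t y' xy by (auto simp: mult_pos_neg mult_nonneg_nonpos)
      then show ?thesis unfolding zz by linarith
    qed
    then show ?thesis using True Om_rect xy by (force simp: z_def[symmetric])
  next
    case False
    have yz: "y \<le> z"
    proof (rule ccontr)
      assume "\<not> y \<le> z"
      then have "t * (y' - y) < 0" by (simp add: z_def)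
      then have "y' < y" using t by (metis mult_nonneg_nonneg diff_ge_0_iff_ge not_less)
      then have "(1 - t) * y \<ge> (1 - t) * y'" using t by (intro mult_left_mono) auto
      then have "z \<ge> y'" unfolding zz by (simp add: algebra_simps)
      then show False using False y' by simp
    qed
    obtain r where r: "r > 0" "ball (x, y) r \<subseteq> Omega_minus b" using p unfolding Om_def mem_interior by blast
    have "ball (x, z) (min r b0) \<subseteq> Omega_minus b"
    proof
      fix q assume q: "q \<in> ball (x, z) (min r b0)"
      define q' where "q' = q - (0, z - y)"
      have "dist (x, y) q' = dist (x, z) q" by (simp add: q'_def dist_prod_def dist_real_def algebra_simps)
      then have "q' \<in> ball (x, y) r" using q by simp
      then have "q' \<in> Omega_minus b" using r by blast
      then have 1: "0 < fst q" "fst q < 1" "- b (fst q) < snd q - (z - y)" by (auto simp: q'_def Omega_minus_def split_beta)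
      have "\<bar>z - snd q\<bar> \<le> dist (x, z) q" using dist_snd_le[of "(x, z)" q] by (simp add: dist_real_def)
      then have "snd q < z + b0" using q by auto
      then have "snd q < 0" using False by simp
      moreover have "- b (fst q) < snd q" using 1 yz by linarith
      ultimately show "q \<in> Omega_minus b" using 1 by (auto simp: Omega_minus_def split_beta)
    qed
    then show ?thesis using r(1) b0 unfolding Om_def mem_interior z_def[symmetric] by (intro exI[of _ "min r b0"]) auto
  qed
qed

text \<open>What the closure adds lies on the axis, on finitely many vertical lines, or on the graph
  of -b over points of differentiability. Each of these is a null set.\<close>

lemma closure_minus_negligible: "negligible (closure (Omega_minus b) - Om)"
proof -
  obtain S where S: "finite S" "b C1_differentiable_on ({0<..<1} - S)" using pw by (auto simp: piecewise_C1_01_def)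
  let ?U = "{0<..<1} - S"
  have oU: "open ?U" using S(1) by (intro open_Diff finite_imp_closed) auto
  have db: "b differentiable (at x)" if "x \<in> ?U" for x
    using S(2) that unfolding C1_differentiable_on_def by (auto simp: differentiable_def has_vector_derivative_def)
  then have cb: "continuous_on ?U b"
    by (intro continuous_at_imp_continuous_on ballI differentiable_imp_continuous_within)
  have n1: "negligible {p :: real \<times> real. fst p = c}" for c
    using negligible_hyperplane[of "(1, 0) :: real \<times> real" c] by (simp add: inner_prod_def zero_prod_def)
  have n2: "negligible {p :: real \<times> real. snd p = c}" for c
    using negligible_hyperplane[of "(0, 1) :: real \<times> real" c] by (simp add: inner_prod_def zero_prod_def)
  have n3: "negligible (\<Union>c\<in>insert 0 (insert 1 S). {p :: real \<times> real. fst p = c})"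
    using S(1) n1 by (intro negligible_Union) auto
  have n4: "negligible ((\<lambda>p. (fst p, - b (fst p))) ` (?U \<times> {0::real}))"
  proof (rule negligible_differentiable_image_negligible)
    show "negligible (?U \<times> {0::real})" by (rule negligible_subset[OF n2[of 0]]) auto
    show "(\<lambda>p. (fst p, - b (fst p))) differentiable_on ?U \<times> {0::real}"
      unfolding differentiable_on_def
    proof
      fix p :: "real \<times> real" assume "p \<in> ?U \<times> {0}"
      then have "b differentiable (at (fst p))" using db by auto
      then have "(\<lambda>p. b (fst p)) differentiable (at p)"
        using differentiable_chain_at[of fst p b] by (simp add: o_def bounded_linear_fst bounded_linear_imp_differentiable)
      then have "(\<lambda>p. (fst p, - b (fst p))) differentiable (at p)"
        by (intro differentiable_Pair[OF bounded_linear_imp_differentiable[OF bounded_linear_fst]] differentiable_minus)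
      then show "(\<lambda>p. (fst p, - b (fst p))) differentiable (at p within ?U \<times> {0})" by (rule differentiable_at_withinI)
    qed
  qed auto
  have "closure (Omega_minus b) - Om \<subseteq> (\<Union>c\<in>insert 0 (insert 1 S). {p :: real \<times> real. fst p = c}) \<union> {p. snd p = 0}
     \<union> (\<lambda>p. (fst p, - b (fst p))) ` (?U \<times> {0::real})"
  proof
    fix p assume p: "p \<in> closure (Omega_minus b) - Om"
    obtain x y where xy: "p = (x, y)" by fastforce
    have "closure (Omega_minus b) \<subseteq> {0..1} \<times> {-b1..0}"
      by (rule closure_minimal) (use minus_sub in \<open>force intro!: closed_Times\<close>)+
    then have r: "0 \<le> x" "x \<le> 1" "y \<le> 0" using p xy by auto
    show "p \<in> (\<Union>c\<in>insert 0 (insert 1 S). {p :: real \<times> real. fst p = c}) \<union> {p. snd p = 0}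
     \<union> (\<lambda>p. (fst p, - b (fst p))) ` (?U \<times> {0::real})"
    proof (cases "x \<in> insert 0 (insert 1 S) \<or> y = 0 \<or> y = - b x")
      case True
      show ?thesis
      proof (cases "x \<in> insert 0 (insert 1 S) \<or> y = 0")
        case True
        then show ?thesis using xy by auto
      next
        case False
        then have "x \<in> ?U" "y = - b x" using \<open>x \<in> insert 0 (insert 1 S) \<or> y = 0 \<or> y = - b x\<close> r by auto
        then show ?thesis using xy by (intro UnI2 image_eqI[of _ _ "(x, 0)"]) auto
      qed
    next
      case False
      then have x: "x \<in> ?U" "y < 0" "y \<noteq> - b x" using r by auto
      have cf: "continuous_on (?U \<times> UNIV) (\<lambda>q :: real \<times> real. snd q + b (fst q))"
        by (intro continuous_intros continuous_on_compose2[OF cb]) auto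
      have oUU: "open (?U \<times> (UNIV :: real set))" by (intro open_Times oU) auto
      show ?thesis
      proof (cases "- b x < y")
        case True
        define V where "V = (?U \<times> UNIV) \<inter> (\<lambda>q :: real \<times> real. snd q + b (fst q)) -` {0<..} \<inter> {q. snd q < 0}"
        have "open {q :: real \<times> real. snd q < 0}" by (intro open_Collect_less continuous_intros)
        then have "open V" unfolding V_def
          by (rule open_Int[OF continuous_open_preimage[OF cf oUU open_greaterThan]])
        moreover have "V \<subseteq> Omega_minus b" by (auto simp: V_def Omega_minus_def)
        moreover have "p \<in> V" using True x xy by (simp add: V_def)
        ultimately have "p \<in> Om" unfolding Om_def using interiorI by blast
        then show ?thesis using p by simp
      next
        case F: False
        define V where "V = (?U \<times> UNIV) \<inter> (\<lambda>q :: real \<times> real. snd q + b (fst q)) -` {..<0}"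
        have "open V" unfolding V_def by (intro continuous_open_preimage[OF cf oUU]) auto
        moreover have "V \<inter> Omega_minus b = {}" by (auto simp: V_def Omega_minus_def)
        moreover have "p \<in> V" using F x xy by (auto simp: V_def)
        ultimately have "p \<notin> closure (Omega_minus b)" using open_Int_closure_eq_empty by blast
        then show ?thesis using p by simp
      qed
    qed
  qed
  then show ?thesis by (rule negligible_subset[rotated]) (intro negligible_Un n2 n3 n4)
qed

text \<open>Taking closure and interior changes the sets only within frontiers of measure zero.
  Integrals over \<Omega> therefore split into base and teeth.\<close>

lemma \<Omega>_AE: "AE p in lebesgue. p \<in> \<Omega> \<longleftrightarrow> p \<in> Om \<union> teeth"
  and minus_AE: "AE p in lebesgue. p \<in> Omega_minus b \<longleftrightarrow> p \<in> Om"
proof -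
  have "negligible (closure (Omega_minus b) - Om \<union> (\<Union>n\<in>{1..N}. T n ` frontier Q))"
    by (intro negligible_Un closure_minus_negligible negligible_Union)
      (auto intro!: negligible_T_image lipschitz_domain_negligible_frontier[OF lipQ])
  then have ae: "AE p in lebesgue. p \<notin> closure (Omega_minus b) - Om \<union> (\<Union>n\<in>{1..N}. T n ` frontier Q)"
    by (simp only: negligible_iff_null_sets AE_not_in)
  have sub: "\<Omega> \<subseteq> closure (Omega_minus b) \<union> closure teeth"
    unfolding \<Omega>_def using interior_subset by (metis closure_Un)
  have fr: "closure Q = Q \<union> frontier Q" using oQ closure_Un_frontier by blast
  show "AE p in lebesgue. p \<in> \<Omega> \<longleftrightarrow> p \<in> Om \<union> teeth"
    using ae
  proof eventually_elim
    case (elim p)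
    have "p \<in> Om \<union> teeth" if p\<Omega>: "p \<in> \<Omega>"
    proof (cases "p \<in> closure (Omega_minus b)")
      case True
      then show ?thesis using elim by blast
    next
      case False
      then obtain n where "n \<in> {1..N}" "p \<in> T n ` (Q \<union> frontier Q)" using p\<Omega> sub closure_teeth fr by auto
      then show ?thesis using elim unfolding teeth_def by blast
    qed
    then show ?case using Om_sub_\<Omega> teeth_sub_\<Omega> by blast
  qed
  show "AE p in lebesgue. p \<in> Omega_minus b \<longleftrightarrow> p \<in> Om"
    using ae by eventually_elim (use Om_sub_minus closure_subset[of "Omega_minus b"] in blast)
qed

lemma Om_teeth_disjoint: "Om \<inter> teeth = {}"
  using Om_sub_minus T_Q_sub by (force simp: teeth_def Omega_minus_def)

lemma measurable_sets: "\<Omega> \<in> sets lebesgue" "Om \<in> sets lebesgue" "teeth \<in> sets lebesgue" "T n ` Q \<in> sets lebesgue"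
  using open_\<Omega> open_Om open_teeth open_T_image[OF oQ, of n] by auto

lemma \<Omega>_bounded: "bounded \<Omega>"
proof -
  have "bounded ({0<..<1::real} \<times> {-b1<..<G})"
    by (rule bounded_subset[OF bounded_cbox[of "(0, -b1)" "(1, G)"]]) (auto simp: cbox_Pair_eq box_real)
  then show ?thesis using \<Omega>_sub bounded_subset by blast
qed

lemma \<Omega>_lm: "\<Omega> \<in> lmeasurable" and Om_lm: "Om \<in> lmeasurable"
  using \<Omega>_bounded open_\<Omega> open_Om Om_sub_\<Omega> bounded_subset by (auto intro!: bounded_set_imp_lmeasurable)

lemma Omega_above: "p \<in> \<Omega> \<Longrightarrow> snd p > 0 \<Longrightarrow> \<exists>n\<in>{1..N}. p \<in> T n ` closure Q"
proof -
  assume p: "p \<in> \<Omega>" "snd p > 0"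
  have "closure (Omega_minus b) \<subseteq> UNIV \<times> {..0}"
    by (rule closure_minimal) (use minus_sub in \<open>force intro!: closed_Times\<close>)+
  then have "p \<notin> closure (Omega_minus b)" using p(2) by auto
  moreover have "p \<in> closure (Omega_minus b) \<union> closure teeth"
    using p(1) interior_subset unfolding \<Omega>_def by (metis closure_Un subsetD)
  ultimately show ?thesis by (auto simp: closure_teeth)
qed

text \<open>A base box places a rectangle of the tooth directly above a rectangle of the base. The
  segment between them lies in the closure of the lower one, so the whole open rectangle is interior
  to the closure of the union: here the tooth is joined to the base.\<close>

lemma glue:
  assumes n: "n \<in> {1..N}" and z: "z \<in> base_boxes b0 Q"
  defines "J \<equiv> {org n + l * (fst z - snd z)<..<org n + l * (fst z + snd z)}"
  shows "T n ` base_box z = J \<times> {0<..<snd z}" "J \<times> {- snd z<..<0} \<subseteq> Om" "J \<times> {- snd z<..<snd z} \<subseteq> \<Omega>" "J \<subseteq> cell n"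
proof -
  have z': "0 < snd z" "snd z \<le> b0" "base_box z \<subseteq> Q" using z by (auto simp: base_boxes_def)
  show im: "T n ` base_box z = J \<times> {0<..<snd z}"
    unfolding T_image using l by (auto simp: base_box_def J_def Ti_def field_simps)
  then have JQ: "J \<times> {0<..<snd z} \<subseteq> T n ` Q" using z'(3) by (metis image_mono)
  show J: "J \<subseteq> cell n"
  proof
    fix x assume "x \<in> J"
    then have "(x, snd z / 2) \<in> T n ` Q" using JQ z'(1) by auto
    then show "x \<in> cell n" using T_Q_sub by blast
  qed
  show low: "J \<times> {- snd z<..<0} \<subseteq> Om"
    using J cell_sub[OF n] Om_rect z' by (fastforce simp: subset_iff)
  have "J \<times> {- snd z<..<snd z} \<subseteq> closure (Omega_minus b \<union> teeth)"
  proof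
    fix p assume p: "p \<in> J \<times> {- snd z<..<snd z}"
    have "p \<in> closure (J \<times> {- snd z<..<0})" if "snd p \<le> 0"
      using p that z'(1) closure_greaterThanLessThan[of "- snd z" 0]
      by (auto simp: closure_Times intro: subsetD[OF closure_subset])
    moreover have "closure (J \<times> {- snd z<..<0}) \<subseteq> closure (Omega_minus b \<union> teeth)"
      using low Om_sub_minus by (intro closure_mono) blast
    moreover have "p \<in> teeth" if "snd p > 0"
      using p that JQ n by (force simp: teeth_def mem_Times_iff)
    moreover have "teeth \<subseteq> closure (Omega_minus b \<union> teeth)" using closure_subset by blast
    ultimately show "p \<in> closure (Omega_minus b \<union> teeth)" by (metis linorder_not_le subsetD)
  qed
  then show "J \<times> {- snd z<..<snd z} \<subseteq> \<Omega>"
    unfolding \<Omega>_def by (intro interior_maximal open_Times) (auto simp: J_def)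
qed

lemma measure_\<Omega>: "measure lebesgue \<Omega> \<le> b1 + G"
proof -
  have "measure lebesgue \<Omega> \<le> measure lebesgue (cbox (0 :: real, - b1) (1, G))"
  proof (rule measure_mono_fmeasurable[OF _ measurable_sets(1) lmeasurable_cbox])
    show "\<Omega> \<subseteq> cbox (0, - b1) (1, G)" using \<Omega>_sub by (auto simp: cbox_Pair_eq box_real)
  qed
  also have "\<dots> = b1 + G" using b0 b01 G by (simp add: content_Pair)
  finally show ?thesis .
qed

section \<open>Scaling of a tooth and the estimate on the teeth\<close>

text \<open>A change of variables with Jacobian \<open>l\<close>.\<close>

lemma L2_T:
  assumes "u \<in> L2 (T n ` A)"
  shows "(\<lambda>q. u (T n q)) \<in> L2 A" "L2_norm (T n ` A) u = sqrt l * L2_norm A (\<lambda>q. u (T n q))"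
proof -
  define c where "c j = (if j = (1, 0) then l else 1)" for j :: "real \<times> real"
  have c: "c j \<noteq> 0" if "j \<in> Basis" for j using l by (simp add: c_def)
  have T: "(org n, 0) + (\<Sum>j\<in>Basis. (c j * (x \<bullet> j)) *\<^sub>R j) = T n x" for x
    unfolding Basis_real_prod by (simp add: c_def T_def inner_prod_def)
  have pr: "(\<Prod>j\<in>Basis. \<bar>c j\<bar>) = l" unfolding Basis_real_prod using l by (simp add: c_def)
  let ?f = "restr (T n ` A) u"
  have f: "?f \<in> borel_measurable lebesgue" "(\<lambda>x. (?f x)\<^sup>2) \<in> borel_measurable lebesgue" using L2_measurable[OF assms] by simp_all
  have "T n x \<in> T n ` A \<longleftrightarrow> x \<in> A" for x unfolding T_image by simp
  then have e: "?f (T n x) = restr A (\<lambda>q. u (T n q)) x" for x by (simp add: restr_def)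
  note m = lebesgue_integral_affine[of c ?f "(org n, 0)", OF c f(1), unfolded T e]
    and m2 = lebesgue_integral_affine[of c "\<lambda>x. (?f x)\<^sup>2" "(org n, 0)", OF c f(2), unfolded T e pr]
  show "(\<lambda>q. u (T n q)) \<in> L2 A" using m(1) m2(2) assms by (simp add: L2_iff)
  show "L2_norm (T n ` A) u = sqrt l * L2_norm A (\<lambda>q. u (T n q))"
    using m2(3) by (simp add: L2_norm_restr real_sqrt_mult)
qed

lemma cell_disjoint: "m \<noteq> n \<Longrightarrow> cell m \<inter> cell n = {}"
proof -
  assume "m \<noteq> n"
  then consider "m < n" | "n < m" by linarith
  then show ?thesis
  proof cases
    case 1
    then show ?thesis by (rule cell_disjoint_less)
  next
    case 2
    from cell_disjoint_less[OF this] show ?thesis by (subst Int_commute)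
  qed
qed

lemma teeth_pairwise_disjoint: "m \<noteq> n \<Longrightarrow> T m ` Q \<inter> T n ` Q = {}"
proof -
  assume "m \<noteq> n"
  have "T m ` Q \<inter> T n ` Q \<subseteq> (cell m \<times> {0<..<G}) \<inter> (cell n \<times> {0<..<G})" by (intro Int_mono T_Q_sub)
  also have "\<dots> = {}" using cell_disjoint[OF \<open>m \<noteq> n\<close>] by (simp add: Times_Int_Times)
  finally show ?thesis by simp
qed

lemma T_Q_strip: "T n ` Q \<subseteq> cell n \<times> UNIV"
  by (rule order_trans[OF T_Q_sub]) auto

lemma Q_lm: "Q \<in> lmeasurable"
  using oQ bQ by (simp add: bounded_set_imp_lmeasurable)

lemma T_Q_lm: "n \<in> {1..N} \<Longrightarrow> T n ` Q \<in> lmeasurable"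
  by (rule fmeasurableI2[OF \<Omega>_lm tooth_sub_\<Omega> measurable_sets(4)])

lemma measure_T_Q: "n \<in> {1..N} \<Longrightarrow> measure lebesgue (T n ` Q) = l * measure lebesgue Q"
proof -
  assume "n \<in> {1..N}"
  note lm = T_Q_lm[OF this]
  have "sqrt (measure lebesgue (T n ` Q)) = sqrt l * sqrt (measure lebesgue Q)"
    using L2_T(2)[OF L2_one(1)[OF lm]] L2_one(2)[OF lm] L2_one(2)[OF Q_lm] by simp
  then show ?thesis by (simp add: real_sqrt_mult[symmetric])
qed

text \<open>A vector (e1, e2) of the cell becomes (l e1, e2) on the tooth. The x-derivative, for
  which only boundedness is available later, therefore enters with the small factor
  \<open>l\<close>; the division by \<open>sqrt l\<close> is the scaling of the L2 norm.\<close>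

lemma incr_bounded_tooth:
  assumes n: "n \<in> {1..N}" and p: "p \<in> L2 \<Omega>" "weak_deriv \<Omega> (1, 0) p p1" "weak_deriv \<Omega> (0, 1) p p2"
  shows "incr_bounded Q (\<lambda>q. p (T n q)) ((l * L2_norm (T n ` Q) p1 + L2_norm (T n ` Q) p2) / sqrt l)"
proof -
  let ?TQ = "T n ` Q"
  have oT: "open ?TQ" and sub: "?TQ \<subseteq> \<Omega>" using open_T_image[OF oQ] tooth_sub_\<Omega>[OF n] by auto
  have pT: "p \<in> L2 ?TQ" using L2_subset(1)[OF p(1) sub measurable_sets(4)] .
  have w1: "weak_deriv ?TQ (1, 0) p p1" and w2: "weak_deriv ?TQ (0, 1) p p2"
    using weak_deriv_subset[OF p(2) sub oT] weak_deriv_subset[OF p(3) sub oT] by auto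
  have p12: "p1 \<in> L2 ?TQ" "p2 \<in> L2 ?TQ" using w1 w2 weak_derivD(1) by auto
  show ?thesis unfolding incr_bounded_def
  proof (intro conjI allI impI)
    show "0 \<le> (l * L2_norm ?TQ p1 + L2_norm ?TQ p2) / sqrt l" using l by simp
    show "(\<lambda>q. p (T n q)) \<in> L2 Q" by (rule L2_T(1)[OF pT])
    fix A e assume A: "open A \<and> (\<forall>x\<in>A. \<forall>t. 0 \<le> t \<and> t \<le> 1 \<longrightarrow> x + t *\<^sub>R e \<in> Q)"
    define e' where "e' = (l * fst e, snd e)"
    have Te: "T n (x + t *\<^sub>R e) = T n x + t *\<^sub>R e'" for x t
      by (simp add: T_def e'_def prod_eq_iff algebra_simps)
    have oTA: "open (T n ` A)" using A open_T_image by blast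
    have "weak_deriv ?TQ ((l * fst e) *\<^sub>R (1, 0) + snd e *\<^sub>R (0, 1)) p (\<lambda>x. (l * fst e) * p1 x + snd e * p2 x)"
      by (rule weak_deriv_direction[OF oT pT w1 w2])
    then have wd: "weak_deriv ?TQ e' p (\<lambda>x. (l * fst e) * p1 x + snd e * p2 x)" by (simp add: e'_def)
    have sw: "x + t *\<^sub>R e' \<in> ?TQ" if "x \<in> T n ` A" "0 \<le> t" "t \<le> 1" for x t
    proof -
      from that obtain y where y: "y \<in> A" "x = T n y" by blast
      then show ?thesis using A that Te[of y t] by (metis imageI)
    qed
    note inc = L2_norm_increment_le[OF oT pT wd oTA sw]
    have ATQ: "T n ` A \<subseteq> ?TQ" using sw[of _ 0] by auto
    have pA: "p \<in> L2 (T n ` A)" using L2_subset(1)[OF pT ATQ] oTA by auto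
    have eq: "p (T n x + e') = p (T n (x + e))" for x using Te[of x 1] by simp
    show "(\<lambda>x. p (T n (x + e))) \<in> L2 A" using L2_T(1)[OF inc(1)] by (simp add: eq)
    have "sqrt l * L2_norm A (\<lambda>x. p (T n (x + e)) - p (T n x)) = L2_norm (T n ` A) (\<lambda>x. p (x + e') - p x)"
      using L2_T(2)[OF L2_diff[OF inc(1) pA]] by (simp add: eq)
    also have "\<dots> \<le> L2_norm ?TQ (\<lambda>x. (l * fst e) * p1 x + snd e * p2 x)" by (rule inc(2))
    also have "\<dots> \<le> \<bar>l * fst e\<bar> * L2_norm ?TQ p1 + \<bar>snd e\<bar> * L2_norm ?TQ p2"
      using L2_norm_triangle[OF L2_cmult[OF p12(1)] L2_cmult[OF p12(2)]] by (simp add: L2_norm_cmult)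
    also have "\<dots> \<le> norm e * (l * L2_norm ?TQ p1 + L2_norm ?TQ p2)"
    proof -
      have ne: "\<bar>fst e\<bar> \<le> norm e" "\<bar>snd e\<bar> \<le> norm e"
        using norm_fst_le[of "fst e" "snd e"] norm_snd_le[of "snd e" "fst e"] by auto
      have "\<bar>l * fst e\<bar> * L2_norm ?TQ p1 \<le> norm e * (l * L2_norm ?TQ p1)"
        using mult_right_mono[OF ne(1), of "l * L2_norm ?TQ p1"] l by (simp add: abs_mult mult_ac)
      moreover have "\<bar>snd e\<bar> * L2_norm ?TQ p2 \<le> norm e * L2_norm ?TQ p2" using ne(2) by (intro mult_right_mono) auto
      ultimately show ?thesis by (simp add: algebra_simps)
    qed
    finally show "L2_norm A (\<lambda>x. p (T n (x + e)) - p (T n x)) \<le> norm e * ((l * L2_norm ?TQ p1 + L2_norm ?TQ p2) / sqrt l)"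
      using l by (simp add: field_simps)
  qed
qed

text \<open>The inequality of the cell is applied to each tooth. The norms over the base boxes are
  transferred to the base by a vertical shift through the joining rectangles, at the price of the
  y-derivative, and the results are summed over the cells.\<close>

lemma teeth_estimate:
  assumes P: "finite P" "P \<subseteq> base_boxes b0 Q" "0 \<le> C"
    and PI: "\<And>v D. incr_bounded Q v D \<Longrightarrow> L2_norm Q v \<le> C * (D + (\<Sum>z\<in>P. L2_norm (base_box z) v))"
    and p: "p \<in> L2 \<Omega>" "weak_deriv \<Omega> (1, 0) p p1" "weak_deriv \<Omega> (0, 1) p p2"
  shows "L2_norm teeth p \<le> 2 * (C * (1 + card P * (1 + b0))) * (l * L2_norm \<Omega> p1 + L2_norm \<Omega> p2 + L2_norm Om p)"
proof -
  define K where "K = C * (1 + card P * (1 + b0))"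
  have K0: "K \<ge> 0" using P(3) b0 by (simp add: K_def)
  \<comment> \<open>The parts of \<Omega> and of the base over one cell. They are disjoint for
    different cells, so the squared estimates for single teeth add up without a factor
    \<open>N\<close>.\<close>
  define Cn where "Cn n = \<Omega> \<inter> cell n \<times> UNIV" for n
  define Mn where "Mn n = Om \<inter> cell n \<times> UNIV" for n
  have oc: "open (cell n \<times> (UNIV :: real set))" for n by (intro open_Times) (auto simp: cell_def)
  have meas: "Cn n \<in> sets lebesgue" "Mn n \<in> sets lebesgue" for n
    using open_Int[OF open_\<Omega> oc, of n] open_Int[OF open_Om oc, of n] by (auto simp: Cn_def Mn_def)
  have p12: "p1 \<in> L2 \<Omega>" "p2 \<in> L2 \<Omega>" using p weak_derivD(1) by auto
  have pOm: "p \<in> L2 Om" using L2_subset(1)[OF p(1) Om_sub_\<Omega> measurable_sets(2)] .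
  have pC: "p \<in> L2 (Cn n)" "p1 \<in> L2 (Cn n)" "p2 \<in> L2 (Cn n)" "p \<in> L2 (Mn n)" for n
    using L2_subset(1)[OF p(1) _ meas(1)] L2_subset(1)[OF p12(1) _ meas(1)] L2_subset(1)[OF p12(2) _ meas(1)]
      L2_subset(1)[OF pOm _ meas(2)] by (auto simp: Cn_def Mn_def)
  have tooth: "L2_norm (T n ` Q) p \<le> K * (l * L2_norm (Cn n) p1 + L2_norm (Cn n) p2 + L2_norm (Mn n) p)" if n: "n \<in> {1..N}" for n
  proof -
    let ?TQ = "T n ` Q"
    have sub: "?TQ \<subseteq> Cn n" unfolding Cn_def by (intro Int_greatest tooth_sub_\<Omega>[OF n] T_Q_strip)
    have TQ: "L2_norm ?TQ p1 \<le> L2_norm (Cn n) p1" "L2_norm ?TQ p2 \<le> L2_norm (Cn n) p2"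
      using L2_subset(2)[OF pC(2) sub measurable_sets(4)] L2_subset(2)[OF pC(3) sub measurable_sets(4)] by auto
    have pT: "p \<in> L2 ?TQ" using L2_subset(1)[OF pC(1) sub measurable_sets(4)] .
    have box: "L2_norm (T n ` base_box z) p \<le> L2_norm (Mn n) p + b0 * L2_norm (Cn n) p2" if z: "z \<in> P" for z
    proof -
      have zb: "z \<in> base_boxes b0 Q" using z P(2) by blast
      then have z': "0 < snd z" "snd z \<le> b0" by (auto simp: base_boxes_def)
      define J where "J = {org n + l * (fst z - snd z)<..<org n + l * (fst z + snd z)}"
      note g = glue[OF n zb, folded J_def]
      let ?R = "J \<times> {- snd z<..<snd z}" and ?A = "J \<times> {0<..<snd z}" and ?B = "J \<times> {- snd z<..<0}"
      have o: "open ?R" "open ?A" "open ?B" unfolding J_def by (intro open_Times open_greaterThanLessThan)+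
      have RC: "?R \<subseteq> Cn n" "?B \<subseteq> Mn n" using g by (auto simp: Cn_def Mn_def)
      have pR: "p \<in> L2 ?R" "p \<in> L2 ?B" "p \<in> L2 ?A"
        using L2_subset(1)[OF p(1) g(3)] L2_subset(1)[OF pOm g(2)] o L2_subset(1)[OF L2_subset(1)[OF p(1) g(3)], of ?A] by force+
      have "weak_deriv ?R (- snd z *\<^sub>R (0, 1) + 0 *\<^sub>R (0, 1)) p (\<lambda>x. - snd z * p2 x + 0 * p2 x)"
        by (rule weak_deriv_direction[OF o(1) pR(1)]) (rule weak_deriv_subset[OF p(3) g(3) o(1)])+
      then have wd: "weak_deriv ?R (0, - snd z) p (\<lambda>x. - snd z * p2 x)" by simp
      have sw: "x + t *\<^sub>R (0, - snd z) \<in> ?R" if "x \<in> ?A" "0 \<le> t" "t \<le> 1" for x t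
      proof -
        have "0 \<le> t * snd z" "t * snd z \<le> snd z" using that z' by (auto simp: mult_left_le_one_le)
        moreover have "0 < snd x" "snd x < snd z" "fst x \<in> J" using that(1) by auto
        ultimately have "- snd z < snd x - t * snd z" "snd x - t * snd z < snd z" "fst x \<in> J" by linarith+
        then show ?thesis by (simp add: mem_Times_iff)
      qed
      \<comment> \<open>The upper rectangle is shifted down by its height \<open>snd z\<close> onto
        the lower one.\<close>
      note inc = L2_norm_increment_le[OF o(1) pR(1) wd o(2) sw]
      have "L2_norm ?A p \<le> L2_norm ?A (\<lambda>x. p (x + (0, - snd z))) + L2_norm ?A (\<lambda>x. p (x + (0, - snd z)) - p x)"
        using L2_norm_triangle_diff[OF inc(1) L2_diff[OF inc(1) pR(3)]] by simp
      also have "L2_norm ?A (\<lambda>x. p (x + (0, - snd z))) \<le> L2_norm ?B p"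
        by (rule L2_norm_translate_set[OF pR(2)]) (use o in auto)
      also have "L2_norm ?A (\<lambda>x. p (x + (0, - snd z)) - p x) \<le> snd z * L2_norm ?R p2"
        using inc(2) z' L2_norm_cmult[of ?R "- snd z" p2] by simp
      also have "L2_norm ?B p \<le> L2_norm (Mn n) p" using L2_subset(2)[OF pC(4) RC(2)] o by auto
      also have "snd z * L2_norm ?R p2 \<le> b0 * L2_norm (Cn n) p2"
        using L2_subset(2)[OF pC(3) RC(1)] o z' by (intro mult_mono) auto
      finally show ?thesis using g(1) by simp
    qed
    have boxL: "base_box z \<subseteq> Q" if "z \<in> P" for z using P(2) that by (auto simp: base_boxes_def)
    have sl: "sqrt l > 0" using l by simp
    have "L2_norm ?TQ p = sqrt l * L2_norm Q (\<lambda>q. p (T n q))" by (rule L2_T(2)[OF pT])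
    also have "\<dots> \<le> sqrt l * (C * ((l * L2_norm ?TQ p1 + L2_norm ?TQ p2) / sqrt l + (\<Sum>z\<in>P. L2_norm (base_box z) (\<lambda>q. p (T n q)))))"
      using PI[OF incr_bounded_tooth[OF n p]] sl by (intro mult_left_mono) auto
    also have "\<dots> = C * ((l * L2_norm ?TQ p1 + L2_norm ?TQ p2) + (\<Sum>z\<in>P. sqrt l * L2_norm (base_box z) (\<lambda>q. p (T n q))))"
    proof -
      have "r * (C * (X / r + S)) = C * (X + r * S)" if "r > 0" for r X S :: real
        using that by (simp add: field_simps)
      from this[OF sl] show ?thesis unfolding sum_distrib_left[symmetric] .
    qed
    also have "(\<Sum>z\<in>P. sqrt l * L2_norm (base_box z) (\<lambda>q. p (T n q))) = (\<Sum>z\<in>P. L2_norm (T n ` base_box z) p)"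
    proof (rule sum.cong)
      fix z assume z: "z \<in> P"
      have "p \<in> L2 (T n ` base_box z)"
        using L2_subset(1)[OF pT, of "T n ` base_box z"] boxL[OF z] open_T_image[OF open_base_box, of n z] by (auto intro: image_mono)
      then show "sqrt l * L2_norm (base_box z) (\<lambda>q. p (T n q)) = L2_norm (T n ` base_box z) p" using L2_T(2) by simp
    qed simp
    also have "C * ((l * L2_norm ?TQ p1 + L2_norm ?TQ p2) + (\<Sum>z\<in>P. L2_norm (T n ` base_box z) p))
        \<le> C * ((l * L2_norm (Cn n) p1 + L2_norm (Cn n) p2) + (\<Sum>z\<in>P. L2_norm (Mn n) p + b0 * L2_norm (Cn n) p2))"
      using TQ l box by (intro mult_left_mono[OF _ P(3)] add_mono sum_mono mult_left_mono) auto
    also have "\<dots> = C * (l * L2_norm (Cn n) p1 + (1 + card P * b0) * L2_norm (Cn n) p2 + card P * L2_norm (Mn n) p)"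
      by (simp add: algebra_simps)
    also have "\<dots> \<le> C * ((1 + card P * (1 + b0)) * (l * L2_norm (Cn n) p1) + (1 + card P * (1 + b0)) * L2_norm (Cn n) p2 + (1 + card P * (1 + b0)) * L2_norm (Mn n) p)"
    proof -
      have "l * L2_norm (Cn n) p1 \<le> (1 + card P * (1 + b0)) * (l * L2_norm (Cn n) p1)"
        using mult_right_mono[of 1 "1 + card P * (1 + b0)" "l * L2_norm (Cn n) p1"] l b0 by simp
      moreover have "(1 + card P * b0) * L2_norm (Cn n) p2 \<le> (1 + card P * (1 + b0)) * L2_norm (Cn n) p2"
        using b0 by (intro mult_right_mono) (auto simp: algebra_simps)
      moreover have "card P * L2_norm (Mn n) p \<le> (1 + card P * (1 + b0)) * L2_norm (Mn n) p"
        using b0 by (intro mult_right_mono) (auto simp: algebra_simps)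
      ultimately show ?thesis by (intro mult_left_mono[OF _ P(3)]) linarith
    qed
    finally show ?thesis by (simp add: K_def algebra_simps)
  qed
  have sq3: "(x + y + z)\<^sup>2 \<le> 3 * (x\<^sup>2 + y\<^sup>2 + z\<^sup>2)" for x y z :: real
    using zero_le_power2[of "x - y"] zero_le_power2[of "y - z"] zero_le_power2[of "x - z"]
    by (simp add: power2_eq_square algebra_simps)
  have dj: "disjoint_family_on (\<lambda>n. T n ` Q) {1..N}" "disjoint_family_on Cn {1..N}" "disjoint_family_on Mn {1..N}"
  proof -
    show "disjoint_family_on (\<lambda>n. T n ` Q) {1..N}" unfolding disjoint_family_on_def by (intro ballI impI teeth_pairwise_disjoint)
    show "disjoint_family_on Cn {1..N}" "disjoint_family_on Mn {1..N}"
      unfolding disjoint_family_on_def Cn_def Mn_def using cell_disjoint by blast+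
  qed
  have pteeth: "p \<in> L2 teeth" using L2_subset(1)[OF p(1) teeth_sub_\<Omega> measurable_sets(3)] .
  have "(L2_norm teeth p)\<^sup>2 = (\<Sum>n\<in>{1..N}. (L2_norm (T n ` Q) p)\<^sup>2)"
    unfolding teeth_def
    by (rule sum_L2_norm_disjoint(1)[OF _ dj(1) _ _ p(1), symmetric]) (use measurable_sets tooth_sub_\<Omega> in auto)
  also have "\<dots> \<le> (\<Sum>n\<in>{1..N}. 3 * K\<^sup>2 * (l\<^sup>2 * (L2_norm (Cn n) p1)\<^sup>2 + (L2_norm (Cn n) p2)\<^sup>2 + (L2_norm (Mn n) p)\<^sup>2))"
  proof (rule sum_mono)
    fix n assume n: "n \<in> {1..N}"
    have "(L2_norm (T n ` Q) p)\<^sup>2 \<le> (K * (l * L2_norm (Cn n) p1 + L2_norm (Cn n) p2 + L2_norm (Mn n) p))\<^sup>2"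
      by (rule power_mono[OF tooth[OF n]]) simp
    also have "\<dots> \<le> K\<^sup>2 * (3 * ((l * L2_norm (Cn n) p1)\<^sup>2 + (L2_norm (Cn n) p2)\<^sup>2 + (L2_norm (Mn n) p)\<^sup>2))"
      unfolding power_mult_distrib[of K] by (intro mult_left_mono sq3) simp
    finally show "(L2_norm (T n ` Q) p)\<^sup>2 \<le> 3 * K\<^sup>2 * (l\<^sup>2 * (L2_norm (Cn n) p1)\<^sup>2 + (L2_norm (Cn n) p2)\<^sup>2 + (L2_norm (Mn n) p)\<^sup>2)"
      by (simp add: power_mult_distrib algebra_simps)
  qed
  also have "\<dots> = 3 * K\<^sup>2 * (l\<^sup>2 * (\<Sum>n\<in>{1..N}. (L2_norm (Cn n) p1)\<^sup>2) + (\<Sum>n\<in>{1..N}. (L2_norm (Cn n) p2)\<^sup>2) + (\<Sum>n\<in>{1..N}. (L2_norm (Mn n) p)\<^sup>2))"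
    by (simp add: sum_distrib_left sum.distrib distrib_left)
  also have "\<dots> \<le> 3 * K\<^sup>2 * (l\<^sup>2 * (L2_norm \<Omega> p1)\<^sup>2 + (L2_norm \<Omega> p2)\<^sup>2 + (L2_norm Om p)\<^sup>2)"
    using meas p12 pOm
    by (intro mult_left_mono add_mono sum_L2_norm_disjoint(2) dj) (auto simp: Cn_def Mn_def)
  \<comment> \<open>The factor 3 from \<open>sq3\<close> is rounded up to 4 in order to obtain a
    square.\<close>
  also have "\<dots> \<le> (2 * K * (l * L2_norm \<Omega> p1 + L2_norm \<Omega> p2 + L2_norm Om p))\<^sup>2"
  proof -
    have "x\<^sup>2 + y\<^sup>2 + z\<^sup>2 \<le> (x + y + z)\<^sup>2" if "x \<ge> 0" "y \<ge> 0" "z \<ge> 0" for x y z :: real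
      using that by (simp add: power2_eq_square algebra_simps)
    from this[of "l * L2_norm \<Omega> p1" "L2_norm \<Omega> p2" "L2_norm Om p"]
    have "l\<^sup>2 * (L2_norm \<Omega> p1)\<^sup>2 + (L2_norm \<Omega> p2)\<^sup>2 + (L2_norm Om p)\<^sup>2 \<le> (l * L2_norm \<Omega> p1 + L2_norm \<Omega> p2 + L2_norm Om p)\<^sup>2"
      using l by (simp add: power_mult_distrib)
    then have "3 * K\<^sup>2 * (l\<^sup>2 * (L2_norm \<Omega> p1)\<^sup>2 + (L2_norm \<Omega> p2)\<^sup>2 + (L2_norm Om p)\<^sup>2) \<le> (4 * K\<^sup>2) * (l * L2_norm \<Omega> p1 + L2_norm \<Omega> p2 + L2_norm Om p)\<^sup>2"
      by (intro mult_mono) auto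
    then show ?thesis by (simp add: power_mult_distrib)
  qed
  finally have "L2_norm teeth p \<le> 2 * K * (l * L2_norm \<Omega> p1 + L2_norm \<Omega> p2 + L2_norm Om p)"
    by (rule power2_le_imp_le) (use K0 l in auto)
  then show ?thesis by (simp add: K_def)
qed

section \<open>Section lengths and the coefficient of the limit equation\<close>

lemma section_minus: "0 < x \<Longrightarrow> x < 1 \<Longrightarrow> section_integral (Omega_minus b) (\<lambda>p. 1) x = b x"
proof -
  assume x: "0 < x" "x < 1"
  then have "{y. (x, y) \<in> Omega_minus b} = {- b x<..<0}" by (auto simp: Omega_minus_def)
  then show ?thesis using b[OF x] b0 by (simp add: section_integral_def set_lebesgue_integral_def)
qed

lemma minus_lm: "Omega_minus b \<in> lmeasurable"
proof -
  have "Omega_minus b = Om \<union> (Omega_minus b - Om)" using Om_sub_minus by auto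
  moreover have "negligible (Omega_minus b - Om)"
    by (rule negligible_subset[OF closure_minus_negligible]) (use closure_subset in auto)
  ultimately show ?thesis using Om_lm negligible_imp_measurable by (metis fmeasurable.Un)
qed

lemma b_L2: "b \<in> L2 {0<..<1}"
proof -
  have "section_integral (Omega_minus b) (\<lambda>p. 1) \<in> L2 {0<..<1}"
    by (rule section_integral_L2(1)[OF minus_sub _ L2_one(1)[OF minus_lm]]) (use b0 b01 in auto)
  then show ?thesis using L2_cong(1)[of "{0<..<1}" "section_integral (Omega_minus b) (\<lambda>p. 1)" b] section_minus by auto
qed

text \<open>The length of the section of \<Omega> minus the limit coefficient q. It oscillates with
  the teeth and is small only in the weak sense, through its integrals over intervals.\<close>

definition qdef :: "real \<Rightarrow> real" where
  "qdef x = section_integral \<Omega> (\<lambda>p. 1) x - (measure lebesgue Q / L + b x)"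

lemma LINT_indicator_fst:
  assumes "A \<subseteq> {0<..<1} \<times> {c<..<d}" "c \<le> d" "A \<in> lmeasurable" "I = {a<..<e}" "I \<subseteq> {0<..<1}"
  shows "(LINT x:I|lebesgue. section_integral A (\<lambda>p. 1) x) = measure lebesgue (A \<inter> I \<times> UNIV)"
proof -
  have Am: "A \<in> sets lebesgue" using assms(3) by auto
  have "open (I \<times> (UNIV :: real set))" using assms(4) by (intro open_Times) auto
  then have Im: "A \<inter> I \<times> UNIV \<in> lmeasurable" using assms(3) Am by (intro fmeasurableI2[OF assms(3)]) auto
  have z: "indicator I \<in> L2 {0<..<1 :: real}" using indicator_L2 assms(4,5) by blast
  have "(LINT x:I|lebesgue. section_integral A (\<lambda>p. 1) x) = (LINT x:{0<..<1}|lebesgue. section_integral A (\<lambda>p. 1) x * indicator I x)"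
    unfolding LINT_restr using assms(5) by (intro Bochner_Integration.integral_cong) (auto simp: restr_def indicator_def)
  also have "\<dots> = (LINT p:A|lebesgue. 1 * indicator I (fst p))"
    by (rule LINT_mult_fst[OF assms(1) Am assms(2) z L2_one(1)[OF assms(3)], symmetric])
  also have "\<dots> = (LINT p|lebesgue. indicator (A \<inter> I \<times> UNIV) p)"
    unfolding LINT_restr by (intro Bochner_Integration.integral_cong) (auto simp: restr_def indicator_def)
  also have "\<dots> = measure lebesgue (A \<inter> I \<times> UNIV)" using Im by simp
  finally show ?thesis .
qed

text \<open>The bound does not involve \<open>l\<close> or \<open>N\<close>, as the passage from
  intervals to general functions in \<open>weak_pairing_tendsto\<close> requires.\<close>

lemma qdef_L2: "qdef \<in> L2 {0<..<1}" "L2_norm {0<..<1} qdef \<le> (b1 + G) + measure lebesgue Q / L + b1"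
proof -
  have i1: "{0<..<1::real} \<in> lmeasurable" "measure lebesgue {0<..<1::real} = 1" by auto
  have bG: "0 \<le> b1 + G" "- b1 \<le> G" using b0 b01 G by auto
  have S: "section_integral \<Omega> (\<lambda>p. 1) \<in> L2 {0<..<1}" "L2_norm {0<..<1} (section_integral \<Omega> (\<lambda>p. 1)) \<le> sqrt (G - - b1) * sqrt (measure lebesgue \<Omega>)"
    using section_integral_L2[OF \<Omega>_sub bG(2) L2_one(1)[OF \<Omega>_lm]] L2_one(2)[OF \<Omega>_lm] by auto
  have "sqrt (G - - b1) * sqrt (measure lebesgue \<Omega>) \<le> sqrt (b1 + G) * sqrt (b1 + G)"
    by (intro mult_mono) (use bG measure_\<Omega> in auto)
  then have S2: "L2_norm {0<..<1} (section_integral \<Omega> (\<lambda>p. 1)) \<le> b1 + G" using S(2) bG by simp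
  have q0: "measure lebesgue Q / L \<ge> 0" using L by simp
  have qL: "(\<lambda>x. measure lebesgue Q / L + b x) \<in> L2 {0<..<1}"
    using L2_add[OF L2_cmult[OF L2_one(1)[OF i1(1)], of "measure lebesgue Q / L"] b_L2] by simp
  have "L2_norm {0<..<1} (\<lambda>x. measure lebesgue Q / L + b x) \<le> (measure lebesgue Q / L + b1) * sqrt (measure lebesgue {0<..<1::real})"
  proof (rule L2_bounded(2)[OF i1(1) L2_measurable[OF qL]])
    fix x :: real assume "x \<in> {0<..<1}"
    then have "b0 \<le> b x" "b x \<le> b1" using b by auto
    then show "\<bar>measure lebesgue Q / L + b x\<bar> \<le> measure lebesgue Q / L + b1" using q0 b0 by linarith
  qed
  then show "L2_norm {0<..<1} qdef \<le> (b1 + G) + measure lebesgue Q / L + b1"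
    using L2_norm_triangle_diff[OF S(1) qL] S2 i1(2) unfolding qdef_def[abs_def] by simp
  show "qdef \<in> L2 {0<..<1}" unfolding qdef_def[abs_def] by (rule L2_diff[OF S(1) qL])
qed

text \<open>A tooth contributes the same to both sides unless its cell contains an end point of the interval.\<close>

lemma qdef_integral:
  assumes "0 \<le> a" "a < c" "c \<le> 1"
  shows "\<bar>LINT x:{a<..<c}|lebesgue. qdef x\<bar> \<le> 3 * l * measure lebesgue Q"
proof -
  let ?I = "{a<..<c}" and ?S = "{a<..<c} \<times> (UNIV :: real set)"
  define m where "m = measure lebesgue Q"
  have m0: "m \<ge> 0" by (simp add: m_def)
  have Isub: "?I \<subseteq> {0<..<1}" using assms by auto
  have Ilm: "?I \<in> lmeasurable" by simp
  have oS: "open ?S" by (intro open_Times) auto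
  have iS: "A \<inter> ?S \<in> lmeasurable" if "A \<in> lmeasurable" for A
    using that oS by (intro fmeasurableI2[OF that]) auto
  have bG: "- b1 \<le> G" "-b1 \<le> 0" using b0 b01 G by auto
  have S1: "section_integral \<Omega> (\<lambda>p. 1) \<in> L2 ?I"
    by (rule L2_subset(1)[OF section_integral_L2(1)[OF \<Omega>_sub bG(1) L2_one(1)[OF \<Omega>_lm]] Isub]) simp
  have bI: "b \<in> L2 ?I" by (rule L2_subset(1)[OF b_L2 Isub]) simp
  have cI: "(\<lambda>x. m / L) \<in> L2 ?I" using L2_cmult[OF L2_one(1)[OF Ilm], of "m / L"] by simp
  note ints = L2_integrable[OF S1 Ilm] L2_integrable[OF bI Ilm] L2_integrable[OF cI Ilm]
  have "(LINT x:?I|lebesgue. b x) = (LINT x:?I|lebesgue. section_integral (Omega_minus b) (\<lambda>p. 1) x)"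
  proof (intro set_lebesgue_integral_cong allI impI)
    fix x assume "x \<in> ?I"
    then have "0 < x" "x < 1" using assms by auto
    from section_minus[OF this] show "b x = section_integral (Omega_minus b) (\<lambda>p. 1) x" by simp
  qed simp
  also have "\<dots> = measure lebesgue (Omega_minus b \<inter> ?S)"
    by (rule LINT_indicator_fst[OF minus_sub bG(2) minus_lm refl Isub])
  also have "\<dots> = measure lebesgue (Om \<inter> ?S)"
  proof -
    have "AE p in lebesgue. p \<in> Omega_minus b \<inter> ?S \<longleftrightarrow> p \<in> Om \<inter> ?S" using minus_AE by eventually_elim auto
    from measure_eq_AE[OF this fmeasurableD[OF iS[OF minus_lm]] fmeasurableD[OF iS[OF Om_lm]]] show ?thesis .
  qed
  finally have B: "(LINT x:?I|lebesgue. b x) = measure lebesgue (Om \<inter> ?S)" .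
  have dj: "disjoint_family_on (\<lambda>n. T n ` Q \<inter> ?S) {1..N}" "disjoint_family_on (\<lambda>n. cell n \<inter> ?I) {1..N}" "disjoint_family_on cell {1..N}"
  proof -
    show "disjoint_family_on (\<lambda>n. T n ` Q \<inter> ?S) {1..N}"
      unfolding disjoint_family_on_def
    proof (intro ballI impI)
      fix m n :: nat assume "m \<noteq> n"
      from teeth_pairwise_disjoint[OF this] show "(T m ` Q \<inter> ?S) \<inter> (T n ` Q \<inter> ?S) = {}" by blast
    qed
    show "disjoint_family_on (\<lambda>n. cell n \<inter> ?I) {1..N}" "disjoint_family_on cell {1..N}"
      unfolding disjoint_family_on_def using cell_disjoint by blast+
  qed
  \<comment> \<open>Tooth area and cell length inside the given interval; in the ideal case
    \<open>t n\<close> equals \<open>s n * (m / L)\<close>.\<close>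
  define t where "t n = measure lebesgue (T n ` Q \<inter> ?S)" for n
  define s where "s n = measure lebesgue (cell n \<inter> ?I)" for n
  have Tlm: "T n ` Q \<inter> ?S \<in> lmeasurable" if "n \<in> {1..N}" for n using iS[OF T_Q_lm[OF that]] .
  have clm: "cell n \<in> lmeasurable" "cell n \<inter> ?I \<in> lmeasurable" for n by (auto simp: cell_def)
  have tt: "measure lebesgue (teeth \<inter> ?S) = (\<Sum>n\<in>{1..N}. t n)"
  proof -
    have "teeth \<inter> ?S = (\<Union>n\<in>{1..N}. T n ` Q \<inter> ?S)" by (auto simp: teeth_def)
    then show ?thesis unfolding t_def using dj(1) Tlm
      by (simp only:) (intro measure_UNION', auto simp: disjoint_family_on_def pairwise_def disjnt_def)
  qed
  have teethS: "teeth \<inter> ?S \<in> lmeasurable"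
    using iS[OF fmeasurableI2[OF \<Omega>_lm teeth_sub_\<Omega> measurable_sets(3)]] .
  have "measure lebesgue (\<Omega> \<inter> ?S) = measure lebesgue (Om \<inter> ?S \<union> teeth \<inter> ?S)"
  proof -
    have "AE p in lebesgue. p \<in> \<Omega> \<inter> ?S \<longleftrightarrow> p \<in> Om \<inter> ?S \<union> teeth \<inter> ?S" using \<Omega>_AE by eventually_elim auto
    from measure_eq_AE[OF this fmeasurableD[OF iS[OF \<Omega>_lm]] fmeasurableD[OF fmeasurable.Un[OF iS[OF Om_lm] teethS]]] show ?thesis .
  qed
  also have "\<dots> = measure lebesgue (Om \<inter> ?S) + measure lebesgue (teeth \<inter> ?S)"
    using iS[OF Om_lm] teethS Om_teeth_disjoint by (intro measure_Union) (auto simp: fmeasurable_def)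
  finally have W: "(LINT x:?I|lebesgue. section_integral \<Omega> (\<lambda>p. 1) x) = measure lebesgue (Om \<inter> ?S) + (\<Sum>n\<in>{1..N}. t n)"
    using LINT_indicator_fst[OF \<Omega>_sub bG(1) \<Omega>_lm refl Isub] tt by simp
  have "(LINT x:?I|lebesgue. qdef x) = (LINT x:?I|lebesgue. section_integral \<Omega> (\<lambda>p. 1) x) - ((LINT x:?I|lebesgue. m / L) + (LINT x:?I|lebesgue. b x))"
    unfolding qdef_def m_def[symmetric] using ints by (simp only: set_integral_diff(2) set_integral_add)
  also have "(LINT x:?I|lebesgue. m / L) = (c - a) * (m / L)"
    using assms by (simp add: set_lebesgue_integral_def)
  finally have q: "(LINT x:?I|lebesgue. qdef x) = (\<Sum>n\<in>{1..N}. t n) - (c - a) * (m / L)" using W B by simp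
  define U where "U = (\<Union>n\<in>{1..N}. cell n)"
  have Ulm: "U \<in> lmeasurable" unfolding U_def by (intro fmeasurable.finite_UN) (auto simp: clm)
  have Usub: "U \<subseteq> {0<..<1}" unfolding U_def using cell_sub by blast
  have mcell: "measure lebesgue (cell n) = L * l" for n using L l by (simp add: cell_def)
  have Us: "measure lebesgue (U \<inter> ?I) = (\<Sum>n\<in>{1..N}. s n)"
  proof -
    have "U \<inter> ?I = (\<Union>n\<in>{1..N}. cell n \<inter> ?I)" by (auto simp: U_def)
    then show ?thesis unfolding s_def using dj(2) clm
      by (simp only:) (intro measure_UNION', auto simp: disjoint_family_on_def pairwise_def disjnt_def)
  qed
  have Um: "measure lebesgue U = real N * (L * l)"
  proof -
    have "measure lebesgue U = (\<Sum>n\<in>{1..N}. measure lebesgue (cell n))"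
      unfolding U_def using dj(3) clm by (intro measure_UNION') (auto simp: disjoint_family_on_def pairwise_def disjnt_def)
    then show ?thesis by (simp add: mcell)
  qed
  have split: "measure lebesgue V = measure lebesgue (U \<inter> V) + measure lebesgue (V - U)" if "V \<in> lmeasurable" for V
  proof -
    have "V = (U \<inter> V) \<union> (V - U)" by auto
    moreover have "U \<inter> V \<in> lmeasurable" "V - U \<in> lmeasurable" using that Ulm by auto
    then have "measure lebesgue ((U \<inter> V) \<union> (V - U)) = measure lebesgue (U \<inter> V) + measure lebesgue (V - U)"
      by (intro measure_Union) (auto simp: fmeasurable_def)
    ultimately show ?thesis by metis
  qed
  \<comment> \<open>Up to a null set the cells fill (0, 1) except for a length 1 - N L l, and
    \<open>N2\<close> makes this rest at most as long as one cell.\<close>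
  have gap: "0 \<le> (c - a) - (\<Sum>n\<in>{1..N}. s n)" "(c - a) - (\<Sum>n\<in>{1..N}. s n) \<le> L * l"
  proof -
    have e: "(c - a) - (\<Sum>n\<in>{1..N}. s n) = measure lebesgue (?I - U)" using split[OF Ilm] Us assms by simp
    then show "0 \<le> (c - a) - (\<Sum>n\<in>{1..N}. s n)" by simp
    have "measure lebesgue (?I - U) \<le> measure lebesgue ({0<..<1} - U)"
      using Isub Ulm by (intro measure_mono_fmeasurable) auto
    also have "\<dots> = 1 - real N * (L * l)"
    proof -
      have "U \<inter> {0<..<1} = U" using Usub by auto
      then show ?thesis using split[of "{0<..<1}"] Um by simp
    qed
    also have "\<dots> \<le> L * l" using N2 by (simp add: algebra_simps)
    finally show "(c - a) - (\<Sum>n\<in>{1..N}. s n) \<le> L * l" using e by simp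
  qed
  \<comment> \<open>A cell inside the interval contributes l m to both sides and a cell disjoint
    from it contributes nothing. Only the cells containing \<open>a\<close> or \<open>c\<close>
    leave an error, at most l m each; together with the uncovered rest this gives the factor
    3.\<close>
  have pt: "\<bar>t n - s n * (m / L)\<bar> \<le> l * m * (indicator (cell n) a + indicator (cell n) c)" if n: "n \<in> {1..N}" for n
  proof (cases "a \<in> cell n \<or> c \<in> cell n")
    case True
    have "0 \<le> t n" "0 \<le> s n" by (simp_all add: t_def s_def)
    moreover have "t n \<le> l * m"
      unfolding t_def m_def measure_T_Q[OF n, symmetric] using Tlm[OF n] T_Q_lm[OF n] by (intro measure_mono_fmeasurable) auto
    moreover have "s n \<le> L * l"
      unfolding s_def mcell[of n, symmetric] using clm by (intro measure_mono_fmeasurable) auto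
    then have "s n * (m / L) \<le> (L * l) * (m / L)" using m0 L by (intro mult_right_mono) auto
    then have "s n * (m / L) \<le> l * m" using L by simp
    moreover have "0 \<le> s n * (m / L)" using \<open>0 \<le> s n\<close> m0 L by simp
    ultimately have "\<bar>t n - s n * (m / L)\<bar> \<le> l * m" by linarith
    also have "\<dots> \<le> l * m * (indicator (cell n) a + indicator (cell n) c)"
    proof -
      have "1 \<le> (indicator (cell n) a + indicator (cell n) c :: real)" using True by (auto simp: indicator_def)
      moreover have "0 \<le> l * m" using l m0 by simp
      ultimately show ?thesis using mult_left_mono[of 1 _ "l * m"] by simp
    qed
    finally show ?thesis .
  next
    case False
    then consider "cell n \<subseteq> ?I" | "cell n \<inter> ?I = {}" using L l by (force simp: cell_def)
    then have "t n = s n * (m / L)"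
    proof cases
      case 1
      then have "cell n \<times> (UNIV :: real set) \<subseteq> ?S" by (intro Sigma_mono) auto
      with T_Q_strip have "T n ` Q \<subseteq> ?S" by (rule order_trans)
      then have "T n ` Q \<inter> ?S = T n ` Q" "cell n \<inter> ?I = cell n" using 1 by (simp_all add: inf.absorb1)
      then show ?thesis using measure_T_Q[OF n] mcell L by (simp add: t_def s_def m_def)
    next
      case 2
      have "T n ` Q \<inter> ?S \<subseteq> (cell n \<times> UNIV) \<inter> ?S" by (intro Int_mono T_Q_strip order_refl)
      also have "\<dots> = {}" using 2 by (simp add: Times_Int_Times)
      finally have "T n ` Q \<inter> ?S = {}" by simp
      then show ?thesis using 2 by (simp add: t_def s_def)
    qed
    then show ?thesis using l m0 by simp
  qed
  have one: "(\<Sum>n\<in>{1..N}. indicator (cell n) x) \<le> (1::real)" for x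
  proof -
    have "(\<Sum>n\<in>{1..N}. indicator (cell n) x) = (indicator U x :: real)"
      unfolding U_def by (rule indicator_UN_disjoint[symmetric, OF _ dj(3)]) simp
    then show ?thesis by (simp add: indicator_def)
  qed
  have "\<bar>(\<Sum>n\<in>{1..N}. t n - s n * (m / L))\<bar> \<le> (\<Sum>n\<in>{1..N}. l * m * (indicator (cell n) a + indicator (cell n) c))"
    using pt by (intro order_trans[OF sum_abs] sum_mono) auto
  also have "\<dots> = l * m * ((\<Sum>n\<in>{1..N}. indicator (cell n) a) + (\<Sum>n\<in>{1..N}. indicator (cell n) c))"
    by (simp add: sum_distrib_left[symmetric] sum.distrib)
  also have "\<dots> \<le> l * m * (1 + 1)" using one[of a] one[of c] l m0 by (intro mult_left_mono add_mono) auto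
  finally have "\<bar>(\<Sum>n\<in>{1..N}. t n - s n * (m / L))\<bar> \<le> 2 * l * m" by simp
  then have 1: "\<bar>(\<Sum>n\<in>{1..N}. t n) - (\<Sum>n\<in>{1..N}. s n) * (m / L)\<bar> \<le> 2 * l * m"
    unfolding sum_subtractf sum_distrib_right .
  have "((c - a) - (\<Sum>n\<in>{1..N}. s n)) * (m / L) \<le> (L * l) * (m / L)" using gap m0 L by (intro mult_right_mono) auto
  then have 2: "((c - a) - (\<Sum>n\<in>{1..N}. s n)) * (m / L) \<le> l * m" using L by simp
  have 3: "0 \<le> ((c - a) - (\<Sum>n\<in>{1..N}. s n)) * (m / L)" using gap m0 L by (intro mult_nonneg_nonneg) auto
  have "(LINT x:?I|lebesgue. qdef x) = ((\<Sum>n\<in>{1..N}. t n) - (\<Sum>n\<in>{1..N}. s n) * (m / L)) - ((c - a) - (\<Sum>n\<in>{1..N}. s n)) * (m / L)"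
    unfolding q by (simp add: algebra_simps diff_divide_distrib)
  then show ?thesis using 1 2 3 unfolding m_def[symmetric] by linarith
qed

text \<open>On the part of a tooth where the cut-off \<open>\<eta>\<close> does not vanish, the profile is the value of \<open>v\<close> at the left
  end of the cell; the smooth staircase below has its steps in the gaps between the teeth.\<close>

lemma profile_exists:
  assumes v: "smooth_fun v" "\<And>x. 0 \<le> x \<Longrightarrow> x \<le> 1 \<Longrightarrow> \<bar>frechet_derivative v (at x) 1\<bar> \<le> V1"
    and \<eta>: "smooth_fun \<eta>" "\<And>y. 0 \<le> \<eta> y" "\<And>y. \<eta> y \<le> 1" "\<And>y. y \<le> \<delta> / 2 \<Longrightarrow> \<eta> y = 0"
      "\<And>y. \<bar>frechet_derivative \<eta> (at y) 1\<bar> \<le> H" "\<delta> > 0"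
    and \<kappa>: "\<kappa> > 0" "\<And>q. q \<in> closure Q \<Longrightarrow> \<delta> / 2 \<le> snd q \<Longrightarrow> \<kappa> < fst q \<and> fst q < L - \<kappa>"
  obtains \<Phi> where "smooth_fun \<Phi>"
    "\<And>p. p \<in> \<Omega> \<Longrightarrow> frechet_derivative \<Phi> (at p) (1, 0) = frechet_derivative v (at (fst p)) 1 * (1 - \<eta> (snd p))"
    "\<And>p. p \<in> \<Omega> \<Longrightarrow> \<bar>frechet_derivative \<Phi> (at p) (0, 1)\<bar> \<le> H * (V1 * (L * l))"
    "\<And>p. p \<in> \<Omega> \<Longrightarrow> \<bar>\<Phi> p - v (fst p)\<bar> \<le> V1 * (L * l)"
    "\<And>p. snd p \<le> 0 \<Longrightarrow> \<Phi> p = v (fst p)"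
proof -
  obtain h :: "real \<Rightarrow> real" where h: "smooth_fun h" "\<And>x. x \<le> 0 \<Longrightarrow> h x = 0" "\<And>x. 1 \<le> x \<Longrightarrow> h x = 1"
    using smooth_step_exists by metis
  have V0: "V1 \<ge> 0" using v(2)[of 0] by simp
  have H0: "H \<ge> 0" using \<eta>(5)[of 0] by linarith
  \<comment> \<open>A smooth step from 0 to 1 across m L l, the common boundary of the cells m and m
    + 1, within distance \<kappa> l of it.\<close>
  define k where "k m x = h ((1 / (2 * \<kappa> * l)) * x + (- (real m * L * l - \<kappa> * l) / (2 * \<kappa> * l)))" for m :: nat and x
  define \<zeta> where "\<zeta> x = (\<Sum>m\<in>{1..N}. (L * l) * k m x)" for x
  have k0: "k m x = 0" if "x \<le> real m * L * l - \<kappa> * l" for m x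
  proof -
    have "(1 / (2 * \<kappa> * l)) * x + (- (real m * L * l - \<kappa> * l) / (2 * \<kappa> * l)) = (x - (real m * L * l - \<kappa> * l)) / (2 * \<kappa> * l)"
      by (simp add: diff_divide_distrib)
    also have "\<dots> \<le> 0" using that \<kappa>(1) l by (intro divide_nonpos_pos) auto
    finally show ?thesis unfolding k_def by (rule h(2))
  qed
  have k1: "k m x = 1" if "real m * L * l + \<kappa> * l \<le> x" for m x
  proof -
    have "1 \<le> (x - (real m * L * l - \<kappa> * l)) / (2 * \<kappa> * l)" using that \<kappa>(1) l by (simp add: le_divide_eq)
    also have "\<dots> = (1 / (2 * \<kappa> * l)) * x + (- (real m * L * l - \<kappa> * l) / (2 * \<kappa> * l))"
      by (simp add: diff_divide_distrib)
    finally show ?thesis unfolding k_def by (rule h(3))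
  qed
  have sk: "smooth_fun (k m)" for m unfolding k_def
    by (intro smooth_fun_compose[OF h(1)] smooth_fun_add smooth_fun_mult smooth_fun_const smooth_fun_id)
  have s\<zeta>: "smooth_fun \<zeta>" unfolding \<zeta>_def by (intro smooth_fun_sum smooth_fun_mult smooth_fun_const sk)
  \<comment> \<open>In the core of cell n all earlier steps are complete and no later one has begun,
    so the staircase stands at the left end of the cell.\<close>
  have \<zeta>n: "\<zeta> x = org n" if n: "n \<in> {1..N}" and x: "org n + \<kappa> * l \<le> x" "x \<le> org n + (L - \<kappa>) * l" for n x
  proof -
    have "k m x = (if m < n then 1 else 0)" for m
    proof (cases "m < n")
      case True
      have "real m * (L * l) \<le> (real n - 1) * (L * l)" using True L l by (intro mult_right_mono) auto
      then have "real m * L * l + \<kappa> * l \<le> x" using x(1) by (simp add: org_def mult.assoc)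
      then show ?thesis using True k1 by simp
    next
      case False
      have "real n * (L * l) \<le> real m * (L * l)" using False L l by (intro mult_right_mono) auto
      then have "x \<le> real m * L * l - \<kappa> * l" using x(2) by (simp add: org_def algebra_simps)
      then show ?thesis using False k0 by simp
    qed
    then have "\<zeta> x = (\<Sum>m\<in>{1..N}. if m < n then L * l else 0)" unfolding \<zeta>_def by (intro sum.cong) auto
    also have "\<dots> = (\<Sum>m\<in>{1..<n}. L * l)"
      using n by (intro sum.mono_neutral_cong_right) auto
    also have "\<dots> = org n" using n by (simp add: org_def of_nat_diff)
    finally show ?thesis .
  qed
  define s where "s x = v (\<zeta> x)" for x
  have ss: "smooth_fun s" unfolding s_def by (rule smooth_fun_compose[OF v(1) s\<zeta>])
  \<comment> \<open>The convex combination of v and the staircase version s, with weight \<eta>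
    depending on the height.\<close>
  define \<Phi> where "\<Phi> p = v (fst p) + \<eta> (snd p) * (s (fst p) + (-1) * v (fst p))" for p :: "real \<times> real"
  note sm = smooth_fun_comp_fst[OF v(1)] smooth_fun_comp_snd[OF \<eta>(1)] smooth_fun_comp_fst[OF ss]
  have d: "smooth_fun (\<lambda>p :: real \<times> real. s (fst p) + (-1) * v (fst p))"
    by (intro smooth_fun_add smooth_fun_mult smooth_fun_const sm)
  have s\<Phi>: "smooth_fun \<Phi>" unfolding \<Phi>_def by (intro smooth_fun_add smooth_fun_mult smooth_fun_const sm)
  let ?v' = "\<lambda>x. frechet_derivative v (at x) 1" and ?s' = "\<lambda>x. frechet_derivative s (at x) 1" and ?\<eta>' = "\<lambda>x. frechet_derivative \<eta> (at x) 1"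
  have D: "frechet_derivative \<Phi> (at p) w = ?v' (fst p) * fst w + (\<eta> (snd p) * (?s' (fst p) * fst w - ?v' (fst p) * fst w) + (?\<eta>' (snd p) * snd w) * (s (fst p) - v (fst p)))" for p w
  proof -
    have "(\<Phi> has_derivative (\<lambda>w. frechet_derivative (\<lambda>p. v (fst p)) (at p) w +
        (\<eta> (snd p) * (frechet_derivative (\<lambda>p. s (fst p)) (at p) w + (-1) * frechet_derivative (\<lambda>p. v (fst p)) (at p) w)
         + frechet_derivative (\<lambda>p. \<eta> (snd p)) (at p) w * (s (fst p) + (-1) * v (fst p))))) (at p)"
      unfolding \<Phi>_def
      by (intro has_derivative_add has_derivative_mult has_derivative_mult_right smooth_fun_has_derivative sm(1,3,5))
    from frechet_derivative_at[OF this] show ?thesis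
      unfolding sm(2,4,6) by (simp add: fun_eq_iff)
  qed
  \<comment> \<open>From height \<delta> / 2 on, a point of \<Omega> lies in the closure of a tooth,
    more than \<kappa> l away from the sides of its cell. There s is locally constant and differs
    from v by at most V1 times the cell width.\<close>
  have act: "s (fst p) = v (org n) \<and> ?s' (fst p) = 0 \<and> \<bar>s (fst p) - v (fst p)\<bar> \<le> V1 * (L * l)"
    if p: "p \<in> \<Omega>" "\<delta> / 2 \<le> snd p" and n: "n \<in> {1..N}" "p \<in> T n ` closure Q" for p n
  proof -
    from n(2) obtain q where q: "q \<in> closure Q" "p = T n q" by blast
    then have "\<kappa> < fst q" "fst q < L - \<kappa>" using \<kappa>(2)[OF q(1)] p(2) by (auto simp: T_def)
    then have "\<kappa> * l < l * fst q" "l * fst q < (L - \<kappa>) * l" "l * fst q < L * l" using l \<kappa>(1) by (auto simp: mult.commute)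
    then have x: "org n + \<kappa> * l < fst p" "fst p < org n + (L - \<kappa>) * l" "fst p < org n + L * l" using q(2) by (auto simp: T_def)
    let ?J = "{org n + \<kappa> * l<..<org n + (L - \<kappa>) * l}"
    have sJ: "s y = v (org n)" if "y \<in> ?J" for y unfolding s_def using \<zeta>n[OF n(1), of y] that by simp
    have "((\<lambda>y. v (org n)) has_derivative frechet_derivative s (at (fst p))) (at (fst p))"
      by (rule has_derivative_transform_within_open[OF smooth_fun_has_derivative[OF ss], of ?J]) (use x sJ in auto)
    then have "frechet_derivative s (at (fst p)) = (\<lambda>v. 0)" using has_derivative_unique[OF _ has_derivative_const] by blast
    then have s0: "?s' (fst p) = 0" by simp
    have sp: "s (fst p) = v (org n)" using sJ x by simp
    have o: "0 \<le> org n" "org n + L * l \<le> 1" using org_bounds[OF n(1)] by auto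
    have \<kappa>l: "0 < \<kappa> * l" using \<kappa>(1) l by simp
    have "norm (v (fst p) - v (org n)) \<le> V1 * norm (fst p - org n)"
    proof (rule field_differentiable_bound[of "{0..1}" v ?v'])
      show "(v has_field_derivative ?v' z) (at z within {0..1})" for z
        using smooth_fun_along_line[OF v(1), of 0 1 z] by (simp add: has_field_derivative_at_within)
      show "norm (?v' z) \<le> V1" if "z \<in> {0..1}" for z using v(2)[of z] that by simp
      show "fst p \<in> {0..1}" "org n \<in> {0..1}" using x o \<kappa>l by auto
    qed simp
    also have "\<dots> \<le> V1 * (L * l)" using x \<kappa>l V0 by (intro mult_left_mono) auto
    finally show ?thesis using sp s0 by (simp add: abs_minus_commute)
  qed
  have act': "?s' (fst p) = 0 \<and> \<bar>s (fst p) - v (fst p)\<bar> \<le> V1 * (L * l)" if p: "p \<in> \<Omega>" "\<delta> / 2 \<le> snd p" for p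
  proof -
    have "snd p > 0" using p(2) \<eta>(6) by linarith
    then obtain n where "n \<in> {1..N}" "p \<in> T n ` closure Q" using Omega_above[OF p(1)] by blast
    then show ?thesis using act[OF p] by blast
  qed
  have \<eta>'0: "?\<eta>' y = 0" if "y < \<delta> / 2" for y
  proof -
    have "((\<lambda>y. 0) has_derivative frechet_derivative \<eta> (at y)) (at y)"
      by (rule has_derivative_transform_within_open[OF smooth_fun_has_derivative[OF \<eta>(1)], of "{..<\<delta> / 2}"]) (use that \<eta>(4) in auto)
    then have "frechet_derivative \<eta> (at y) = (\<lambda>v. 0)" using has_derivative_unique[OF _ has_derivative_const] by blast
    then show ?thesis by simp
  qed
  have c0: "0 \<le> V1 * (L * l)" using V0 L l by simp
  show ?thesis
  proof (rule that[of \<Phi>])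
    show "smooth_fun \<Phi>" by (rule s\<Phi>)
    fix p :: "real \<times> real"
    show "frechet_derivative \<Phi> (at p) (1, 0) = ?v' (fst p) * (1 - \<eta> (snd p))" if "p \<in> \<Omega>"
    proof (cases "\<delta> / 2 \<le> snd p")
      case True
      then show ?thesis using act'[OF that] unfolding D by (simp add: algebra_simps)
    next
      case False
      then show ?thesis using \<eta>(4)[of "snd p"] unfolding D by simp
    qed
    show "\<bar>frechet_derivative \<Phi> (at p) (0, 1)\<bar> \<le> H * (V1 * (L * l))" if "p \<in> \<Omega>"
    proof (cases "\<delta> / 2 \<le> snd p")
      case True
      have "\<bar>?\<eta>' (snd p) * (s (fst p) - v (fst p))\<bar> \<le> H * (V1 * (L * l))"
        unfolding abs_mult using act'[OF that True] \<eta>(5)[of "snd p"] H0 by (intro mult_mono) auto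
      then show ?thesis unfolding D by simp
    next
      case False
      then show ?thesis using \<eta>'0[of "snd p"] H0 c0 unfolding D by simp
    qed
    show "\<bar>\<Phi> p - v (fst p)\<bar> \<le> V1 * (L * l)" if "p \<in> \<Omega>"
    proof (cases "\<delta> / 2 \<le> snd p")
      case True
      have "\<bar>\<eta> (snd p) * (s (fst p) - v (fst p))\<bar> \<le> 1 * (V1 * (L * l))"
        unfolding abs_mult using act'[OF that True] \<eta>(2,3)[of "snd p"] by (intro mult_mono) auto
      then show ?thesis by (simp add: \<Phi>_def)
    next
      case False
      then show ?thesis using \<eta>(4)[of "snd p"] c0 by (simp add: \<Phi>_def)
    qed
    show "\<Phi> p = v (fst p)" if "snd p \<le> 0" using \<eta>(4)[of "snd p"] \<eta>(6) that by (simp add: \<Phi>_def)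
  qed
qed

section \<open>Splitting of the test function and the error terms\<close>

lemma LINT_split:
  assumes "set_integrable lebesgue \<Omega> F"
  shows "(LINT p:\<Omega>|lebesgue. F p) = (LINT p:Om|lebesgue. F p) + (LINT p:teeth|lebesgue. F p :: real)"
proof -
  have i: "set_integrable lebesgue Om F" "set_integrable lebesgue teeth F"
    using set_integrable_subset[OF assms] measurable_sets Om_sub_\<Omega> teeth_sub_\<Omega> by auto
  show ?thesis unfolding LINT_AE_set[OF \<Omega>_AE] by (rule set_integral_Un[OF Om_teeth_disjoint i])
qed

lemma L2_norm_split:
  assumes "u \<in> L2 \<Omega>"
  shows "L2_norm \<Omega> u \<le> L2_norm Om u + L2_norm teeth u"
proof (rule power2_le_imp_le)
  have "(L2_norm \<Omega> u)\<^sup>2 = (L2_norm Om u)\<^sup>2 + (L2_norm teeth u)\<^sup>2"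
    using LINT_split[of "\<lambda>p. (u p)\<^sup>2"] assms unfolding L2_norm_power2 by (simp add: L2_def)
  also have "\<dots> \<le> (L2_norm Om u + L2_norm teeth u)\<^sup>2" by (simp add: power2_sum)
  finally show "(L2_norm \<Omega> u)\<^sup>2 \<le> (L2_norm Om u + L2_norm teeth u)\<^sup>2" .
qed simp

text \<open>z is the vertical average of \<open>w\<close> over the rectangle of depth
  \<open>b0\<close> below the axis. On the base the remainder is bounded by its y-derivative, which
  is of size e A; on the teeth \<open>teeth_estimate\<close> adds \<open>l\<close> times its
  x-derivative. That x-derivative is bounded by a multiple of A and carries no small factor.\<close>

lemma split_exists:
  assumes P: "finite P" "P \<subseteq> base_boxes b0 Q" "0 \<le> C"
    and PI: "\<And>v D. incr_bounded Q v D \<Longrightarrow> L2_norm Q v \<le> C * (D + (\<Sum>z\<in>P. L2_norm (base_box z) v))"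
    and \<rho>: "test_fun {-b0<..<0} \<rho>" "(LINT y:{-b0<..<0}|lebesgue. \<rho> y) = 1" "\<And>y. \<bar>\<rho> y\<bar> \<le> B"
    and w: "w \<in> L2 \<Omega>" "weak_deriv \<Omega> (1, 0) w w1" "weak_deriv \<Omega> (0, 1) w w2"
    and A: "L2_norm \<Omega> w \<le> A" "L2_norm \<Omega> w1 \<le> A" "L2_norm \<Omega> w2 \<le> e * A" and e: "e > 0"
    and \<Lambda>: "\<Lambda> = split_const b0 b1 G B (L2_norm {-b0<..<0} \<rho>) (2 * (C * (1 + card P * (1 + b0))))"
  shows "\<exists>z z'. z \<in> L2 {0<..<1} \<and> weak_deriv {0<..<1} 1 z z' \<and> L2_norm {0<..<1} z \<le> \<Lambda> * A \<and> L2_norm {0<..<1} z' \<le> \<Lambda> * A \<and>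
    weak_deriv \<Omega> (1, 0) (\<lambda>p. w p - z (fst p)) (\<lambda>p. w1 p - z' (fst p)) \<and> L2_norm \<Omega> (\<lambda>p. w1 p - z' (fst p)) \<le> \<Lambda> * A \<and>
    L2_norm Om (\<lambda>p. w p - z (fst p)) \<le> \<Lambda> * (e * A) \<and> L2_norm \<Omega> (\<lambda>p. w p - z (fst p)) \<le> \<Lambda> * ((l + e) * A)"
proof -
  define R where "R = L2_norm {-b0<..<0} \<rho>"
  define K where "K = 2 * (C * (1 + card P * (1 + b0)))"
  define c0 where "c0 = sqrt b0 * B"
  define c1 where "c1 = 1 + sqrt (b1 + G) * c0"
  define c2 where "c2 = R * sqrt (2 * b1) * b1"
  define c3 where "c3 = c2 + K * (c1 + 1 + c2)"
  have \<Lambda>_eq: "\<Lambda> = c0 + c1 + c2 + c3" unfolding \<Lambda> split_const_def c0_def c1_def c2_def c3_def R_def K_def by simp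
  have B: "B \<ge> 0" using \<rho>(3)[of 0] by linarith
  have b1: "b1 > 0" using b0 b01 by linarith
  have A0: "0 \<le> A" using A(1) L2_norm_nonneg[of \<Omega> w] by linarith
  have K: "K \<ge> 0" unfolding K_def using P(3) b0 by (intro mult_nonneg_nonneg add_nonneg_nonneg) auto
  have c: "0 \<le> c0" "0 \<le> c1" "0 \<le> c2" "0 \<le> c3"
    unfolding c0_def c1_def c2_def c3_def R_def using B b0 b1 G K
    by (auto intro!: mult_nonneg_nonneg add_nonneg_nonneg)
  have cL: "c0 \<le> \<Lambda>" "c1 \<le> \<Lambda>" "c2 \<le> \<Lambda>" "c3 \<le> \<Lambda>" using c \<Lambda>_eq by auto
  let ?I = "{0<..<1::real}" and ?R = "{0<..<1::real} \<times> {-b0<..<0::real}"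
  have R: "?R \<subseteq> \<Omega>" using Om_rect Om_sub_\<Omega> by blast
  have nb: "- b0 \<le> 0" using b0 by simp
  have bG: "- b1 \<le> G" using b1 G by simp
  define z where "z = vavg \<rho> ?R w"
  define z' where "z' = vavg \<rho> ?R w1"
  note va = vavg_weak_deriv[OF open_\<Omega> R open_greaterThanLessThan nb \<rho>(1,3) w(1,2), folded z_def z'_def]
  have c0A: "sqrt (0 - - b0) * B * L2_norm \<Omega> w \<le> c0 * A" "sqrt (0 - - b0) * B * L2_norm \<Omega> w1 \<le> c0 * A"
    unfolding c0_def using A(1,2) B b0 by (auto intro!: mult_left_mono)
  have z: "z \<in> L2 ?I" "L2_norm ?I z \<le> c0 * A" "weak_deriv ?I 1 z z'" "L2_norm ?I z' \<le> c0 * A"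
    using va c0A by auto
  have z'L: "z' \<in> L2 ?I" using weak_derivD(1)[OF z(3)] .
  let ?p = "\<lambda>p. w p - z (fst p)" and ?p1 = "\<lambda>p. w1 p - z' (fst p)"
  have zf: "(\<lambda>p. z (fst p)) \<in> L2 \<Omega>" using fst_L2(1)[OF \<Omega>_sub measurable_sets(1) bG z(1)] .
  have z'f: "(\<lambda>p. z' (fst p)) \<in> L2 \<Omega>" "L2_norm \<Omega> (\<lambda>p. z' (fst p)) \<le> sqrt (G - - b1) * L2_norm ?I z'"
    using fst_L2[OF \<Omega>_sub measurable_sets(1) bG z'L] by auto
  note wf = weak_deriv_fst[OF open_\<Omega> \<Omega>_sub zero_less_one bG z(1,3)]
  have p1: "weak_deriv \<Omega> (1, 0) ?p ?p1" by (rule weak_deriv_diff[OF open_\<Omega> w(1) zf w(2) wf(1)])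
  have p2: "weak_deriv \<Omega> (0, 1) ?p w2" using weak_deriv_diff[OF open_\<Omega> w(1) zf w(3) wf(2)] by simp
  have pL: "?p \<in> L2 \<Omega>" by (rule L2_diff[OF w(1) zf])
  have n1: "L2_norm \<Omega> ?p1 \<le> c1 * A"
  proof -
    have "L2_norm \<Omega> ?p1 \<le> L2_norm \<Omega> w1 + L2_norm \<Omega> (\<lambda>p. z' (fst p))"
      by (rule L2_norm_triangle_diff[OF weak_derivD(1)[OF w(2)] z'f(1)])
    moreover have "sqrt (G - - b1) * L2_norm ?I z' \<le> sqrt (b1 + G) * (c0 * A)"
      using z(4) b1 G by (simp add: add.commute mult_left_mono)
    ultimately show ?thesis using z'f(2) A(2) by (simp add: c1_def algebra_simps)
  qed
  have vm: "z = vavg \<rho> (?I \<times> {-b0<..<0}) w" by (simp add: z_def)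
  have n2: "L2_norm Om ?p \<le> c2 * (e * A)"
  proof -
    have wO: "w \<in> L2 Om" "weak_deriv Om (0, 1) w w2"
      using L2_subset(1)[OF w(1) Om_sub_\<Omega> measurable_sets(2)] weak_deriv_subset[OF w(3) Om_sub_\<Omega> open_Om] by auto
    have OmS: "Om \<subseteq> ?I \<times> {-b1<..<0}" using Om_sub_minus minus_sub by blast
    have "L2_norm Om ?p \<le> L2_norm {-b0<..<0} \<rho> * sqrt (2 * (0 - - b1)) * (0 - - b1) * L2_norm Om w2"
      unfolding vm
      by (rule vavg_diff_le[OF open_Om OmS Om_rect _ Om_vertical _ _ _ open_greaterThanLessThan \<rho>(1,2) wO]) (use b0 b01 b1 in auto)
    also have "\<dots> = c2 * L2_norm Om w2" by (simp add: c2_def R_def)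
    also have "\<dots> \<le> c2 * (e * A)"
      using L2_subset(2)[OF weak_derivD(1)[OF w(3)] Om_sub_\<Omega> measurable_sets(2)] A(3) c by (intro mult_left_mono) auto
    finally show ?thesis .
  qed
  have n3: "L2_norm \<Omega> ?p \<le> c3 * ((l + e) * A)"
  proof -
    have "L2_norm teeth ?p \<le> K * (l * L2_norm \<Omega> ?p1 + L2_norm \<Omega> w2 + L2_norm Om ?p)"
      unfolding K_def by (rule teeth_estimate[OF P PI pL p1 p2])
    also have "\<dots> \<le> K * (l * (c1 * A) + e * A + c2 * (e * A))"
      using K l n1 n2 A(3) by (intro mult_left_mono add_mono) auto
    also have "\<dots> \<le> K * ((c1 + 1 + c2) * ((l + e) * A))"
    proof (rule mult_left_mono[OF _ K])
      have "0 \<le> (c1 * e + l + c2 * l) * A" using c l e A0 by (intro mult_nonneg_nonneg add_nonneg_nonneg) auto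
      then show "l * (c1 * A) + e * A + c2 * (e * A) \<le> (c1 + 1 + c2) * ((l + e) * A)" by (simp add: algebra_simps)
    qed
    finally have t: "L2_norm teeth ?p \<le> K * ((c1 + 1 + c2) * ((l + e) * A))" .
    have "0 \<le> c2 * (l * A)" using c l A0 by simp
    then show ?thesis using L2_norm_split[OF pL] t n2 by (simp add: c3_def algebra_simps)
  qed
  have up: "x \<le> \<Lambda> * y" if "x \<le> k * y" "k \<le> \<Lambda>" "0 \<le> y" for x y k
    using that mult_right_mono order_trans by blast
  have e0: "0 \<le> e * A" "0 \<le> (l + e) * A" using e l A0 by auto
  show ?thesis
    using z(1,3) p1 up[OF z(2) cL(1) A0] up[OF z(4) cL(1) A0] up[OF n1 cL(2) A0] up[OF n2 cL(3) e0(1)] up[OF n3 cL(4) e0(2)] by blast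
qed

text \<open>The limit equation tested with \<open>z\<close> cancels the three main terms once v is
  exchanged for \<open>u0\<close> at the cost \<sigma>, \<open>F\<close> for \<open>f_hat\<close> at
  the cost \<eta>1, and the section length for q at the cost \<eta>2.\<close>

lemma limit_pairing:
  assumes lim: "weak_solution_limit b (\<lambda>x. measure lebesgue Q / L + b x) f_hat u0" and fh: "f_hat \<in> L2 {0<..<1}"
    and F: "F \<in> L2 {0<..<1}"
    and v: "smooth_fun v" "\<And>x. x \<in> {0<..<1} \<Longrightarrow> \<bar>v x\<bar> \<le> V0" "\<And>x. x \<in> {0<..<1} \<Longrightarrow> \<bar>frechet_derivative v (at x) 1\<bar> \<le> V1"
    and \<sigma>: "L2_norm {0<..<1} (\<lambda>x. u0 x - v x) \<le> \<sigma>" "L2_norm {0<..<1} (\<lambda>x. wderiv {0<..<1} 1 u0 x - frechet_derivative v (at x) 1) \<le> \<sigma>"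
    and p1: "\<And>w w'. w \<in> L2 {0<..<1} \<Longrightarrow> weak_deriv {0<..<1} 1 w w' \<Longrightarrow>
        \<bar>LINT x:{0<..<1}|lebesgue. (F x - f_hat x) * w x\<bar> \<le> \<eta>1 * (L2_norm {0<..<1} w + L2_norm {0<..<1} w')"
    and p2: "\<And>w w'. w \<in> L2 {0<..<1} \<Longrightarrow> weak_deriv {0<..<1} 1 w w' \<Longrightarrow>
        \<bar>LINT x:{0<..<1}|lebesgue. qdef x * w x\<bar> \<le> \<eta>2 * (L2_norm {0<..<1} w + L2_norm {0<..<1} w')"
    and z: "z \<in> L2 {0<..<1}" "weak_deriv {0<..<1} 1 z z'" "L2_norm {0<..<1} z \<le> M" "L2_norm {0<..<1} z' \<le> M"
    and \<eta>: "0 \<le> \<eta>1" "0 \<le> \<eta>2"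
  shows "\<bar>(LINT x:{0<..<1}|lebesgue. F x * z x) - (LINT x:{0<..<1}|lebesgue. b x * frechet_derivative v (at x) 1 * z' x)
      - (LINT x:{0<..<1}|lebesgue. section_integral \<Omega> (\<lambda>p. 1) x * (v x * z x))\<bar>
     \<le> ((measure lebesgue Q / L + 2 * b1) * \<sigma> + 2 * \<eta>1 + \<eta>2 * (2 * V0 + V1)) * M"
proof -
  let ?I = "{0<..<1::real}" and ?g = "wderiv {0<..<1} 1 u0" and ?v' = "\<lambda>x. frechet_derivative v (at x) 1"
  define m where "m = measure lebesgue Q / L"
  have m: "m \<ge> 0" unfolding m_def using L by simp
  have V: "V0 \<ge> 0" "V1 \<ge> 0" using v(2)[of "1/2"] v(3)[of "1/2"] by auto
  have M: "M \<ge> 0" using z(3) L2_norm_nonneg[of ?I z] by linarith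
  have u0: "u0 \<in> H1 ?I" using lim by (simp add: weak_solution_limit_def)
  have u0L: "u0 \<in> L2 ?I" "?g \<in> L2 ?I" using H1_L2[OF u0] wderiv_L2[OF u0, of 1] by auto
  have vL: "v \<in> L2 ?I" "?v' \<in> L2 ?I" using smooth_weak_deriv(1)[of ?I v] weak_derivD(1)[OF smooth_weak_deriv(2)[of ?I v 1]] v(1) by auto
  have z'L: "z' \<in> L2 ?I" using weak_derivD(1)[OF z(2)] .
  have bb: "\<bar>b x\<bar> \<le> b1" if "x \<in> ?I" for x using b[of x] b0 that by auto
  have qq: "\<bar>m + b x\<bar> \<le> m + b1" if "x \<in> ?I" for x using b[of x] b0 m that by auto
  have bm: "restr ?I b \<in> borel_measurable lebesgue" by (rule L2_measurable[OF b_L2])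
  have qL: "(\<lambda>x. m + b x) \<in> L2 ?I"
    using L2_add[OF L2_cmult[OF L2_one(1), of ?I m] b_L2] by simp
  note qm = L2_measurable[OF qL]
  note bg = L2_mult_bounded(1)[OF u0L(2) bm bb] and bv = L2_mult_bounded(1)[OF vL(2) bm bb]
  note qu = L2_mult_bounded(1)[OF u0L(1) qm qq] and qv = L2_mult_bounded(1)[OF vL(1) qm qq]
  have zH: "z \<in> H1 ?I" by (rule H1I[OF z(1), of "\<lambda>_. z'"]) (use z(2) in auto)
  have E1: "(LINT x:?I|lebesgue. f_hat x * z x) = (LINT x:?I|lebesgue. b x * ?g x * z' x) + (LINT x:?I|lebesgue. (m + b x) * u0 x * z x)"
  proof -
    have "(LINT x:?I|lebesgue. f_hat x * z x) = (LINT x:?I|lebesgue. b x * ?g x * wderiv ?I 1 z x + (m + b x) * u0 x * z x)"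
      using lim zH unfolding weak_solution_limit_def m_def by auto
    also have "\<dots> = (LINT x:?I|lebesgue. b x * ?g x * z' x + (m + b x) * u0 x * z x)"
      by (rule LINT_cong_AE) (use wderiv_AE[OF open_greaterThanLessThan z(2)] in \<open>auto elim: eventually_mono\<close>)
    also have "\<dots> = (LINT x:?I|lebesgue. b x * ?g x * z' x) + (LINT x:?I|lebesgue. (m + b x) * u0 x * z x)"
      by (rule set_integral_add(2)[OF L2_mult_integrable[OF bg z'L] L2_mult_integrable[OF qu z(1)]])
    finally show ?thesis .
  qed
  have E2: "\<bar>(LINT x:?I|lebesgue. b x * ?g x * z' x) - (LINT x:?I|lebesgue. b x * ?v' x * z' x)\<bar> \<le> b1 * \<sigma> * M"
  proof -
    note d = L2_mult_bounded[OF L2_diff[OF u0L(2) vL(2)] bm bb]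
    have "b1 * L2_norm ?I (\<lambda>x. ?g x - ?v' x) \<le> b1 * \<sigma>" using \<sigma>(2) b0 b01 by (intro mult_left_mono) auto
    then have "\<bar>LINT x:?I|lebesgue. b x * (?g x - ?v' x) * z' x\<bar> \<le> b1 * \<sigma> * M"
      using d(2) by (intro abs_LINT_mult_le[OF d(1) z'L _ z(4)]) auto
    then show ?thesis using LINT_diff_mult[OF bg bv z'L] by (simp add: right_diff_distrib)
  qed
  have E3: "\<bar>(LINT x:?I|lebesgue. (m + b x) * u0 x * z x) - (LINT x:?I|lebesgue. (m + b x) * v x * z x)\<bar> \<le> (m + b1) * \<sigma> * M"
  proof -
    note d = L2_mult_bounded[OF L2_diff[OF u0L(1) vL(1)] qm qq]
    have "(m + b1) * L2_norm ?I (\<lambda>x. u0 x - v x) \<le> (m + b1) * \<sigma>" using \<sigma>(1) m b0 b01 by (intro mult_left_mono) auto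
    then have "\<bar>LINT x:?I|lebesgue. (m + b x) * (u0 x - v x) * z x\<bar> \<le> (m + b1) * \<sigma> * M"
      using d(2) by (intro abs_LINT_mult_le[OF d(1) z(1) _ z(3)]) auto
    then show ?thesis using LINT_diff_mult[OF qu qv z(1)] by (simp add: right_diff_distrib)
  qed
  have vm: "restr ?I v \<in> borel_measurable lebesgue" "restr ?I ?v' \<in> borel_measurable lebesgue"
    using L2_measurable vL by auto
  note vz = L2_mult_bounded[OF z(1) vm(1) v(2)] and vz' = L2_mult_bounded[OF z'L vm(1) v(2)] and v'z = L2_mult_bounded[OF z(1) vm(2) v(3)]
  have E4: "(LINT x:?I|lebesgue. section_integral \<Omega> (\<lambda>p. 1) x * (v x * z x))
      = (LINT x:?I|lebesgue. qdef x * (v x * z x)) + (LINT x:?I|lebesgue. (m + b x) * v x * z x)"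
    using set_integral_add(2)[OF L2_mult_integrable[OF qdef_L2(1) vz(1)] L2_mult_integrable[OF qL vz(1)]]
    by (simp add: qdef_def m_def algebra_simps)
  \<comment> \<open>The pairing bound for \<open>qdef\<close> is applied to the product v z; by the
    Leibniz rule the norms of v z and of its derivative add up to at most (2 V0 + V1) M.\<close>
  have E5: "\<bar>LINT x:?I|lebesgue. qdef x * (v x * z x)\<bar> \<le> \<eta>2 * ((2 * V0 + V1) * M)"
  proof -
    have wd: "weak_deriv ?I 1 (\<lambda>x. v x * z x) (\<lambda>x. v x * z' x + ?v' x * z x)"
      by (rule weak_deriv_mult_smooth[OF open_greaterThanLessThan z(1,2) v(1), of "V0 + V1"]) (use v(2,3) V in \<open>auto intro: add_increasing add_increasing2\<close>)
    have "L2_norm ?I (\<lambda>x. v x * z' x + ?v' x * z x) \<le> L2_norm ?I (\<lambda>x. v x * z' x) + L2_norm ?I (\<lambda>x. ?v' x * z x)"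
      by (rule L2_norm_triangle[OF vz'(1) v'z(1)])
    moreover have "V0 * L2_norm ?I z' \<le> V0 * M" "V1 * L2_norm ?I z \<le> V1 * M" "V0 * L2_norm ?I z \<le> V0 * M"
      using V z(3,4) by (auto intro: mult_left_mono)
    ultimately have "L2_norm ?I (\<lambda>x. v x * z x) + L2_norm ?I (\<lambda>x. v x * z' x + ?v' x * z x) \<le> (2 * V0 + V1) * M"
      using vz(2) vz'(2) v'z(2) by (simp add: algebra_simps)
    then show ?thesis using p2[OF vz(1) wd] \<eta>(2) by (meson mult_left_mono order_trans)
  qed
  have E6: "\<bar>(LINT x:?I|lebesgue. F x * z x) - (LINT x:?I|lebesgue. f_hat x * z x)\<bar> \<le> \<eta>1 * (M + M)"
  proof -
    have "\<eta>1 * (L2_norm ?I z + L2_norm ?I z') \<le> \<eta>1 * (M + M)" using z(3,4) \<eta>(1) by (intro mult_left_mono add_mono)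
    then show ?thesis using p1[OF z(1,2)] LINT_diff_mult[OF F fh z(1)] by simp
  qed
  have "((m + 2 * b1) * \<sigma> + 2 * \<eta>1 + \<eta>2 * (2 * V0 + V1)) * M = b1 * \<sigma> * M + (m + b1) * \<sigma> * M + \<eta>2 * ((2 * V0 + V1) * M) + \<eta>1 * (M + M)"
    by (simp add: algebra_simps)
  then show ?thesis using E1 E2 E3 E4 E5 E6 unfolding m_def[symmetric] by linarith
qed

text \<open>On the teeth \<Phi>1 vanishes above height \<delta>, so it lives on a set of area at
  most \<delta>. On the base \<open>w1\<close> is z' plus the derivative of the remainder, which is
  not small. Replacing v' by \<psi> costs \<open>X * M\<close>; then the derivative is moved to
  \<psi>, which leaves \<open>Y\<close> times the small norm of the remainder itself.\<close>

lemma base_pairing: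
  assumes v: "smooth_fun v" "\<And>x. x \<in> {0<..<1} \<Longrightarrow> \<bar>frechet_derivative v (at x) 1\<bar> \<le> V1"
    and \<eta>: "\<And>y. 0 \<le> \<eta> y" "\<And>y. \<eta> y \<le> 1" "\<And>y. y \<le> 0 \<Longrightarrow> \<eta> y = 0" "\<And>y. \<delta> \<le> y \<Longrightarrow> \<eta> y = 1" "\<delta> > 0"
    and \<Phi>1: "smooth_fun \<Phi>1" "\<And>p. p \<in> \<Omega> \<Longrightarrow> \<Phi>1 p = frechet_derivative v (at (fst p)) 1 * (1 - \<eta> (snd p))"
    and \<psi>: "test_fun Om \<psi>" "L2_norm Om (\<lambda>p. frechet_derivative v (at (fst p)) 1 - \<psi> p) \<le> X"
      "L2_norm Om (\<lambda>p. frechet_derivative \<psi> (at p) (1, 0)) \<le> Y"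
    and w1: "w1 \<in> L2 \<Omega>" "L2_norm \<Omega> w1 \<le> A"
    and z: "z' \<in> L2 {0<..<1}" "weak_deriv \<Omega> (1, 0) p (\<lambda>p. w1 p - z' (fst p))"
      "L2_norm \<Omega> (\<lambda>p. w1 p - z' (fst p)) \<le> M" "L2_norm Om p \<le> M'" "p \<in> L2 Om"
  shows "\<bar>(LINT p:\<Omega>|lebesgue. \<Phi>1 p * w1 p) - (LINT x:{0<..<1}|lebesgue. b x * frechet_derivative v (at x) 1 * z' x)\<bar>
     \<le> V1 * sqrt \<delta> * A + X * M + Y * M'"
proof -
  let ?I = "{0<..<1::real}" and ?v' = "\<lambda>x. frechet_derivative v (at x) 1"
  let ?p1 = "\<lambda>p. w1 p - z' (fst p)"
  have V: "V1 \<ge> 0" using v(2)[of "1/2"] by auto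
  have bG: "- b1 \<le> G" using b0 b01 G by simp
  have \<Phi>L: "\<Phi>1 \<in> L2 \<Omega>" by (rule smooth_weak_deriv(1)[OF open_\<Omega> \<Omega>_bounded \<Phi>1(1)])
  have \<Phi>T: "\<Phi>1 \<in> L2 teeth" by (rule L2_subset(1)[OF \<Phi>L teeth_sub_\<Omega> measurable_sets(3)])
  have w1T: "w1 \<in> L2 teeth" "L2_norm teeth w1 \<le> A" using L2_subset[OF w1(1) teeth_sub_\<Omega> measurable_sets(3)] w1(2) by auto
  have w1O: "w1 \<in> L2 Om" by (rule L2_subset(1)[OF w1(1) Om_sub_\<Omega> measurable_sets(2)])
  have nT: "L2_norm teeth \<Phi>1 \<le> V1 * sqrt \<delta>"
  proof -
    let ?U = "teeth \<inter> {p. snd p < \<delta>}"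
    have op: "open {p :: real \<times> real. snd p < \<delta>}" by (rule open_Collect_less) (auto intro!: continuous_intros)
    then have oU: "open ?U" using open_teeth by blast
    have US: "?U \<subseteq> cbox (0 :: real, 0) (1, \<delta>)"
    proof
      fix p assume p: "p \<in> ?U"
      then obtain n where n: "n \<in> {1..N}" "p \<in> T n ` Q" by (auto simp: teeth_def)
      then have "p \<in> cell n \<times> {0<..<G}" using T_Q_sub by (rule_tac subsetD)
      moreover have "cell n \<subseteq> ?I" using cell_sub n(1) .
      ultimately show "p \<in> cbox (0, 0) (1, \<delta>)" using p by (auto simp: cbox_Pair_eq box_real)
    qed
    have lm: "?U \<in> lmeasurable" by (rule lmeasurable_open[OF bounded_subset[OF bounded_cbox US] oU])
    have m: "measure lebesgue ?U \<le> \<delta>"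
      using measure_mono_fmeasurable[OF US _ lmeasurable_cbox] lm \<eta>(5) by (simp add: content_Pair fmeasurableD)
    have sub: "?U \<subseteq> \<Omega>" using teeth_sub_\<Omega> by auto
    have "L2_norm ?U \<Phi>1 \<le> V1 * sqrt (measure lebesgue ?U)"
    proof (rule L2_bounded(2)[OF lm])
      show "restr ?U \<Phi>1 \<in> borel_measurable lebesgue" by (rule smooth_restr_measurable[OF \<Phi>1(1)]) (use lm in auto)
      fix p assume p: "p \<in> ?U"
      then have "p \<in> \<Omega>" using sub by auto
      then have "\<Phi>1 p = ?v' (fst p) * (1 - \<eta> (snd p))" "fst p \<in> ?I" using \<Phi>1(2) \<Omega>_sub by auto
      moreover have "\<bar>?v' (fst p) * (1 - \<eta> (snd p))\<bar> \<le> V1 * 1"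
        unfolding abs_mult using v(2)[OF \<open>fst p \<in> ?I\<close>] \<eta>(1,2)[of "snd p"] V by (intro mult_mono) auto
      ultimately show "\<bar>\<Phi>1 p\<bar> \<le> V1" by simp
    qed
    also have "\<dots> \<le> V1 * sqrt \<delta>" using m V by (intro mult_left_mono) auto
    finally have U: "L2_norm ?U \<Phi>1 \<le> V1 * sqrt \<delta>" .
    have "(LINT p:teeth|lebesgue. (\<Phi>1 p)\<^sup>2) = (LINT p:?U|lebesgue. (\<Phi>1 p)\<^sup>2)"
    proof (rule LINT_eq_of_zero)
      fix p assume "p \<in> teeth" "p \<notin> ?U"
      then have "p \<in> \<Omega>" "\<delta> \<le> snd p" using teeth_sub_\<Omega> by auto
      then show "(\<Phi>1 p)\<^sup>2 = 0" using \<Phi>1(2) \<eta>(4) by simp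
    qed auto
    then show ?thesis using U unfolding L2_norm_def by simp
  qed
  have v'L: "?v' \<in> L2 ?I" using weak_derivD(1)[OF smooth_weak_deriv(2)[of ?I v 1]] v(1) by auto
  have v'f: "(\<lambda>p. ?v' (fst p)) \<in> L2 Om"
    by (rule L2_subset(1)[OF fst_L2(1)[OF \<Omega>_sub measurable_sets(1) bG v'L] Om_sub_\<Omega> measurable_sets(2)])
  have z'f: "(\<lambda>p. z' (fst p)) \<in> L2 Om"
    by (rule L2_subset(1)[OF fst_L2(1)[OF \<Omega>_sub measurable_sets(1) bG z(1)] Om_sub_\<Omega> measurable_sets(2)])
  have p1O: "?p1 \<in> L2 Om" "L2_norm Om ?p1 \<le> M"
    using L2_subset[OF weak_derivD(1)[OF z(2)] Om_sub_\<Omega> measurable_sets(2)] z(3) by auto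
  have \<psi>L: "\<psi> \<in> L2 Om" by (rule test_fun_L2[OF \<psi>(1) measurable_sets(2)])
  have S1: "(LINT p:\<Omega>|lebesgue. \<Phi>1 p * w1 p) = (LINT p:Om|lebesgue. \<Phi>1 p * w1 p) + (LINT p:teeth|lebesgue. \<Phi>1 p * w1 p)"
    by (rule LINT_split[OF L2_mult_integrable[OF \<Phi>L w1(1)]])
  have S2: "\<bar>LINT p:teeth|lebesgue. \<Phi>1 p * w1 p\<bar> \<le> V1 * sqrt \<delta> * A"
    by (rule abs_LINT_mult_le[OF \<Phi>T w1T(1) nT w1T(2)])
  have S3: "(LINT p:Om|lebesgue. \<Phi>1 p * w1 p) = (LINT p:Om|lebesgue. ?v' (fst p) * w1 p)"
  proof (rule LINT_cong_AE, rule AE_I2, intro impI)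
    fix p assume p: "p \<in> Om"
    then have "snd p \<le> 0" using Om_sub_minus by (auto simp: Omega_minus_def)
    then show "\<Phi>1 p * w1 p = ?v' (fst p) * w1 p" using \<Phi>1(2)[of p] p Om_sub_\<Omega> \<eta>(3) by auto
  qed
  have S4: "(LINT p:Om|lebesgue. ?v' (fst p) * ?p1 p) = (LINT p:Om|lebesgue. ?v' (fst p) * w1 p) - (LINT p:Om|lebesgue. ?v' (fst p) * z' (fst p))"
    by (rule LINT_mult_diff[OF w1O z'f v'f])
  have S5: "(LINT p:Om|lebesgue. (?v' (fst p) - \<psi> p) * ?p1 p) = (LINT p:Om|lebesgue. ?v' (fst p) * ?p1 p) - (LINT p:Om|lebesgue. \<psi> p * ?p1 p)"
    by (rule LINT_diff_mult[OF v'f \<psi>L p1O(1)])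
  have S6: "\<bar>LINT p:Om|lebesgue. (?v' (fst p) - \<psi> p) * ?p1 p\<bar> \<le> X * M"
    by (rule abs_LINT_mult_le[OF L2_diff[OF v'f \<psi>L] p1O(1) \<psi>(2) p1O(2)])
  have S7: "\<bar>LINT p:Om|lebesgue. \<psi> p * ?p1 p\<bar> \<le> Y * M'"
  proof -
    have "(LINT q:Om|lebesgue. frechet_derivative \<psi> (at q) (1, 0) * p q) = - (LINT p:Om|lebesgue. \<psi> p * ?p1 p)"
      using weak_derivD(2)[OF weak_deriv_subset[OF z(2) Om_sub_\<Omega> open_Om] \<psi>(1)] by (simp add: mult.commute)
    moreover have "\<bar>LINT q:Om|lebesgue. frechet_derivative \<psi> (at q) (1, 0) * p q\<bar> \<le> Y * M'"
      by (rule abs_LINT_mult_le[OF test_fun_deriv_L2[OF \<psi>(1) measurable_sets(2)] z(5) \<psi>(3) z(4)])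
    ultimately show ?thesis by simp
  qed
  \<comment> \<open>Fubini: the section of the base at x has length \<open>b x\<close>, which is
    where the coefficient of the limit equation arises.\<close>
  have S8: "(LINT p:Om|lebesgue. ?v' (fst p) * z' (fst p)) = (LINT x:?I|lebesgue. b x * ?v' x * z' x)"
  proof -
    have v'm: "restr ?I ?v' \<in> borel_measurable lebesgue" by (rule L2_measurable[OF v'L])
    note vz = L2_mult_bounded(1)[OF z(1) v'm v(2)]
    have "(LINT p:Om|lebesgue. ?v' (fst p) * z' (fst p)) = (LINT p:Omega_minus b|lebesgue. 1 * (?v' (fst p) * z' (fst p)))"
      using LINT_AE_set[OF minus_AE] by simp
    also have "\<dots> = (LINT x:?I|lebesgue. section_integral (Omega_minus b) (\<lambda>p. 1) x * (?v' x * z' x))"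
      by (rule LINT_mult_fst[OF minus_sub _ _ vz L2_one(1)[OF minus_lm]]) (use minus_lm b0 b01 in auto)
    also have "\<dots> = (LINT x:?I|lebesgue. b x * ?v' x * z' x)"
      by (rule LINT_cong_AE, rule AE_I2) (auto simp: section_minus)
    finally show ?thesis .
  qed
  show ?thesis using S1 S2 S3 S4 S5 S6 S7 S8 by linarith
qed

section \<open>The energy estimate for a fixed \<epsilon>\<close>

text \<open>Testing with w = u - \<Phi> expresses A^2 by four pairings, each of which equals 0 or a
  one-dimensional pairing up to a multiple of A. The summands of \<open>K\<close> are, in order: the
  strip of height \<delta>, the transition in y, the difference of \<Phi> and v, the remainder
  against f and v, the two prices for replacing v' by \<psi>, and the one-dimensional
  errors.\<close>

lemma energy_estimate:
  assumes P: "finite P" "P \<subseteq> base_boxes b0 Q" "0 \<le> C"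
    and PI: "\<And>v D. incr_bounded Q v D \<Longrightarrow> L2_norm Q v \<le> C * (D + (\<Sum>z\<in>P. L2_norm (base_box z) v))"
    and \<rho>: "test_fun {-b0<..<0} \<rho>" "(LINT y:{-b0<..<0}|lebesgue. \<rho> y) = 1" "\<And>y. \<bar>\<rho> y\<bar> \<le> B"
    and \<Lambda>: "\<Lambda> = split_const b0 b1 G B (L2_norm {-b0<..<0} \<rho>) (2 * (C * (1 + card P * (1 + b0))))"
    and e: "e > 0"
    and f: "f \<in> L2 \<Omega>" "L2_norm \<Omega> f \<le> Cf"
    and sol: "weak_solution_thin \<Omega> e f u"
    and lim: "weak_solution_limit b (\<lambda>x. measure lebesgue Q / L + b x) f_hat u0" and fh: "f_hat \<in> L2 {0<..<1}"
    and v: "smooth_fun v" "\<And>x. 0 \<le> x \<Longrightarrow> x \<le> 1 \<Longrightarrow> \<bar>v x\<bar> \<le> V0" "\<And>x. 0 \<le> x \<Longrightarrow> x \<le> 1 \<Longrightarrow> \<bar>frechet_derivative v (at x) 1\<bar> \<le> V1"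
    and \<sigma>: "L2_norm {0<..<1} (\<lambda>x. u0 x - v x) \<le> \<sigma>" "L2_norm {0<..<1} (\<lambda>x. wderiv {0<..<1} 1 u0 x - frechet_derivative v (at x) 1) \<le> \<sigma>"
    and p1: "\<And>w w'. w \<in> L2 {0<..<1} \<Longrightarrow> weak_deriv {0<..<1} 1 w w' \<Longrightarrow>
        \<bar>LINT x:{0<..<1}|lebesgue. (section_integral \<Omega> f x - f_hat x) * w x\<bar> \<le> \<eta>1 * (L2_norm {0<..<1} w + L2_norm {0<..<1} w')"
    and p2: "\<And>w w'. w \<in> L2 {0<..<1} \<Longrightarrow> weak_deriv {0<..<1} 1 w w' \<Longrightarrow>
        \<bar>LINT x:{0<..<1}|lebesgue. qdef x * w x\<bar> \<le> \<eta>2 * (L2_norm {0<..<1} w + L2_norm {0<..<1} w')"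
    and \<eta>12: "0 \<le> \<eta>1" "0 \<le> \<eta>2"
    and \<eta>: "smooth_fun \<eta>" "\<And>y. 0 \<le> \<eta> y" "\<And>y. \<eta> y \<le> 1" "\<And>y. y \<le> \<delta> / 2 \<Longrightarrow> \<eta> y = 0" "\<And>y. \<delta> \<le> y \<Longrightarrow> \<eta> y = 1"
      "\<And>y. \<bar>frechet_derivative \<eta> (at y) 1\<bar> \<le> H" "\<delta> > 0"
    and \<kappa>: "\<kappa> > 0" "\<And>q. q \<in> closure Q \<Longrightarrow> \<delta> / 2 \<le> snd q \<Longrightarrow> \<kappa> < fst q \<and> fst q < L - \<kappa>"
    and \<psi>: "test_fun Om \<psi>" "L2_norm Om (\<lambda>p. frechet_derivative v (at (fst p)) 1 - \<psi> p) \<le> X"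
      "L2_norm Om (\<lambda>p. frechet_derivative \<psi> (at p) (1, 0)) \<le> Y"
    and K: "K = V1 * sqrt \<delta> + H * (V1 * L) * sqrt (b1 + G) * (l / e) + V1 * (L * l) * sqrt (b1 + G)
      + (Cf + V0 * sqrt (b1 + G)) * (\<Lambda> * (l + e)) + X * \<Lambda> + Y * (\<Lambda> * e)
      + ((measure lebesgue Q / L + 2 * b1) * \<sigma> + 2 * \<eta>1 + \<eta>2 * (2 * V0 + V1)) * \<Lambda>"
  shows "L2_norm \<Omega> (\<lambda>p. u p - v (fst p)) \<le> K + V1 * (L * l) * sqrt (b1 + G) \<and>
    (\<exists>g1 g2. weak_deriv Om (1, 0) (\<lambda>p. u p - v (fst p)) g1 \<and> weak_deriv Om (0, 1) (\<lambda>p. u p - v (fst p)) g2 \<and>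
      L2_norm Om g1 \<le> K \<and> L2_norm Om g2 \<le> e * K)"
proof -
  let ?I = "{0<..<1::real}" and ?v' = "\<lambda>x. frechet_derivative v (at x) 1"
  define s where "s = sqrt (b1 + G)"
  have s0: "s \<ge> 0" unfolding s_def using b0 b01 G by simp
  have V: "V0 \<ge> 0" "V1 \<ge> 0" using v(2)[of 0] v(3)[of 0] by auto
  have H: "H \<ge> 0" using \<eta>(6)[of 0] by linarith
  have bG: "- b1 \<le> G" using b0 b01 G by simp
  obtain \<Phi> where \<Phi>: "smooth_fun \<Phi>"
    "\<And>p. p \<in> \<Omega> \<Longrightarrow> frechet_derivative \<Phi> (at p) (1, 0) = ?v' (fst p) * (1 - \<eta> (snd p))"
    "\<And>p. p \<in> \<Omega> \<Longrightarrow> \<bar>frechet_derivative \<Phi> (at p) (0, 1)\<bar> \<le> H * (V1 * (L * l))"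
    "\<And>p. p \<in> \<Omega> \<Longrightarrow> \<bar>\<Phi> p - v (fst p)\<bar> \<le> V1 * (L * l)"
    "\<And>p. snd p \<le> 0 \<Longrightarrow> \<Phi> p = v (fst p)"
    by (rule profile_exists[OF v(1,3) \<eta>(1-4,6,7) \<kappa>]) (assumption | (rule that; assumption))+
  define \<Phi>1 where "\<Phi>1 = (\<lambda>p. frechet_derivative \<Phi> (at p) (1, 0))"
  define \<Phi>2 where "\<Phi>2 = (\<lambda>p. frechet_derivative \<Phi> (at p) (0, 1))"
  have \<Phi>s: "smooth_fun \<Phi>1" "smooth_fun \<Phi>2" unfolding \<Phi>1_def \<Phi>2_def by (intro smooth_fun_deriv \<Phi>(1))+
  have \<Phi>w: "weak_deriv \<Omega> (1, 0) \<Phi> \<Phi>1" "weak_deriv \<Omega> (0, 1) \<Phi> \<Phi>2"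
    unfolding \<Phi>1_def \<Phi>2_def by (rule smooth_weak_deriv(2)[OF open_\<Omega> \<Omega>_bounded \<Phi>(1)])+
  have \<Phi>L: "\<Phi> \<in> L2 \<Omega>" "\<Phi>1 \<in> L2 \<Omega>" "\<Phi>2 \<in> L2 \<Omega>"
    using smooth_weak_deriv(1)[OF open_\<Omega> \<Omega>_bounded] \<Phi>(1) \<Phi>s by auto
  have vf: "(\<lambda>p. v (fst p)) \<in> L2 \<Omega>"
    by (rule smooth_weak_deriv(1)[OF open_\<Omega> \<Omega>_bounded smooth_fun_comp_fst(1)[OF v(1)]])
  have nb: "L2_norm \<Omega> g \<le> k * s" if "g \<in> L2 \<Omega>" "\<And>p. p \<in> \<Omega> \<Longrightarrow> \<bar>g p\<bar> \<le> k" "0 \<le> k" for g k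
  proof -
    have "L2_norm \<Omega> g \<le> k * sqrt (measure lebesgue \<Omega>)" by (rule L2_bounded(2)[OF \<Omega>_lm L2_measurable[OF that(1)] that(2)])
    also have "\<dots> \<le> k * s" unfolding s_def using measure_\<Omega> that(3) by (intro mult_left_mono) auto
    finally show ?thesis .
  qed
  have Ll: "0 \<le> V1 * (L * l)" using V L l by simp
  have n\<Phi>2: "L2_norm \<Omega> \<Phi>2 \<le> H * (V1 * (L * l)) * s" by (rule nb[OF \<Phi>L(3)]) (use \<Phi>(3) H Ll in \<open>auto simp: \<Phi>2_def\<close>)
  have n\<Phi>: "L2_norm \<Omega> (\<lambda>p. \<Phi> p - v (fst p)) \<le> V1 * (L * l) * s" by (rule nb[OF L2_diff[OF \<Phi>L(1) vf] \<Phi>(4) Ll])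
  have nv: "L2_norm \<Omega> (\<lambda>p. v (fst p)) \<le> V0 * s" by (rule nb[OF vf _ V(1)]) (use \<Omega>_sub v(2) in auto)

  have uH: "u \<in> H1 \<Omega>" using sol by (simp add: weak_solution_thin_def)
  have uL: "u \<in> L2 \<Omega>" by (rule H1_L2[OF uH])
  have Ba: "(1, 0) \<in> (Basis :: (real \<times> real) set)" "(0, 1) \<in> (Basis :: (real \<times> real) set)" by (auto simp: Basis_prod_def)
  define u1 where "u1 = wderiv \<Omega> (1, 0) u"
  define u2 where "u2 = wderiv \<Omega> (0, 1) u"
  have uw: "weak_deriv \<Omega> (1, 0) u u1" "weak_deriv \<Omega> (0, 1) u u2"
    unfolding u1_def u2_def by (rule H1_weak_deriv[OF uH Ba(1)], rule H1_weak_deriv[OF uH Ba(2)])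
  have u12: "u1 \<in> L2 \<Omega>" "u2 \<in> L2 \<Omega>" using weak_derivD(1) uw by blast+
  define w where "w = (\<lambda>p. u p - \<Phi> p)"
  define w1 where "w1 = (\<lambda>p. u1 p - \<Phi>1 p)"
  define w2 where "w2 = (\<lambda>p. u2 p - \<Phi>2 p)"
  have w: "w \<in> L2 \<Omega>" "weak_deriv \<Omega> (1, 0) w w1" "weak_deriv \<Omega> (0, 1) w w2"
    unfolding w_def w1_def w2_def
    by (rule L2_diff[OF uL \<Phi>L(1)], rule weak_deriv_diff[OF open_\<Omega> uL \<Phi>L(1) uw(1) \<Phi>w(1)], rule weak_deriv_diff[OF open_\<Omega> uL \<Phi>L(1) uw(2) \<Phi>w(2)])
  have w12: "w1 \<in> L2 \<Omega>" "w2 \<in> L2 \<Omega>" using weak_derivD(1) w by blast+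
  have wH: "w \<in> H1 \<Omega>" unfolding w_def by (rule H1_diff[OF open_\<Omega> uH smooth_H1[OF open_\<Omega> \<Omega>_bounded \<Phi>(1)]])
  \<comment> \<open>The energy norm of \<open>w\<close>; the factor 1 / e in front of the
    y-derivative yields the bound e A for \<open>w2\<close>.\<close>
  define A where "A = sqrt ((L2_norm \<Omega> w1)\<^sup>2 + (L2_norm \<Omega> w2 / e)\<^sup>2 + (L2_norm \<Omega> w)\<^sup>2)"
  have A2: "A\<^sup>2 = (L2_norm \<Omega> w1)\<^sup>2 + (L2_norm \<Omega> w2 / e)\<^sup>2 + (L2_norm \<Omega> w)\<^sup>2" unfolding A_def by simp
  have A0: "A \<ge> 0" unfolding A_def by simp
  have wA: "L2_norm \<Omega> w \<le> A" "L2_norm \<Omega> w1 \<le> A" unfolding A_def by (rule real_le_rsqrt, simp)+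
  have "L2_norm \<Omega> w2 / e \<le> A" unfolding A_def by (rule real_le_rsqrt, simp)
  then have w2A: "L2_norm \<Omega> w2 \<le> e * A" using e by (simp add: divide_le_eq mult.commute)

  have EQ: "(LINT p:\<Omega>|lebesgue. u1 p * w1 p) + 1 / e\<^sup>2 * (LINT p:\<Omega>|lebesgue. u2 p * w2 p) + (LINT p:\<Omega>|lebesgue. u p * w p)
      = (LINT p:\<Omega>|lebesgue. f p * w p)"
  proof -
    have "(LINT p:\<Omega>|lebesgue. f p * w p) = (LINT p:\<Omega>|lebesgue. u1 p * wderiv \<Omega> (1, 0) w p + 1 / e\<^sup>2 * (u2 p * wderiv \<Omega> (0, 1) w p) + u p * w p)"
      using sol wH unfolding weak_solution_thin_def u1_def u2_def by auto
    also have "\<dots> = (LINT p:\<Omega>|lebesgue. u1 p * w1 p + 1 / e\<^sup>2 * (u2 p * w2 p) + u p * w p)"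
    proof (rule LINT_cong_AE)
      show "AE p in lebesgue. p \<in> \<Omega> \<longrightarrow> u1 p * wderiv \<Omega> (1, 0) w p + 1 / e\<^sup>2 * (u2 p * wderiv \<Omega> (0, 1) w p) + u p * w p
          = u1 p * w1 p + 1 / e\<^sup>2 * (u2 p * w2 p) + u p * w p"
        using wderiv_AE[OF open_\<Omega> w(2)] wderiv_AE[OF open_\<Omega> w(3)] by eventually_elim simp
    qed
    also have "\<dots> = (LINT p:\<Omega>|lebesgue. u1 p * w1 p + 1 / e\<^sup>2 * (u2 p * w2 p)) + (LINT p:\<Omega>|lebesgue. u p * w p)"
      by (intro set_integral_add L2_mult_integrable set_integrable_mult_right u12 w12 w(1) uL)
    also have "(LINT p:\<Omega>|lebesgue. u1 p * w1 p + 1 / e\<^sup>2 * (u2 p * w2 p))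
        = (LINT p:\<Omega>|lebesgue. u1 p * w1 p) + (LINT p:\<Omega>|lebesgue. 1 / e\<^sup>2 * (u2 p * w2 p))"
      by (intro set_integral_add L2_mult_integrable set_integrable_mult_right u12 w12)
    also have "(LINT p:\<Omega>|lebesgue. 1 / e\<^sup>2 * (u2 p * w2 p)) = 1 / e\<^sup>2 * (LINT p:\<Omega>|lebesgue. u2 p * w2 p)"
      by (rule set_integral_mult_right)
    finally show ?thesis by simp
  qed
  have q1: "(L2_norm \<Omega> w1)\<^sup>2 = (LINT p:\<Omega>|lebesgue. u1 p * w1 p) - (LINT p:\<Omega>|lebesgue. \<Phi>1 p * w1 p)"
    unfolding L2_norm_power2 using LINT_diff_mult[OF u12(1) \<Phi>L(2) w12(1)] by (simp add: w1_def power2_eq_square)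
  have q2: "(L2_norm \<Omega> w2)\<^sup>2 = (LINT p:\<Omega>|lebesgue. u2 p * w2 p) - (LINT p:\<Omega>|lebesgue. \<Phi>2 p * w2 p)"
    unfolding L2_norm_power2 using LINT_diff_mult[OF u12(2) \<Phi>L(3) w12(2)] by (simp add: w2_def power2_eq_square)
  have q3: "(L2_norm \<Omega> w)\<^sup>2 = (LINT p:\<Omega>|lebesgue. u p * w p) - (LINT p:\<Omega>|lebesgue. \<Phi> p * w p)"
    unfolding L2_norm_power2 using LINT_diff_mult[OF uL \<Phi>L(1) w(1)] by (simp add: w_def power2_eq_square)
  have q2': "(L2_norm \<Omega> w2 / e)\<^sup>2 = 1 / e\<^sup>2 * (LINT p:\<Omega>|lebesgue. u2 p * w2 p) - 1 / e\<^sup>2 * (LINT p:\<Omega>|lebesgue. \<Phi>2 p * w2 p)"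
    unfolding power_divide q2 by (simp add: diff_divide_distrib)
  have energy: "A\<^sup>2 = (LINT p:\<Omega>|lebesgue. f p * w p) - (LINT p:\<Omega>|lebesgue. \<Phi>1 p * w1 p)
      - 1 / e\<^sup>2 * (LINT p:\<Omega>|lebesgue. \<Phi>2 p * w2 p) - (LINT p:\<Omega>|lebesgue. \<Phi> p * w p)"
    using A2 q1 q2' q3 EQ by linarith

  obtain z z' where z: "z \<in> L2 ?I" "weak_deriv ?I 1 z z'" "L2_norm ?I z \<le> \<Lambda> * A" "L2_norm ?I z' \<le> \<Lambda> * A"
    "weak_deriv \<Omega> (1, 0) (\<lambda>p. w p - z (fst p)) (\<lambda>p. w1 p - z' (fst p))" "L2_norm \<Omega> (\<lambda>p. w1 p - z' (fst p)) \<le> \<Lambda> * A"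
    "L2_norm Om (\<lambda>p. w p - z (fst p)) \<le> \<Lambda> * (e * A)" "L2_norm \<Omega> (\<lambda>p. w p - z (fst p)) \<le> \<Lambda> * ((l + e) * A)"
    using split_exists[OF P PI \<rho> w wA w2A e \<Lambda>] by blast
  have z'L: "z' \<in> L2 ?I" using weak_derivD(1)[OF z(2)] .
  have zf: "(\<lambda>p. z (fst p)) \<in> L2 \<Omega>" using fst_L2(1)[OF \<Omega>_sub measurable_sets(1) bG z(1)] .
  have pL: "(\<lambda>p. w p - z (fst p)) \<in> L2 \<Omega>" by (rule L2_diff[OF w(1) zf])
  have v3: "\<And>x. x \<in> ?I \<Longrightarrow> \<bar>v x\<bar> \<le> V0" "\<And>x. x \<in> ?I \<Longrightarrow> \<bar>?v' x\<bar> \<le> V1" using v(2,3) by auto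
  have F: "section_integral \<Omega> f \<in> L2 ?I" by (rule section_integral_L2(1)[OF \<Omega>_sub bG f(1)])

  have t1: "\<bar>(LINT p:\<Omega>|lebesgue. f p * w p) - (LINT x:?I|lebesgue. section_integral \<Omega> f x * z x)\<bar> \<le> Cf * (\<Lambda> * ((l + e) * A))"
    using abs_LINT_mult_le[OF f(1) pL f(2) z(8)] LINT_mult_diff[OF w(1) zf f(1)]
      LINT_mult_fst[OF \<Omega>_sub measurable_sets(1) bG z(1) f(1)] by simp
  have t2: "\<bar>(LINT p:\<Omega>|lebesgue. \<Phi>1 p * w1 p) - (LINT x:?I|lebesgue. b x * ?v' x * z' x)\<bar>
      \<le> V1 * sqrt \<delta> * A + X * (\<Lambda> * A) + Y * (\<Lambda> * (e * A))"
  proof (rule base_pairing[where \<eta> = \<eta> and \<psi> = \<psi> and p = "\<lambda>p. w p - z (fst p)"])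
    show "\<eta> y = 0" if "y \<le> 0" for y using \<eta>(4,7) that by simp
    show "\<Phi>1 p = ?v' (fst p) * (1 - \<eta> (snd p))" if "p \<in> \<Omega>" for p using \<Phi>(2)[OF that] by (simp add: \<Phi>1_def)
    show "(\<lambda>p. w p - z (fst p)) \<in> L2 Om" by (rule L2_subset(1)[OF pL Om_sub_\<Omega> measurable_sets(2)])
  qed (use v(1) v3(2) \<eta>(2,3,5,7) \<Phi>s(1) \<psi> w12(1) wA(2) z'L z(5-7) in auto)
  \<comment> \<open>The weight 1 / e^2 meets \<Phi>2 of size l and \<open>w2\<close> of size e A.
    The remaining quotient l / e tends to 0 when l is the power \<alpha> > 1 of e.\<close>
  have t3: "\<bar>1 / e\<^sup>2 * (LINT p:\<Omega>|lebesgue. \<Phi>2 p * w2 p)\<bar> \<le> H * (V1 * L) * s * (l / e) * A"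
  proof -
    have "1 / e\<^sup>2 * \<bar>LINT p:\<Omega>|lebesgue. \<Phi>2 p * w2 p\<bar> \<le> 1 / e\<^sup>2 * (H * (V1 * (L * l)) * s * (e * A))"
      by (intro mult_left_mono abs_LINT_mult_le[OF \<Phi>L(3) w12(2) n\<Phi>2 w2A]) simp
    also have "\<dots> = H * (V1 * L) * s * (l / e) * A" using e by (simp add: power2_eq_square field_simps)
    finally show ?thesis using e by (simp add: abs_mult)
  qed
  have t4: "\<bar>(LINT p:\<Omega>|lebesgue. \<Phi> p * w p) - (LINT x:?I|lebesgue. section_integral \<Omega> (\<lambda>p. 1) x * (v x * z x))\<bar>
      \<le> V1 * (L * l) * s * A + V0 * s * (\<Lambda> * ((l + e) * A))"
  proof -
    have "restr ?I v \<in> borel_measurable lebesgue" by (rule smooth_restr_measurable[OF v(1)]) simp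
    note vz = L2_mult_bounded(1)[OF z(1) this v3(1)]
    have "(LINT p:\<Omega>|lebesgue. v (fst p) * z (fst p)) = (LINT x:?I|lebesgue. section_integral \<Omega> (\<lambda>p. 1) x * (v x * z x))"
      using LINT_mult_fst[OF \<Omega>_sub measurable_sets(1) bG vz L2_one(1)[OF \<Omega>_lm]] by simp
    then show ?thesis
      using abs_LINT_mult_le[OF L2_diff[OF \<Phi>L(1) vf] w(1) n\<Phi> wA(1)] abs_LINT_mult_le[OF vf pL nv z(8)]
        LINT_diff_mult[OF \<Phi>L(1) vf w(1)] LINT_mult_diff[OF w(1) zf vf] by linarith
  qed
  have t5: "\<bar>(LINT x:?I|lebesgue. section_integral \<Omega> f x * z x) - (LINT x:?I|lebesgue. b x * ?v' x * z' x)
      - (LINT x:?I|lebesgue. section_integral \<Omega> (\<lambda>p. 1) x * (v x * z x))\<bar>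
     \<le> ((measure lebesgue Q / L + 2 * b1) * \<sigma> + 2 * \<eta>1 + \<eta>2 * (2 * V0 + V1)) * (\<Lambda> * A)"
    by (rule limit_pairing[OF lim fh F v(1) v3 \<sigma> p1 p2 z(1-4) \<eta>12])
  have "K * A = V1 * sqrt \<delta> * A + X * (\<Lambda> * A) + Y * (\<Lambda> * (e * A)) + H * (V1 * L) * s * (l / e) * A
      + (V1 * (L * l) * s * A + V0 * s * (\<Lambda> * ((l + e) * A))) + Cf * (\<Lambda> * ((l + e) * A))
      + ((measure lebesgue Q / L + 2 * b1) * \<sigma> + 2 * \<eta>1 + \<eta>2 * (2 * V0 + V1)) * (\<Lambda> * A)"
    unfolding K s_def[symmetric] ring_distribs by (simp only: mult_ac add_ac)
  then have "A\<^sup>2 \<le> K * A" using energy t1 t2 t3 t4 t5 by linarith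
  then have AK: "A \<le> K" if "A > 0" using that by (simp add: power2_eq_square)
  \<comment> \<open>This settles the case A = 0, in which the division by A is not possible.\<close>
  have "0 \<le> K"
  proof -
    have "0 \<le> \<Lambda>"
    proof -
      have B: "B \<ge> 0" using \<rho>(3)[of 0] by linarith
      show ?thesis unfolding \<Lambda> split_const_def using B P(3) b0 b01 G
        by (intro add_nonneg_nonneg mult_nonneg_nonneg) auto
    qed
    moreover have "0 \<le> X" "0 \<le> Y" "0 \<le> \<sigma>" "0 \<le> Cf"
      using \<psi>(2,3) \<sigma>(1) f(2) L2_norm_nonneg order_trans by blast+
    ultimately show ?thesis unfolding K using V H L l e \<eta>(7) b0 b01 G \<eta>12 by (intro add_nonneg_nonneg mult_nonneg_nonneg) auto
  qed
  then have AK: "A \<le> K" using AK A0 by force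
  show ?thesis
  proof (intro conjI exI)
    have "L2_norm \<Omega> (\<lambda>p. u p - v (fst p)) \<le> L2_norm \<Omega> w + L2_norm \<Omega> (\<lambda>p. \<Phi> p - v (fst p))"
      unfolding w_def by (rule L2_norm_triangle3[OF uL \<Phi>L(1) vf])
    then show "L2_norm \<Omega> (\<lambda>p. u p - v (fst p)) \<le> K + V1 * (L * l) * sqrt (b1 + G)"
      using wA(1) AK n\<Phi> by (simp add: s_def)
    have ae: "AE p in lebesgue. p \<in> Om \<longrightarrow> w p = u p - v (fst p)"
    proof (rule AE_I2, intro impI)
      fix p assume "p \<in> Om"
      then have "snd p \<le> 0" using Om_sub_minus by (auto simp: Omega_minus_def)
      then show "w p = u p - v (fst p)" using \<Phi>(5) by (simp add: w_def)
    qed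
    show "weak_deriv Om (1, 0) (\<lambda>p. u p - v (fst p)) w1" "weak_deriv Om (0, 1) (\<lambda>p. u p - v (fst p)) w2"
      using weak_deriv_cong_AE[OF weak_deriv_subset[OF w(2) Om_sub_\<Omega> open_Om] ae]
        weak_deriv_cong_AE[OF weak_deriv_subset[OF w(3) Om_sub_\<Omega> open_Om] ae] by auto
    show "L2_norm Om w1 \<le> K" using L2_subset(2)[OF w12(1) Om_sub_\<Omega> measurable_sets(2)] wA(2) AK by linarith
    have "e * A \<le> e * K" using e AK by simp
    then show "L2_norm Om w2 \<le> e * K" using L2_subset(2)[OF w12(2) Om_sub_\<Omega> measurable_sets(2)] w2A by linarith
  qed
qed

text \<open>Lifting a function of x to \<Omega> multiplies its norm by at most sqrt (b1 + G),
  because the sections have length at most b1 + G; this is the price for exchanging v for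
  \<open>u0\<close>. In the H1 norm the three parts give sqrt 3, rounded up to 3.\<close>

lemma fst_close:
  assumes uL: "u \<in> L2 \<Omega>" and u0: "u0 \<in> L2 {0<..<1}" "weak_deriv {0<..<1} 1 u0 u0'" and v: "smooth_fun v"
    and \<sigma>: "L2_norm {0<..<1} (\<lambda>x. u0 x - v x) \<le> \<sigma>" "L2_norm {0<..<1} (\<lambda>x. u0' x - frechet_derivative v (at x) 1) \<le> \<sigma>"
    and K: "L2_norm \<Omega> (\<lambda>p. u p - v (fst p)) \<le> K"
    and g1: "weak_deriv Om (1, 0) (\<lambda>p. u p - v (fst p)) g1" "L2_norm Om g1 \<le> K"
    and g2: "weak_deriv Om (0, 1) (\<lambda>p. u p - v (fst p)) g2" "L2_norm Om g2 \<le> K"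
  shows "L2_norm \<Omega> (\<lambda>p. u p - u0 (fst p)) \<le> K + sqrt (b1 + G) * \<sigma>"
    and "H1_norm Om (\<lambda>p. u p - u0 (fst p)) \<le> 3 * (K + sqrt (b1 + G) * \<sigma>)"
    and "(\<lambda>p. u0 (fst p)) \<in> H1 Om"
proof -
  let ?I = "{0<..<1::real}" and ?v' = "\<lambda>x. frechet_derivative v (at x) 1"
  define R where "R = K + sqrt (b1 + G) * \<sigma>"
  have bG: "- b1 \<le> G" "0 \<le> b1 + G" using b0 b01 G by auto
  have \<sigma>0: "\<sigma> \<ge> 0" using \<sigma>(1) L2_norm_nonneg order_trans by blast
  have vL: "v \<in> L2 ?I" "weak_deriv ?I 1 v ?v'" using smooth_weak_deriv[of ?I v] v by auto
  have dL: "(\<lambda>x. u0 x - v x) \<in> L2 ?I" by (rule L2_diff[OF u0(1) vL(1)])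
  have dw: "weak_deriv ?I 1 (\<lambda>x. u0 x - v x) (\<lambda>x. u0' x - ?v' x)" by (rule weak_deriv_diff[OF _ u0(1) vL(1) u0(2) vL(2)]) simp
  note d'L = weak_derivD(1)[OF dw]
  have dn: "L2_norm \<Omega> (\<lambda>p. z (fst p)) \<le> sqrt (b1 + G) * \<sigma>" if "z \<in> L2 ?I" "L2_norm ?I z \<le> \<sigma>" for z
  proof -
    have "L2_norm \<Omega> (\<lambda>p. z (fst p)) \<le> sqrt (G - - b1) * L2_norm ?I z" by (rule fst_L2(2)[OF \<Omega>_sub measurable_sets(1) bG(1) that(1)])
    also have "\<dots> \<le> sqrt (b1 + G) * \<sigma>" using that(2) bG by (simp add: add.commute mult_left_mono)
    finally show ?thesis .
  qed
  note ff = fst_L2(1)[OF \<Omega>_sub measurable_sets(1) bG(1)]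
  note dfL = ff[OF dL] and d'fL = ff[OF d'L]
  have uv: "(\<lambda>p. u p - v (fst p)) \<in> L2 \<Omega>" by (rule L2_diff[OF uL ff[OF vL(1)]])
  have eq: "(\<lambda>p. u p - v (fst p) - (u0 (fst p) - v (fst p))) = (\<lambda>p. u p - u0 (fst p))" by (simp add: fun_eq_iff)
  have n: "L2_norm \<Omega> (\<lambda>p. u p - u0 (fst p)) \<le> R"
    using L2_norm_triangle_diff[OF uv dfL] dn[OF dL \<sigma>(1)] K unfolding R_def eq by linarith
  then show "L2_norm \<Omega> (\<lambda>p. u p - u0 (fst p)) \<le> K + sqrt (b1 + G) * \<sigma>" unfolding R_def .
  have OmS: "Om \<subseteq> {0<..<1} \<times> {-b1<..<G}" using Om_sub_\<Omega> \<Omega>_sub by blast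
  note wf = weak_deriv_fst[OF open_Om OmS zero_less_one bG(1) dL dw] and wu = weak_deriv_fst[OF open_Om OmS zero_less_one bG(1) u0]
  note sub = L2_subset[OF _ Om_sub_\<Omega> measurable_sets(2)]
  have w1: "weak_deriv Om (1, 0) (\<lambda>p. u p - u0 (fst p)) (\<lambda>p. g1 p - (u0' (fst p) - ?v' (fst p)))"
    using weak_deriv_diff[OF open_Om sub(1)[OF uv] sub(1)[OF dfL] g1(1) wf(1)] unfolding eq .
  have w2: "weak_deriv Om (0, 1) (\<lambda>p. u p - u0 (fst p)) g2"
    using weak_deriv_diff[OF open_Om sub(1)[OF uv] sub(1)[OF dfL] g2(1) wf(2)] unfolding eq by simp
  have n1: "L2_norm Om (wderiv Om (1, 0) (\<lambda>p. u p - u0 (fst p))) \<le> R"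
    unfolding L2_norm_wderiv[OF open_Om w1] R_def
    using L2_norm_triangle_diff[OF weak_derivD(1)[OF g1(1)] sub(1)[OF d'fL]] sub(2)[OF d'fL] dn[OF d'L \<sigma>(2)] g1(2) by linarith
  have "0 \<le> sqrt (b1 + G) * \<sigma>" using bG \<sigma>0 by simp
  then have n2: "L2_norm Om (wderiv Om (0, 1) (\<lambda>p. u p - u0 (fst p))) \<le> R"
    unfolding L2_norm_wderiv[OF open_Om w2] R_def using g2(2) by linarith
  have n0: "L2_norm Om (\<lambda>p. u p - u0 (fst p)) \<le> R"
    using sub(2)[OF L2_diff[OF uL ff[OF u0(1)]]] n by linarith
  have R0: "R \<ge> 0" using n0 L2_norm_nonneg order_trans by blast
  have three: "sqrt (x\<^sup>2 + (y\<^sup>2 + z\<^sup>2)) \<le> 3 * R" if "0 \<le> x" "x \<le> R" "0 \<le> y" "y \<le> R" "0 \<le> z" "z \<le> R" for x y z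
  proof (rule real_le_lsqrt)
    have "x\<^sup>2 \<le> R\<^sup>2" "y\<^sup>2 \<le> R\<^sup>2" "z\<^sup>2 \<le> R\<^sup>2" using that by (auto intro: power_mono)
    moreover have "(3 * R)\<^sup>2 = 9 * R\<^sup>2" by (simp add: power_mult_distrib)
    ultimately show "x\<^sup>2 + (y\<^sup>2 + z\<^sup>2) \<le> (3 * R)\<^sup>2" using zero_le_power2[of R] by linarith
  qed (use R0 in auto)
  show "H1_norm Om (\<lambda>p. u p - u0 (fst p)) \<le> 3 * (K + sqrt (b1 + G) * \<sigma>)"
    unfolding H1_norm_def Basis_real_prod using three[OF _ n0 _ n1 _ n2] by (simp add: R_def)
  show "(\<lambda>p. u0 (fst p)) \<in> H1 Om"
  proof (rule H1I[OF sub(1)[OF ff[OF u0(1)]], of "\<lambda>v p. if v = (1, 0) then u0' (fst p) else 0"])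
    fix v :: "real \<times> real" assume "v \<in> Basis"
    then have "v = (1, 0) \<or> v = (0, 1)" unfolding Basis_real_prod by auto
    then show "weak_deriv Om v (\<lambda>p. u0 (fst p)) (\<lambda>p. if v = (1, 0) then u0' (fst p) else 0)" using wu by auto
  qed
qed

end

section \<open>Passage to the limit\<close>

lemma comb_scaled:
  assumes "L > 0" "G > 0" "piecewise_C1_01 b" "b0 > 0" "\<And>x. x \<in> {0<..<1} \<Longrightarrow> b0 \<le> b x \<and> b x \<le> b1"
    and "lipschitz_domain Q" "Q \<subseteq> {0<..<L} \<times> {0<..<G}" "\<epsilon> > 0"
  shows "comb L G b0 b1 (\<epsilon> powr \<alpha>) b Q (num_teeth \<alpha> L \<epsilon>)"
    and "comb.\<Omega> L (\<epsilon> powr \<alpha>) b Q (num_teeth \<alpha> L \<epsilon>) = Omega \<alpha> L Q b \<epsilon>"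
proof -
  have l: "\<epsilon> powr \<alpha> > 0" using assms(8) by simp
  note nt = num_teeth_bounds[OF assms(1) l]
  have "real (Suc (num_teeth \<alpha> L \<epsilon>)) * L * \<epsilon> powr \<alpha> > 1"
    using nt(2)[of "Suc (num_teeth \<alpha> L \<epsilon>)"] unfolding num_teeth_def by (meson not_less Suc_n_not_le_n)
  then show c: "comb L G b0 b1 (\<epsilon> powr \<alpha>) b Q (num_teeth \<alpha> L \<epsilon>)"
    using assms l nt(1) unfolding num_teeth_def by unfold_locales auto
  interpret comb L G b0 b1 "\<epsilon> powr \<alpha>" b Q "num_teeth \<alpha> L \<epsilon>" by (rule c)
  have "T n ` Q = tooth \<alpha> L Q \<epsilon> n" for n
    unfolding tooth_def by (rule image_cong) (auto simp: T_def org_def)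
  then show "\<Omega> = Omega \<alpha> L Q b \<epsilon>" unfolding \<Omega>_def Omega_def teeth_def Omega_plus_def by simp
qed

theorem theorem2p4:
  fixes \<alpha> L G b0 b1 C \<epsilon>0 :: real
    and b f_hat u0 :: "real \<Rightarrow> real"
    and Q0 :: "(real \<times> real) set"
    and f u :: "real \<Rightarrow> real \<times> real \<Rightarrow> real"
  assumes "\<alpha> > 1" "L > 0" "G > 0"
    and "piecewise_C1_01 b"
    and "b0 > 0" "\<And>x. x \<in> {0<..<1} \<Longrightarrow> b0 \<le> b x \<and> b x \<le> b1"
    and "lipschitz_domain Q0"
    and "Q0 \<subseteq> {0<..<L} \<times> {0<..<G}"
    and "frontier Q0 \<inter> ({0} \<times> {0<..G}) = {}"
    and "frontier Q0 \<inter> ({L} \<times> {0<..G}) = {}"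
    and "negligible (frontier {s. (s, 0) \<in> Gamma0 Q0})"
    and "first_eigenvalue Q0 > 0"
    and "\<epsilon>0 > 0"
    and "\<And>\<epsilon>. \<epsilon> \<in> {0<..<\<epsilon>0} \<Longrightarrow>
           f \<epsilon> \<in> L2 (Omega \<alpha> L Q0 b \<epsilon>) \<and> L2_norm (Omega \<alpha> L Q0 b \<epsilon>) (f \<epsilon>) \<le> C"
    and "weak_tendsto_L2 {0<..<1} (\<lambda>\<epsilon>. section_integral (Omega \<alpha> L Q0 b \<epsilon>) (f \<epsilon>)) f_hat (at_right 0)"
    and "\<And>\<epsilon>. \<epsilon> \<in> {0<..<\<epsilon>0} \<Longrightarrow> weak_solution_thin (Omega \<alpha> L Q0 b \<epsilon>) \<epsilon> (f \<epsilon>) (u \<epsilon>)"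
    and "weak_solution_limit b (\<lambda>x. measure lebesgue Q0 / L + b x) f_hat u0"
  shows "((\<lambda>\<epsilon>. L2_norm (Omega \<alpha> L Q0 b \<epsilon>) (\<lambda>p. u \<epsilon> p - u0 (fst p))) \<longlongrightarrow> 0) (at_right 0)
       \<and> tendsto_H1 (interior (Omega_minus b)) u (\<lambda>p. u0 (fst p)) (at_right 0)"
proof -
  let ?I = "{0<..<1::real}" and ?O = "Omega \<alpha> L Q0 b" and ?Om = "interior (Omega_minus b)"
  note \<alpha> = assms(1) and L = assms(2) and G = assms(3) and b0 = assms(5) and b = assms(6) and lip = assms(7)
    and Qs = assms(8) and \<epsilon>0 = assms(13) and fb = assms(14) and wk = assms(15) and sol = assms(16) and lim = assms(17)
  define m where "m = measure lebesgue Q0"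
  have cs: "comb L G b0 b1 (\<epsilon> powr \<alpha>) b Q0 (num_teeth \<alpha> L \<epsilon>)"
    "comb.\<Omega> L (\<epsilon> powr \<alpha>) b Q0 (num_teeth \<alpha> L \<epsilon>) = ?O \<epsilon>" if "\<epsilon> > 0" for \<epsilon>
    using comb_scaled[OF L G assms(4) b0 b lip Qs that] by blast+
  have b01: "b0 \<le> b1" using b[of "1/2"] by auto
  have bG: "- b1 \<le> G" using b0 b01 G by simp
  have fh: "f_hat \<in> L2 ?I" using wk by (simp add: weak_tendsto_L2_def)
  have u0H: "u0 \<in> H1 ?I" using lim by (simp add: weak_solution_limit_def)
  have u0: "u0 \<in> L2 ?I" "weak_deriv ?I 1 u0 (wderiv ?I 1 u0)" using H1_L2[OF u0H] H1_weak_deriv[OF u0H, of 1] by auto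
  have pos: "\<And>q. q \<in> Q0 \<Longrightarrow> snd q > 0" using Qs by auto
  obtain P Cp where P: "finite P" "P \<subseteq> base_boxes b0 Q0" "0 \<le> Cp"
     "\<And>v D. incr_bounded Q0 v D \<Longrightarrow> L2_norm Q0 v \<le> Cp * (D + (\<Sum>z\<in>P. L2_norm (base_box z) v))"
    by (rule Poincare_Lipschitz[OF lip pos assms(11,12) b0]) (assumption | (rule that; assumption))+
  have ne: "open {-b0<..<0}" "{-b0<..<0} \<noteq> {}" using b0 by auto
  obtain \<rho> where \<rho>: "test_fun {-b0<..<0} \<rho>" "(LINT y:{-b0<..<0}|lebesgue. \<rho> y) = 1"
    by (rule unit_test_fun_exists[OF ne]) (rule that; assumption)
  obtain B where B: "\<And>y. \<bar>\<rho> y\<bar> \<le> B" using test_fun_bounded[OF \<rho>(1)] by blast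
  define \<Lambda> where "\<Lambda> = split_const b0 b1 G B (L2_norm {-b0<..<0} \<rho>) (2 * (Cp * (1 + card P * (1 + b0))))"
  define s where "s = sqrt (b1 + G)"
  have B0: "B \<ge> 0" using B[of 0] by linarith
  have \<Lambda>0: "0 \<le> \<Lambda>" unfolding \<Lambda>_def split_const_def using B0 P(3) b0 b01 G
    by (intro add_nonneg_nonneg mult_nonneg_nonneg) auto
  have m0: "0 \<le> m / L" using L by (simp add: m_def)
  have Om_b: "bounded ?Om"
  proof (rule bounded_subset[OF bounded_cbox])
    show "?Om \<subseteq> cbox (0, - b1) (1, 0)"
    proof (rule order_trans[OF interior_subset], rule subsetI)
      fix p assume p: "p \<in> Omega_minus b"
      then have "b (fst p) \<le> b1" using b[of "fst p"] by (auto simp: Omega_minus_def)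
      then show "p \<in> cbox (0, - b1) (1, 0)" using p by (auto simp: Omega_minus_def cbox_Pair_eq box_real)
    qed
  qed

  have lt: "((\<lambda>\<epsilon>. \<epsilon> powr a) \<longlongrightarrow> 0) (at_right 0)" if "a > 0" for a :: real
    using that by (intro tendsto_zero_powrI[OF tendsto_ident_at tendsto_const]) (auto intro: eventually_mono[OF eventually_at_right_less])
  \<comment> \<open>The transition term of the profile is of this size; its decay is where \<alpha>
    > 1 enters.\<close>
  have lte: "((\<lambda>\<epsilon>. \<epsilon> powr \<alpha> / \<epsilon>) \<longlongrightarrow> 0) (at_right 0)"
  proof (rule Lim_transform_eventually[OF lt[of "\<alpha> - 1"]])
    show "\<forall>\<^sub>F \<epsilon> in at_right 0. \<epsilon> powr (\<alpha> - 1) = \<epsilon> powr \<alpha> / \<epsilon>"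
      using eventually_at_right_less by (rule eventually_mono) (simp add: powr_diff)
  qed (use \<alpha> in simp)
  \<comment> \<open>Besides the range of the hypotheses this secures \<epsilon> < 1, so that the
    bound \<epsilon> K for the y-derivative is also a bound K.\<close>
  have small: "\<forall>\<^sub>F \<epsilon> in at_right 0. \<epsilon> \<in> {0<..<min \<epsilon>0 1}" by (rule eventually_at_right_real) (use \<epsilon>0 in auto)

  define F where "F \<epsilon> = section_integral (?O \<epsilon>) (f \<epsilon>)" for \<epsilon>
  define qd where "qd \<epsilon> x = section_integral (?O \<epsilon>) (\<lambda>p. 1) x - (m / L + b x)" for \<epsilon> x
  have FL: "F \<epsilon> \<in> L2 ?I" "L2_norm ?I (F \<epsilon>) \<le> sqrt (G - - b1) * C" if \<epsilon>: "\<epsilon> \<in> {0<..<min \<epsilon>0 1}" for \<epsilon>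
  proof -
    interpret c: comb L G b0 b1 "\<epsilon> powr \<alpha>" b Q0 "num_teeth \<alpha> L \<epsilon>" by (rule cs) (use \<epsilon> in simp)
    have \<Omega>: "c.\<Omega> = ?O \<epsilon>" by (rule cs(2)) (use \<epsilon> in simp)
    have f: "f \<epsilon> \<in> L2 (?O \<epsilon>)" "L2_norm (?O \<epsilon>) (f \<epsilon>) \<le> C" using fb[of \<epsilon>] \<epsilon> by auto
    note S = section_integral_L2[OF c.\<Omega>_sub[unfolded \<Omega>] bG f(1)]
    show "F \<epsilon> \<in> L2 ?I" unfolding F_def by (rule S(1))
    have "sqrt (G - - b1) * L2_norm (?O \<epsilon>) (f \<epsilon>) \<le> sqrt (G - - b1) * C" using f(2) bG by (intro mult_left_mono) auto
    then show "L2_norm ?I (F \<epsilon>) \<le> sqrt (G - - b1) * C" unfolding F_def using S(2) by linarith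
  qed
  \<comment> \<open>Weak convergence controls pairings with fixed functions, but the function z of
    the energy estimate changes with \<epsilon>. Convergence against indicators of intervals is
    therefore upgraded to a bound uniform in w, relative to the norms of w and w'.\<close>
  have pair1: "\<forall>\<^sub>F \<epsilon> in at_right 0. \<forall>w w'. w \<in> L2 ?I \<longrightarrow> weak_deriv ?I 1 w w' \<longrightarrow>
      \<bar>LINT x:?I|lebesgue. (F \<epsilon> x - f_hat x) * w x\<bar> \<le> \<eta> * (L2_norm ?I w + L2_norm ?I w')" if "\<eta> > 0" for \<eta>
  proof (rule weak_pairing_tendsto[where M = "sqrt (G - - b1) * C + L2_norm ?I f_hat", OF _ _ that])
    show "\<forall>\<^sub>F \<epsilon> in at_right 0. (\<lambda>x. F \<epsilon> x - f_hat x) \<in> L2 ?I \<and> L2_norm ?I (\<lambda>x. F \<epsilon> x - f_hat x) \<le> sqrt (G - - b1) * C + L2_norm ?I f_hat"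
      using small
    proof eventually_elim
      case (elim \<epsilon>)
      show ?case using L2_diff[OF FL(1)[OF elim] fh] L2_norm_triangle_diff[OF FL(1)[OF elim] fh] FL(2)[OF elim] by auto
    qed
    fix a e :: real assume ae: "0 \<le> a" "a < e" "e \<le> 1"
    have sub: "{a<..<e} \<subseteq> ?I" using ae by auto
    note ind = indicator_L2[OF sub]
    have "((\<lambda>\<epsilon>. LINT x:?I|lebesgue. F \<epsilon> x * indicator {a<..<e} x) \<longlongrightarrow> (LINT x:?I|lebesgue. f_hat x * indicator {a<..<e} x)) (at_right 0)"
      using wk ind unfolding weak_tendsto_L2_def F_def by blast
    from tendsto_diff[OF this tendsto_const[of "LINT x:?I|lebesgue. f_hat x * indicator {a<..<e} x"]]
    have lim0: "((\<lambda>\<epsilon>. (LINT x:?I|lebesgue. F \<epsilon> x * indicator {a<..<e} x) - (LINT x:?I|lebesgue. f_hat x * indicator {a<..<e} x)) \<longlongrightarrow> 0) (at_right 0)"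
      by simp
    show "((\<lambda>\<epsilon>. LINT x:{a<..<e}|lebesgue. F \<epsilon> x - f_hat x) \<longlongrightarrow> 0) (at_right 0)"
    proof (rule Lim_transform_eventually[OF lim0])
      show "\<forall>\<^sub>F \<epsilon> in at_right 0. (LINT x:?I|lebesgue. F \<epsilon> x * indicator {a<..<e} x) - (LINT x:?I|lebesgue. f_hat x * indicator {a<..<e} x)
          = (LINT x:{a<..<e}|lebesgue. F \<epsilon> x - f_hat x)"
        using small
      proof eventually_elim
        case (elim \<epsilon>)
        show ?case using LINT_diff_mult[OF FL(1)[OF elim] fh ind] LINT_mult_indicator[OF sub, of "\<lambda>x. F \<epsilon> x - f_hat x"] by simp
      qed
    qed
  qed
  have pair2: "\<forall>\<^sub>F \<epsilon> in at_right 0. \<forall>w w'. w \<in> L2 ?I \<longrightarrow> weak_deriv ?I 1 w w' \<longrightarrow>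
      \<bar>LINT x:?I|lebesgue. qd \<epsilon> x * w x\<bar> \<le> \<eta> * (L2_norm ?I w + L2_norm ?I w')" if "\<eta> > 0" for \<eta>
  proof (rule weak_pairing_tendsto[where M = "(b1 + G) + m / L + b1", OF _ _ that])
    have qc: "qd \<epsilon> \<in> L2 ?I" "L2_norm ?I (qd \<epsilon>) \<le> (b1 + G) + m / L + b1"
      "0 \<le> a \<Longrightarrow> a < e \<Longrightarrow> e \<le> 1 \<Longrightarrow> \<bar>LINT x:{a<..<e}|lebesgue. qd \<epsilon> x\<bar> \<le> 3 * \<epsilon> powr \<alpha> * m"
      if \<epsilon>: "\<epsilon> \<in> {0<..<min \<epsilon>0 1}" for \<epsilon> a e
    proof -
      interpret c: comb L G b0 b1 "\<epsilon> powr \<alpha>" b Q0 "num_teeth \<alpha> L \<epsilon>" by (rule cs) (use \<epsilon> in simp)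
      have "c.\<Omega> = ?O \<epsilon>" by (rule cs(2)) (use \<epsilon> in simp)
      then have eq: "qd \<epsilon> = c.qdef" by (simp add: fun_eq_iff qd_def c.qdef_def m_def)
      show "qd \<epsilon> \<in> L2 ?I" unfolding eq by (rule c.qdef_L2(1))
      show "L2_norm ?I (qd \<epsilon>) \<le> (b1 + G) + m / L + b1" unfolding eq m_def by (rule c.qdef_L2(2))
      show "\<bar>LINT x:{a<..<e}|lebesgue. qd \<epsilon> x\<bar> \<le> 3 * \<epsilon> powr \<alpha> * m" if "0 \<le> a" "a < e" "e \<le> 1"
        unfolding eq m_def by (rule c.qdef_integral[OF that])
    qed
    show "\<forall>\<^sub>F \<epsilon> in at_right 0. qd \<epsilon> \<in> L2 ?I \<and> L2_norm ?I (qd \<epsilon>) \<le> (b1 + G) + m / L + b1"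
      using small by (rule eventually_mono) (use qc(1,2) in blast)
    fix a e :: real assume ae: "0 \<le> a" "a < e" "e \<le> 1"
    have "((\<lambda>\<epsilon>. 3 * \<epsilon> powr \<alpha> * m) \<longlongrightarrow> 3 * 0 * m) (at_right 0)" using \<alpha> by (intro tendsto_intros lt) auto
    then have l0: "((\<lambda>\<epsilon>. 3 * \<epsilon> powr \<alpha> * m) \<longlongrightarrow> 0) (at_right 0)" by simp
    show "((\<lambda>\<epsilon>. LINT x:{a<..<e}|lebesgue. qd \<epsilon> x) \<longlongrightarrow> 0) (at_right 0)"
      by (rule Lim_null_comparison[OF eventually_mono[OF small] l0]) (use qc(3)[OF _ ae] in simp)
  qed

  \<comment> \<open>The 3 collects the strip, the \<epsilon>-dependent terms
    \<open>r \<epsilon>\<close>, and the distance of \<Phi> and v. In the factor of \<Lambda>, the 4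
    is one \<tau> from \<psi>, two from \<open>pair1\<close> and one from \<open>pair2\<close>, and
    m / L + 2 b1 comes from exchanging v for \<open>u0\<close> in the limit equation. The last s
    comes from the same exchange on \<Omega>.\<close>
  define M0 where "M0 = 3 + \<Lambda> * (4 + m / L + 2 * b1) + s"
  have key: "\<forall>\<^sub>F \<epsilon> in at_right 0. L2_norm (?O \<epsilon>) (\<lambda>p. u \<epsilon> p - u0 (fst p)) \<le> 3 * M0 * \<tau> \<and> u \<epsilon> \<in> H1 ?Om \<and>
      H1_norm ?Om (\<lambda>p. u \<epsilon> p - u0 (fst p)) \<le> 3 * M0 * \<tau> \<and> (\<lambda>p. u0 (fst p)) \<in> H1 ?Om" if \<tau>: "\<tau> > 0" for \<tau>
  proof -
    obtain v where v: "smooth_fun v" "L2_norm ?I (\<lambda>x. u0 x - v x) < \<tau>"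
      "L2_norm ?I (\<lambda>x. wderiv ?I 1 u0 x - frechet_derivative v (at x) 1) < \<tau>"
      by (rule smooth_dense_interval[OF zero_less_one u0 \<tau>]) (rule that; assumption)
    have vs: "L2_norm ?I (\<lambda>x. u0 x - v x) \<le> \<tau>" "L2_norm ?I (\<lambda>x. wderiv ?I 1 u0 x - frechet_derivative v (at x) 1) \<le> \<tau>"
      using v(2,3) by auto
    have bI: "bounded {0..1::real}" by simp
    obtain V0 where "\<forall>x\<in>{0..1}. \<bar>v x\<bar> \<le> V0" using smooth_bounded_on[OF v(1) bI] by blast
    then have V0: "\<And>x. 0 \<le> x \<Longrightarrow> x \<le> 1 \<Longrightarrow> \<bar>v x\<bar> \<le> V0" by simp
    obtain V1 where "\<forall>x\<in>{0..1}. \<bar>frechet_derivative v (at x) 1\<bar> \<le> V1" using smooth_bounded_on[OF smooth_fun_deriv[OF v(1)] bI] by blast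
    then have V1: "\<And>x. 0 \<le> x \<Longrightarrow> x \<le> 1 \<Longrightarrow> \<bar>frechet_derivative v (at x) 1\<bar> \<le> V1" by simp
    have V: "V0 \<ge> 0" "V1 \<ge> 0" using V0[of 0] V1[of 0] by auto
    \<comment> \<open>The strip costs V1 sqrt \<delta>, which this choice makes at most \<tau>;
      adding 1 keeps the quotient meaningful for V1 = 0.\<close>
    define \<delta> where "\<delta> = (\<tau> / (V1 + 1))\<^sup>2"
    have \<delta>: "\<delta> > 0" unfolding \<delta>_def using \<tau> V by auto
    have V\<delta>: "V1 * sqrt \<delta> \<le> \<tau>"
    proof -
      have "sqrt \<delta> = \<tau> / (V1 + 1)" unfolding \<delta>_def using \<tau> V by simp
      then have "V1 * sqrt \<delta> = \<tau> - sqrt \<delta>" using V by (simp add: field_simps)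
      then show ?thesis using real_sqrt_ge_zero[of \<delta>] \<delta> by linarith
    qed
    obtain \<eta> H where \<eta>: "smooth_fun \<eta>" "\<And>y. 0 \<le> \<eta> y" "\<And>y. \<eta> y \<le> 1" "\<And>y. y \<le> \<delta> / 2 \<Longrightarrow> \<eta> y = 0" "\<And>y. \<delta> \<le> y \<Longrightarrow> \<eta> y = 1"
      "\<And>y. \<bar>frechet_derivative \<eta> (at y) (1::real)\<bar> \<le> H"
      using cutoff_exists[OF \<delta>] by blast
    have oQ: "open Q0" using lip by (simp add: lipschitz_domain_def)
    have "\<delta> / 2 > 0" using \<delta> by simp
    then obtain \<kappa> where \<kappa>: "\<kappa> > 0" "\<And>q. q \<in> closure Q0 \<Longrightarrow> \<delta> / 2 \<le> snd q \<Longrightarrow> \<kappa> < fst q \<and> fst q < L - \<kappa>"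
      using lateral_gap[OF oQ Qs assms(9,10)] by blast
    let ?v' = "\<lambda>p :: real \<times> real. frechet_derivative v (at (fst p)) 1"
    have "?v' \<in> L2 ?Om"
      by (rule smooth_weak_deriv(1)[OF open_interior Om_b smooth_fun_comp_fst(1)[OF smooth_fun_deriv[OF v(1)]]])
    then obtain \<psi> where \<psi>: "test_fun ?Om \<psi>" "L2_norm ?Om (\<lambda>p. ?v' p - \<psi> p) < \<tau>"
      by (rule test_fun_dense[OF open_interior _ \<tau>]) (rule that; assumption)
    \<comment> \<open>This norm may be large, since \<psi> has to drop to zero near the boundary of
      the base. It is fixed before \<epsilon> and appears in \<open>K\<close> only with a factor
      \<epsilon>.\<close>
    define Y where "Y = L2_norm ?Om (\<lambda>p. frechet_derivative \<psi> (at p) (1, 0))"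
    define \<eta>2 where "\<eta>2 = \<tau> / (2 * V0 + V1 + 1)"
    have \<eta>2: "\<eta>2 > 0" "\<eta>2 * (2 * V0 + V1) \<le> \<tau>" unfolding \<eta>2_def using \<tau> V by (auto simp: field_simps intro: divide_pos_pos)
    \<comment> \<open>The part of \<open>K\<close> that depends on \<epsilon>. With v, \<delta>, H
      and Y already fixed it tends to 0.\<close>
    define r where "r \<epsilon> = H * (V1 * L) * s * (\<epsilon> powr \<alpha> / \<epsilon>) + V1 * (L * \<epsilon> powr \<alpha>) * s
      + (C + V0 * s) * (\<Lambda> * (\<epsilon> powr \<alpha> + \<epsilon>)) + Y * (\<Lambda> * \<epsilon>)" for \<epsilon>
    have "(r \<longlongrightarrow> H * (V1 * L) * s * 0 + V1 * (L * 0) * s + (C + V0 * s) * (\<Lambda> * (0 + 0)) + Y * (\<Lambda> * 0)) (at_right 0)"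
      unfolding r_def using \<alpha> by (intro tendsto_intros lte lt) auto
    then have r: "\<forall>\<^sub>F \<epsilon> in at_right 0. r \<epsilon> < \<tau>" using \<tau> by (intro order_tendstoD(2)) auto
    have "((\<lambda>\<epsilon>. V1 * (L * \<epsilon> powr \<alpha>) * s) \<longlongrightarrow> V1 * (L * 0) * s) (at_right 0)"
      using \<alpha> by (intro tendsto_intros lt) auto
    then have r': "\<forall>\<^sub>F \<epsilon> in at_right 0. V1 * (L * \<epsilon> powr \<alpha>) * s < \<tau>" using \<tau> by (intro order_tendstoD(2)) auto
    show ?thesis using small r r' pair1[OF \<tau>] pair2[OF \<eta>2(1)]
    proof eventually_elim
      case (elim \<epsilon>)
      have \<epsilon>: "\<epsilon> > 0" "\<epsilon> < 1" "\<epsilon> \<in> {0<..<\<epsilon>0}" using elim(1) by auto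
      interpret c: comb L G b0 b1 "\<epsilon> powr \<alpha>" b Q0 "num_teeth \<alpha> L \<epsilon>" by (rule cs(1)[OF \<epsilon>(1)])
      have \<Omega>: "c.\<Omega> = ?O \<epsilon>" by (rule cs(2)[OF \<epsilon>(1)])
      have Om: "c.Om = ?Om" by (simp add: c.Om_def)
      have qeq: "c.qdef = qd \<epsilon>" by (simp add: fun_eq_iff qd_def c.qdef_def m_def \<Omega>)
      have f: "f \<epsilon> \<in> L2 c.\<Omega>" "L2_norm c.\<Omega> (f \<epsilon>) \<le> C" using fb[OF \<epsilon>(3)] unfolding \<Omega> by auto
      have solc: "weak_solution_thin c.\<Omega> \<epsilon> (f \<epsilon>) (u \<epsilon>)" using sol[OF \<epsilon>(3)] unfolding \<Omega> .
      have p1: "\<And>w w'. w \<in> L2 ?I \<Longrightarrow> weak_deriv ?I 1 w w' \<Longrightarrow>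
        \<bar>LINT x:?I|lebesgue. (section_integral c.\<Omega> (f \<epsilon>) x - f_hat x) * w x\<bar> \<le> \<tau> * (L2_norm ?I w + L2_norm ?I w')"
        using elim(4) unfolding \<Omega> F_def by blast
      have p2: "\<And>w w'. w \<in> L2 ?I \<Longrightarrow> weak_deriv ?I 1 w w' \<Longrightarrow>
        \<bar>LINT x:?I|lebesgue. c.qdef x * w x\<bar> \<le> \<eta>2 * (L2_norm ?I w + L2_norm ?I w')"
        using elim(5) unfolding qeq by blast
      have \<psi>c: "test_fun c.Om \<psi>" "L2_norm c.Om (\<lambda>p. ?v' p - \<psi> p) \<le> \<tau>"
        "L2_norm c.Om (\<lambda>p. frechet_derivative \<psi> (at p) (1, 0)) \<le> Y"
        using \<psi> unfolding Om Y_def by auto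
      define K where "K = V1 * sqrt \<delta> + H * (V1 * L) * sqrt (b1 + G) * (\<epsilon> powr \<alpha> / \<epsilon>) + V1 * (L * \<epsilon> powr \<alpha>) * sqrt (b1 + G)
        + (C + V0 * sqrt (b1 + G)) * (\<Lambda> * (\<epsilon> powr \<alpha> + \<epsilon>)) + \<tau> * \<Lambda> + Y * (\<Lambda> * \<epsilon>)
        + ((measure lebesgue Q0 / L + 2 * b1) * \<tau> + 2 * \<tau> + \<eta>2 * (2 * V0 + V1)) * \<Lambda>"
      have E: "L2_norm c.\<Omega> (\<lambda>p. u \<epsilon> p - v (fst p)) \<le> K + V1 * (L * \<epsilon> powr \<alpha>) * sqrt (b1 + G) \<and>
        (\<exists>g1 g2. weak_deriv c.Om (1, 0) (\<lambda>p. u \<epsilon> p - v (fst p)) g1 \<and> weak_deriv c.Om (0, 1) (\<lambda>p. u \<epsilon> p - v (fst p)) g2 \<and>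
          L2_norm c.Om g1 \<le> K \<and> L2_norm c.Om g2 \<le> \<epsilon> * K)"
        by (rule c.energy_estimate[OF P \<rho> B \<Lambda>_def \<epsilon>(1) f solc lim fh v(1) V0 V1 vs p1 p2 less_imp_le[OF \<tau>] less_imp_le[OF \<eta>2(1)]
            \<eta> \<delta> \<kappa> \<psi>c K_def])
      then obtain g1 g2 where g: "weak_deriv c.Om (1, 0) (\<lambda>p. u \<epsilon> p - v (fst p)) g1" "weak_deriv c.Om (0, 1) (\<lambda>p. u \<epsilon> p - v (fst p)) g2"
        "L2_norm c.Om g1 \<le> K" "L2_norm c.Om g2 \<le> \<epsilon> * K" by blast
      have K0: "0 \<le> K" using g(3) L2_norm_nonneg order_trans by blast
      have "((m / L + 2 * b1) * \<tau> + 2 * \<tau> + \<eta>2 * (2 * V0 + V1)) * \<Lambda> \<le> ((m / L + 2 * b1) * \<tau> + 2 * \<tau> + \<tau>) * \<Lambda>"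
        using \<eta>2(2) \<Lambda>0 by (intro mult_right_mono) auto
      then have "K \<le> \<tau> + \<tau> + \<tau> * \<Lambda> + ((m / L + 2 * b1) * \<tau> + 2 * \<tau> + \<tau>) * \<Lambda>"
        using V\<delta> elim(2) unfolding K_def r_def s_def m_def by linarith
      also have "\<dots> = (2 + \<Lambda> * (4 + m / L + 2 * b1)) * \<tau>" by (simp add: algebra_simps)
      finally have K1: "K + \<tau> \<le> (3 + \<Lambda> * (4 + m / L + 2 * b1)) * \<tau>" by (simp add: algebra_simps)
      define K' where "K' = (3 + \<Lambda> * (4 + m / L + 2 * b1)) * \<tau>"
      have "\<epsilon> * K \<le> K" using mult_right_mono[of \<epsilon> 1 K] \<epsilon>(2) K0 by simp
      then have g': "L2_norm c.Om g1 \<le> K'" "L2_norm c.Om g2 \<le> K'" using g(3,4) K1 \<tau> unfolding K'_def by linarith+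
      have E': "L2_norm c.\<Omega> (\<lambda>p. u \<epsilon> p - v (fst p)) \<le> K'" using E elim(3) K1 unfolding K'_def s_def by linarith
      have uH: "u \<epsilon> \<in> H1 c.\<Omega>" using solc by (simp add: weak_solution_thin_def)
      note fc = c.fst_close[OF H1_L2[OF uH] u0 v(1) vs E' g(1) g'(1) g(2) g'(2)]
      have R: "K' + sqrt (b1 + G) * \<tau> = M0 * \<tau>" unfolding K'_def M0_def s_def by (simp add: algebra_simps)
      have "0 \<le> M0 * \<tau>" using fc(1) L2_norm_nonneg[of c.\<Omega> "\<lambda>p. u \<epsilon> p - u0 (fst p)"] unfolding R by linarith
      moreover have "u \<epsilon> \<in> H1 c.Om" by (rule H1_subset[OF uH c.Om_sub_\<Omega> c.open_Om])
      ultimately show ?case using fc unfolding R \<Omega> Om by auto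
    qed
  qed
  have "(\<lambda>p. u0 (fst p)) \<in> H1 ?Om" and ev: "\<forall>\<^sub>F \<epsilon> in at_right 0. u \<epsilon> \<in> H1 ?Om"
  proof -
    have "\<forall>\<^sub>F \<epsilon> :: real in at_right 0. (\<lambda>p. u0 (fst p)) \<in> H1 ?Om" using key[OF zero_less_one] by (rule eventually_mono) simp
    then show "(\<lambda>p. u0 (fst p)) \<in> H1 ?Om" using eventually_happens'[OF trivial_limit_at_right_real] by blast
    show "\<forall>\<^sub>F \<epsilon> in at_right 0. u \<epsilon> \<in> H1 ?Om" using key[OF zero_less_one] by (rule eventually_mono) simp
  qed
  moreover have "((\<lambda>\<epsilon>. H1_norm ?Om (\<lambda>p. u \<epsilon> p - u0 (fst p))) \<longlongrightarrow> 0) (at_right 0)"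
  proof (rule tendsto_zero_of_multiple[where M = "3 * M0"])
    show "\<forall>\<^sub>F \<epsilon> in at_right 0. H1_norm ?Om (\<lambda>p. u \<epsilon> p - u0 (fst p)) \<le> 3 * M0 * \<tau>" if "\<tau> > 0" for \<tau>
      using key[OF that] by (rule eventually_mono) simp
  qed (auto simp: H1_norm_def intro!: add_nonneg_nonneg sum_nonneg)
  moreover have "((\<lambda>\<epsilon>. L2_norm (?O \<epsilon>) (\<lambda>p. u \<epsilon> p - u0 (fst p))) \<longlongrightarrow> 0) (at_right 0)"
  proof (rule tendsto_zero_of_multiple[where M = "3 * M0"])
    show "\<forall>\<^sub>F \<epsilon> in at_right 0. L2_norm (?O \<epsilon>) (\<lambda>p. u \<epsilon> p - u0 (fst p)) \<le> 3 * M0 * \<tau>" if "\<tau> > 0" for \<tau>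
      using key[OF that] by (rule eventually_mono) simp
  qed simp
  ultimately show ?thesis unfolding tendsto_H1_def by blast
qed

end
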